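(* A minimal Lagrangian surface in $\mathbb{C}P^2$ is translationally equivariant if and only if it is generated by a degree one constant potential $D(\lambda)\,dz$. In this case the immersion can be defined without loss of generality on all of $\mathbb{C}$. The potential function $D(\lambda)$ can be obtained from an extended frame $\mathbb{F}$ satisfying $\mathbb{F}(0,\lambda)=I$ and $\mathbb{F}(t+z,\lambda)=\chi(t,\lambda)\mathbb{F}(z,\lambda)$ for all real $t$ (with $\chi(\cdot,\lambda)$ a one-parameter group) by the equation $$D(\lambda)=\mathbb{F}(z,\lambda)^{-1}\partial_x\mathbb{F}(z,\lambda)\big|_{z=0}.$$
   Context: $\mathbb{C}P^2$ carries the Fubini-Study metric of holomorphic sectional curvature $4$; $z=x+iy$. The surfaces considered are conformal minimal Lagrangian immersions $f:\mathbb{S}\to\mathbb{C}P^2$, where $\mathbb{S}\subset\mathbb{C}$ is a strip parallel to the $x$-axis with $0\in\mathbb{S}$ (possibly $\mathbb{S}=\mathbb{C}$), with induced metric $2e^{u}dzd\bar z$. $f$ is translationally equivariant if there is a one-parameter subgroup $R(t)$ of $SU(3)$ with $f(t+z)=R(t)f(z)$ for all $t\in\mathbb{R}$, $z\in\mathbb{S}$. Surfaces are normalized by an isometry in $SU(3)$ so that their frames equal $I$ at $z=0$. Extended frame: for $\lambda\in S^1$, let $\mathbb{F}(z,\lambda)\in SU(3)$ solve $$\mathbb{F}^{-1}\mathbb{F}_z=\lambda^{-1}\begin{pmatrix}0&0&ie^{u/2}\\ -i\psi e^{-u}&0&0\\ 0&ie^{u/2}&0\end{pmatrix}+\mathrm{diag}\left(\tfrac{u_z}{2},-\tfrac{u_z}{2},0\right),$$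 $$\mathbb{F}^{-1}\mathbb{F}_{\bar z}=\lambda\begin{pmatrix}0&-i\bar\psi e^{-u}&0\\ 0&0&ie^{u/2}\\ ie^{u/2}&0&0\end{pmatrix}+\mathrm{diag}\left(-\tfrac{u_{\bar z}}{2},\tfrac{u_{\bar z}}{2},0\right),$$ with $\psi$ holomorphic; then $f^\lambda=[\mathbb{F}(z,\lambda)e_3]$ is a minimal Lagrangian surface with metric $2e^udzd\bar z$ and Hopf cubic differential $-i\lambda^{-3}\psi dz^3$, and $f=f^{1}$ up to an isometry. (The Hopf differential of a minimal Lagrangian surface is $(F_{zz}\cdot\overline{F_{\bar z}})dz^3$ for a local horizontal lift $F$ to $S^5\subset\mathbb{C}^3$, where $\cdot\,\overline{\phantom{x}}$ is the Hermitian product.) More generally $\mathbb{F}k$, with $k$ a $\lambda$-independent map into $U(1)=\{\mathrm{diag}(c,c^{-1},1):|c|=1\}$, is also called an extended frame of $f$. Loop groups: $\epsilon=e^{\pi i/3}$, $\alpha=e^{2\pi i/3}$, $P=\begin{pmatrix}0&\alpha&0\\ \alpha^2&0&0\\ 0&0&1\end{pmatrix}$; $\sigma(g)=P(g^t)^{-1}P^{-1}$ on $SL(3,\mathbb{C})$ and $\sigma(\xi)=-P\xi^tP^{-1}$ on $sl(3,\mathbb{C})$. $\Lambda SL(3,\mathbb{C})_\sigma$ is the group of (smooth) loops $g:S^1\to SL(3,\mathbb{C})$ with $g(\epsilon\lambda)=\sigma(g(\lambda))$; $\Lambda SU(3)_\sigma$ is its subgroup of $SU(3)$-valued loops, $\Lambda^+SL(3,\mathbb{C})_\sigma$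 the subgroup of loops extending holomorphically to $|\lambda|<1$; $\Lambda su(3)_\sigma$ is the Lie algebra of $\Lambda SU(3)_\sigma$. A degree one constant potential is $D(\lambda)dz$ with $D(\lambda)=\lambda^{-1}D_{-1}+D_0+\lambda D_1\in\Lambda su(3)_\sigma$ independent of $z$. A surface $f$ is generated by $D(\lambda)dz$ if, for the Iwasawa splitting $\exp(zD(\lambda))=\mathbb{F}(z,\lambda)U_+(z,\lambda)$ with $\mathbb{F}(z,\cdot)\in\Lambda SU(3)_\sigma$, $U_+(z,\cdot)\in\Lambda^+SL(3,\mathbb{C})_\sigma$ (such a splitting always exists and is unique up to $U(1)$), $\mathbb{F}$ is an extended frame of $f$; in particular $f=[\mathbb{F}(z,1)e_3]$. *)

theory Defs
  imports "HOL-Analysis.Analysis" "HOL-Complex_Analysis.Complex_Analysis"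
begin

section \<open>Calculus\<close>

text \<open>\<open>C\<^sup>k\<close> and \<open>C\<^sup>\<infinity>\<close> maps on an open set \<open>S\<close> of a finite-dimensional space.\<close>

fun Ck_on :: "nat \<Rightarrow> 'a::real_normed_vector set \<Rightarrow> ('a \<Rightarrow> 'b::real_normed_vector) \<Rightarrow> bool" where
  "Ck_on 0 S f \<longleftrightarrow> continuous_on S f"
| "Ck_on (Suc k) S f \<longleftrightarrow>
     (\<forall>x\<in>S. f differentiable (at x)) \<and> (\<forall>v. Ck_on k S (\<lambda>x. frechet_derivative f (at x) v))"

definition smooth_on :: "'a::real_normed_vector set \<Rightarrow> ('a \<Rightarrow> 'b::real_normed_vector) \<Rightarrow> bool" where
  "smooth_on S f \<longleftrightarrow> (\<forall>k. Ck_on k S f)"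

definition dx :: "(complex \<Rightarrow> 'b::real_normed_vector) \<Rightarrow> complex \<Rightarrow> 'b" where
  "dx f z = frechet_derivative f (at z) 1"

definition dy :: "(complex \<Rightarrow> 'b::real_normed_vector) \<Rightarrow> complex \<Rightarrow> 'b" where
  "dy f z = frechet_derivative f (at z) \<i>"

text \<open>Wirtinger derivatives, for complex functions and entrywise for vectors and matrices.\<close>

definition d_z :: "(complex \<Rightarrow> complex) \<Rightarrow> complex \<Rightarrow> complex" where
  "d_z h z = (dx h z - \<i> * dy h z) / 2"

definition d_zbar :: "(complex \<Rightarrow> complex) \<Rightarrow> complex \<Rightarrow> complex" where
  "d_zbar h z = (dx h z + \<i> * dy h z) / 2"

definition vec_d_z :: "(complex \<Rightarrow> complex^3) \<Rightarrow> complex \<Rightarrow> complex^3" where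
  "vec_d_z F z = (\<chi> i. d_z (\<lambda>w. F w $ i) z)"

definition vec_d_zbar :: "(complex \<Rightarrow> complex^3) \<Rightarrow> complex \<Rightarrow> complex^3" where
  "vec_d_zbar F z = (\<chi> i. d_zbar (\<lambda>w. F w $ i) z)"

definition mat_d_z :: "(complex \<Rightarrow> complex^3^3) \<Rightarrow> complex \<Rightarrow> complex^3^3" where
  "mat_d_z F z = (\<chi> i j. d_z (\<lambda>w. F w $ i $ j) z)"

definition mat_d_zbar :: "(complex \<Rightarrow> complex^3^3) \<Rightarrow> complex \<Rightarrow> complex^3^3" where
  "mat_d_zbar F z = (\<chi> i j. d_zbar (\<lambda>w. F w $ i $ j) z)"


section \<open>Matrices\<close>

definition adjoint_mat :: "complex^3^3 \<Rightarrow> complex^3^3" where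
  "adjoint_mat A = map_matrix cnj (transpose A)"

definition cscale :: "complex \<Rightarrow> complex^3^3 \<Rightarrow> complex^3^3" where
  "cscale c A = map_matrix ((*) c) A"

definition diag3 :: "complex \<Rightarrow> complex \<Rightarrow> complex \<Rightarrow> complex^3^3" where
  "diag3 a b c = vector [vector [a, 0, 0], vector [0, b, 0], vector [0, 0, c]]"

definition mat_exp :: "complex^3^3 \<Rightarrow> complex^3^3" where
  "mat_exp A = (\<Sum>n. (1 / fact n) *\<^sub>R (((**) A) ^^ n) (mat 1))"

definition SL3 :: "(complex^3^3) set" where
  "SL3 = {A. det A = 1}"

definition SU3 :: "(complex^3^3) set" where
  "SU3 = {A. adjoint_mat A ** A = mat 1 \<and> det A = 1}"

definition su3 :: "(complex^3^3) set" where
  "su3 = {A. adjoint_mat A = - A \<and> trace A = 0}"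

definition U1 :: "(complex^3^3) set" where
  "U1 = {diag3 c (inverse c) 1 | c. cmod c = 1}"

definition one_param_subgroup :: "(real \<Rightarrow> complex^3^3) \<Rightarrow> bool" where
  "one_param_subgroup R \<longleftrightarrow>
     continuous_on UNIV R \<and> range R \<subseteq> SU3 \<and> R 0 = mat 1 \<and> (\<forall>s t. R (s + t) = R s ** R t)"


section \<open>The complex projective plane\<close>

text \<open>
  The point \<open>[v]\<close> of the complex projective plane is identified with the orthogonal projection
  \<open>v v\<^sup>*/|v|\<^sup>2\<close> onto the line spanned by \<open>v\<close>, which makes the plane a submanifold of the
  Euclidean space of Hermitian matrices. For \<open>|v| = 1\<close> the tangent vectors at \<open>[v]\<close> are
  \<open>X = w v\<^sup>* + v w\<^sup>*\<close> with \<open>w\<close> Hermitian-orthogonal to \<open>v\<close>, and \<open>w\<close> is the horizontal lift of \<open>X\<close>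
  to \<open>v\<close> under the Hopf fibration of the unit 5-sphere. Hence
  \<open>tr(X X)/2 = |w|\<^sup>2\<close>, so that half the trace form induces the Fubini-Study metric for which the
  Hopf fibration is a Riemannian submersion, i.e. the one of holomorphic sectional curvature 4;
  and \<open>\<i> (X P - P X) = (\<i> w) v\<^sup>* + v (\<i> w)\<^sup>*\<close> for \<open>P = v v\<^sup>*\<close>, so that this is the
  complex structure. The Levi-Civita connection is the tangential part of the flat connection.
\<close>

definition cp_point :: "complex^3 \<Rightarrow> complex^3^3" where
  "cp_point v = (\<chi> i j. v $ i * cnj (v $ j) / of_real ((norm v)\<^sup>2))"

definition CP2 :: "(complex^3^3) set" where
  "CP2 = cp_point ` {v. v \<noteq> 0}"

text \<open>The action \<open>[v] \<mapsto> [A v]\<close> of a unitary matrix \<open>A\<close>.\<close>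

definition cp_act :: "complex^3^3 \<Rightarrow> complex^3^3 \<Rightarrow> complex^3^3" where
  "cp_act A P = A ** P ** adjoint_mat A"

definition fs_metric :: "complex^3^3 \<Rightarrow> complex^3^3 \<Rightarrow> real" where
  "fs_metric X Y = Re (trace (X ** Y)) / 2"

definition fs_J :: "complex^3^3 \<Rightarrow> complex^3^3 \<Rightarrow> complex^3^3" where
  "fs_J P X = cscale \<i> (X ** P - P ** X)"

definition kaehler_form :: "complex^3^3 \<Rightarrow> complex^3^3 \<Rightarrow> complex^3^3 \<Rightarrow> real" where
  "kaehler_form P X Y = fs_metric (fs_J P X) Y"

text \<open>Orthogonal projection of a Hermitian matrix onto the tangent space at \<open>P\<close>.\<close>

definition cp_tangential :: "complex^3^3 \<Rightarrow> complex^3^3 \<Rightarrow> complex^3^3" where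
  "cp_tangential P X = P ** X ** (mat 1 - P) + (mat 1 - P) ** X ** P"


section \<open>Conformal minimal Lagrangian immersions\<close>

text \<open>
  Mean curvature vector of a conformal immersion: half the metric trace of the component of
  the covariant second derivative that is normal to the surface.
\<close>

definition mean_curvature :: "(complex \<Rightarrow> complex^3^3) \<Rightarrow> complex \<Rightarrow> complex^3^3" where
  "mean_curvature f z =
     (let X = dx f z; Y = dy f z; E = fs_metric X X;
          T = cp_tangential (f z) (dx (dx f) z + dy (dy f) z)
      in (1 / (2 * E)) *\<^sub>R (T - (fs_metric T X / E) *\<^sub>R X - (fs_metric T Y / E) *\<^sub>R Y))"

text \<open>The induced metric is \<open>2 e\<^sup>u dz d\<bar>z = 2 e\<^sup>u (dx\<^sup>2 + dy\<^sup>2)\<close>; values off \<open>S\<close> are irrelevant.\<close>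

definition conformal_minimal_lagrangian ::
    "complex set \<Rightarrow> (complex \<Rightarrow> real) \<Rightarrow> (complex \<Rightarrow> complex^3^3) \<Rightarrow> bool" where
  "conformal_minimal_lagrangian S u f \<longleftrightarrow>
     smooth_on S u \<and> smooth_on S f \<and>
     (\<forall>z\<in>S. f z \<in> CP2 \<and>
        fs_metric (dx f z) (dx f z) = 2 * exp (u z) \<and>
        fs_metric (dy f z) (dy f z) = 2 * exp (u z) \<and>
        fs_metric (dx f z) (dy f z) = 0 \<and>
        kaehler_form (f z) (dx f z) (dy f z) = 0 \<and>
        mean_curvature f z = 0)"

text \<open>Open strip parallel to the real axis containing 0; half-planes and the plane are included.\<close>

definition strip :: "complex set \<Rightarrow> bool" where
  "strip S \<longleftrightarrow>
     (\<exists>a b::ereal. a < 0 \<and> 0 < b \<and> S = {z. a < ereal (Im z) \<and> ereal (Im z) < b})"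

definition translationally_equivariant :: "complex set \<Rightarrow> (complex \<Rightarrow> complex^3^3) \<Rightarrow> bool" where
  "translationally_equivariant S f \<longleftrightarrow>
     (\<exists>R. one_param_subgroup R \<and> (\<forall>t. \<forall>z\<in>S. f (of_real t + z) = cp_act (R t) (f z)))"

definition herm :: "complex^3 \<Rightarrow> complex^3 \<Rightarrow> complex" where
  "herm v w = (\<Sum>i\<in>UNIV. v $ i * cnj (w $ i))"

definition horizontal_lift ::
    "complex set \<Rightarrow> (complex \<Rightarrow> complex^3^3) \<Rightarrow> (complex \<Rightarrow> complex^3) \<Rightarrow> bool" where
  "horizontal_lift U f L \<longleftrightarrow>
     smooth_on U L \<and>
     (\<forall>z\<in>U. norm (L z) = 1 \<and> f z = cp_point (L z) \<and>
        herm (dx L z) (L z) = 0 \<and> herm (dy L z) (L z) = 0)"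

text \<open>
  The columns are \<open>-\<i> e\<^bsup>-u/2\<^esup> L\<^sub>z\<close>, \<open>-\<i> e\<^bsup>-u/2\<^esup> L\<^bsub>zbar\<^esub>\<close> and \<open>L\<close>: the Maurer-Cartan system
  \<open>lax_z\<close>, \<open>lax_zbar\<close> below, at spectral parameter 1, says exactly that the third column
  \<open>L\<close> of a solution has \<open>L\<^sub>z\<close> and \<open>L\<^bsub>zbar\<^esub>\<close> equal to \<open>\<i> e\<^bsup>u/2\<^esup>\<close> times the first and second column.
\<close>

definition lift_frame ::
    "(complex \<Rightarrow> real) \<Rightarrow> (complex \<Rightarrow> complex^3) \<Rightarrow> complex \<Rightarrow> complex^3^3" where
  "lift_frame u L z = transpose (vector
     [(- \<i> * of_real (exp (- u z / 2))) *s vec_d_z L z,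
      (- \<i> * of_real (exp (- u z / 2))) *s vec_d_zbar L z,
      L z])"

text \<open>
  The normalization of the surface by an isometry: some frame at 0 is the identity, frames
  being determined by the surface up to the choice of a horizontal lift and a \<open>U(1)\<close>-gauge.
\<close>

definition normalized_at_0 ::
    "complex set \<Rightarrow> (complex \<Rightarrow> real) \<Rightarrow> (complex \<Rightarrow> complex^3^3) \<Rightarrow> bool" where
  "normalized_at_0 S u f \<longleftrightarrow>
     (\<exists>U L k. open U \<and> 0 \<in> U \<and> U \<subseteq> S \<and> horizontal_lift U f L \<and> k \<in> U1 \<and>
        lift_frame u L 0 ** k = mat 1)"


section \<open>Extended frames\<close>

definition lax_z ::
    "(complex \<Rightarrow> real) \<Rightarrow> (complex \<Rightarrow> complex) \<Rightarrow> complex \<Rightarrow> complex \<Rightarrow> complex^3^3" where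
  "lax_z u \<psi> l z =
     (let r = \<i> * of_real (exp (u z / 2)); uz = d_z (\<lambda>w. of_real (u w)) z in
      cscale (inverse l) (vector
        [vector [0, 0, r],
         vector [- \<i> * \<psi> z * of_real (exp (- u z)), 0, 0],
         vector [0, r, 0]])
      + diag3 (uz / 2) (- uz / 2) 0)"

definition lax_zbar ::
    "(complex \<Rightarrow> real) \<Rightarrow> (complex \<Rightarrow> complex) \<Rightarrow> complex \<Rightarrow> complex \<Rightarrow> complex^3^3" where
  "lax_zbar u \<psi> l z =
     (let r = \<i> * of_real (exp (u z / 2)); uzb = d_zbar (\<lambda>w. of_real (u w)) z in
      cscale l (vector
        [vector [0, - \<i> * cnj (\<psi> z) * of_real (exp (- u z)), 0],
         vector [0, 0, r],
         vector [r, 0, 0]])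
      + diag3 (- uzb / 2) (uzb / 2) 0)"

text \<open>
  \<open>F z l\<close> is the frame at the point \<open>z\<close> and the spectral parameter \<open>l\<close> on the unit circle;
  \<open>e\<^sub>3\<close> is \<open>axis 3 1\<close>.
\<close>

definition extended_frame ::
    "complex set \<Rightarrow> (complex \<Rightarrow> real) \<Rightarrow> (complex \<Rightarrow> complex^3^3) \<Rightarrow>
     (complex \<Rightarrow> complex \<Rightarrow> complex^3^3) \<Rightarrow> bool" where
  "extended_frame S u f F \<longleftrightarrow>
     (\<exists>\<psi> G k. \<psi> holomorphic_on S \<and>
        (\<forall>l\<in>sphere 0 1. smooth_on S (\<lambda>z. G z l) \<and>
           (\<forall>z\<in>S. G z l \<in> SU3 \<and>
              matrix_inv (G z l) ** mat_d_z (\<lambda>w. G w l) z = lax_z u \<psi> l z \<and>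
              matrix_inv (G z l) ** mat_d_zbar (\<lambda>w. G w l) z = lax_zbar u \<psi> l z)) \<and>
        smooth_on S k \<and> k ` S \<subseteq> U1 \<and>
        (\<forall>z\<in>S. \<forall>l\<in>sphere 0 1. F z l = G z l ** k z) \<and>
        (\<forall>z\<in>S. f z = cp_point (F z 1 *v axis 3 1)))"


section \<open>Twisted loop groups and potentials\<close>

definition eps :: complex where
  "eps = cis (pi / 3)"

definition alpha :: complex where
  "alpha = cis (2 * pi / 3)"

definition P_sigma :: "complex^3^3" where
  "P_sigma = vector [vector [0, alpha, 0], vector [alpha\<^sup>2, 0, 0], vector [0, 0, 1]]"

definition sigma_group :: "complex^3^3 \<Rightarrow> complex^3^3" where
  "sigma_group g = P_sigma ** matrix_inv (transpose g) ** matrix_inv P_sigma"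

definition sigma_algebra :: "complex^3^3 \<Rightarrow> complex^3^3" where
  "sigma_algebra \<xi> = - (P_sigma ** transpose \<xi> ** matrix_inv P_sigma)"

text \<open>Loops are maps on \<open>\<complex>\<close> of which only the values on the unit circle matter.\<close>

definition smooth_loop :: "(complex \<Rightarrow> complex^3^3) \<Rightarrow> bool" where
  "smooth_loop g \<longleftrightarrow> smooth_on UNIV (\<lambda>\<theta>::real. g (cis \<theta>))"

definition loop_SL3 :: "(complex \<Rightarrow> complex^3^3) set" where
  "loop_SL3 = {g. smooth_loop g \<and>
     (\<forall>l\<in>sphere 0 1. g l \<in> SL3 \<and> g (eps * l) = sigma_group (g l))}"

definition loop_SU3 :: "(complex \<Rightarrow> complex^3^3) set" where
  "loop_SU3 = {g \<in> loop_SL3. \<forall>l\<in>sphere 0 1. g l \<in> SU3}"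

definition loop_plus_SL3 :: "(complex \<Rightarrow> complex^3^3) set" where
  "loop_plus_SL3 = {g \<in> loop_SL3. \<exists>h. continuous_on (cball 0 1) h \<and>
     (\<forall>i j. (\<lambda>l. h l $ i $ j) holomorphic_on ball 0 1) \<and> (\<forall>l\<in>sphere 0 1. h l = g l)}"

definition loop_su3 :: "(complex \<Rightarrow> complex^3^3) set" where
  "loop_su3 = {\<xi>. smooth_loop \<xi> \<and>
     (\<forall>l\<in>sphere 0 1. \<xi> l \<in> su3 \<and> \<xi> (eps * l) = sigma_algebra (\<xi> l))}"

definition degree_one_constant_potential :: "(complex \<Rightarrow> complex^3^3) \<Rightarrow> bool" where
  "degree_one_constant_potential D \<longleftrightarrow>
     D \<in> loop_su3 \<and>
     (\<exists>A B C. \<forall>l\<in>sphere 0 1. D l = cscale (inverse l) A + B + cscale l C)"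

text \<open>
  The Iwasawa splitting is unique only up to a \<open>U(1)\<close>-valued factor, chosen for each \<open>z\<close>; the
  existential quantifier selects a choice for which \<open>F\<close> is smooth in \<open>z\<close>.
\<close>

definition generated_by ::
    "complex set \<Rightarrow> (complex \<Rightarrow> real) \<Rightarrow> (complex \<Rightarrow> complex^3^3) \<Rightarrow>
     (complex \<Rightarrow> complex^3^3) \<Rightarrow> bool" where
  "generated_by S u f D \<longleftrightarrow>
     (\<exists>F V. (\<forall>z\<in>S. F z \<in> loop_SU3 \<and> V z \<in> loop_plus_SL3 \<and>
               (\<forall>l\<in>sphere 0 1. mat_exp (cscale z (D l)) = F z l ** V z l)) \<and>
            extended_frame S u f F)"

definition equivariant_frame ::
    "complex set \<Rightarrow> (complex \<Rightarrow> real) \<Rightarrow> (complex \<Rightarrow> complex^3^3) \<Rightarrow>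
     (complex \<Rightarrow> complex \<Rightarrow> complex^3^3) \<Rightarrow> (real \<Rightarrow> complex \<Rightarrow> complex^3^3) \<Rightarrow> bool" where
  "equivariant_frame S u f F \<rho> \<longleftrightarrow>
     extended_frame S u f F \<and>
     (\<forall>l\<in>sphere 0 1. F 0 l = mat 1 \<and> one_param_subgroup (\<lambda>t. \<rho> t l) \<and>
        (\<forall>t. \<forall>z\<in>S. F (of_real t + z) l = \<rho> t l ** F z l))"

end

theory Submission
  imports Defs
begin

text \<open>
  A point of the projective plane is the projection \<open>P\<close> onto a line, so that a surface is a matrix
  valued map \<open>f = P\<close> with Wirtinger derivatives \<open>A = P\<^sub>z\<close> and \<open>B = P\<^bsub>zbar\<^esub> = A\<^sup>*\<close>. This makes all local
  geometry an algebra of 3 by 3 matrices, and no horizontal lifts have to be chosen along the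
  surface.

  \<^emph>\<open>From a potential to equivariance.\<close> Since \<open>exp ((t + z) D) = exp (t D) exp (z D)\<close> and \<open>exp (t D)\<close>
  is unitary on the circle for real \<open>t\<close>, the loops \<open>exp (t D) F(z)\<close> and \<open>F(t + z)\<close> are unitary factors
  of the same loop. Two such factors differ by a unitary loop which extends holomorphically to the
  disc, hence is constant (\<open>unitary_holomorphic_loop_constant\<close>); being twisted it fixes the line of the
  third basis vector (\<open>sigma_fixed_axis3\<close>), and so \<open>f(t + z) = exp (t D(1)) f(z)\<close>
  (\<open>generated_imp_equivariant\<close>).

  \<^emph>\<open>From an equivariant frame to the potential.\<close> Differentiating \<open>F(t + z) = \<rho>(t) F(z)\<close> at \<open>t = 0\<close> gives
  \<open>\<rho>(t) = exp (t D)\<close> with \<open>D = F\<^bsup>-1\<^esup> F\<^sub>x\<close> at 0, a degree one loop by the Lax pair. The factor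
  \<open>V(z) = F(z)\<^bsup>-1\<^esup> exp (z D)\<close> depends on \<open>y = Im z\<close> only, and along the imaginary axis it satisfies
  \<open>V' = 2 \<i> (F\<^bsup>-1\<^esup> F\<^bsub>zbar\<^esub>) V\<close>. The coefficient is a polynomial of degree one in the spectral
  parameter, because the pole lives in \<open>F\<^bsup>-1\<^esup> F\<^sub>z\<close>; holomorphic dependence of linear systems on
  parameters (\<open>linear_ode_holomorphic\<close>, \<open>holomorphic_factor\<close>) makes \<open>V\<close> entire in the parameter, so that
  \<open>exp (z D) = F V\<close> is the Iwasawa splitting (\<open>equivariant_frame_potential\<close>).

  \<^emph>\<open>From equivariance to a global equivariant frame.\<close> The structure equations express the second
  derivatives of \<open>P\<close> by \<open>P\<close>, \<open>A\<close>, \<open>B\<close>, the conformal factor \<open>u\<close> and the cubic coefficient \<open>q\<close>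
  (\<open>minimal_lagrangian_structure\<close>), with the Gauss and Codazzi equations as compatibility conditions
  (\<open>gauss_codazzi\<close>). Equivariance forces \<open>u\<close> to depend on \<open>y\<close> only and \<open>q\<close> to be constant
  (\<open>equivariant_gauss\<close>), leaving the equation \<open>u'' = 4 (|q|\<^sup>2 exp (-2u) - exp u)\<close>. It is a quadratic
  system tangent to spheres in the coordinates \<open>(u', 2 |q| exp (-u), 2 sqrt 2 exp (u/2))\<close>, so its
  solutions exist for all \<open>y\<close> (\<open>tangential_ode_global\<close>, \<open>gauss_ode_global\<close>). Write \<open>\<alpha>(y) dx + \<beta>(y) dy\<close>
  for the Maurer-Cartan form belonging to such a solution. Its flatness is the Gauss equation in the
  Lax form \<open>\<alpha>' = [\<alpha>, \<beta>]\<close>, so that the solution of \<open>H' = H \<beta>\<close> intertwines \<open>\<alpha>(0)\<close> and \<open>\<alpha>(y)\<close>, and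
  \<open>exp (x \<alpha>(0)) H(y)\<close> is an equivariant frame of a minimal Lagrangian surface defined on the whole
  plane (\<open>frame_exists\<close>, \<open>surface_exists\<close>). That surface has the same \<open>u\<close> and \<open>q\<close> as the given one and,
  by the normalisation, the same \<open>P\<close> and \<open>A\<close> at 0 (\<open>normalized_initial_data\<close>). The structure
  equations then make the differences of \<open>P\<close> and \<open>A\<close> a solution of a homogeneous linear system along
  each segment from 0, which vanishes (\<open>minimal_lagrangian_congruence\<close>, \<open>equivariant_extension\<close>).
\<close>

(* leaves the dollar sign to the components of vectors *)
no_notation fps_nth (infixl "$" 75)

section \<open>Complex 3 by 3 matrices\<close>

lemma mat_eq3_iff: "(A::complex^3^3) = B \<longleftrightarrow> (\<forall>i j. A $ i $ j = B $ i $ j)"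
  by (auto simp: vec_eq_iff)

lemma mult_nth3: "((A::complex^3^3) ** (B::complex^3^3)) $ i $ j = A$i$1 * B$1$j + A$i$2 * B$2$j + A$i$3 * B$3$j"
  by (simp add: matrix_matrix_mult_def sum_3)

lemma transpose_nth: "transpose A $ i $ j = A $ j $ i"
  by (simp add: transpose_def)

lemma adjoint_nth: "adjoint_mat A $ i $ j = cnj (A $ j $ i)"
  by (simp add: adjoint_mat_def transpose_def)

lemma cscale_nth: "cscale c A $ i $ j = c * A $ i $ j"
  by (simp add: cscale_def)

lemma mat1_nth: "(mat 1 :: complex^3^3) $ i $ j = (if i = j then 1 else 0)"
  by (simp add: mat_def)

lemma trace3: "trace (A::complex^3^3) = A$1$1 + A$2$2 + A$3$3"
  by (simp add: trace_def sum_3)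

lemmas mat3_nth = mult_nth3 transpose_nth adjoint_nth cscale_nth mat1_nth

lemma one_neq_two_three [simp]:
  "(1::3) \<noteq> 2" "(1::3) \<noteq> 3" "(2::3) \<noteq> 3" "(2::3) \<noteq> 1" "(3::3) \<noteq> 1" "(3::3) \<noteq> 2"
  by auto

lemma mult_sub_left:
  fixes A B C :: "complex^3^3"
  shows "(A - B) ** C = A ** C - B ** C"
  by (simp add: mat_eq3_iff mult_nth3 algebra_simps)
lemma mult_sub_right:
  fixes A B C :: "complex^3^3"
  shows "A ** (B - C) = A ** B - A ** C"
  by (simp add: mat_eq3_iff mult_nth3 algebra_simps)
lemma mult_add_left:
  fixes A B C :: "complex^3^3"
  shows "(A + B) ** C = A ** C + B ** C"
  by (simp add: mat_eq3_iff mult_nth3 algebra_simps)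
lemma mult_add_right:
  fixes A B C :: "complex^3^3"
  shows "A ** (B + C) = A ** B + A ** C"
  by (simp add: mat_eq3_iff mult_nth3 algebra_simps)
lemma mult_minus_left3:
  fixes A B :: "complex^3^3"
  shows "(- A) ** B = - (A ** B)"
  by (simp add: mat_eq3_iff mult_nth3 algebra_simps)
lemma mult_minus_right3:
  fixes A B :: "complex^3^3"
  shows "A ** (- B) = - (A ** B)"
  by (simp add: mat_eq3_iff mult_nth3 algebra_simps)
lemma mult_cscale_left:
  fixes A B :: "complex^3^3"
  shows "cscale c A ** B = cscale c (A ** B)"
  by (auto simp: mat_eq3_iff mult_nth3 cscale_nth algebra_simps)
lemma mult_cscale_right:
  fixes A B :: "complex^3^3"
  shows "A ** cscale c B = cscale c (A ** B)"
  by (auto simp: mat_eq3_iff mult_nth3 cscale_nth algebra_simps)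
lemma mult_scaleR_left3:
  fixes A B :: "complex^3^3"
  shows "(r *\<^sub>R A) ** B = r *\<^sub>R (A ** B)"
  by (simp add: mat_eq3_iff mult_nth3 algebra_simps)
lemma mult_scaleR_right3:
  fixes A B :: "complex^3^3"
  shows "A ** (r *\<^sub>R B) = r *\<^sub>R (A ** B)"
  by (simp add: mat_eq3_iff mult_nth3 algebra_simps)
lemma mult_assoc3:
  fixes A B C :: "complex^3^3"
  shows "(A ** B) ** C = A ** (B ** C)"
  by (rule matrix_mul_assoc[symmetric])

lemmas mat_distrib = mult_sub_left mult_sub_right mult_add_left mult_add_right
  mult_minus_left3 mult_minus_right3 mult_cscale_left mult_cscale_right
  mult_scaleR_left3 mult_scaleR_right3 mult_assoc3

lemma cscale_cscale [simp]: "cscale a (cscale b A) = cscale (a * b) A"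
  by (auto simp: mat_eq3_iff cscale_nth)
lemma cscale_one [simp]: "cscale 1 A = A"
  by (auto simp: mat_eq3_iff cscale_nth)
lemma cscale_zero [simp]: "cscale 0 A = 0" "cscale c 0 = 0"
  by (auto simp: mat_eq3_iff cscale_nth)
lemma cscale_add: "cscale c (A + B) = cscale c A + cscale c B"
  by (auto simp: mat_eq3_iff cscale_nth algebra_simps)
lemma cscale_diff: "cscale c (A - B) = cscale c A - cscale c B"
  by (auto simp: mat_eq3_iff cscale_nth algebra_simps)
lemma cscale_minus: "cscale c (- A) = - cscale c A"
  by (auto simp: mat_eq3_iff cscale_nth algebra_simps)
lemma cscale_of_real: "cscale (of_real r) A = r *\<^sub>R A"
  unfolding mat_eq3_iff cscale_nth by (simp add: scaleR_conv_of_real[where 'a=complex])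
lemma cscale_add_left: "cscale (a + b) A = cscale a A + cscale b A"
  by (auto simp: mat_eq3_iff cscale_nth algebra_simps)

lemma adjoint_mult: "adjoint_mat (A ** B) = adjoint_mat B ** adjoint_mat A"
  by (auto simp: mat_eq3_iff mat3_nth algebra_simps)
lemma adjoint_adjoint [simp]: "adjoint_mat (adjoint_mat A) = A"
  by (auto simp: mat_eq3_iff mat3_nth)
lemma adjoint_add: "adjoint_mat (A + B) = adjoint_mat A + adjoint_mat B"
  by (auto simp: mat_eq3_iff mat3_nth)
lemma adjoint_diff: "adjoint_mat (A - B) = adjoint_mat A - adjoint_mat B"
  by (auto simp: mat_eq3_iff mat3_nth)
lemma adjoint_minus: "adjoint_mat (- A) = - adjoint_mat A"
  by (auto simp: mat_eq3_iff mat3_nth)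
lemma adjoint_cscale: "adjoint_mat (cscale c A) = cscale (cnj c) (adjoint_mat A)"
  by (auto simp: mat_eq3_iff mat3_nth)
lemma adjoint_scaleR: "adjoint_mat (r *\<^sub>R A) = r *\<^sub>R adjoint_mat A"
  by (auto simp: mat_eq3_iff mat3_nth)
lemma adjoint_mat1 [simp]: "adjoint_mat (mat 1) = mat 1"
  by (auto simp: mat_eq3_iff mat3_nth)

lemmas adjoint_simps = adjoint_mult adjoint_add adjoint_diff adjoint_minus adjoint_cscale adjoint_scaleR

lemma trace_cscale: "trace (cscale c A) = c * trace A"
  by (simp add: trace3 cscale_nth algebra_simps)
lemma trace_scaleR3: "trace (r *\<^sub>R (A::complex^3^3)) = of_real r * trace A"
  by (simp add: trace3 scaleR_conv_of_real[where 'a=complex] algebra_simps)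
lemma trace_minus3: "trace (- (A::complex^3^3)) = - trace A"
  by (simp add: trace3)
lemma trace_adjoint: "trace (adjoint_mat A) = cnj (trace A)"
  by (simp add: trace3 adjoint_nth)
lemma det_adjoint: "det (adjoint_mat A) = cnj (det A)"
  by (simp add: det_3 adjoint_nth algebra_simps)

lemma matrix_inv_unique:
  assumes "(A::complex^3^3) ** B = mat 1"
  shows "matrix_inv A = B"
proof -
  have BA: "B ** A = mat 1" by (rule matrix_left_right_inverse[THEN iffD1, OF assms])
  have "A ** matrix_inv A = mat 1 \<and> matrix_inv A ** A = mat 1"
    unfolding matrix_inv_def by (rule someI[where x = B]) (use assms BA in simp)
  then have "B ** (A ** matrix_inv A) = B" by simp
  then show ?thesis by (simp add: matrix_mul_assoc BA)
qed

lemma matrix_inv_unique': "(B::complex^3^3) ** A = mat 1 \<Longrightarrow> matrix_inv A = B"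
  by (rule matrix_inv_unique, rule matrix_left_right_inverse[THEN iffD1])

text \<open>
  The adjugate. It is polynomial in the entries, so that the inverse of a loop in \<open>SL(3, \<complex>)\<close> is
  holomorphic wherever the loop is. The cyclic indexing in the type \<open>3\<close> takes care of the signs.
\<close>

definition adj3 :: "complex^3^3 \<Rightarrow> complex^3^3" where
  "adj3 A = (\<chi> i j. A $ (j+1) $ (i+1) * A $ (j+2) $ (i+2) - A $ (j+1) $ (i+2) * A $ (j+2) $ (i+1))"

lemma adj3_nth: "adj3 A $ i $ j = A $ (j+1) $ (i+1) * A $ (j+2) $ (i+2) - A $ (j+1) $ (i+2) * A $ (j+2) $ (i+1)"
  by (simp add: adj3_def)

lemma cyclic3: "(1::3) + 1 = 2" "(1::3) + 2 = 3" "(2::3) + 1 = 3" "(2::3) + 2 = 1" "(3::3) + 1 = 1" "(3::3) + 2 = 2"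
  by simp_all

lemma adj3_entry: "(A ** adj3 A) $ i $ j = (if i = j then det A else 0)"
proof -
  have "i = 1 \<or> i = 2 \<or> i = 3" "j = 1 \<or> j = 2 \<or> j = 3" using exhaust_3 by auto
  then show ?thesis
    unfolding mult_nth3 adj3_nth det_3
    by (elim disjE) (simp_all only: cyclic3, simp_all add: algebra_simps)
qed

lemma adj3_mult: "A ** adj3 A = cscale (det A) (mat 1)"
  by (simp add: mat_eq3_iff adj3_entry cscale_nth mat1_nth)

lemma matrix_inv_SL3: "A \<in> SL3 \<Longrightarrow> matrix_inv A = adj3 A"
  by (rule matrix_inv_unique) (simp add: adj3_mult SL3_def)

lemma SL3_inv: 
  assumes "A \<in> SL3"
  shows "A ** matrix_inv A = mat 1" "matrix_inv A ** A = mat 1" "matrix_inv A \<in> SL3"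
proof -
  show 1: "A ** matrix_inv A = mat 1"
    using assms by (simp add: matrix_inv_SL3 adj3_mult SL3_def)
  then show 2: "matrix_inv A ** A = mat 1" by (rule matrix_left_right_inverse[THEN iffD1])
  have "det (A ** matrix_inv A) = 1" by (simp add: 1)
  then show "matrix_inv A \<in> SL3" using assms by (simp add: SL3_def det_mul)
qed

lemma SU3_SL3: "A \<in> SU3 \<Longrightarrow> A \<in> SL3"
  by (simp add: SU3_def SL3_def)

lemma SU3_adj: "A \<in> SU3 \<Longrightarrow> adjoint_mat A ** A = mat 1" "A \<in> SU3 \<Longrightarrow> A ** adjoint_mat A = mat 1"
  unfolding SU3_def by (auto intro: matrix_left_right_inverse[THEN iffD1])

lemma SU3_inv: "A \<in> SU3 \<Longrightarrow> matrix_inv A = adjoint_mat A"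
  by (rule matrix_inv_unique) (rule SU3_adj)

lemma SU3_adjoint: "A \<in> SU3 \<Longrightarrow> adjoint_mat A \<in> SU3"
  using SU3_adj(2)[of A] by (simp add: SU3_def det_adjoint)

lemma SU3_mult:
  assumes "A \<in> SU3" "B \<in> SU3"
  shows "A ** B \<in> SU3"
proof -
  have "adjoint_mat (A ** B) ** (A ** B) = adjoint_mat B ** ((adjoint_mat A ** A) ** B)"
    by (simp only: adjoint_mult matrix_mul_assoc)
  also have "\<dots> = mat 1" by (simp only: SU3_adj assms matrix_mul_lid)
  finally show ?thesis using assms by (simp add: SU3_def det_mul)
qed

lemma SU3_mat1: "mat 1 \<in> SU3"
  by (simp add: SU3_def)

lemma U1_SU3: "k \<in> U1 \<Longrightarrow> k \<in> SU3"
proof -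
  assume "k \<in> U1"
  then obtain c where k: "k = diag3 c (inverse c) 1" and c: "cmod c = 1" unfolding U1_def by auto
  have "cnj c * c = 1" using c by (simp add: complex_norm_square[symmetric] mult.commute)
  moreover have "c \<noteq> 0" using c by auto
  ultimately have "inverse c = cnj c" by (simp add: field_simps)
  then show ?thesis unfolding k SU3_def using \<open>cnj c * c = 1\<close>
    by (simp add: mat_eq3_iff forall_3 mat3_nth diag3_def det_3 mult.commute)
qed

text \<open>The linear embedding of a single complex entry, used to differentiate matrices entrywise.\<close>

definition entry_mat :: "3 \<Rightarrow> 3 \<Rightarrow> complex \<Rightarrow> complex^3^3" where
  "entry_mat i j c = (\<chi> a b. if a = i \<and> b = j then c else 0)"

lemma entry_mat_linear: "bounded_linear (entry_mat i j)"
  by (rule linear_conv_bounded_linear[THEN iffD1], rule linearI) (auto simp: entry_mat_def mat_eq3_iff)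

lemma mat_as_entries: "(A::complex^3^3) = (\<Sum>i\<in>UNIV. \<Sum>j\<in>UNIV. entry_mat i j (A $ i $ j))"
  by (simp add: mat_eq3_iff forall_3 sum_3 entry_mat_def)

lemma bounded_linear_nth2: "bounded_linear (\<lambda>A::complex^3^3. A $ i $ j)"
  using bounded_linear_compose[OF bounded_linear_vec_nth bounded_linear_vec_nth] .

lemma bounded_bilinear_mult3: "bounded_bilinear ((**) :: complex^3^3 \<Rightarrow> complex^3^3 \<Rightarrow> complex^3^3)"
  by (rule bilinear_conv_bounded_bilinear[THEN iffD1])
     (auto simp: bilinear_def intro!: linearI simp: mat_distrib)

lemma mult3_bound: obtains K where "K \<ge> 1" "\<And>(A::complex^3^3) (B::complex^3^3). norm (A ** B) \<le> K * norm A * norm B"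
proof -
  obtain K where K: "\<And>(A::complex^3^3) (B::complex^3^3). norm (A ** B) \<le> norm A * norm B * K"
    using bounded_bilinear.bounded[OF bounded_bilinear_mult3] by blast
  have "norm (A ** B) \<le> max K 1 * norm A * norm B" for A :: "complex^3^3" and B :: "complex^3^3"
  proof -
    have "norm A * norm B * K \<le> norm A * norm B * max K 1" by (intro mult_left_mono) auto
    then show ?thesis using K[of A B] by (simp add: mult.commute mult.left_commute)
  qed
  then show thesis using that[of "max K 1"] by simp
qed

lemma bounded_linear_adjoint: "bounded_linear adjoint_mat"
  by (rule linear_conv_bounded_linear[THEN iffD1], rule linearI) (auto simp: adjoint_simps)

lemma bounded_linear_cscale: "bounded_linear (cscale c)"
  by (rule linear_conv_bounded_linear[THEN iffD1], rule linearI)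
     (auto simp: cscale_add mat_eq3_iff cscale_nth)

lemma bounded_bilinear_cscale: "bounded_bilinear cscale"
  by (rule bilinear_conv_bounded_bilinear[THEN iffD1])
     (auto simp: bilinear_def cscale_add cscale_add_left mat_eq3_iff cscale_nth intro!: linearI)

lemma bounded_linear_trace: "bounded_linear (trace :: complex^3^3 \<Rightarrow> complex)"
  by (rule linear_conv_bounded_linear[THEN iffD1], rule linearI)
     (auto simp: trace_add trace_scaleR3 scaleR_conv_of_real[where 'a=complex])

lemma bounded_linear_transpose: "bounded_linear (transpose :: complex^3^3 \<Rightarrow> complex^3^3)"
  by (rule linear_conv_bounded_linear[THEN iffD1], rule linearI)
     (auto simp: mat_eq3_iff transpose_nth)

lemmas mult3_has_derivative = bounded_bilinear.FDERIV[OF bounded_bilinear_mult3]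
lemmas mult3_has_vector_derivative = bounded_bilinear.has_vector_derivative[OF bounded_bilinear_mult3]
lemmas mult3_continuous_on [continuous_intros] = bounded_bilinear.continuous_on[OF bounded_bilinear_mult3]
lemmas adjoint_has_vector_derivative = bounded_linear.has_vector_derivative[OF bounded_linear_adjoint]
lemmas cscale_continuous_on [continuous_intros] = bounded_bilinear.continuous_on[OF bounded_bilinear_cscale]
lemmas adjoint_continuous_on [continuous_intros] = bounded_linear.continuous_on[OF bounded_linear_adjoint]

lemma has_vector_derivative_entries:
  fixes M :: "real \<Rightarrow> complex^3^3"
  shows "(M has_vector_derivative M') F \<longleftrightarrow> (\<forall>i j. ((\<lambda>t. M t $ i $ j) has_vector_derivative M' $ i $ j) F)"
proof
  assume "(M has_vector_derivative M') F"
  then show "\<forall>i j. ((\<lambda>t. M t $ i $ j) has_vector_derivative M' $ i $ j) F"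
    using bounded_linear.has_vector_derivative[OF bounded_linear_nth2] by blast
next
  assume *: "\<forall>i j. ((\<lambda>t. M t $ i $ j) has_vector_derivative M' $ i $ j) F"
  have "((\<lambda>t. \<Sum>i\<in>UNIV. \<Sum>j\<in>UNIV. entry_mat i j (M t $ i $ j)) has_vector_derivative
        (\<Sum>i\<in>UNIV. \<Sum>j\<in>UNIV. entry_mat i j (M' $ i $ j))) F"
    by (intro has_vector_derivative_sum bounded_linear.has_vector_derivative[OF entry_mat_linear]
        *[rule_format])
  then show "(M has_vector_derivative M') F" by (simp add: mat_as_entries[symmetric])
qed

lemma has_derivative_entries:
  fixes M :: "'a::real_normed_vector \<Rightarrow> complex^3^3"
  assumes "\<And>i j. ((\<lambda>t. M t $ i $ j) has_derivative (\<lambda>h. M' h $ i $ j)) F"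
  shows "(M has_derivative M') F"
proof -
  have "((\<lambda>t. \<Sum>i\<in>UNIV. \<Sum>j\<in>UNIV. entry_mat i j (M t $ i $ j)) has_derivative
        (\<lambda>h. \<Sum>i\<in>UNIV. \<Sum>j\<in>UNIV. entry_mat i j (M' h $ i $ j))) F"
    by (intro has_derivative_sum bounded_linear.has_derivative[OF entry_mat_linear] assms)
  then show ?thesis by (simp add: mat_as_entries[symmetric])
qed

lemma continuous_on_entries:
  fixes M :: "'a::topological_space \<Rightarrow> complex^3^3"
  assumes "\<And>i j. continuous_on S (\<lambda>t. M t $ i $ j)"
  shows "continuous_on S M"
proof -
  have "continuous_on S (\<lambda>t. \<Sum>i\<in>UNIV. \<Sum>j\<in>UNIV. entry_mat i j (M t $ i $ j))"
    by (intro continuous_on_sum bounded_linear.continuous_on[OF entry_mat_linear] assms)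
  then show ?thesis by (simp add: mat_as_entries[symmetric])
qed

section \<open>Ordinary differential equations\<close>

text \<open>
  Squared norms are differentiable also where \<open>w\<close> vanishes. By \<open>2 \<eta> |w| \<le> |w|\<^sup>2 + \<eta>\<^sup>2\<close> the function
  \<open>(|w|\<^sup>2 + \<eta>\<^sup>2) exp (- (2 C + 1) s)\<close> does not increase, which explains the constant in the exponent.
\<close>

lemma gronwall_square:
  fixes w :: "real \<Rightarrow> 'a::real_inner"
  assumes der: "\<And>s. s \<in> {0..1} \<Longrightarrow> (w has_vector_derivative w' s) (at s within {0..1})"
    and bd: "\<And>s. s \<in> {0..1} \<Longrightarrow> norm (w' s) \<le> C * norm (w s) + \<eta>"
    and C: "0 \<le> C" and \<eta>: "0 \<le> \<eta>" and t: "t \<in> {0..1}"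
  shows "(norm (w t))\<^sup>2 \<le> ((norm (w 0))\<^sup>2 + \<eta>\<^sup>2) * exp (2 * C + 1)"
proof -
  define \<phi> where "\<phi> s = (w s \<bullet> w s + \<eta>\<^sup>2) * exp (- (2 * C + 1) * s)" for s
  have cw: "continuous_on {0..1} w"
    using der by (meson continuous_on_eq_continuous_within has_vector_derivative_continuous)
  have "\<phi> 0 \<ge> \<phi> t"
  proof (rule DERIV_nonpos_imp_decreasing_open[where f = \<phi> and a = 0 and b = t])
    show "0 \<le> t" using t by simp
    show "continuous_on {0..t} \<phi>" unfolding \<phi>_def
      using t by (intro continuous_intros continuous_on_subset[OF cw]) auto
    fix s :: real assume s: "0 < s" "s < t"
    then have s01: "s \<in> {0..1}" "0 < s" "s < 1" using t by auto
    have dw: "(w has_vector_derivative w' s) (at s)"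
      using der[OF s01(1)] at_within_Icc_at[OF s01(2,3)] by simp
    have "((\<lambda>s. w s \<bullet> w s) has_vector_derivative (w s \<bullet> w' s + w' s \<bullet> w s)) (at s)"
      by (rule bounded_bilinear.has_vector_derivative[OF bounded_bilinear_inner dw dw])
    then have d: "((\<lambda>s. w s \<bullet> w s) has_real_derivative (2 * (w s \<bullet> w' s))) (at s)"
      by (simp add: has_real_derivative_iff_has_vector_derivative inner_commute)
    define y where "y = (2 * (w s \<bullet> w' s)) * exp (- (2 * C + 1) * s)
        + (w s \<bullet> w s + \<eta>\<^sup>2) * (exp (- (2 * C + 1) * s) * (- (2 * C + 1)))"
    have "DERIV \<phi> s :> y" unfolding \<phi>_def y_def
      by (rule derivative_eq_intros d refl | simp)+
    moreover have "y \<le> 0"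
    proof -
      have "w s \<bullet> w' s \<le> norm (w s) * norm (w' s)" by (rule norm_cauchy_schwarz)
      also have "\<dots> \<le> norm (w s) * (C * norm (w s) + \<eta>)"
        using bd[OF s01(1)] by (simp add: mult_left_mono)
      finally have 1: "w s \<bullet> w' s \<le> C * (norm (w s))\<^sup>2 + \<eta> * norm (w s)"
        by (simp add: power2_eq_square algebra_simps)
      have "2 * (\<eta> * norm (w s)) \<le> \<eta>\<^sup>2 + (norm (w s))\<^sup>2"
        using sum_squares_bound[of \<eta> "norm (w s)"] by simp
      moreover have "0 \<le> C * \<eta>\<^sup>2" using C by simp
      ultimately have "2 * (w s \<bullet> w' s) - (w s \<bullet> w s + \<eta>\<^sup>2) * (2 * C + 1) \<le> 0"
        using 1 by (simp add: power2_norm_eq_inner algebra_simps)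
      then have "(2 * (w s \<bullet> w' s) - (w s \<bullet> w s + \<eta>\<^sup>2) * (2 * C + 1)) * exp (- (2 * C + 1) * s) \<le> 0"
        by (simp add: mult_nonpos_nonneg)
      then show ?thesis unfolding y_def by (simp add: algebra_simps)
    qed
    ultimately show "\<exists>y. DERIV \<phi> s :> y \<and> y \<le> 0" by blast
  qed
  have "(norm (w t))\<^sup>2 + \<eta>\<^sup>2 \<le> ((norm (w 0))\<^sup>2 + \<eta>\<^sup>2) * exp ((2 * C + 1) * t)"
  proof -
    have "((norm (w t))\<^sup>2 + \<eta>\<^sup>2) * exp (- (2 * C + 1) * t) * exp ((2 * C + 1) * t)
        \<le> ((norm (w 0))\<^sup>2 + \<eta>\<^sup>2) * exp ((2 * C + 1) * t)"
      using \<open>\<phi> 0 \<ge> \<phi> t\<close> by (intro mult_right_mono) (auto simp: \<phi>_def power2_norm_eq_inner)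
    moreover have "exp (- (2 * C + 1) * t) * exp ((2 * C + 1) * t) = 1"
      by (simp only: exp_add[symmetric]) (simp add: algebra_simps)
    ultimately show ?thesis by (simp only: mult.assoc mult_1_right)
  qed
  also have "\<dots> \<le> ((norm (w 0))\<^sup>2 + \<eta>\<^sup>2) * exp (2 * C + 1)"
    using t C by (intro mult_left_mono) (auto simp: mult_left_le)
  finally show ?thesis using zero_le_power2[of \<eta>] by linarith
qed

lemma gronwall_zero:
  fixes w :: "real \<Rightarrow> 'a::real_inner"
  assumes "\<And>s. s \<in> {0..1} \<Longrightarrow> (w has_vector_derivative w' s) (at s within {0..1})"
    and "\<And>s. s \<in> {0..1} \<Longrightarrow> norm (w' s) \<le> C * norm (w s)"
    and "w 0 = 0" and t: "t \<in> {0..1}"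
  shows "w t = 0"
proof -
  have "(norm (w t))\<^sup>2 \<le> ((norm (w 0))\<^sup>2 + 0\<^sup>2) * exp (2 * max C 0 + 1)"
  proof (rule gronwall_square)
    fix s :: real assume s: "s \<in> {0..1}"
    have "C * norm (w s) \<le> max C 0 * norm (w s)" by (intro mult_right_mono) auto
    then show "norm (w' s) \<le> max C 0 * norm (w s) + 0" using assms(2)[OF s] by linarith
  qed (use assms in auto)
  then show ?thesis using assms(3) by simp
qed

text \<open>
  The oriented integral from 0 to \<open>t\<close>: one of the two intervals is empty or a point.
\<close>

definition antider :: "(real \<Rightarrow> 'a::banach) \<Rightarrow> real \<Rightarrow> 'a" where
  "antider g t = integral {0..t} g - integral {t..0} g"

lemma antider_0 [simp]: "antider g 0 = 0"
  by (simp add: antider_def)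

lemma antider_has_vector_derivative:
  fixes g :: "real \<Rightarrow> 'a::banach"
  assumes g: "continuous_on UNIV g"
  shows "(antider g has_vector_derivative g t) (at t)"
proof -
  define N where "N = \<bar>t\<bar> + 1"
  have gs: "continuous_on S g" for S using g continuous_on_subset by blast
  have i: "g integrable_on {a..b}" for a b
    by (rule integrable_continuous_real[OF gs])
  have "((\<lambda>u. integral {-N..u} g) has_vector_derivative g t) (at t within {-N..N})"
    by (rule integral_has_vector_derivative[OF gs]) (auto simp: N_def)
  then have "((\<lambda>u. integral {-N..u} g) has_vector_derivative g t) (at t)"
    using at_within_Icc_at[of "-N" t N] by (simp add: N_def)
  then have d: "((\<lambda>u. integral {-N..u} g - integral {-N..0} g) has_vector_derivative g t) (at t)"
    using has_vector_derivative_diff[OF _ has_vector_derivative_const] by fastforce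
  show ?thesis
  proof (rule has_vector_derivative_transform_within_open[OF d])
    show "open {-N<..<N}" "t \<in> {-N<..<N}" by (auto simp: N_def)
    fix u assume u: "u \<in> {-N<..<N}"
    show "integral {-N..u} g - integral {-N..0} g = antider g u"
    proof (cases "u \<ge> 0")
      case True
      then have "integral {-N..0} g + integral {0..u} g = integral {-N..u} g"
        using u by (intro Henstock_Kurzweil_Integration.integral_combine i) (auto simp: N_def)
      moreover have "integral {u..0} g = 0" using True by (cases "u = 0") auto
      ultimately show ?thesis by (simp add: antider_def algebra_simps)
    next
      case False
      then have "integral {-N..u} g + integral {u..0} g = integral {-N..0} g"
        using u by (intro Henstock_Kurzweil_Integration.integral_combine i) (auto simp: N_def)
      moreover have "integral {0..u} g = 0" using False by auto
      ultimately show ?thesis by (simp add: antider_def algebra_simps)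
    qed
  qed
qed

lemma antider_continuous_on:
  fixes g :: "real \<Rightarrow> 'a::banach"
  assumes "continuous_on UNIV g"
  shows "continuous_on S (antider g)"
  using antider_has_vector_derivative[OF assms]
  by (meson continuous_at_imp_continuous_on has_vector_derivative_continuous)

lemma exp_growth_bound_nonneg:
  fixes G :: "real \<Rightarrow> 'a::real_normed_vector"
  assumes d: "\<And>t. (G has_vector_derivative g t) (at t)" and G0: "G 0 = 0"
    and b: "\<And>t. t \<ge> 0 \<Longrightarrow> norm (g t) \<le> M * exp (c * t)" and c: "c > 0" and t: "t \<ge> 0" and M: "M \<ge> 0"
  shows "norm (G t) \<le> (M / c) * exp (c * t)"
proof (cases "t = 0")
  case True then show ?thesis using G0 c M by simp
next
  case False
  have "norm (G t - G 0) \<le> (M / c) * exp (c * t) - (M / c) * exp (c * 0)"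
  proof (rule differentiable_bound_general[where f' = g and \<phi>' = "\<lambda>t. M * exp (c * t)"])
    show "0 < t" using False t by simp
    show "continuous_on {0..t} G" using d
      by (meson continuous_at_imp_continuous_on has_vector_derivative_continuous)
    show "continuous_on {0..t} (\<lambda>t. (M / c) * exp (c * t))" by (intro continuous_intros)
    show "((\<lambda>t. (M / c) * exp (c * t)) has_vector_derivative M * exp (c * x)) (at x)" for x
      using c by (auto intro!: derivative_eq_intros simp: has_real_derivative_iff_has_vector_derivative[symmetric])
  qed (use d b in auto)
  also have "\<dots> \<le> (M / c) * exp (c * t)" using M c by simp
  finally show ?thesis using G0 by simp
qed

lemma exp_growth_bound:
  fixes G :: "real \<Rightarrow> 'a::real_normed_vector"
  assumes d: "\<And>t. (G has_vector_derivative g t) (at t)" and G0: "G 0 = 0"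
    and b: "\<And>t. norm (g t) \<le> M * exp (c * \<bar>t\<bar>)" and c: "c > 0" and M: "M \<ge> 0"
  shows "norm (G t) \<le> (M / c) * exp (c * \<bar>t\<bar>)"
proof (cases "t \<ge> 0")
  case True
  have "norm (g s) \<le> M * exp (c * s)" if "s \<ge> 0" for s using b[of s] that by simp
  then show ?thesis using exp_growth_bound_nonneg[OF d G0 _ c True M] True by simp
next
  case False
  have d': "((\<lambda>s. G (- s)) has_vector_derivative - g (- s)) (at s)" for s
  proof -
    have "((\<lambda>s. - s) has_vector_derivative - 1) (at s)"
      by (auto intro!: derivative_eq_intros)
    from vector_diff_chain_at[OF this, of G "g (-s)"] d[of "-s"] show ?thesis by (simp add: o_def)
  qed
  have "norm (- g (- s)) \<le> M * exp (c * s)" if "s \<ge> 0" for s using b[of "- s"] that by simp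
  from exp_growth_bound_nonneg[OF d' _ this c _ M, of "- t"] False G0 show ?thesis by simp
qed

text \<open>
  The integral operator is a contraction of the bounded continuous functions once solutions are
  rescaled by \<open>exp (-2 L |t|)\<close> (Bielecki's weight), which yields a solution on the whole line
  at once.
\<close>

theorem picard_global:
  fixes F :: "real \<Rightarrow> 'a::banach \<Rightarrow> 'a"
  assumes cont: "continuous_on UNIV (\<lambda>(t, x). F t x)"
    and lip: "\<And>t x y. norm (F t x - F t y) \<le> L * norm (x - y)"
    and bd: "\<And>t. norm (F t 0) \<le> K"
  shows "\<exists>x. x 0 = x0 \<and> (\<forall>t. (x has_vector_derivative F t (x t)) (at t))"
proof -
  define l where "l = max L 1"
  have l: "l > 0" and lip: "norm (F t x - F t y) \<le> l * norm (x - y)" for t x y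
    using lip[of t x y] mult_right_mono[of L l "norm (x - y)"] by (auto simp: l_def)
  have K: "K \<ge> 0" using bd[of 0] norm_ge_zero order_trans by blast
  define E where "E t = exp (2 * l * \<bar>t\<bar>)" for t :: real
  have E1: "E t \<ge> 1" and E0: "E t > 0" for t using l by (auto simp: E_def)
  have contE: "continuous_on UNIV E" unfolding E_def by (intro continuous_intros)
  define I where "I b s = F s (E s *\<^sub>R apply_bcontfun b s)" for b :: "real \<Rightarrow>\<^sub>C 'a" and s
  have contI: "continuous_on UNIV (I b)" for b
  proof -
    have "continuous_on UNIV (\<lambda>s. (\<lambda>(t, x). F t x) (s, E s *\<^sub>R apply_bcontfun b s))"
      by (rule continuous_on_compose2[OF cont]) (auto intro!: continuous_intros contE)
    then show ?thesis by (simp add: I_def[abs_def])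
  qed
  define T where "T b t = (1 / E t) *\<^sub>R (x0 + antider (I b) t)" for b t
  have normI: "norm (I b s) \<le> (K + l * norm b) * exp (2 * l * \<bar>s\<bar>)" for b s
  proof -
    have "norm (I b s) \<le> norm (F s 0) + norm (I b s - F s 0)"
      by (metis add.commute diff_add_cancel norm_triangle_ineq)
    also have "\<dots> \<le> K + l * norm (E s *\<^sub>R apply_bcontfun b s)"
      using bd[of s] lip[of s "E s *\<^sub>R apply_bcontfun b s" 0] by (simp add: I_def)
    also have "\<dots> \<le> K * E s + l * (E s * norm b)"
      using K E1[of s] l norm_bounded[of b s]
      by (intro add_mono mult_left_mono) (auto simp: mult_le_cancel_left1 mult_left_mono)
    finally show ?thesis by (simp add: E_def algebra_simps)
  qed
  have Tb: "T b \<in> bcontfun" for b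
  proof (rule bcontfun_normI)
    show "continuous_on UNIV (T b)" unfolding T_def
      using E0 by (intro continuous_intros contE antider_continuous_on contI)
        (metis less_irrefl)
    fix t
    have "norm (antider (I b) t) \<le> (K + l * norm b) / (2 * l) * exp (2 * l * \<bar>t\<bar>)"
      using l K by (intro exp_growth_bound[OF antider_has_vector_derivative[OF contI]] normI) auto
    then have "norm (x0 + antider (I b) t) \<le> norm x0 * E t + (K + l * norm b) / (2 * l) * E t"
      using norm_triangle_ineq[of x0 "antider (I b) t"] mult_left_mono[OF E1[of t] norm_ge_zero[of x0]]
      unfolding E_def by linarith
    then have "norm (x0 + antider (I b) t) / E t \<le> norm x0 + (K + l * norm b) / (2 * l)"
      using E0[of t] by (simp add: divide_le_eq algebra_simps)
    then show "norm (T b t) \<le> norm x0 + (K + l * norm b) / (2 * l)"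
      using E0[of t] by (simp add: T_def)
  qed
  define \<Phi> where "\<Phi> b = Bcontfun (T b)" for b
  have \<Phi>: "apply_bcontfun (\<Phi> b) t = T b t" for b t
    unfolding \<Phi>_def by (simp add: Bcontfun_inverse[OF Tb])
  have "dist (\<Phi> b) (\<Phi> c) \<le> (1/2) * dist b c" for b c
  proof (rule dist_bound)
    fix t
    have d: "((\<lambda>t. antider (I b) t - antider (I c) t) has_vector_derivative I b t - I c t) (at t)" for t
      by (intro has_vector_derivative_diff antider_has_vector_derivative contI)
    have "norm (I b s - I c s) \<le> (l * dist b c) * exp (2 * l * \<bar>s\<bar>)" for s
    proof -
      have "norm (I b s - I c s) \<le> l * norm (E s *\<^sub>R apply_bcontfun b s - E s *\<^sub>R apply_bcontfun c s)"
        unfolding I_def by (rule lip)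
      also have "\<dots> = l * (E s * dist (apply_bcontfun b s) (apply_bcontfun c s))"
        using E0[of s] by (simp add: dist_norm scaleR_diff_right[symmetric])
      also have "\<dots> \<le> l * (E s * dist b c)"
        using l E0[of s] dist_bounded[of b s c] by (intro mult_left_mono) auto
      finally show ?thesis by (simp add: E_def algebra_simps)
    qed
    from exp_growth_bound[OF d _ this] l
    have "norm (antider (I b) t - antider (I c) t) \<le> (l * dist b c) / (2 * l) * E t"
      by (simp add: E_def)
    then have "norm (antider (I b) t - antider (I c) t) / E t \<le> dist b c / 2"
      using E0[of t] l by (simp add: divide_le_eq)
    moreover have "T b t - T c t = (1 / E t) *\<^sub>R (antider (I b) t - antider (I c) t)"
      by (simp add: T_def algebra_simps)
    ultimately show "dist (apply_bcontfun (\<Phi> b) t) (apply_bcontfun (\<Phi> c) t) \<le> (1/2) * dist b c"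
      using E0[of t] by (simp add: \<Phi> dist_norm)
  qed
  then obtain b where b: "\<Phi> b = b"
    using banach_fix_type[of "1/2" \<Phi>] by auto
  define x where "x t = x0 + antider (I b) t" for t
  have xb: "E t *\<^sub>R apply_bcontfun b t = x t" for t
  proof -
    have "apply_bcontfun b t = (1 / E t) *\<^sub>R x t" using \<Phi>[of b t] b by (simp add: T_def x_def)
    then show ?thesis using E0[of t] by simp
  qed
  have "(x has_vector_derivative F t (x t)) (at t)" for t
  proof -
    have "(x has_vector_derivative 0 + I b t) (at t)" unfolding x_def
      by (intro has_vector_derivative_add has_vector_derivative_const antider_has_vector_derivative contI)
    then show ?thesis by (simp add: I_def xb)
  qed
  moreover have "x 0 = x0" by (simp add: x_def)
  ultimately show ?thesis by blast
qed

text \<open>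
  An autonomous system whose right-hand side is tangent to spheres: the radial retraction onto
  the ball makes it globally Lipschitz without changing it along the solution.
\<close>

theorem tangential_ode_global:
  fixes \<Phi> :: "'a::euclidean_space \<Rightarrow> 'a"
  assumes lip: "\<And>x y. x \<in> cball 0 r \<Longrightarrow> y \<in> cball 0 r \<Longrightarrow> norm (\<Phi> x - \<Phi> y) \<le> L * norm (x - y)"
    and tang: "\<And>x. x \<bullet> \<Phi> x = 0" and x0: "norm x0 = r" and r: "r > 0" and L: "L \<ge> 0"
  shows "\<exists>x. x 0 = x0 \<and> (\<forall>t. (x has_vector_derivative \<Phi> (x t)) (at t) \<and> norm (x t) = r)"
proof -
  let ?B = "cball (0::'a) r"
  define \<pi> where "\<pi> = closest_point ?B"
  have B: "convex ?B" "closed ?B" "?B \<noteq> {}" using r by auto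
  have \<pi>B: "\<pi> x \<in> ?B" for x unfolding \<pi>_def using closest_point_in_set[OF B(2,3)] .
  have \<pi>lip: "norm (\<pi> x - \<pi> y) \<le> norm (x - y)" for x y
    using closest_point_lipschitz[OF B] by (simp add: \<pi>_def dist_norm)
  have \<Phi>lip: "norm (\<Phi> (\<pi> x) - \<Phi> (\<pi> y)) \<le> L * norm (x - y)" for x y
    using lip[OF \<pi>B \<pi>B, of x y] mult_left_mono[OF \<pi>lip[of x y] L] by linarith
  have "L-lipschitz_on UNIV (\<lambda>x. \<Phi> (\<pi> x))"
    using \<Phi>lip L by (intro lipschitz_onI) (auto simp: dist_norm)
  then have "continuous_on UNIV (\<lambda>x. \<Phi> (\<pi> x))" by (rule lipschitz_on_continuous_on)
  then have "continuous_on UNIV (\<lambda>p::real \<times> 'a. \<Phi> (\<pi> (snd p)))"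
    by (rule continuous_on_compose2) (auto intro: continuous_intros)
  then have cont: "continuous_on UNIV (\<lambda>(t::real, x). \<Phi> (\<pi> x))" by (simp add: case_prod_beta')
  obtain x where x: "x 0 = x0" "\<And>t. (x has_vector_derivative \<Phi> (\<pi> (x t))) (at t)"
    using picard_global[OF cont, of L "norm (\<Phi> (\<pi> 0))" x0] \<Phi>lip by auto
  have \<pi>_scale: "\<exists>c\<ge>0. \<pi> v = c *\<^sub>R v \<and> (norm v \<le> r \<longrightarrow> c = 1)" for v
  proof (cases "norm v \<le> r")
    case True
    then have "\<pi> v = v" unfolding \<pi>_def by (intro closest_point_self) simp
    then show ?thesis by (intro exI[of _ 1]) simp
  next
    case False
    then have v: "norm v > r" "norm v > 0" using r by linarith+
    define p where "p = (r / norm v) *\<^sub>R v"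
    have pB: "p \<in> ?B" using v r by (simp add: p_def)
    have "dist v p \<le> dist v q" if "q \<in> ?B" for q
    proof -
      have "v - p = (1 - r / norm v) *\<^sub>R v" by (simp add: p_def algebra_simps)
      then have "dist v p = \<bar>1 - r / norm v\<bar> * norm v" by (simp add: dist_norm)
      also have "\<dots> = norm v - r" using v by (simp add: abs_if field_simps)
      also have "\<dots> \<le> norm v - norm q" using that by simp
      also have "\<dots> \<le> dist v q" by (simp add: dist_norm norm_triangle_ineq2)
      finally show ?thesis .
    qed
    then have "p = closest_point ?B v" using closest_point_unique[OF B(1,2) pB] by blast
    then show ?thesis using v r by (intro exI[of _ "r / norm v"]) (auto simp: \<pi>_def p_def)
  qed
  have orth: "v \<bullet> \<Phi> (\<pi> v) = 0" for v
  proof (cases "norm v \<le> r")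
    case True then show ?thesis using \<pi>_scale[of v] tang by auto
  next
    case False
    obtain c where c: "c \<ge> 0" "\<pi> v = c *\<^sub>R v" using \<pi>_scale by blast
    show ?thesis
    proof (cases "c = 0")
      case True
      have "v \<noteq> 0" using False r by (metis norm_zero less_imp_le)
      \<comment> \<open>the radial retraction never vanishes off the origin\<close>
      have "dist v (\<pi> v) \<le> dist v ((r / norm v) *\<^sub>R v)"
        unfolding \<pi>_def using closest_point_le[OF B(2)] r by (simp add: \<open>v \<noteq> 0\<close>)
      moreover have "v - (r / norm v) *\<^sub>R v = (1 - r / norm v) *\<^sub>R v" by (simp add: algebra_simps)
      ultimately have "norm v \<le> \<bar>1 - r / norm v\<bar> * norm v" using True c by (simp add: dist_norm)
      moreover have "\<bar>1 - r / norm v\<bar> * norm v = norm v - r"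
        using False r \<open>v \<noteq> 0\<close> by (simp add: abs_if field_simps)
      ultimately show ?thesis using r by simp
    next
      case False
      then show ?thesis using tang[of "\<pi> v"] c by simp
    qed
  qed
  have nrm: "norm (x t) = r" for t
  proof -
    have "((\<lambda>t. x t \<bullet> x t) has_vector_derivative (x s \<bullet> \<Phi> (\<pi> (x s)) + \<Phi> (\<pi> (x s)) \<bullet> x s)) (at s)" for s
      by (rule bounded_bilinear.has_vector_derivative[OF bounded_bilinear_inner x(2) x(2)])
    then have "((\<lambda>t. x t \<bullet> x t) has_real_derivative 0) (at s)" for s
      by (simp add: has_real_derivative_iff_has_vector_derivative orth inner_commute)
    then have "x t \<bullet> x t = x 0 \<bullet> x 0" by (intro DERIV_isconst_all) auto
    then show ?thesis using x0 x(1) by (simp add: norm_eq_sqrt_inner)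
  qed
  then have "\<pi> (x t) = x t" for t unfolding \<pi>_def by (intro closest_point_self) simp
  then show ?thesis using x nrm by (intro exI[of _ x]) metis
qed

subsection \<open>Linear systems\<close>

lemma continuous_extension_01:
  fixes g :: "real \<Rightarrow> 'a::euclidean_space"
  assumes "continuous_on {0..1} g"
  obtains h M where "continuous_on UNIV h" "\<And>s. s \<in> {0..1} \<Longrightarrow> h s = g s" "\<And>s. norm (h s) \<le> M"
proof -
  have "continuous_on (cbox 0 1) g" using assms by simp
  then obtain h :: "real \<Rightarrow>\<^sub>C 'a" where h: "\<And>s. s \<in> cbox 0 1 \<Longrightarrow> apply_bcontfun h s = g s"
    using continuous_on_cbox_bcontfunE[of 0 1 g] by metis
  show thesis
    by (rule that[of "apply_bcontfun h" "norm h"]) (use h norm_bounded in auto)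
qed

lemma bounded_on_01:
  fixes g :: "real \<Rightarrow> 'a::euclidean_space"
  assumes "continuous_on {0..1} g"
  obtains M where "M \<ge> 0" "\<And>s. s \<in> {0..1} \<Longrightarrow> norm (g s) \<le> M"
proof -
  obtain h M where "\<And>s. s \<in> {0..1} \<Longrightarrow> h s = g s" "\<And>s. norm (h s) \<le> M"
    using continuous_extension_01[OF assms] by metis
  then show thesis using that[of M] norm_ge_zero[of "h 0"] by (metis order_trans)
qed

text \<open>
  Coefficients bounded on the whole line make the right-hand side globally Lipschitz, as the
  fixed-point argument demands; systems on \<open>[0, 1]\<close> are reduced to this case by extending the
  coefficients.
\<close>

lemma linear_ode_global:
  fixes X Y :: "real \<Rightarrow> complex^3^3"
  assumes X: "continuous_on UNIV X" "\<And>s. norm (X s) \<le> M"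
    and Y: "continuous_on UNIV Y" "\<And>s. norm (Y s) \<le> N"
  shows "\<exists>V. V 0 = V0 \<and> (\<forall>s. (V has_vector_derivative X s ** V s + Y s) (at s))"
proof -
  obtain K where K: "K \<ge> 1" "\<And>(A::complex^3^3) (B::complex^3^3). norm (A ** B) \<le> K * norm A * norm B"
    using mult3_bound by blast
  have "continuous_on UNIV (\<lambda>p. X (fst p) ** snd p + Y (fst p))"
    by (intro continuous_intros continuous_on_compose2[OF X(1)] continuous_on_compose2[OF Y(1)]) auto
  then have "continuous_on UNIV (\<lambda>(s, V). X s ** V + Y s)" by (simp add: case_prod_beta')
  then show ?thesis
  proof (rule picard_global)
    fix s :: real and V W :: "complex^3^3"
    have "X s ** V + Y s - (X s ** W + Y s) = X s ** (V - W)" by (simp add: mat_distrib)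
    moreover have "K * norm (X s) * norm (V - W) \<le> (K * M) * norm (V - W)"
      using K(1) X(2)[of s] by (intro mult_right_mono mult_left_mono) auto
    ultimately show "norm (X s ** V + Y s - (X s ** W + Y s)) \<le> (K * M) * norm (V - W)"
      using K(2)[of "X s" "V - W"] by simp
    show "norm (X s ** 0 + Y s) \<le> N" using Y(2) by simp
  qed
qed

lemma linear_ode_01:
  fixes X Y :: "real \<Rightarrow> complex^3^3"
  assumes X: "continuous_on {0..1} X" and Y: "continuous_on {0..1} Y"
  shows "\<exists>V. V 0 = V0 \<and> (\<forall>s\<in>{0..1}. (V has_vector_derivative X s ** V s + Y s) (at s within {0..1}))"
proof -
  obtain X' M where X': "continuous_on UNIV X'" "\<And>s. s \<in> {0..1} \<Longrightarrow> X' s = X s" "\<And>s. norm (X' s) \<le> M"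
    using continuous_extension_01[OF X] by metis
  obtain Y' N where Y': "continuous_on UNIV Y'" "\<And>s. s \<in> {0..1} \<Longrightarrow> Y' s = Y s" "\<And>s. norm (Y' s) \<le> N"
    using continuous_extension_01[OF Y] by metis
  obtain V where "V 0 = V0" "\<And>s. (V has_vector_derivative X' s ** V s + Y' s) (at s)"
    using linear_ode_global[OF X'(1,3) Y'(1,3)] by blast
  then show ?thesis using X'(2) Y'(2) by (metis has_vector_derivative_at_within)
qed

lemma linear_ode_bound:
  fixes X Y Z :: "real \<Rightarrow> complex^3^3"
  assumes K: "\<And>(A::complex^3^3) (B::complex^3^3). norm (A ** B) \<le> K * norm A * norm B" "K \<ge> 1"
    and Z: "\<And>s. s \<in> {0..1} \<Longrightarrow> (Z has_vector_derivative X s ** Z s + Y s) (at s within {0..1})"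
    and X: "\<And>s. s \<in> {0..1} \<Longrightarrow> norm (X s) \<le> M" and Y: "\<And>s. s \<in> {0..1} \<Longrightarrow> norm (Y s) \<le> N"
    and Z0: "Z 0 = 0" and t: "t \<in> {0..1}"
  shows "norm (Z t) \<le> N * exp (K * M + 1)"
proof -
  have M: "M \<ge> 0" "N \<ge> 0" using order_trans[OF norm_ge_zero X[of 0]] order_trans[OF norm_ge_zero Y[of 0]] by simp_all
  have "(norm (Z t))\<^sup>2 \<le> ((norm (Z 0))\<^sup>2 + N\<^sup>2) * exp (2 * (K * M) + 1)"
  proof (rule gronwall_square[OF Z])
    fix s :: real assume s: "s \<in> {0..1}"
    have "norm (X s ** Z s + Y s) \<le> norm (X s ** Z s) + norm (Y s)" by (rule norm_triangle_ineq)
    also have "\<dots> \<le> K * norm (X s) * norm (Z s) + N" using K(1)[of "X s" "Z s"] Y[OF s] by linarith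
    also have "\<dots> \<le> K * M * norm (Z s) + N"
      using K(2) X[OF s] by (intro add_right_mono mult_right_mono mult_left_mono) auto
    finally show "norm (X s ** Z s + Y s) \<le> K * M * norm (Z s) + N" .
  qed (use M K(2) t in auto)
  also have "\<dots> \<le> N\<^sup>2 * exp (2 * (K * M + 1))" using Z0 by (simp add: mult_left_mono)
  also have "\<dots> = (N * exp (K * M + 1))\<^sup>2" by (simp only: power_mult_distrib exp_double)
  finally show ?thesis using M by (simp add: power2_le_iff_abs_le)
qed

lemma linear_ode_unique:
  fixes X Z W :: "real \<Rightarrow> complex^3^3"
  assumes X: "continuous_on {0..1} X"
    and Z: "\<And>s. s \<in> {0..1} \<Longrightarrow> (Z has_vector_derivative X s ** Z s) (at s within {0..1})"
    and W: "\<And>s. s \<in> {0..1} \<Longrightarrow> (W has_vector_derivative X s ** W s) (at s within {0..1})"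
    and eq: "Z 0 = W 0" and t: "t \<in> {0..1}"
  shows "Z t = W t"
proof -
  obtain K where K: "K \<ge> 1" "\<And>(A::complex^3^3) (B::complex^3^3). norm (A ** B) \<le> K * norm A * norm B"
    using mult3_bound by blast
  obtain M where M: "\<And>s. s \<in> {0..1} \<Longrightarrow> norm (X s) \<le> M" using bounded_on_01[OF X] by blast
  have "norm (Z t - W t) \<le> 0 * exp (K * M + 1)"
  proof (rule linear_ode_bound[OF K(2,1), where X = X and Y = "\<lambda>_. 0" and Z = "\<lambda>t. Z t - W t"])
    fix s :: real assume s: "s \<in> {0..1}"
    show "((\<lambda>t. Z t - W t) has_vector_derivative X s ** (Z s - W s) + 0) (at s within {0..1})"
      using has_vector_derivative_diff[OF Z[OF s] W[OF s]] by (simp add: mult_sub_right)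
  qed (use M eq t in auto)
  then show ?thesis by simp
qed

lemma linear_ode_unique_right:
  fixes X Z W :: "real \<Rightarrow> complex^3^3"
  assumes X: "continuous_on {0..1} X"
    and Z: "\<And>s. s \<in> {0..1} \<Longrightarrow> (Z has_vector_derivative Z s ** X s) (at s within {0..1})"
    and W: "\<And>s. s \<in> {0..1} \<Longrightarrow> (W has_vector_derivative W s ** X s) (at s within {0..1})"
    and eq: "Z 0 = W 0" and t: "t \<in> {0..1}"
  shows "Z t = W t"
proof -
  have "adjoint_mat (Z t) = adjoint_mat (W t)"
    by (rule linear_ode_unique[where X = "\<lambda>s. adjoint_mat (X s)" and Z = "\<lambda>s. adjoint_mat (Z s)"
          and W = "\<lambda>s. adjoint_mat (W s)"])
       (use adjoint_has_vector_derivative[OF Z] adjoint_has_vector_derivative[OF W] X eq t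
        in \<open>auto simp: adjoint_mult intro!: continuous_intros\<close>)
  then show ?thesis using adjoint_adjoint by metis
qed

text \<open>
  Holomorphic dependence on a parameter: the candidate for the parameter derivative solves the
  linearised equation, and Gronwall's inequality shows that the remainder is of smaller order than
  the increment. Two scalar parameter functions suffice for loops, where they are \<open>l\<close> and \<open>1/l\<close>.
\<close>

theorem linear_ode_holomorphic:
  fixes C0 C1 C2 :: "real \<Rightarrow> complex^3^3" and V :: "real \<Rightarrow> complex \<Rightarrow> complex^3^3"
  assumes C: "continuous_on {0..1} C0" "continuous_on {0..1} C1" "continuous_on {0..1} C2"
    and \<phi>: "\<phi> holomorphic_on \<Omega>" and \<kappa>: "\<kappa> holomorphic_on \<Omega>" and \<Omega>: "open \<Omega>"
    and V0: "\<And>l. l \<in> \<Omega> \<Longrightarrow> V 0 l = mat 1"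
    and V: "\<And>l s. l \<in> \<Omega> \<Longrightarrow> s \<in> {0..1} \<Longrightarrow>
      ((\<lambda>s. V s l) has_vector_derivative (C0 s + cscale (\<phi> l) (C1 s) + cscale (\<kappa> l) (C2 s)) ** V s l)
        (at s within {0..1})"
  shows "(\<lambda>l. V 1 l $ i $ j) holomorphic_on \<Omega>"
proof -
  define X where "X l s = C0 s + cscale (\<phi> l) (C1 s) + cscale (\<kappa> l) (C2 s)" for l s
  have Xc: "continuous_on {0..1} (X l)" for l unfolding X_def by (intro continuous_intros C)
  obtain K where K: "K \<ge> 1" "\<And>(A::complex^3^3) (B::complex^3^3). norm (A ** B) \<le> K * norm A * norm B"
    using mult3_bound by blast
  obtain Q where Q: "\<And>a (A::complex^3^3). norm (cscale a A) \<le> norm a * norm A * Q" "Q > 0"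
    using bounded_bilinear.pos_bounded[OF bounded_bilinear_cscale] by blast
  obtain c0 where c0: "\<And>s. s \<in> {0..1} \<Longrightarrow> norm (C0 s) \<le> c0" using bounded_on_01[OF C(1)] by blast
  obtain c1 where c1: "c1 \<ge> 0" "\<And>s. s \<in> {0..1} \<Longrightarrow> norm (C1 s) \<le> c1" using bounded_on_01[OF C(2)] by blast
  obtain c2 where c2: "c2 \<ge> 0" "\<And>s. s \<in> {0..1} \<Longrightarrow> norm (C2 s) \<le> c2" using bounded_on_01[OF C(3)] by blast
  have comb: "norm (cscale a (C1 s) + cscale b (C2 s)) \<le> norm a * (c1 * Q) + norm b * (c2 * Q)"
    if "s \<in> {0..1}" for a b s
  proof -
    have "norm (cscale a (C1 s)) \<le> norm a * c1 * Q"
      using Q(1)[of a "C1 s"] c1(2)[OF that] Q(2) 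
      by (meson mult_left_mono mult_right_mono less_imp_le norm_ge_zero order_trans)
    moreover have "norm (cscale b (C2 s)) \<le> norm b * c2 * Q"
      using Q(1)[of b "C2 s"] c2(2)[OF that] Q(2)
      by (meson mult_left_mono mult_right_mono less_imp_le norm_ge_zero order_trans)
    ultimately show ?thesis using norm_triangle_ineq[of "cscale a (C1 s)" "cscale b (C2 s)"]
      by (simp add: mult.assoc)
  qed
  have "\<exists>d. ((\<lambda>l. V 1 l $ i $ j) has_field_derivative d) (at \<nu>)" if \<nu>: "\<nu> \<in> \<Omega>" for \<nu>
  proof -
    obtain \<phi>' where \<phi>': "(\<phi> has_field_derivative \<phi>') (at \<nu>)"
      using \<phi> \<Omega> \<nu> holomorphic_derivI by blast
    obtain \<kappa>' where \<kappa>': "(\<kappa> has_field_derivative \<kappa>') (at \<nu>)"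
      using \<kappa> \<Omega> \<nu> holomorphic_derivI by blast
    have Vc: "continuous_on {0..1} (\<lambda>s. V s l)" if "l \<in> \<Omega>" for l
      using V[OF that] by (meson continuous_on_eq_continuous_within has_vector_derivative_continuous)
    obtain v where v: "v \<ge> 0" "\<And>s. s \<in> {0..1} \<Longrightarrow> norm (V s \<nu>) \<le> v"
      using bounded_on_01[OF Vc[OF \<nu>]] by blast
    \<comment> \<open>W is the parameter derivative of the solution; a and b below bound the increment of the
      coefficient matrix and its deviation from the linear part\<close>
    define Xd where "Xd s = cscale \<phi>' (C1 s) + cscale \<kappa>' (C2 s)" for s
    have "continuous_on {0..1} (\<lambda>s. Xd s ** V s \<nu>)"
      unfolding Xd_def by (intro continuous_intros C Vc \<nu>)
    then obtain W where W: "W 0 = 0"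
      "\<And>s. s \<in> {0..1} \<Longrightarrow> (W has_vector_derivative X \<nu> s ** W s + Xd s ** V s \<nu>) (at s within {0..1})"
      using linear_ode_01[OF Xc] by blast
    define a where "a \<mu> = norm (\<phi> \<mu> - \<phi> \<nu>) * (c1 * Q) + norm (\<kappa> \<mu> - \<kappa> \<nu>) * (c2 * Q)" for \<mu>
    define b where "b \<mu> = norm (\<phi> \<mu> - \<phi> \<nu> - (\<mu> - \<nu>) * \<phi>') * (c1 * Q)
        + norm (\<kappa> \<mu> - \<kappa> \<nu> - (\<mu> - \<nu>) * \<kappa>') * (c2 * Q)" for \<mu>
    have a0: "a \<mu> \<ge> 0" for \<mu> unfolding a_def using c1 c2 Q by simp
    have dX: "norm (X \<mu> s - X \<nu> s) \<le> a \<mu>" if "s \<in> {0..1}" for \<mu> s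
    proof -
      have "X \<mu> s - X \<nu> s = cscale (\<phi> \<mu> - \<phi> \<nu>) (C1 s) + cscale (\<kappa> \<mu> - \<kappa> \<nu>) (C2 s)"
        by (simp add: X_def mat_eq3_iff cscale_nth algebra_simps)
      then show ?thesis using comb[OF that] by (simp add: a_def)
    qed
    have ddX: "norm (X \<mu> s - X \<nu> s - cscale (\<mu> - \<nu>) (Xd s)) \<le> b \<mu>" if "s \<in> {0..1}" for \<mu> s
    proof -
      have "X \<mu> s - X \<nu> s - cscale (\<mu> - \<nu>) (Xd s) = cscale (\<phi> \<mu> - \<phi> \<nu> - (\<mu> - \<nu>) * \<phi>') (C1 s)
          + cscale (\<kappa> \<mu> - \<kappa> \<nu> - (\<mu> - \<nu>) * \<kappa>') (C2 s)"
        by (simp add: X_def Xd_def mat_eq3_iff cscale_nth algebra_simps)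
      then show ?thesis using comb[OF that] by (simp add: b_def)
    qed
    obtain m where m: "m \<ge> 0" "\<And>s. s \<in> {0..1} \<Longrightarrow> norm (X \<nu> s) \<le> m" using bounded_on_01[OF Xc] by blast
    define e where "e = exp (K * (m + 1) + 1)"
    have e: "e > 0" by (simp add: e_def)
    \<comment> \<open>the solution is Lipschitz in the parameter, with constant controlled by a\<close>
    have \<delta>: "norm (V s \<mu> - V s \<nu>) \<le> (K * a \<mu> * v) * e" if \<mu>: "\<mu> \<in> \<Omega>" "a \<mu> \<le> 1" and s: "s \<in> {0..1}" for \<mu> s
      unfolding e_def
    proof (rule linear_ode_bound[OF K(2,1), where X = "X \<mu>" and Z = "\<lambda>s. V s \<mu> - V s \<nu>"
            and Y = "\<lambda>s. (X \<mu> s - X \<nu> s) ** V s \<nu>"])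
      fix s :: real assume s: "s \<in> {0..1}"
      show "((\<lambda>s. V s \<mu> - V s \<nu>) has_vector_derivative
          X \<mu> s ** (V s \<mu> - V s \<nu>) + (X \<mu> s - X \<nu> s) ** V s \<nu>) (at s within {0..1})"
        using has_vector_derivative_diff[OF V[OF \<mu>(1) s] V[OF \<nu> s]]
        by (simp add: X_def[symmetric] mat_distrib)
      show "norm (X \<mu> s) \<le> m + 1"
        using norm_triangle_ineq[of "X \<nu> s" "X \<mu> s - X \<nu> s"] m(2)[OF s] dX[OF s, of \<mu>] \<mu>(2) by simp
      have "K * norm (X \<mu> s - X \<nu> s) * norm (V s \<nu>) \<le> K * a \<mu> * v"
        using K(1) dX[OF s] v(2)[OF s] a0 by (intro mult_mono mult_left_mono) auto
      then show "norm ((X \<mu> s - X \<nu> s) ** V s \<nu>) \<le> K * a \<mu> * v"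
        using K(2)[of "X \<mu> s - X \<nu> s" "V s \<nu>"] by linarith
    qed (use V0 \<mu> \<nu> s in auto)
    have rem: "norm (V 1 \<mu> - V 1 \<nu> - cscale (\<mu> - \<nu>) (W 1)) \<le> (K * a \<mu> * ((K * a \<mu> * v) * e) + K * b \<mu> * v) * e"
      if \<mu>: "\<mu> \<in> \<Omega>" "a \<mu> \<le> 1" for \<mu>
      unfolding e_def
    proof (rule linear_ode_bound[OF K(2,1), where X = "X \<nu>" and Z = "\<lambda>s. V s \<mu> - V s \<nu> - cscale (\<mu> - \<nu>) (W s)"
            and Y = "\<lambda>s. (X \<mu> s - X \<nu> s) ** (V s \<mu> - V s \<nu>)
              + (X \<mu> s - X \<nu> s - cscale (\<mu> - \<nu>) (Xd s)) ** V s \<nu>"])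
      fix s :: real assume s: "s \<in> {0..1}"
      have "((\<lambda>s. cscale (\<mu> - \<nu>) (W s)) has_vector_derivative
          cscale (\<mu> - \<nu>) (X \<nu> s ** W s + Xd s ** V s \<nu>)) (at s within {0..1})"
        by (rule bounded_linear.has_vector_derivative[OF bounded_linear_cscale W(2)[OF s]])
      from has_vector_derivative_diff[OF has_vector_derivative_diff[OF V[OF \<mu>(1) s] V[OF \<nu> s]] this]
      show "((\<lambda>s. V s \<mu> - V s \<nu> - cscale (\<mu> - \<nu>) (W s)) has_vector_derivative
          X \<nu> s ** (V s \<mu> - V s \<nu> - cscale (\<mu> - \<nu>) (W s)) + ((X \<mu> s - X \<nu> s) ** (V s \<mu> - V s \<nu>)
              + (X \<mu> s - X \<nu> s - cscale (\<mu> - \<nu>) (Xd s)) ** V s \<nu>)) (at s within {0..1})"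
        by (simp add: X_def[symmetric] mat_distrib cscale_add, simp add: algebra_simps)
      show "norm (X \<nu> s) \<le> m + 1" using m(2)[OF s] by simp
      have "K * norm (X \<mu> s - X \<nu> s) * norm (V s \<mu> - V s \<nu>) \<le> K * a \<mu> * ((K * a \<mu> * v) * e)"
        using K(1) dX[OF s] \<delta>[OF \<mu> s] a0 by (intro mult_mono mult_left_mono) auto
      moreover have "K * norm (X \<mu> s - X \<nu> s - cscale (\<mu> - \<nu>) (Xd s)) * norm (V s \<nu>) \<le> K * b \<mu> * v"
        using K(1) ddX[OF s] v(2)[OF s] order_trans[OF norm_ge_zero ddX[OF s]]
        by (intro mult_mono mult_left_mono) auto
      ultimately show "norm ((X \<mu> s - X \<nu> s) ** (V s \<mu> - V s \<nu>)
              + (X \<mu> s - X \<nu> s - cscale (\<mu> - \<nu>) (Xd s)) ** V s \<nu>)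
            \<le> K * a \<mu> * (K * a \<mu> * v * exp (K * (m + 1) + 1)) + K * b \<mu> * v"
        unfolding e_def[symmetric]
        using K(2)[of "X \<mu> s - X \<nu> s" "V s \<mu> - V s \<nu>"] K(2)[of "X \<mu> s - X \<nu> s - cscale (\<mu> - \<nu>) (Xd s)" "V s \<nu>"]
          norm_triangle_ineq[of "(X \<mu> s - X \<nu> s) ** (V s \<mu> - V s \<nu>)"
            "(X \<mu> s - X \<nu> s - cscale (\<mu> - \<nu>) (Xd s)) ** V s \<nu>"] by linarith
    qed (use V0 \<mu> \<nu> W(1) in auto)
    have \<phi>q: "((\<lambda>\<mu>. (\<phi> \<mu> - \<phi> \<nu>) / (\<mu> - \<nu>)) \<longlongrightarrow> \<phi>') (at \<nu>)"
      using \<phi>' by (simp add: has_field_derivative_iff)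
    have \<kappa>q: "((\<lambda>\<mu>. (\<kappa> \<mu> - \<kappa> \<nu>) / (\<mu> - \<nu>)) \<longlongrightarrow> \<kappa>') (at \<nu>)"
      using \<kappa>' by (simp add: has_field_derivative_iff)
    \<comment> \<open>difference quotients, so that the remainder can be divided by the increment\<close>
    define a' where "a' \<mu> = norm ((\<phi> \<mu> - \<phi> \<nu>) / (\<mu> - \<nu>)) * (c1 * Q) + norm ((\<kappa> \<mu> - \<kappa> \<nu>) / (\<mu> - \<nu>)) * (c2 * Q)" for \<mu>
    define b' where "b' \<mu> = norm ((\<phi> \<mu> - \<phi> \<nu>) / (\<mu> - \<nu>) - \<phi>') * (c1 * Q)
        + norm ((\<kappa> \<mu> - \<kappa> \<nu>) / (\<mu> - \<nu>) - \<kappa>') * (c2 * Q)" for \<mu>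
    have a'_lim: "(a' \<longlongrightarrow> norm \<phi>' * (c1 * Q) + norm \<kappa>' * (c2 * Q)) (at \<nu>)"
      unfolding a'_def by (intro tendsto_intros \<phi>q \<kappa>q)
    have "(b' \<longlongrightarrow> norm (\<phi>' - \<phi>') * (c1 * Q) + norm (\<kappa>' - \<kappa>') * (c2 * Q)) (at \<nu>)"
      unfolding b'_def by (intro tendsto_intros \<phi>q \<kappa>q)
    then have b'_lim: "(b' \<longlongrightarrow> 0) (at \<nu>)" by simp
    have aa': "a \<mu> = norm (\<mu> - \<nu>) * a' \<mu>" if "\<mu> \<noteq> \<nu>" for \<mu>
      using that by (simp add: a_def a'_def norm_divide field_simps)
    have bb': "b \<mu> = norm (\<mu> - \<nu>) * b' \<mu>" if "\<mu> \<noteq> \<nu>" for \<mu>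
    proof -
      have "norm (g - (\<mu> - \<nu>) * d) = norm (\<mu> - \<nu>) * norm (g / (\<mu> - \<nu>) - d)" for g d
        using that by (simp add: norm_mult[symmetric] right_diff_distrib)
      then show ?thesis unfolding b_def b'_def by (simp only: distrib_left mult.assoc)
    qed
    have "((\<lambda>\<mu>. norm (\<mu> - \<nu>) * a' \<mu>) \<longlongrightarrow> norm (\<nu> - \<nu>) * (norm \<phi>' * (c1 * Q) + norm \<kappa>' * (c2 * Q))) (at \<nu>)"
      by (intro tendsto_intros a'_lim)
    then have na'_lim: "((\<lambda>\<mu>. norm (\<mu> - \<nu>) * a' \<mu>) \<longlongrightarrow> 0) (at \<nu>)" by simp
    then have "\<forall>\<^sub>F \<mu> in at \<nu>. norm (\<mu> - \<nu>) * a' \<mu> < 1" by (rule order_tendstoD) simp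
    moreover have "\<forall>\<^sub>F \<mu> in at \<nu>. \<mu> \<in> \<Omega>" using \<Omega> \<nu> by (rule eventually_at_in_open')
    moreover have "\<forall>\<^sub>F \<mu> in at \<nu>. \<mu> \<noteq> \<nu>" by (simp add: eventually_at_filter)
    ultimately have ev: "\<forall>\<^sub>F \<mu> in at \<nu>. norm ((V 1 \<mu> $ i $ j - V 1 \<nu> $ i $ j) / (\<mu> - \<nu>) - W 1 $ i $ j)
        \<le> (K * a' \<mu> * ((K * (norm (\<mu> - \<nu>) * a' \<mu>) * v) * e) + K * b' \<mu> * v) * e"
    proof eventually_elim
      case (elim \<mu>)
      let ?R = "V 1 \<mu> - V 1 \<nu> - cscale (\<mu> - \<nu>) (W 1)"
      have n: "norm (\<mu> - \<nu>) > 0" using elim by simp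
      have "norm (?R $ i $ j) \<le> norm ?R"
        using Finite_Cartesian_Product.norm_nth_le[of "?R $ i" j] Finite_Cartesian_Product.norm_nth_le[of ?R i] by linarith
      also have "\<dots> \<le> (K * a \<mu> * ((K * a \<mu> * v) * e) + K * b \<mu> * v) * e"
        using elim aa' by (intro rem) auto
      also have "\<dots> = norm (\<mu> - \<nu>) * ((K * a' \<mu> * ((K * (norm (\<mu> - \<nu>) * a' \<mu>) * v) * e) + K * b' \<mu> * v) * e)"
        using aa' bb' elim by (simp add: algebra_simps)
      finally have "norm (?R $ i $ j) / norm (\<mu> - \<nu>)
          \<le> (K * a' \<mu> * ((K * (norm (\<mu> - \<nu>) * a' \<mu>) * v) * e) + K * b' \<mu> * v) * e"
        using n by (simp add: divide_le_eq mult.commute)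
      moreover have "(V 1 \<mu> $ i $ j - V 1 \<nu> $ i $ j) / (\<mu> - \<nu>) - W 1 $ i $ j = ?R $ i $ j / (\<mu> - \<nu>)"
        using elim by (simp add: cscale_nth diff_divide_distrib)
      ultimately show ?case by (simp add: norm_divide)
    qed
    have "((\<lambda>\<mu>. (K * a' \<mu> * ((K * (norm (\<mu> - \<nu>) * a' \<mu>) * v) * e) + K * b' \<mu> * v) * e) \<longlongrightarrow>
        (K * (norm \<phi>' * (c1 * Q) + norm \<kappa>' * (c2 * Q)) * ((K * 0 * v) * e) + K * 0 * v) * e) (at \<nu>)"
      by (intro tendsto_intros a'_lim na'_lim b'_lim)
    then have "((\<lambda>\<mu>. (K * a' \<mu> * ((K * (norm (\<mu> - \<nu>) * a' \<mu>) * v) * e) + K * b' \<mu> * v) * e) \<longlongrightarrow> 0) (at \<nu>)"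
      by simp
    then have "((\<lambda>\<mu>. (V 1 \<mu> $ i $ j - V 1 \<nu> $ i $ j) / (\<mu> - \<nu>) - W 1 $ i $ j) \<longlongrightarrow> 0) (at \<nu>)"
      using ev by (rule Lim_null_comparison[rotated])
    then have "((\<lambda>\<mu>. (V 1 \<mu> $ i $ j - V 1 \<nu> $ i $ j) / (\<mu> - \<nu>)) \<longlongrightarrow> W 1 $ i $ j) (at \<nu>)"
      by (simp add: LIM_zero_iff)
    then show ?thesis by (auto simp: has_field_derivative_iff)
  qed
  then show ?thesis using \<Omega> by (auto simp: holomorphic_on_open)
qed

section \<open>The matrix exponential\<close>

abbreviation mpow :: "complex^3^3 \<Rightarrow> nat \<Rightarrow> complex^3^3" where
  "mpow X n \<equiv> (((**) X) ^^ n) (mat 1)"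

lemma mpow_cscale: "mpow (cscale z X) n = cscale (z ^ n) (mpow X n)"
  by (induction n) (simp_all add: mat_distrib mult.commute)

lemma mpow_commute: "mpow X n ** X = X ** mpow X n"
  by (induction n) (simp_all add: mult_assoc3)

lemma mpow_norm_bound:
  assumes "\<And>(A::complex^3^3) (B::complex^3^3). norm (A ** B) \<le> K * norm A * norm B"
  shows "norm (mpow X n) \<le> norm (mat 1 :: complex^3^3) * (K * norm X) ^ n"
proof (induction n)
  case (Suc n)
  have "0 \<le> K * norm X * norm (mat 1 :: complex^3^3)"
    using assms[of X "mat 1"] norm_ge_zero order_trans by blast
  have "0 \<le> K * norm X \<or> norm (mat 1 :: complex^3^3) = 0"
    using \<open>0 \<le> K * norm X * norm (mat 1 :: complex^3^3)\<close> by (auto simp: zero_le_mult_iff)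
  moreover have "norm (mat 1 :: complex^3^3) \<noteq> 0"
    using mat1_nth[of 1 1] by (auto simp del: nth_map_matrix)
  ultimately have K: "0 \<le> K * norm X" by blast
  have "norm (X ** mpow X n) \<le> K * norm X * norm (mpow X n)" by (rule assms)
  also have "\<dots> \<le> K * norm X * (norm (mat 1 :: complex^3^3) * (K * norm X) ^ n)"
    using Suc K by (intro mult_left_mono) auto
  finally show ?case by (simp add: mult_ac)
qed simp

lemma mat_exp_summable: "summable (\<lambda>n. (1 / fact n) *\<^sub>R mpow X n)"
proof -
  obtain K where "K \<ge> 1" and K: "\<And>(A::complex^3^3) (B::complex^3^3). norm (A ** B) \<le> K * norm A * norm B"
    using mult3_bound by blast
  have "summable (\<lambda>n. norm (mat 1 :: complex^3^3) * (inverse (fact n) * (K * norm X) ^ n))"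
    by (intro summable_mult summable_exp)
  then show ?thesis
  proof (rule summable_comparison_test'[where N = 0])
    fix n :: nat
    have "norm ((1 / fact n) *\<^sub>R mpow X n) = inverse (fact n) * norm (mpow X n)"
      by (simp add: divide_inverse)
    also have "\<dots> \<le> inverse (fact n) * (norm (mat 1 :: complex^3^3) * (K * norm X) ^ n)"
      by (intro mult_left_mono mpow_norm_bound K) simp
    finally show "norm ((1 / fact n) *\<^sub>R mpow X n)
        \<le> norm (mat 1 :: complex^3^3) * (inverse (fact n) * (K * norm X) ^ n)"
      by (simp only: mult.left_commute)
  qed
qed

lemma mat_exp_sums: "(\<lambda>n. (1 / fact n) *\<^sub>R mpow X n) sums mat_exp X"
  unfolding mat_exp_def using mat_exp_summable by (rule summable_sums)

text \<open>
  On a complex line through 0 the entries of the exponential are scalar power series, which can be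
  differentiated term by term.
\<close>

lemma mat_exp_entry_sums:
  "(\<lambda>n. (mpow X n $ i $ j / fact n) * z ^ n) sums (mat_exp (cscale z X) $ i $ j)"
proof -
  have "(\<lambda>n. ((1 / fact n) *\<^sub>R mpow (cscale z X) n) $ i $ j) sums (mat_exp (cscale z X) $ i $ j)"
    by (rule bounded_linear.sums[OF bounded_linear_nth2 mat_exp_sums])
  moreover have "((1 / fact n) *\<^sub>R mpow (cscale z X) n) $ i $ j = (mpow X n $ i $ j / fact n) * z ^ n" for n
    by (simp add: mpow_cscale cscale_nth scaleR_conv_of_real[where 'a=complex] divide_inverse mult_ac)
  ultimately show ?thesis by simp
qed

lemma mat_exp_commute: "mat_exp X ** X = X ** mat_exp X"
proof -
  have "(\<lambda>n. ((1 / fact n) *\<^sub>R mpow X n) ** X) sums (mat_exp X ** X)"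
    by (rule bounded_linear.sums[OF bounded_bilinear.bounded_linear_left[OF bounded_bilinear_mult3] mat_exp_sums])
  moreover have "(\<lambda>n. X ** ((1 / fact n) *\<^sub>R mpow X n)) sums (X ** mat_exp X)"
    by (rule bounded_linear.sums[OF bounded_bilinear.bounded_linear_right[OF bounded_bilinear_mult3] mat_exp_sums])
  ultimately show ?thesis
    by (simp add: mult_scaleR_left3 mult_scaleR_right3 mpow_commute sums_unique2)
qed

lemma mat_exp_0 [simp]: "mat_exp 0 = mat 1"
proof -
  have "(\<lambda>n. (mpow 0 n $ i $ j / fact n) * 0 ^ n) sums (mpow 0 0 $ i $ j)" for i j
    using powser_sums_zero[of "\<lambda>n. mpow 0 n $ i $ j / fact n"] by simp
  then have "mat_exp (cscale 0 0) $ i $ j = mat 1 $ i $ j" for i j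
    using sums_unique2[OF mat_exp_entry_sums[of 0 i j 0]] by simp
  then show ?thesis by (simp add: mat_eq3_iff)
qed

lemma mat_exp_has_field_derivative:
  "((\<lambda>z. mat_exp (cscale z X) $ i $ j) has_field_derivative (X ** mat_exp (cscale z X)) $ i $ j) (at z)"
proof -
  define c where "c i j n = mpow X n $ i $ j / fact n" for i j n
  have sm: "summable (\<lambda>n. c i j n * z ^ n)" for i j z
    unfolding c_def by (rule sums_summable[OF mat_exp_entry_sums])
  have eq: "(\<Sum>n. c i j n * z ^ n) = mat_exp (cscale z X) $ i $ j" for i j z
    unfolding c_def by (rule sums_unique[OF mat_exp_entry_sums, symmetric])
  have fd: "((\<lambda>z. \<Sum>n. c i j n * z ^ n) has_field_derivative (\<Sum>n. diffs (c i j) n * z ^ n)) (at z)"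
    by (rule termdiffs_strong_converges_everywhere) (rule sm)
  have "diffs (c i j) n = X $ i $ 1 * c 1 j n + X $ i $ 2 * c 2 j n + X $ i $ 3 * c 3 j n" for n
  proof -
    have "diffs (c i j) n = (X ** mpow X n) $ i $ j / fact n"
      by (simp add: diffs_def c_def field_simps del: of_nat_Suc)
    then show ?thesis by (simp add: mult_nth3 c_def add_divide_distrib)
  qed
  then have "(\<Sum>n. diffs (c i j) n * z ^ n) =
      (\<Sum>n. X $ i $ 1 * (c 1 j n * z ^ n) + X $ i $ 2 * (c 2 j n * z ^ n) + X $ i $ 3 * (c 3 j n * z ^ n))"
    by (simp add: algebra_simps)
  also have "\<dots> = (X ** mat_exp (cscale z X)) $ i $ j"
    by (simp add: suminf_add[symmetric] suminf_mult sm summable_add summable_mult eq mult_nth3)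
  finally have "(\<Sum>n. diffs (c i j) n * z ^ n) = (X ** mat_exp (cscale z X)) $ i $ j" .
  then show ?thesis using fd by (simp add: eq)
qed

lemma mat_exp_line_derivative:
  "((\<lambda>s. mat_exp (cscale (of_real s * z + w) X)) has_vector_derivative
      cscale z X ** mat_exp (cscale (of_real s * z + w) X)) (at s within T)"
  unfolding has_vector_derivative_entries
proof (intro allI)
  fix i j
  have "((\<lambda>s. of_real s * z + w) has_vector_derivative z) (at s)"
    by (auto intro!: derivative_eq_intros)
  from field_vector_diff_chain_at[OF this mat_exp_has_field_derivative[of X i j]]
  have "((\<lambda>s. mat_exp (cscale (of_real s * z + w) X) $ i $ j) has_vector_derivative
      z * (X ** mat_exp (cscale (of_real s * z + w) X)) $ i $ j) (at s)"
    by (simp add: o_def)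
  then show "((\<lambda>s. mat_exp (cscale (of_real s * z + w) X) $ i $ j) has_vector_derivative
      (cscale z X ** mat_exp (cscale (of_real s * z + w) X)) $ i $ j) (at s within T)"
    by (simp add: mult_cscale_left cscale_nth has_vector_derivative_at_within)
qed

lemma mat_exp_derivative:
  "((\<lambda>s. mat_exp (cscale (of_real s * z) X)) has_vector_derivative
      cscale z X ** mat_exp (cscale (of_real s * z) X)) (at s within T)"
  using mat_exp_line_derivative[of z 0] by simp

text \<open>
  Both sides, with \<open>z\<close> replaced by \<open>s z\<close>, solve the same linear system in \<open>s\<close>.
\<close>

lemma mat_exp_add:
  "mat_exp (cscale (z + w) X) = mat_exp (cscale z X) ** mat_exp (cscale w X)"
proof -
  have "mat_exp (cscale (of_real 1 * z + w) X) = mat_exp (cscale (of_real 1 * z) X) ** mat_exp (cscale w X)"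
  proof (rule linear_ode_unique[where X = "\<lambda>_. cscale z X"
        and Z = "\<lambda>s. mat_exp (cscale (of_real s * z + w) X)"
        and W = "\<lambda>s. mat_exp (cscale (of_real s * z) X) ** mat_exp (cscale w X)"])
    fix s :: real
    show "((\<lambda>s. mat_exp (cscale (of_real s * z) X) ** mat_exp (cscale w X)) has_vector_derivative
          cscale z X ** (mat_exp (cscale (of_real s * z) X) ** mat_exp (cscale w X))) (at s within {0..1})"
      using mult3_has_vector_derivative[OF mat_exp_derivative[of z X s "{0..1}"] has_vector_derivative_const]
      by (simp add: mult_assoc3)
  qed (auto intro: mat_exp_line_derivative)
  then show ?thesis by simp
qed

lemma mat_exp_commute_cscale: "mat_exp (cscale z X) ** X = X ** mat_exp (cscale z X)"
proof (cases "z = 0")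
  case False
  have "cscale z (mat_exp (cscale z X) ** X) = cscale z (X ** mat_exp (cscale z X))"
    using mat_exp_commute[of "cscale z X"] by (simp add: mult_cscale_left mult_cscale_right)
  then have "cscale (inverse z) (cscale z (mat_exp (cscale z X) ** X))
     = cscale (inverse z) (cscale z (X ** mat_exp (cscale z X)))" by simp
  then show ?thesis using False by simp
qed simp

lemma mat_exp_conj:
  assumes "k ** k' = mat 1"
  shows "mat_exp (cscale z (k ** X ** k')) = k ** mat_exp (cscale z X) ** k'"
proof -
  have k': "k' ** k = mat 1" by (rule matrix_left_right_inverse[THEN iffD1, OF assms])
  have "mpow (cscale z (k ** X ** k')) n = k ** mpow (cscale z X) n ** k'" for n
  proof (induction n)
    case 0 then show ?case by (simp add: assms)
  next
    case (Suc n)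
    have "mpow (cscale z (k ** X ** k')) (Suc n) = cscale z (k ** X ** k') ** (k ** mpow (cscale z X) n ** k')"
      by (simp add: Suc)
    also have "\<dots> = cscale z (k ** X ** ((k' ** k) ** (mpow (cscale z X) n ** k')))"
      by (simp only: mat_distrib)
    also have "\<dots> = k ** mpow (cscale z X) (Suc n) ** k'" by (simp add: k' mat_distrib)
    finally show ?case .
  qed
  then have eq: "(1 / fact n) *\<^sub>R mpow (cscale z (k ** X ** k')) n = k ** ((1 / fact n) *\<^sub>R mpow (cscale z X) n) ** k'" for n
    by (simp add: mat_distrib)
  have "(\<lambda>n. k ** ((1 / fact n) *\<^sub>R mpow (cscale z X) n) ** k') sums (k ** mat_exp (cscale z X) ** k')"
    by (intro bounded_linear.sums[OF bounded_bilinear.bounded_linear_left[OF bounded_bilinear_mult3]]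
        bounded_linear.sums[OF bounded_bilinear.bounded_linear_right[OF bounded_bilinear_mult3]] mat_exp_sums)
  then show ?thesis using mat_exp_sums[of "cscale z (k ** X ** k')"] unfolding eq
    using sums_unique2 by blast
qed

subsection \<open>Determinants and unitarity of solutions\<close>

text \<open>
  Liouville's formula.
\<close>

lemma det_has_vector_derivative:
  fixes Z :: "real \<Rightarrow> complex^3^3"
  assumes "(Z has_vector_derivative X ** Z s) (at s within T)"
  shows "((\<lambda>s. det (Z s)) has_vector_derivative trace X * det (Z s)) (at s within T)"
proof -
  have d: "((\<lambda>s. Z s $ i $ j) has_vector_derivative
      (X$i$1 * Z s$1$j + X$i$2 * Z s$2$j + X$i$3 * Z s$3$j)) (at s within T)" for i j
    using assms unfolding has_vector_derivative_entries by (simp add: mult_nth3)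
  show ?thesis unfolding det_3 trace3
    by (rule derivative_eq_intros has_vector_derivative_mult d refl)+ algebra
qed

lemma constant_on_01:
  fixes g :: "real \<Rightarrow> 'a::real_normed_vector"
  assumes "\<And>s. s \<in> {0..1} \<Longrightarrow> (g has_vector_derivative 0) (at s within {0..1})" and t: "t \<in> {0..1}"
  shows "g t = g 0"
proof -
  obtain c where "\<And>s. s \<in> {0..1} \<Longrightarrow> g s = c"
    using has_vector_derivative_zero_constant[of "{0..1}" g] assms(1) by auto
  then show ?thesis using t by simp
qed

lemma det_ode:
  fixes Z :: "real \<Rightarrow> complex^3^3"
  assumes "\<And>s. s \<in> {0..1} \<Longrightarrow> (Z has_vector_derivative X s ** Z s) (at s within {0..1})"
    and "\<And>s. s \<in> {0..1} \<Longrightarrow> trace (X s) = 0" and "t \<in> {0..1}"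
  shows "det (Z t) = det (Z 0)"
  by (rule constant_on_01) (use det_has_vector_derivative[OF assms(1)] assms(2,3) in auto)

text \<open>
  A skew-Hermitian coefficient makes \<open>Z Z\<^sup>*\<close> constant, a traceless one the determinant.
\<close>

lemma SU3_ode:
  fixes Z :: "real \<Rightarrow> complex^3^3"
  assumes Z: "\<And>s. s \<in> {0..1} \<Longrightarrow> (Z has_vector_derivative Z s ** X s) (at s within {0..1})"
    and X: "\<And>s. s \<in> {0..1} \<Longrightarrow> X s \<in> su3" and Z0: "Z 0 \<in> SU3" and t: "t \<in> {0..1}"
  shows "Z t \<in> SU3"
proof -
  have "Z t ** adjoint_mat (Z t) = Z 0 ** adjoint_mat (Z 0)"
  proof (rule constant_on_01)
    fix s :: real assume s: "s \<in> {0..1}"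
    have "Z s ** adjoint_mat (Z s ** X s) + Z s ** X s ** adjoint_mat (Z s)
        = Z s ** (adjoint_mat (X s) + X s) ** adjoint_mat (Z s)"
      by (simp add: adjoint_mult mat_distrib)
    also have "\<dots> = 0" using X[OF s] by (simp add: su3_def)
    finally show "((\<lambda>t. Z t ** adjoint_mat (Z t)) has_vector_derivative 0) (at s within {0..1})"
      using mult3_has_vector_derivative[OF Z[OF s] adjoint_has_vector_derivative[OF Z[OF s]]] by simp
  qed (use t in auto)
  then have u: "Z t ** adjoint_mat (Z t) = mat 1" using SU3_adj(2)[OF Z0] by simp
  \<comment> \<open>the adjoint turns multiplication from the right into multiplication from the left\<close>
  have "det (adjoint_mat (Z t)) = det (adjoint_mat (Z 0))"
  proof (rule det_ode[where X = "\<lambda>s. adjoint_mat (X s)"])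
    fix s :: real assume s: "s \<in> {0..1}"
    show "((\<lambda>s. adjoint_mat (Z s)) has_vector_derivative adjoint_mat (X s) ** adjoint_mat (Z s)) (at s within {0..1})"
      using adjoint_has_vector_derivative[OF Z[OF s]] by (simp add: adjoint_mult)
    show "trace (adjoint_mat (X s)) = 0" using X[OF s] by (simp add: su3_def trace_minus3)
  qed (use t in auto)
  then have "det (Z t) = 1" using Z0 by (simp add: det_adjoint SU3_def)
  then show ?thesis using matrix_left_right_inverse[THEN iffD1, OF u] by (simp add: SU3_def)
qed

lemma mat_exp_SU3:
  assumes "X \<in> su3"
  shows "mat_exp (cscale (of_real t) X) \<in> SU3"
proof -
  have "mat_exp (cscale (of_real 1 * of_real t) X) \<in> SU3"
  proof (rule SU3_ode[where Z = "\<lambda>s. mat_exp (cscale (of_real s * of_real t) X)" and X = "\<lambda>_. cscale (of_real t) X"])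
    fix s :: real
    show "((\<lambda>s. mat_exp (cscale (of_real s * of_real t) X)) has_vector_derivative
         mat_exp (cscale (of_real s * of_real t) X) ** cscale (of_real t) X) (at s within {0..1})"
      using mat_exp_derivative[of "of_real t" X s "{0..1}"]
      by (simp add: mult_cscale_left mult_cscale_right mat_exp_commute_cscale)
    show "cscale (of_real t) X \<in> su3" using assms
      by (simp add: su3_def adjoint_cscale trace_cscale cscale_minus)
  qed (auto simp: SU3_mat1)
  then show ?thesis by simp
qed

lemma one_param_subgroup_exp:
  assumes X: "X \<in> su3"
  shows "one_param_subgroup (\<lambda>t. mat_exp (cscale (of_real t) X))"
  unfolding one_param_subgroup_def
proof (intro conjI allI)
  have "((\<lambda>s. mat_exp (cscale (of_real s * 1) X)) has_vector_derivative
     cscale 1 X ** mat_exp (cscale (of_real s * 1) X)) (at s)" for s by (rule mat_exp_derivative)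
  then show "continuous_on UNIV (\<lambda>t. mat_exp (cscale (of_real t) X))"
    by (metis (no_types, lifting) continuous_at_imp_continuous_on ext has_vector_derivative_continuous mult.right_neutral)
qed (auto simp: mat_exp_SU3[OF X] mat_exp_add)

text \<open>
  By the group law the derivative at any time is determined by the derivative at 0, so that the group
  solves the system of the exponential.
\<close>

lemma one_param_subgroup_generator:
  assumes grp: "\<And>s t. R (s + t) = R s ** R t" and R0: "R 0 = mat 1"
    and d: "(R has_vector_derivative X) (at 0)"
  shows "R t = mat_exp (cscale (of_real t) X)"
proof -
  have dR: "(R has_vector_derivative R s ** X) (at s)" for s
  proof -
    have "((\<lambda>h. h - s) has_vector_derivative 1) (at s)" by (auto intro!: derivative_eq_intros)
    from vector_diff_chain_at[OF this, of R X] d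
    have "((\<lambda>h. R (h - s)) has_vector_derivative X) (at s)" by (simp add: o_def)
    from mult3_has_vector_derivative[OF has_vector_derivative_const this, of "R s"]
    have "((\<lambda>h. R s ** R (h - s)) has_vector_derivative R s ** X) (at s)" by simp
    then show ?thesis using grp[of s] by (simp add: grp[symmetric])
  qed
  have "R (1 * t) = mat_exp (cscale (of_real 1 * of_real t) X)"
  proof (rule linear_ode_unique_right[where X = "\<lambda>_. t *\<^sub>R X" and Z = "\<lambda>s. R (s * t)"
        and W = "\<lambda>s. mat_exp (cscale (of_real s * of_real t) X)"])
    fix s :: real
    have "((\<lambda>s. s * t) has_vector_derivative t) (at s)" by (auto intro!: derivative_eq_intros)
    from vector_diff_chain_at[OF this, of R "R (s * t) ** X"] dR
    show "((\<lambda>s. R (s * t)) has_vector_derivative R (s * t) ** t *\<^sub>R X) (at s within {0..1})"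
      by (simp add: o_def mult_scaleR_right3 has_vector_derivative_at_within)
    show "((\<lambda>s. mat_exp (cscale (of_real s * of_real t) X)) has_vector_derivative
       mat_exp (cscale (of_real s * of_real t) X) ** t *\<^sub>R X) (at s within {0..1})"
      using mat_exp_derivative[of "of_real t" X s "{0..1}"]
      by (simp add: cscale_of_real[symmetric] mult_cscale_left mult_cscale_right mat_exp_commute_cscale
            del: of_real_mult)
  qed (auto simp: R0)
  then show ?thesis by simp
qed

section \<open>Smooth maps\<close>

lemma Ck_on_cong:
  assumes "open S" "\<And>x. x \<in> S \<Longrightarrow> f x = g x"
  shows "Ck_on k S f \<longleftrightarrow> Ck_on k S g"
  using assms(2)
proof (induction k arbitrary: f g)
  case 0 then show ?case by (auto intro: continuous_on_cong)
next
  case (Suc k)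
  have diff: "f differentiable (at x) \<longleftrightarrow> g differentiable (at x)" if "x \<in> S" for x
    using Suc.prems that assms(1)
    by (metis (no_types, lifting) differentiable_def has_derivative_transform_within_open)
  have fd: "frechet_derivative f (at x) = frechet_derivative g (at x)"
    if "x \<in> S" "f differentiable (at x)" for x
    using frechet_derivative_transform_within_open[OF that(2) assms(1) that(1)] Suc.prems by blast
  have "Ck_on k S (\<lambda>x. frechet_derivative f (at x) v) \<longleftrightarrow> Ck_on k S (\<lambda>x. frechet_derivative g (at x) v)"
    if "\<forall>x\<in>S. f differentiable (at x)" for v
    by (rule Suc.IH) (simp add: fd that)
  then show ?case using diff by auto
qed

lemma Ck_on_Suc_imp: "Ck_on (Suc k) S f \<Longrightarrow> Ck_on k S f"
proof (induction k arbitrary: f)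
  case 0
  then show ?case by (auto intro!: continuous_at_imp_continuous_on differentiable_imp_continuous_within)
next
  case (Suc k)
  then show ?case by (metis Ck_on.simps(2))
qed

lemma Ck_on_subset: "Ck_on k S f \<Longrightarrow> T \<subseteq> S \<Longrightarrow> Ck_on k T f"
  by (induction k arbitrary: f) (auto intro: continuous_on_subset)

lemma smooth_on_subset: "smooth_on S f \<Longrightarrow> T \<subseteq> S \<Longrightarrow> smooth_on T f"
  unfolding smooth_on_def using Ck_on_subset by blast

lemma smooth_on_cong:
  assumes "open S" "\<And>x. x \<in> S \<Longrightarrow> f x = g x"
  shows "smooth_on S f \<longleftrightarrow> smooth_on S g"
  unfolding smooth_on_def using Ck_on_cong[OF assms(1), of f g] assms(2) by simp

lemma Ck_on_const: "Ck_on k S (\<lambda>_. c)"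
  by (induction k arbitrary: c) auto

lemma Ck_on_add:
  assumes "open S" "Ck_on k S f" "Ck_on k S g"
  shows "Ck_on k S (\<lambda>x. f x + g x)"
  using assms(2,3)
proof (induction k arbitrary: f g)
  case 0 then show ?case by (auto intro: continuous_intros)
next
  case (Suc k)
  have "Ck_on k S (\<lambda>x. frechet_derivative (\<lambda>x. f x + g x) (at x) v)" for v
  proof -
    have "frechet_derivative (\<lambda>x. f x + g x) (at x) v
       = frechet_derivative f (at x) v + frechet_derivative g (at x) v" if "x \<in> S" for x
    proof -
      have "((\<lambda>x. f x + g x) has_derivative (\<lambda>v. frechet_derivative f (at x) v + frechet_derivative g (at x) v)) (at x)"
        using Suc.prems that by (intro has_derivative_add) (auto simp: frechet_derivative_works[symmetric])
      from frechet_derivative_at[OF this] show ?thesis by metis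
    qed
    then show ?thesis using Suc by (subst Ck_on_cong[OF assms(1)]) auto
  qed
  then show ?case using Suc.prems by (auto intro: differentiable_add)
qed

lemma Ck_on_bounded_linear:
  assumes "open S" "bounded_linear L" "Ck_on k S f"
  shows "Ck_on k S (\<lambda>x. L (f x))"
  using assms(3)
proof (induction k arbitrary: f)
  case 0 then show ?case using bounded_linear.continuous_on[OF assms(2)] by auto
next
  case (Suc k)
  have d: "((\<lambda>x. L (f x)) has_derivative (\<lambda>v. L (frechet_derivative f (at x) v))) (at x)" if "x \<in> S" for x
    using Suc.prems that by (intro bounded_linear.has_derivative[OF assms(2)]) (auto simp: frechet_derivative_works[symmetric])
  have "frechet_derivative (\<lambda>x. L (f x)) (at x) v = L (frechet_derivative f (at x) v)" if "x \<in> S" for x v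
    using frechet_derivative_at[OF d[OF that]] by metis
  then have "Ck_on k S (\<lambda>x. frechet_derivative (\<lambda>x. L (f x)) (at x) v)" for v
    using Suc by (subst Ck_on_cong[OF assms(1)]) auto
  then show ?case using d by (auto simp: differentiable_def)
qed

lemma Ck_on_bounded_bilinear:
  assumes "open S" "bounded_bilinear B" "Ck_on k S f" "Ck_on k S g"
  shows "Ck_on k S (\<lambda>x. B (f x) (g x))"
  using assms(3,4)
proof (induction k arbitrary: f g)
  case 0 then show ?case using bounded_bilinear.continuous_on[OF assms(2)] by auto
next
  case (Suc k)
  have d: "((\<lambda>x. B (f x) (g x)) has_derivative
      (\<lambda>v. B (f x) (frechet_derivative g (at x) v) + B (frechet_derivative f (at x) v) (g x))) (at x)" if "x \<in> S" for x
    using Suc.prems that by (intro bounded_bilinear.FDERIV[OF assms(2)]) (auto simp: frechet_derivative_works[symmetric])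
  have "frechet_derivative (\<lambda>x. B (f x) (g x)) (at x) v =
      B (f x) (frechet_derivative g (at x) v) + B (frechet_derivative f (at x) v) (g x)" if "x \<in> S" for x v
    using frechet_derivative_at[OF d[OF that]] by metis
  moreover have "Ck_on k S (\<lambda>x. B (f x) (frechet_derivative g (at x) v) + B (frechet_derivative f (at x) v) (g x))" for v
  proof (rule Ck_on_add[OF assms(1)])
    show "Ck_on k S (\<lambda>x. B (f x) (frechet_derivative g (at x) v))"
      using Suc.prems(2) by (intro Suc.IH Ck_on_Suc_imp[OF Suc.prems(1)]) simp
    show "Ck_on k S (\<lambda>x. B (frechet_derivative f (at x) v) (g x))"
      using Suc.prems(1) by (intro Suc.IH Ck_on_Suc_imp[OF Suc.prems(2)]) simp
  qed
  ultimately have "Ck_on k S (\<lambda>x. frechet_derivative (\<lambda>x. B (f x) (g x)) (at x) v)" for v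
    by (subst Ck_on_cong[OF assms(1)]) auto
  then show ?case using d by (auto simp: differentiable_def)
qed

lemma Ck_on_sum:
  assumes "open S" "\<And>i. i \<in> I \<Longrightarrow> Ck_on k S (f i)"
  shows "Ck_on k S (\<lambda>x. \<Sum>i\<in>I. f i x)"
  using assms(2)
  by (induction I rule: infinite_finite_induct) (auto intro: Ck_on_const Ck_on_add[OF assms(1)])

lemma Ck_on_entries:
  fixes M :: "'a::real_normed_vector \<Rightarrow> complex^3^3"
  assumes "open S" "\<And>i j. Ck_on k S (\<lambda>x. M x $ i $ j)"
  shows "Ck_on k S M"
proof -
  have "Ck_on k S (\<lambda>x. \<Sum>i\<in>UNIV. \<Sum>j\<in>UNIV. entry_mat i j (M x $ i $ j))"
    by (intro Ck_on_sum assms Ck_on_bounded_linear[OF assms(1) entry_mat_linear])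
  then show ?thesis by (simp add: mat_as_entries[symmetric])
qed

subsection \<open>Partial derivatives\<close>

lemma complex_linear_split:
  assumes "linear L"
  shows "L h = Re h *\<^sub>R L 1 + Im h *\<^sub>R L \<i>"
proof -
  have "h = Re h *\<^sub>R 1 + Im h *\<^sub>R \<i>" by (simp add: complex_eq_iff)
  then have "L h = L (Re h *\<^sub>R 1 + Im h *\<^sub>R \<i>)" by simp
  then show ?thesis using assms by (simp only: linear_add linear_scale)
qed

lemma has_derivative_dx_dy:
  assumes "f differentiable (at z)"
  shows "(f has_derivative (\<lambda>h. Re h *\<^sub>R dx f z + Im h *\<^sub>R dy f z)) (at z)"
proof -
  have d: "(f has_derivative frechet_derivative f (at z)) (at z)"
    using assms by (simp add: frechet_derivative_works)
  have "frechet_derivative f (at z) = (\<lambda>h. Re h *\<^sub>R dx f z + Im h *\<^sub>R dy f z)"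
    unfolding dx_def dy_def using complex_linear_split[OF has_derivative_linear[OF d]] by blast
  then show ?thesis using d by simp
qed

lemma dx_dy_eqI:
  assumes "(f has_derivative (\<lambda>h. Re h *\<^sub>R a + Im h *\<^sub>R b)) (at z)"
  shows "dx f z = a" "dy f z = b"
  unfolding dx_def dy_def frechet_derivative_at[OF assms, symmetric] by simp_all

lemma Ck_on_dxdyI:
  assumes "open S" and d: "\<And>z. z \<in> S \<Longrightarrow> (f has_derivative (\<lambda>h. Re h *\<^sub>R a z + Im h *\<^sub>R b z)) (at z)"
    and "Ck_on k S a" "Ck_on k S b"
  shows "Ck_on (Suc k) S f"
proof -
  have "Ck_on k S (\<lambda>z. frechet_derivative f (at z) v)" for v
  proof -
    have "frechet_derivative f (at z) v = Re v *\<^sub>R a z + Im v *\<^sub>R b z" if "z \<in> S" for z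
      using frechet_derivative_at[OF d[OF that]] by metis
    moreover have "Ck_on k S (\<lambda>z. Re v *\<^sub>R a z + Im v *\<^sub>R b z)"
      using assms by (intro Ck_on_add[OF assms(1)] Ck_on_bounded_linear[OF assms(1) bounded_linear_scaleR_right])
    ultimately show ?thesis by (subst Ck_on_cong[OF assms(1)]) auto
  qed
  then show ?thesis using d by (auto simp: differentiable_def)
qed

lemma smooth_on_differentiable: "smooth_on S f \<Longrightarrow> z \<in> S \<Longrightarrow> f differentiable (at z)"
  unfolding smooth_on_def using Ck_on.simps(2) by blast

lemma smooth_on_continuous: "smooth_on S f \<Longrightarrow> continuous_on S f"
  unfolding smooth_on_def using Ck_on.simps(1) by blast

lemma smooth_on_dx: "smooth_on S f \<Longrightarrow> smooth_on S (dx f)"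
  and smooth_on_dy: "smooth_on S f \<Longrightarrow> smooth_on S (dy f)"
  unfolding smooth_on_def dx_def[abs_def] dy_def[abs_def] using Ck_on.simps(2) by blast+

lemma smooth_on_bounded_linear: "open S \<Longrightarrow> bounded_linear L \<Longrightarrow> smooth_on S f \<Longrightarrow> smooth_on S (\<lambda>x. L (f x))"
  unfolding smooth_on_def using Ck_on_bounded_linear by blast

lemma smooth_on_const: "smooth_on S (\<lambda>_. c)"
  unfolding smooth_on_def using Ck_on_const by blast

lemma smooth_on_mult3:
  fixes f g :: "'a::real_normed_vector \<Rightarrow> complex^3^3"
  shows "open S \<Longrightarrow> smooth_on S f \<Longrightarrow> smooth_on S g \<Longrightarrow> smooth_on S (\<lambda>x. f x ** g x)"
  unfolding smooth_on_def using Ck_on_bounded_bilinear[OF _ bounded_bilinear_mult3] by blast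

text \<open>
  Bootstrapping: if \<open>G\<close> is \<open>C\<^sup>k\<close>, so are its partial derivatives \<open>G A\<close> and \<open>G B\<close>, and \<open>G\<close> is \<open>C\<^bsup>k+1\<^esup>\<close>.
\<close>

lemma smooth_on_linear_system:
  fixes G A B :: "complex \<Rightarrow> complex^3^3"
  assumes S: "open S" and d: "\<And>z. z \<in> S \<Longrightarrow> (G has_derivative (\<lambda>h. Re h *\<^sub>R (G z ** A z) + Im h *\<^sub>R (G z ** B z))) (at z)"
    and A: "smooth_on S A" and B: "smooth_on S B"
  shows "smooth_on S G"
proof -
  have "Ck_on k S G" for k
  proof (induction k)
    case 0
    then show ?case using d
      by (auto intro!: continuous_at_imp_continuous_on has_derivative_continuous)
  next
    case (Suc k)
    then show ?case using A B
      by (intro Ck_on_dxdyI[OF S d] Ck_on_bounded_bilinear[OF S bounded_bilinear_mult3]) (auto simp: smooth_on_def)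
  qed
  then show ?thesis by (simp add: smooth_on_def)
qed

lemma Ck_on_exp:
  fixes u :: "complex \<Rightarrow> real"
  assumes S: "open S" and u: "Ck_on k S u"
  shows "Ck_on k S (\<lambda>z. exp (c * u z))"
  using u
proof (induction k)
  case 0 then show ?case by (auto intro!: continuous_intros)
next
  case (Suc k)
  have ud: "\<And>z. z \<in> S \<Longrightarrow> u differentiable (at z)" and udx: "Ck_on k S (dx u)" "Ck_on k S (dy u)"
    using Suc.prems by (auto simp: dx_def[abs_def] dy_def[abs_def])
  have E: "Ck_on k S (\<lambda>z. exp (c * u z))" using Suc Ck_on_Suc_imp by blast
  show ?case
  proof (rule Ck_on_dxdyI[OF S])
    fix z assume "z \<in> S"
    have "((\<lambda>z. exp (c * u z)) has_derivative (\<lambda>h. c * (Re h *\<^sub>R dx u z + Im h *\<^sub>R dy u z) * exp (c * u z))) (at z)"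
      by (rule derivative_eq_intros has_derivative_dx_dy[OF ud[OF \<open>z \<in> S\<close>]] refl)+
    then show "((\<lambda>z. exp (c * u z)) has_derivative
        (\<lambda>h. Re h *\<^sub>R (c *\<^sub>R (exp (c * u z) * dx u z)) + Im h *\<^sub>R (c *\<^sub>R (exp (c * u z) * dy u z)))) (at z)"
      by (simp add: algebra_simps)
  qed (intro Ck_on_bounded_linear[OF S bounded_linear_scaleR_right]
        Ck_on_bounded_bilinear[OF S bounded_bilinear_mult] E udx)+
qed

lemma line_derivative:
  assumes "f differentiable (at (z + of_real s * w))"
  shows "((\<lambda>s. f (z + of_real s * w)) has_vector_derivative
      (Re w *\<^sub>R dx f (z + of_real s * w) + Im w *\<^sub>R dy f (z + of_real s * w))) (at s within T)"
proof -
  have l: "((\<lambda>s. z + of_real s * w) has_derivative (\<lambda>h. of_real h * w)) (at s within T)"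
    by (auto intro!: derivative_eq_intros)
  have "((\<lambda>s. f (z + of_real s * w)) has_derivative
      (\<lambda>h. Re (of_real h * w) *\<^sub>R dx f (z + of_real s * w) + Im (of_real h * w) *\<^sub>R dy f (z + of_real s * w))) (at s within T)"
    using has_derivative_compose[OF l has_derivative_dx_dy[OF assms]] by simp
  then show ?thesis by (simp add: has_vector_derivative_def algebra_simps)
qed

text \<open>
  Differentiating \<open>f(z + s + \<i> \<tau>) - f(z + \<i> \<tau>) = \<integral> f\<^sub>x(z + \<sigma> + \<i> \<tau>) d\<sigma>\<close> under the integral sign at
  \<open>\<tau> = 0\<close> writes \<open>f\<^sub>y(z + s) - f\<^sub>y(z)\<close> as the integral of \<open>(f\<^sub>x)\<^sub>y\<close>; differentiating in \<open>s\<close> gives the claim.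
\<close>

theorem mixed_partials_commute:
  fixes f :: "complex \<Rightarrow> 'b::euclidean_space"
  assumes S: "open S" and f: "smooth_on S f" and z: "z \<in> S"
  shows "dx (dy f) z = dy (dx f) z"
proof -
  obtain e where e: "e > 0" "cball z e \<subseteq> S" using S z open_contains_cball by blast
  define r where "r = e / 2"
  have r: "r > 0" using e by (simp add: r_def)
  have inS: "z + of_real \<sigma> + of_real \<tau> * \<i> \<in> S" if "\<sigma> \<in> {0..r}" "\<tau> \<in> {0..r}" for \<sigma> \<tau>
  proof -
    have "norm (of_real \<sigma> + of_real \<tau> * \<i>) \<le> \<sigma> + \<tau>"
      using norm_triangle_ineq[of "of_real \<sigma>" "of_real \<tau> * \<i>"] that by (simp add: norm_mult)
    also have "\<dots> \<le> e" using that by (simp add: r_def)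
    finally show ?thesis using e(2) by (auto simp: dist_norm subset_iff algebra_simps norm_minus_commute)
  qed
  note fdx = smooth_on_dx[OF f] and fdy = smooth_on_dy[OF f]
  note D = smooth_on_differentiable
  have horiz: "((\<lambda>\<sigma>. g (z + of_real \<sigma> + of_real \<tau> * \<i>)) has_vector_derivative dx g (z + of_real \<sigma> + of_real \<tau> * \<i>)) (at \<sigma> within T)"
    if "smooth_on S g" "\<sigma> \<in> {0..r}" "\<tau> \<in> {0..r}" for g :: "complex \<Rightarrow> 'b" and \<sigma> \<tau> T
    using line_derivative[of g "z + of_real \<tau> * \<i>" \<sigma> 1 T] D[OF that(1) inS[OF that(2,3)]]
    by (simp add: algebra_simps)
  have vert: "((\<lambda>\<tau>. g (z + of_real \<sigma> + of_real \<tau> * \<i>)) has_vector_derivative dy g (z + of_real \<sigma> + of_real \<tau> * \<i>)) (at \<tau> within T)"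
    if "smooth_on S g" "\<sigma> \<in> {0..r}" "\<tau> \<in> {0..r}" for g :: "complex \<Rightarrow> 'b" and \<sigma> \<tau> T
    using line_derivative[of g "z + of_real \<sigma>" \<tau> \<i> T] D[OF that(1) inS[OF that(2,3)]]
    by (simp add: algebra_simps)
  have cont: "continuous_on ({0..r} \<times> {0..r}) (\<lambda>(\<tau>, \<sigma>). g (z + of_real \<sigma> + of_real \<tau> * \<i>))"
    if "smooth_on S g" for g :: "complex \<Rightarrow> 'b"
    unfolding case_prod_beta'
    by (rule continuous_on_compose2[OF smooth_on_continuous[OF that]]) (use inS in \<open>auto intro!: continuous_intros\<close>)
  have cont1: "continuous_on {0..r} (\<lambda>\<sigma>. g (z + of_real \<sigma> + of_real \<tau> * \<i>))"
    if "smooth_on S g" "\<tau> \<in> {0..r}" for g :: "complex \<Rightarrow> 'b" and \<tau>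
    by (rule continuous_on_compose2[OF smooth_on_continuous[OF that(1)]]) (use inS that in \<open>auto intro!: continuous_intros\<close>)
  have int: "dy f (z + of_real s) - dy f z = integral {0..s} (\<lambda>\<sigma>. dy (dx f) (z + of_real \<sigma>))"
    if s: "s \<in> {0..r}" for s
  proof -
    have sub: "{0..s} \<subseteq> {0..r}" using s by auto
    have lb: "((\<lambda>\<tau>. integral (cbox 0 s) (\<lambda>\<sigma>. dx f (z + of_real \<sigma> + of_real \<tau> * \<i>))) has_vector_derivative
        integral (cbox 0 s) (\<lambda>\<sigma>. dy (dx f) (z + of_real \<sigma> + of_real 0 * \<i>))) (at 0 within {0..r})"
    proof (rule leibniz_rule_vector_derivative[where fx = "\<lambda>\<tau> \<sigma>. dy (dx f) (z + of_real \<sigma> + of_real \<tau> * \<i>)"])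
      show "continuous_on ({0..r} \<times> cbox 0 s) (\<lambda>(\<tau>, \<sigma>). dy (dx f) (z + of_real \<sigma> + of_real \<tau> * \<i>))"
        by (rule continuous_on_subset[OF cont[OF smooth_on_dy[OF fdx]]]) (use s in auto)
    qed (use r s vert[OF fdx] in \<open>auto intro!: integrable_continuous_real continuous_on_subset[OF cont1[OF fdx]]\<close>)
    have eq: "integral (cbox 0 s) (\<lambda>\<sigma>. dx f (z + of_real \<sigma> + of_real \<tau> * \<i>))
        = f (z + of_real s + of_real \<tau> * \<i>) - f (z + of_real 0 + of_real \<tau> * \<i>)" if \<tau>: "\<tau> \<in> {0..r}" for \<tau>
    proof -
      have "((\<lambda>\<sigma>. dx f (z + of_real \<sigma> + of_real \<tau> * \<i>)) has_integral
          f (z + of_real s + of_real \<tau> * \<i>) - f (z + of_real 0 + of_real \<tau> * \<i>)) {0..s}"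
        using s sub \<tau> by (intro fundamental_theorem_of_calculus horiz[OF f]) auto
      then show ?thesis by (simp add: integral_unique)
    qed
    have "((\<lambda>\<tau>. f (z + of_real s + of_real \<tau> * \<i>) - f (z + of_real 0 + of_real \<tau> * \<i>)) has_vector_derivative
        integral (cbox 0 s) (\<lambda>\<sigma>. dy (dx f) (z + of_real \<sigma> + of_real 0 * \<i>))) (at 0 within {0..r})"
      by (rule has_vector_derivative_transform[OF _ _ lb], use r in simp, rule eq[symmetric])
    moreover have "((\<lambda>\<tau>. f (z + of_real s + of_real \<tau> * \<i>) - f (z + of_real 0 + of_real \<tau> * \<i>)) has_vector_derivative
        dy f (z + of_real s + of_real 0 * \<i>) - dy f (z + of_real 0 + of_real 0 * \<i>)) (at 0 within {0..r})"
      using s r by (intro has_vector_derivative_diff vert[OF f]) auto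
    ultimately show ?thesis
      using vector_derivative_unique_within_closed_interval[of 0 r 0] r by fastforce
  qed
  have li: "((\<lambda>s. integral {0..s} (\<lambda>\<sigma>. dy (dx f) (z + of_real \<sigma>))) has_vector_derivative dy (dx f) (z + of_real 0)) (at 0 within {0..r})"
    using cont1[OF smooth_on_dy[OF fdx], of 0] r by (intro integral_has_vector_derivative) auto
  have "((\<lambda>s. dy f (z + of_real s) - dy f z) has_vector_derivative dy (dx f) (z + of_real 0)) (at 0 within {0..r})"
    by (rule has_vector_derivative_transform[OF _ _ li], use r in simp, rule int)
  moreover have "((\<lambda>s. dy f (z + of_real s) - dy f z) has_vector_derivative dx (dy f) (z + of_real 0)) (at 0 within {0..r})"
    using has_vector_derivative_diff[OF horiz[OF fdy, of 0 0 "{0..r}"] has_vector_derivative_const[of "dy f z"]] r by simp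
  ultimately show ?thesis
    using vector_derivative_unique_within_closed_interval[of 0 r 0] r by fastforce
qed

subsection \<open>Wirtinger derivatives of matrices\<close>

lemma dx_dy_entry:
  fixes F :: "complex \<Rightarrow> complex^3^3"
  assumes "F differentiable (at z)"
  shows "dx (\<lambda>w. F w $ i $ j) z = dx F z $ i $ j" "dy (\<lambda>w. F w $ i $ j) z = dy F z $ i $ j"
  using bounded_linear.has_derivative[OF bounded_linear_nth2 has_derivative_dx_dy[OF assms], of i j]
  by (auto intro!: dx_dy_eqI)

lemma mat_d_z_eq:
  assumes "F differentiable (at z)"
  shows "mat_d_z F z = cscale (1/2) (dx F z - cscale \<i> (dy F z))"
    and "mat_d_zbar F z = cscale (1/2) (dx F z + cscale \<i> (dy F z))"
  by (simp_all add: mat_eq3_iff mat_d_z_def mat_d_zbar_def d_z_def d_zbar_def cscale_nth dx_dy_entry[OF assms])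

lemma dx_dy_from_wirtinger:
  assumes "F differentiable (at z)"
  shows "dx F z = mat_d_z F z + mat_d_zbar F z" "dy F z = cscale \<i> (mat_d_z F z - mat_d_zbar F z)"
  unfolding mat_d_z_eq[OF assms] by (simp_all add: mat_eq3_iff cscale_nth field_simps)

lemma mat_d_z_mult:
  assumes "F differentiable (at z)" "G differentiable (at z)"
  shows "mat_d_z (\<lambda>w. F w ** G w) z = mat_d_z F z ** G z + F z ** mat_d_z G z"
    and "mat_d_zbar (\<lambda>w. F w ** G w) z = mat_d_zbar F z ** G z + F z ** mat_d_zbar G z"
    and "dx (\<lambda>w. F w ** G w) z = dx F z ** G z + F z ** dx G z"
    and "dy (\<lambda>w. F w ** G w) z = dy F z ** G z + F z ** dy G z"
    and "(\<lambda>w. F w ** G w) differentiable (at z)"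
proof -
  have d: "((\<lambda>w. F w ** G w) has_derivative (\<lambda>h. Re h *\<^sub>R (dx F z ** G z + F z ** dx G z)
      + Im h *\<^sub>R (dy F z ** G z + F z ** dy G z))) (at z)"
    using mult3_has_derivative[OF has_derivative_dx_dy[OF assms(1)] has_derivative_dx_dy[OF assms(2)]]
    by (simp add: mat_distrib algebra_simps)
  show 1: "dx (\<lambda>w. F w ** G w) z = dx F z ** G z + F z ** dx G z"
    and 2: "dy (\<lambda>w. F w ** G w) z = dy F z ** G z + F z ** dy G z"
    using dx_dy_eqI[OF d] by auto
  show 3: "(\<lambda>w. F w ** G w) differentiable (at z)" using d by (auto simp: differentiable_def)
  show "mat_d_z (\<lambda>w. F w ** G w) z = mat_d_z F z ** G z + F z ** mat_d_z G z"
    and "mat_d_zbar (\<lambda>w. F w ** G w) z = mat_d_zbar F z ** G z + F z ** mat_d_zbar G z"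
    unfolding mat_d_z_eq[OF 3] mat_d_z_eq[OF assms(1)] mat_d_z_eq[OF assms(2)] 1 2
    by (simp_all add: mat_distrib cscale_add cscale_diff)
qed

subsection \<open>Loops\<close>

text \<open>
  The derivative of \<open>h\<close> along the circle is \<open>\<i> l h'(l)\<close>, again the restriction of a holomorphic function.
\<close>

lemma smooth_loop_holomorphic:
  assumes \<Omega>: "open \<Omega>" "sphere 0 1 \<subseteq> \<Omega>"
    and g: "\<And>i j. (\<lambda>l. g l $ i $ j) holomorphic_on \<Omega>"
  shows "smooth_loop g"
proof -
  have "Ck_on k UNIV (\<lambda>\<theta>::real. h (cis \<theta>))" if "h holomorphic_on \<Omega>" for k h
    using that
  proof (induction k arbitrary: h)
    case 0
    have "continuous_on UNIV (\<lambda>\<theta>::real. h (cis \<theta>))"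
      by (rule continuous_on_compose2[OF holomorphic_on_imp_continuous_on[OF 0]])
         (use \<Omega> in \<open>auto intro!: continuous_intros simp: cis_conv_exp\<close>)
    then show ?case by simp
  next
    case (Suc k)
    have d: "((\<lambda>\<theta>. h (cis \<theta>)) has_derivative (\<lambda>v. v *\<^sub>R (\<i> * cis \<theta> * deriv h (cis \<theta>)))) (at \<theta>)" for \<theta>
    proof -
      have "cis \<theta> \<in> \<Omega>" using \<Omega>(2) by auto
      then have "(h has_field_derivative deriv h (cis \<theta>)) (at (cis \<theta>))"
        using Suc.prems \<Omega>(1) holomorphic_derivI by blast
      moreover have "(cis has_vector_derivative \<i> * cis \<theta>) (at \<theta>)"
        unfolding has_vector_derivative_complex_iff by (auto intro!: derivative_eq_intros)
      ultimately have "((\<lambda>\<theta>. h (cis \<theta>)) has_vector_derivative \<i> * cis \<theta> * deriv h (cis \<theta>)) (at \<theta>)"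
        using field_vector_diff_chain_at by (fastforce simp: o_def)
      then show ?thesis by (simp add: has_vector_derivative_def)
    qed
    have "(\<lambda>l. v *\<^sub>R (\<i> * l * deriv h l)) holomorphic_on \<Omega>" for v
      using Suc.prems \<Omega>(1) unfolding scaleR_conv_of_real
      by (intro holomorphic_intros holomorphic_deriv)
    then have "Ck_on k UNIV (\<lambda>\<theta>::real. v *\<^sub>R (\<i> * cis \<theta> * deriv h (cis \<theta>)))" for v
      using Suc.IH[of "\<lambda>l. v *\<^sub>R (\<i> * l * deriv h l)"] by simp
    moreover have "frechet_derivative (\<lambda>\<theta>. h (cis \<theta>)) (at \<theta>) v = v *\<^sub>R (\<i> * cis \<theta> * deriv h (cis \<theta>))" for \<theta> v
      using frechet_derivative_at[OF d] by metis
    moreover have "(\<lambda>\<theta>. h (cis \<theta>)) differentiable (at \<theta>)" for \<theta>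
      using d unfolding differentiable_def by blast
    ultimately show ?case by simp
  qed
  then show ?thesis unfolding smooth_loop_def smooth_on_def using g by (blast intro: Ck_on_entries)
qed

section \<open>The twisting automorphism\<close>

lemma eps_facts: "eps ^ 3 = -1" "alpha = eps\<^sup>2" "eps \<noteq> 0" "cnj eps = - eps\<^sup>2" "inverse eps = - eps\<^sup>2"
proof -
  show 3: "eps ^ 3 = -1" by (simp add: eps_def Complex.DeMoivre)
  show "alpha = eps\<^sup>2" by (simp add: eps_def alpha_def Complex.DeMoivre)
  show "eps \<noteq> 0" by (simp add: eps_def)
  have "eps * eps\<^sup>2 = -1" using 3 by (simp add: power3_eq_cube power2_eq_square mult.assoc)
  then show i: "inverse eps = - eps\<^sup>2" using \<open>eps \<noteq> 0\<close> by (simp add: field_simps)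
  show "cnj eps = - eps\<^sup>2" using i unfolding eps_def by (simp only: cis_cnj cis_inverse)
qed

lemma eps4: "eps ^ 4 = - eps"
  using eps_facts(1) by (simp add: power_numeral_reduce)

lemma P_sigma_nth:
  "P_sigma $ 1 $ 1 = 0" "P_sigma $ 1 $ 2 = eps\<^sup>2" "P_sigma $ 1 $ 3 = 0"
  "P_sigma $ 2 $ 1 = - eps" "P_sigma $ 2 $ 2 = 0" "P_sigma $ 2 $ 3 = 0"
  "P_sigma $ 3 $ 1 = 0" "P_sigma $ 3 $ 2 = 0" "P_sigma $ 3 $ 3 = 1"
  using eps4 by (simp_all add: P_sigma_def eps_facts(2) power_mult[symmetric])

text \<open>
  The matrix \<open>P_sigma\<close> is an involution; this is \<open>P_sigma\<close> with its entries written in powers of \<open>eps\<close>.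
\<close>

definition P_inv :: "complex^3^3" where
  "P_inv = vector [vector [0, eps\<^sup>2, 0], vector [- eps, 0, 0], vector [0, 0, 1]]"

lemma P_inv_nth:
  "P_inv $ 1 $ 1 = 0" "P_inv $ 1 $ 2 = eps\<^sup>2" "P_inv $ 1 $ 3 = 0"
  "P_inv $ 2 $ 1 = - eps" "P_inv $ 2 $ 2 = 0" "P_inv $ 2 $ 3 = 0"
  "P_inv $ 3 $ 1 = 0" "P_inv $ 3 $ 2 = 0" "P_inv $ 3 $ 3 = 1"
  by (simp_all add: P_inv_def)

lemma P_sigma_inv: "P_sigma ** P_inv = mat 1" "P_inv ** P_sigma = mat 1" "matrix_inv P_sigma = P_inv"
proof -
  have "eps\<^sup>2 * eps = -1" "eps * eps\<^sup>2 = -1"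
    using eps_facts(1) by (simp_all add: power3_eq_cube power2_eq_square mult.assoc)
  then show 1: "P_sigma ** P_inv = mat 1"
    by (simp add: mat_eq3_iff forall_3 mult_nth3 P_sigma_nth P_inv_nth mat1_nth)
  then show "P_inv ** P_sigma = mat 1" by (rule matrix_left_right_inverse[THEN iffD1])
  show "matrix_inv P_sigma = P_inv" by (rule matrix_inv_unique[OF 1])
qed

lemma sigma_group_unique:
  assumes "P_sigma ** transpose g ** P_inv ** h = mat 1"
  shows "sigma_group g = h"
proof -
  have "P_inv ** (P_sigma ** transpose g ** P_inv ** h) ** P_sigma = P_inv ** P_sigma"
    by (simp add: assms)
  then have "transpose g ** (P_inv ** h ** P_sigma) = mat 1"
    by (simp add: matrix_mul_assoc P_sigma_inv)
  then have "matrix_inv (transpose g) = P_inv ** h ** P_sigma" by (rule matrix_inv_unique)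
  then have "sigma_group g = (P_sigma ** P_inv) ** h ** (P_sigma ** P_inv)"
    by (simp only: sigma_group_def P_sigma_inv(3) mult_assoc3)
  then show ?thesis by (simp add: P_sigma_inv)
qed

lemma sigma_group_right:
  assumes "g \<in> SL3"
  shows "P_sigma ** transpose g ** P_inv ** sigma_group g = mat 1"
proof -
  have "transpose g \<in> SL3" using assms by (simp add: SL3_def)
  from SL3_inv(1)[OF this]
  have i: "transpose g ** matrix_inv (transpose g) = mat 1" .
  have "P_sigma ** transpose g ** P_inv ** sigma_group g
      = P_sigma ** (transpose g ** ((P_inv ** P_sigma) ** matrix_inv (transpose g))) ** P_inv"
    by (simp only: sigma_group_def P_sigma_inv(3) mult_assoc3)
  also have "\<dots> = mat 1" by (simp add: P_sigma_inv i)
  finally show ?thesis .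
qed

lemma sigma_group_mult:
  assumes "g \<in> SL3" "h \<in> SL3"
  shows "sigma_group (g ** h) = sigma_group g ** sigma_group h"
proof (rule sigma_group_unique)
  have "P_sigma ** transpose (g ** h) ** P_inv ** (sigma_group g ** sigma_group h)
    = P_sigma ** transpose h ** (P_inv ** P_sigma) ** transpose g ** P_inv ** sigma_group g ** sigma_group h"
    by (simp add: matrix_transpose_mul P_sigma_inv matrix_mul_assoc)
  also have "\<dots> = P_sigma ** transpose h ** P_inv ** (P_sigma ** transpose g ** P_inv ** sigma_group g) ** sigma_group h"
    by (simp only: mult_assoc3)
  also have "\<dots> = mat 1" by (simp add: sigma_group_right[OF assms(1)] sigma_group_right[OF assms(2)])
  finally show "P_sigma ** transpose (g ** h) ** P_inv ** (sigma_group g ** sigma_group h) = mat 1" .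
qed

lemma sigma_group_mat1: "sigma_group (mat 1) = mat 1"
  by (rule sigma_group_unique) (simp add: P_sigma_inv)

lemma sigma_group_inv:
  assumes "g \<in> SL3"
  shows "sigma_group (matrix_inv g) = matrix_inv (sigma_group g)"
  using sigma_group_mult[OF assms SL3_inv(3)[OF assms]]
  by (simp add: SL3_inv[OF assms] sigma_group_mat1 matrix_inv_unique)

lemma sigma_algebra_eq: "sigma_algebra \<xi> = - (P_sigma ** transpose \<xi> ** P_inv)"
  by (simp add: sigma_algebra_def P_sigma_inv)

lemma sigma_algebra_cscale: "sigma_algebra (cscale c \<xi>) = cscale c (sigma_algebra \<xi>)"
proof -
  have "transpose (cscale c \<xi>) = cscale c (transpose \<xi>)"
    by (simp add: mat_eq3_iff transpose_nth cscale_nth)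
  then show ?thesis by (simp add: sigma_algebra_eq mat_distrib cscale_minus)
qed

text \<open>
  Twisting intertwines linear systems: the product of the transposed twist of one solution with a
  solution of the twisted system has derivative zero.
\<close>

lemma sigma_group_ode:
  fixes Z Y :: "real \<Rightarrow> complex^3^3"
  assumes Z: "\<And>s. s \<in> {0..1} \<Longrightarrow> (Z has_vector_derivative X s ** Z s) (at s within {0..1})"
    and Y: "\<And>s. s \<in> {0..1} \<Longrightarrow> (Y has_vector_derivative sigma_algebra (X s) ** Y s) (at s within {0..1})"
    and "Z 0 = mat 1" "Y 0 = mat 1" and t: "t \<in> {0..1}"
  shows "Y t = sigma_group (Z t)"
proof -
  have "P_sigma ** transpose (Z t) ** P_inv ** Y t = P_sigma ** transpose (Z 0) ** P_inv ** Y 0"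
  proof (rule constant_on_01)
    fix s :: real assume s: "s \<in> {0..1}"
    have "((\<lambda>s. transpose (Z s)) has_vector_derivative transpose (Z s) ** transpose (X s)) (at s within {0..1})"
      using bounded_linear.has_vector_derivative[OF bounded_linear_transpose Z[OF s]]
      by (simp add: matrix_transpose_mul)
    from mult3_has_vector_derivative[OF mult3_has_vector_derivative[OF mult3_has_vector_derivative[OF
            has_vector_derivative_const[of P_sigma] this] has_vector_derivative_const[of P_inv]] Y[OF s]]
    have "((\<lambda>s. P_sigma ** transpose (Z s) ** P_inv ** Y s) has_vector_derivative
       P_sigma ** transpose (Z s) ** P_inv ** (sigma_algebra (X s) ** Y s)
       + P_sigma ** (transpose (Z s) ** transpose (X s)) ** P_inv ** Y s) (at s within {0..1})"
      by simp
    moreover have "P_sigma ** transpose (Z s) ** P_inv ** (sigma_algebra (X s) ** Y s)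
        = - (P_sigma ** transpose (Z s) ** (P_inv ** P_sigma) ** transpose (X s) ** P_inv ** Y s)"
      by (simp only: sigma_algebra_eq mat_distrib)
    ultimately show "((\<lambda>s. P_sigma ** transpose (Z s) ** P_inv ** Y s) has_vector_derivative 0) (at s within {0..1})"
      by (simp add: P_sigma_inv matrix_mul_assoc)
  qed (rule t)
  then have "P_sigma ** transpose (Z t) ** P_inv ** Y t = mat 1" by (simp add: assms(3,4) P_sigma_inv)
  then show ?thesis by (rule sigma_group_unique[symmetric])
qed

section \<open>Points of the projective plane\<close>

definition outer :: "complex^3 \<Rightarrow> complex^3 \<Rightarrow> complex^3^3" where
  "outer v w = (\<chi> i j. v $ i * cnj (w $ j))"

lemma outer_nth: "outer v w $ i $ j = v $ i * cnj (w $ j)"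
  by (simp add: outer_def)

lemma matrix_vector_nth3: "((A::complex^3^3) *v v) $ i = A$i$1 * v$1 + A$i$2 * v$2 + A$i$3 * v$3"
  by (simp add: matrix_vector_mult_def sum_3)

lemma outer_matrix: "outer (A *v v) (B *v w) = A ** outer v w ** adjoint_mat B"
  by (simp add: mat_eq3_iff outer_nth mult_nth3 matrix_vector_nth3 adjoint_nth algebra_simps)

lemma trace_outer_self: "trace (outer v v) = of_real ((norm v)\<^sup>2)"
  by (simp add: trace3 outer_nth norm_vec_def L2_set_def sum_3 sum_nonneg complex_norm_square
      real_sqrt_pow2 del: of_real_power)

lemma cp_point_outer: "cp_point v = cscale (inverse (of_real ((norm v)\<^sup>2))) (outer v v)"
  by (simp add: mat_eq3_iff cp_point_def cscale_nth outer_nth divide_inverse mult_ac)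

lemma cp_point_unit: "norm v = 1 \<Longrightarrow> cp_point v = outer v v"
  by (simp add: cp_point_outer)

lemma SU3_norm: 
  assumes "A \<in> SU3"
  shows "norm (A *v v) = norm v"
proof -
  have "trace (outer (A *v v) (A *v v)) = trace (outer v v)"
    using trace_mul_sym[of "A ** outer v v" "adjoint_mat A"]
    by (simp add: outer_matrix matrix_mul_assoc SU3_adj[OF assms])
  then have "(norm (A *v v))\<^sup>2 = (norm v)\<^sup>2" unfolding trace_outer_self by (simp only: of_real_eq_iff)
  then show ?thesis by (simp add: power2_eq_iff_nonneg)
qed

lemma cp_point_SU3:
  assumes "A \<in> SU3"
  shows "cp_point (A *v v) = cp_act A (cp_point v)"
  by (simp add: cp_point_outer cp_act_def SU3_norm[OF assms] outer_matrix mat_distrib)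

lemma cp_point_scale:
  assumes "c \<noteq> 0"
  shows "cp_point (c *s v) = cp_point v"
proof -
  have o: "outer (c *s v) (c *s v) = cscale (of_real ((norm c)\<^sup>2)) (outer v v)"
    by (simp add: mat_eq3_iff outer_nth cscale_nth complex_norm_square mult_ac del: of_real_power)
  have "complex_of_real ((norm (c *s v))\<^sup>2) = of_real ((norm c)\<^sup>2 * (norm v)\<^sup>2)"
    using trace_outer_self[of "c *s v"] trace_outer_self[of v] by (simp add: o trace_cscale)
  then have "(norm (c *s v))\<^sup>2 = (norm c)\<^sup>2 * (norm v)\<^sup>2" by (simp only: of_real_eq_iff)
  then show ?thesis using assms by (simp add: cp_point_outer o) (simp add: field_simps)
qed

section \<open>Uniqueness of the Iwasawa splitting\<close>

text \<open>
  The functions \<open>exp (\<i> h)\<close> and \<open>exp (- \<i> h)\<close> have modulus 1 on the circle, so by the maximum principle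
  at most 1 in the disc: \<open>h\<close> is real in the disc, and real holomorphic functions are constant.
\<close>

lemma holomorphic_real_on_circle_constant:
  assumes h: "h holomorphic_on ball 0 1" "continuous_on (cball 0 1) h"
    and real: "\<And>l. l \<in> sphere 0 1 \<Longrightarrow> Im (h l) = 0"
  obtains c where "\<And>l. l \<in> cball 0 1 \<Longrightarrow> h l = c"
proof -
  have bound: "norm (exp (a * h z)) \<le> 1" if a: "a = \<i> \<or> a = - \<i>" and z: "z \<in> cball 0 1" for a z
  proof (rule maximum_modulus_frontier[where S = "cball 0 1" and f = "\<lambda>z. exp (a * h z)"])
    show "(\<lambda>z. exp (a * h z)) holomorphic_on interior (cball 0 1)"
      using h(1) by (auto intro!: holomorphic_intros)
    show "continuous_on (closure (cball 0 1)) (\<lambda>z. exp (a * h z))"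
      using h(2) by (auto intro!: continuous_intros)
    show "norm (exp (a * h w)) \<le> 1" if "w \<in> frontier (cball 0 1)" for w
      using that a real[of w] by auto
  qed (use z in auto)
  have im: "Im (h z) = 0" if "z \<in> cball 0 1" for z
    using bound[of \<i> z] bound[of "- \<i>" z] that by (simp add: norm_exp_eq_Re)
  have "\<exists>c. \<forall>z\<in>ball 0 1. h z = c"
  proof -
    have "(h has_field_derivative 0) (at z)" if z: "z \<in> ball 0 1" for z
    proof -
      obtain d where d: "(h has_field_derivative d) (at z)"
        using h(1) z holomorphic_derivI[OF _ open_ball] by blast
      then have "((\<lambda>w. Im (h w)) has_derivative (\<lambda>v. Im (d * v))) (at z)"
        unfolding has_field_derivative_def by (rule has_derivative_Im)
      moreover have "((\<lambda>w. Im (h w)) has_derivative (\<lambda>v. 0)) (at z)"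
        by (rule has_derivative_transform_within_open[OF has_derivative_const open_ball z]) (use im in auto)
      ultimately have "(\<lambda>v. Im (d * v)) = (\<lambda>v. 0)" by (rule has_derivative_unique)
      then have "Im (d * 1) = 0" "Im (d * \<i>) = 0" by metis+
      then have "d = 0" by (simp add: complex_eq_iff)
      then show ?thesis using d by simp
    qed
    then show ?thesis
      by (intro has_field_derivative_zero_constant) (auto intro: has_field_derivative_at_within)
  qed
  then obtain c where c: "\<And>z. z \<in> ball 0 1 \<Longrightarrow> h z = c" by blast
  have "h l = c" if "l \<in> cball 0 1" for l
    by (rule continuous_constant_on_closure[where S = "ball 0 1" and f = h]) (use h(2) c that in auto)
  then show thesis using that by blast
qed

text \<open>
  The inverse of the loop is both its adjugate, which extends holomorphically, and its adjoint. Hence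
  the real and imaginary parts of the entries are boundary values of holomorphic functions, real on
  the circle and therefore constant.
\<close>

lemma unitary_holomorphic_loop_constant:
  assumes W: "\<And>l. l \<in> sphere 0 1 \<Longrightarrow> W l \<in> SU3"
    and hW: "\<And>l. l \<in> sphere 0 1 \<Longrightarrow> h l = W l"
    and cont: "continuous_on (cball 0 1) h"
    and hol: "\<And>i j. (\<lambda>l. h l $ i $ j) holomorphic_on ball 0 1"
  shows "\<exists>W0. \<forall>l\<in>sphere 0 1. W l = W0"
proof -
  have entry: "\<exists>c. \<forall>l\<in>sphere 0 1. W l $ i $ j = c" for i j
  proof -
    have adj: "adj3 (h l) $ j $ i = cnj (h l $ i $ j)" if "l \<in> sphere 0 1" for l
      using matrix_inv_SL3[OF SU3_SL3[OF W[OF that]]] SU3_inv[OF W[OF that]] hW[OF that]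
      by (metis adjoint_nth)
    have hola: "(\<lambda>l. adj3 (h l) $ j $ i) holomorphic_on ball 0 1"
      unfolding adj3_nth by (intro holomorphic_intros hol)
    have conte: "continuous_on (cball 0 1) (\<lambda>l. h l $ i $ j)" for i j
      by (rule bounded_linear.continuous_on[OF bounded_linear_nth2 cont])
    have conta: "continuous_on (cball 0 1) (\<lambda>l. adj3 (h l) $ j $ i)"
      unfolding adj3_nth by (intro continuous_intros conte)
    obtain a where a: "\<And>l. l \<in> cball 0 1 \<Longrightarrow> h l $ i $ j + adj3 (h l) $ j $ i = a"
      by (rule holomorphic_real_on_circle_constant[where h = "\<lambda>l. h l $ i $ j + adj3 (h l) $ j $ i"])
         (use adj in \<open>auto intro!: holomorphic_intros continuous_intros hol hola conte conta\<close>)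
    obtain b where b: "\<And>l. l \<in> cball 0 1 \<Longrightarrow> \<i> * (h l $ i $ j - adj3 (h l) $ j $ i) = b"
      by (rule holomorphic_real_on_circle_constant[where h = "\<lambda>l. \<i> * (h l $ i $ j - adj3 (h l) $ j $ i)"])
         (use adj in \<open>auto intro!: holomorphic_intros continuous_intros hol hola conte conta\<close>)
    have "W l $ i $ j = (a - \<i> * b) / 2" if "l \<in> sphere 0 1" for l
    proof -
      have l: "l \<in> cball 0 1" using that by simp
      show ?thesis unfolding a[OF l, symmetric] b[OF l, symmetric] hW[OF that]
        by (simp add: mult.assoc[symmetric])
    qed
    then show ?thesis by blast
  qed
  then obtain c where "\<And>i j l. l \<in> sphere 0 1 \<Longrightarrow> W l $ i $ j = c i j" by metis
  then have "W l = (\<chi> i j. c i j)" if "l \<in> sphere 0 1" for l using that by (simp add: mat_eq3_iff)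
  then show ?thesis by blast
qed

text \<open>
  For a unitary matrix the twist is conjugation of the complex conjugate matrix by \<open>P_sigma\<close>. Comparing
  third columns gives \<open>w\<^sub>1 = eps\<^sup>2 cnj w\<^sub>2\<close> and \<open>w\<^sub>2 = - eps cnj w\<^sub>1\<close>, hence \<open>w\<^sub>1 = - eps w\<^sub>1\<close>, and both
  entries vanish. This is why the splitting determines the surface.
\<close>

lemma sigma_fixed_axis3:
  assumes W: "W \<in> SU3" and fixd: "sigma_group W = W"
  shows "W *v axis 3 1 = (W $ 3 $ 3) *s axis 3 1" "W $ 3 $ 3 \<noteq> 0"
proof -
  define C where "C = transpose (adjoint_mat W)"
  have "transpose W ** C = mat 1"
    using arg_cong[OF SU3_adj(1)[OF W], of transpose] by (simp add: C_def matrix_transpose_mul)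
  then have "W = P_sigma ** C ** P_inv"
    using fixd matrix_inv_unique[of "transpose W" C] by (simp add: sigma_group_def P_sigma_inv)
  then have e: "W $ i $ j = (P_sigma ** C ** P_inv) $ i $ j" for i j by simp
  have C: "C $ i $ j = cnj (W $ i $ j)" for i j by (simp add: C_def transpose_nth adjoint_nth)
  have w1: "W $ 1 $ 3 = eps\<^sup>2 * cnj (W $ 2 $ 3)"
    using e[of 1 3] by (simp add: mult_nth3 P_sigma_nth P_inv_nth C)
  have w2: "W $ 2 $ 3 = - eps * cnj (W $ 1 $ 3)"
    using e[of 2 3] by (simp add: mult_nth3 P_sigma_nth P_inv_nth C)
  have "W $ 1 $ 3 = eps\<^sup>2 * (- cnj eps) * W $ 1 $ 3"
    using w1 by (subst (asm) w2) (simp add: mult.assoc)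
  also have "\<dots> = eps ^ 4 * W $ 1 $ 3" by (simp add: eps_facts(4) power_add[symmetric])
  also have "\<dots> = - eps * W $ 1 $ 3" by (simp add: eps4)
  finally have "W $ 1 $ 3 - - eps * W $ 1 $ 3 = 0" by (simp only: diff_self eq_iff_diff_eq_0[symmetric])
  then have "(1 + eps) * W $ 1 $ 3 = 0" by (simp add: distrib_right)
  moreover have "1 + eps \<noteq> 0"
  proof
    assume "1 + eps = 0"
    then have "Re (1 + eps) = 0" by simp
    then show False by (simp add: eps_def cos_60)
  qed
  ultimately have z: "W $ 1 $ 3 = 0" "W $ 2 $ 3 = 0" using w2 by auto
  then show "W *v axis 3 1 = (W $ 3 $ 3) *s axis 3 1"
    by (simp add: vec_eq_iff forall_3 matrix_vector_nth3 axis_def)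
  show "W $ 3 $ 3 \<noteq> 0"
  proof
    assume "W $ 3 $ 3 = 0"
    then have "det W = 0" using z by (simp add: det_3)
    then show False using W by (simp add: SU3_def)
  qed
qed

lemma strip_translate: "strip S \<Longrightarrow> z \<in> S \<Longrightarrow> of_real t + z \<in> S"
  by (auto simp: strip_def)

lemma eps_sphere: "l \<in> sphere 0 1 \<Longrightarrow> eps * l \<in> sphere 0 1"
  by (simp add: norm_mult eps_def)

text \<open>
  The surface moves by the unitary group \<open>exp (t D(1))\<close>, because \<open>exp (t D) F(z)\<close> and \<open>F(t + z)\<close> are unitary
  factors of the same loop \<open>exp ((t + z) D)\<close>.
\<close>

theorem generated_imp_equivariant:
  assumes S: "strip S" and D: "degree_one_constant_potential D" and gen: "generated_by S u f D"
  shows "translationally_equivariant S f"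
proof -
  obtain F V where FV0: "\<forall>z\<in>S. F z \<in> loop_SU3 \<and> V z \<in> loop_plus_SL3 \<and>
      (\<forall>l\<in>sphere 0 1. mat_exp (cscale z (D l)) = F z l ** V z l)" and ef: "extended_frame S u f F"
    using gen unfolding generated_by_def by (elim exE conjE)
  have F: "F z \<in> loop_SU3" and V: "V z \<in> loop_plus_SL3" if "z \<in> S" for z using FV0 that by simp_all
  have FV: "mat_exp (cscale z (D l)) = F z l ** V z l" if "z \<in> S" "l \<in> sphere 0 1" for z l
    using FV0 that by simp
  have fF: "f z = cp_point (F z 1 *v axis 3 1)" if "z \<in> S" for z
    using ef that unfolding extended_frame_def by (elim exE conjE) simp
  have Dsu: "D l \<in> su3" if "l \<in> sphere 0 1" for l
    using D that by (auto simp: degree_one_constant_potential_def loop_su3_def)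
  define R where "R t = mat_exp (cscale (of_real t) (D 1))" for t :: real
  have R: "one_param_subgroup R" unfolding R_def by (rule one_param_subgroup_exp[OF Dsu]) simp
  have "f (of_real t + z) = cp_act (R t) (f z)" if z: "z \<in> S" for t z
  proof -
    let ?w = "of_real t + z"
    have w: "?w \<in> S" using strip_translate[OF S z] .
    have FS: "F z l \<in> SU3" "F ?w l \<in> SU3" if "l \<in> sphere 0 1" for l
      using F[OF z] F[OF w] that by (auto simp: loop_SU3_def)
    have VS: "V z l \<in> SL3" "V ?w l \<in> SL3" if "l \<in> sphere 0 1" for l
      using V[OF z] V[OF w] that by (auto simp: loop_plus_SL3_def loop_SL3_def)
    have Vt: "V z (eps * l) = sigma_group (V z l)" "V ?w (eps * l) = sigma_group (V ?w l)" if "l \<in> sphere 0 1" for l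
      using V[OF z] V[OF w] that by (auto simp: loop_plus_SL3_def loop_SL3_def)
    \<comment> \<open>the discrepancy of the two unitary factors\<close>
    define W where "W l = V ?w l ** matrix_inv (V z l)" for l
    have FW: "mat_exp (cscale (of_real t) (D l)) ** F z l = F ?w l ** W l" if l: "l \<in> sphere 0 1" for l
    proof -
      have "F ?w l ** V ?w l = mat_exp (cscale (of_real t) (D l)) ** (F z l ** V z l)"
        by (simp add: FV[OF w l, symmetric] FV[OF z l, symmetric] mat_exp_add)
      then have "F ?w l ** V ?w l ** matrix_inv (V z l)
          = mat_exp (cscale (of_real t) (D l)) ** (F z l ** (V z l ** matrix_inv (V z l)))"
        by (simp only: mult_assoc3)
      then show ?thesis by (simp add: SL3_inv[OF VS(1)[OF l]] W_def mult_assoc3)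
    qed
    have WU: "W l \<in> SU3" if l: "l \<in> sphere 0 1" for l
    proof -
      have "adjoint_mat (F ?w l) ** (mat_exp (cscale (of_real t) (D l)) ** F z l) = W l"
        unfolding FW[OF l] by (simp add: matrix_mul_assoc SU3_adj[OF FS(2)[OF l]])
      then show ?thesis
        using SU3_mult[OF SU3_adjoint[OF FS(2)[OF l]] SU3_mult[OF mat_exp_SU3[OF Dsu[OF l]] FS(1)[OF l]]] by metis
    qed
    have "\<exists>W0. \<forall>l\<in>sphere 0 1. W l = W0"
    proof -
      obtain hz where hz: "continuous_on (cball 0 1) hz" "\<And>i j. (\<lambda>l. hz l $ i $ j) holomorphic_on ball 0 1"
        "\<And>l. l \<in> sphere 0 1 \<Longrightarrow> hz l = V z l"
        using V[OF z] unfolding loop_plus_SL3_def by blast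
      obtain hw where hw: "continuous_on (cball 0 1) hw" "\<And>i j. (\<lambda>l. hw l $ i $ j) holomorphic_on ball 0 1"
        "\<And>l. l \<in> sphere 0 1 \<Longrightarrow> hw l = V ?w l"
        using V[OF w] unfolding loop_plus_SL3_def by blast
      have adj_cont: "continuous_on (cball 0 1) (\<lambda>l. adj3 (hz l))"
        by (rule continuous_on_entries, unfold adj3_nth)
           (intro continuous_intros bounded_linear.continuous_on[OF bounded_linear_nth2 hz(1)])
      show ?thesis
      proof (rule unitary_holomorphic_loop_constant[OF WU])
        show "hw l ** adj3 (hz l) = W l" if "l \<in> sphere 0 1" for l
          using that by (simp add: hz(3) hw(3) W_def matrix_inv_SL3[OF VS(1)])
        show "continuous_on (cball 0 1) (\<lambda>l. hw l ** adj3 (hz l))"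
          by (intro continuous_intros hw(1) adj_cont)
        show "(\<lambda>l. (hw l ** adj3 (hz l)) $ i $ j) holomorphic_on ball 0 1" for i j
          unfolding mult_nth3 adj3_nth by (intro holomorphic_intros hz(2) hw(2))
      qed
    qed
    then obtain W0 where W0: "\<And>l. l \<in> sphere 0 1 \<Longrightarrow> W l = W0" by blast
    have one: "1 \<in> sphere (0::complex) 1" by simp
    have "W (eps * 1) = sigma_group (W 1)"
      unfolding W_def Vt[OF one] using VS[OF one] SL3_inv(3)[OF VS(1)[OF one]]
      by (simp add: sigma_group_mult sigma_group_inv)
    then have fixd: "sigma_group W0 = W0" using W0[OF one] W0[OF eps_sphere[OF one]] by simp
    have W0U: "W0 \<in> SU3" using WU[OF one] W0[OF one] by simp
    note ax = sigma_fixed_axis3[OF W0U fixd]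
    have "R t *v (F z 1 *v axis 3 1) = F ?w 1 *v (W0 *v axis 3 1)"
      using FW[OF one] W0[OF one] by (simp add: R_def matrix_vector_mul_assoc)
    also have "\<dots> = (W0 $ 3 $ 3) *s (F ?w 1 *v axis 3 1)"
      unfolding ax(1) by (simp add: vec_eq_iff matrix_vector_nth3 algebra_simps)
    finally have "cp_point (R t *v (F z 1 *v axis 3 1)) = cp_point (F ?w 1 *v axis 3 1)"
      by (simp add: cp_point_scale[OF ax(2)])
    moreover have "R t \<in> SU3" using R by (auto simp: one_param_subgroup_def)
    ultimately show ?thesis by (simp add: fF[OF z] fF[OF w] cp_point_SU3)
  qed
  then show ?thesis using R unfolding translationally_equivariant_def by blast
qed

section \<open>Twisted loops of degree one\<close>

definition pot_minus :: "complex \<Rightarrow> complex \<Rightarrow> complex^3^3" where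
  "pot_minus a b = vector [vector [0, 0, a], vector [b, 0, 0], vector [0, a, 0]]"

definition pot_plus :: "complex \<Rightarrow> complex \<Rightarrow> complex^3^3" where
  "pot_plus p q = vector [vector [0, q, 0], vector [0, 0, p], vector [p, 0, 0]]"

text \<open>
  The coefficients of \<open>1/l\<close>, \<open>1\<close> and \<open>l\<close> are eigenvectors of the twisting automorphism for the eigenvalues
  \<open>1/eps\<close>, \<open>1\<close> and \<open>eps\<close>. Both matrices of the Lax pair have this shape, and diagonal gauge
  transformations preserve it.
\<close>

definition pot :: "complex \<Rightarrow> complex \<Rightarrow> complex \<Rightarrow> complex \<Rightarrow> complex \<Rightarrow> complex \<Rightarrow> complex^3^3" where
  "pot s a b p q l = cscale (inverse l) (pot_minus a b) + diag3 s (- s) 0 + cscale l (pot_plus p q)"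

lemma pot_nth:
  "pot s a b p q l $ 1 $ 1 = s" "pot s a b p q l $ 1 $ 2 = l * q" "pot s a b p q l $ 1 $ 3 = inverse l * a"
  "pot s a b p q l $ 2 $ 1 = inverse l * b" "pot s a b p q l $ 2 $ 2 = - s" "pot s a b p q l $ 2 $ 3 = l * p"
  "pot s a b p q l $ 3 $ 1 = l * p" "pot s a b p q l $ 3 $ 2 = inverse l * a" "pot s a b p q l $ 3 $ 3 = 0"
  by (simp_all add: pot_def pot_minus_def pot_plus_def diag3_def cscale_nth)

lemma diag3_nth:
  "diag3 a b c $ 1 $ 1 = a" "diag3 a b c $ 1 $ 2 = 0" "diag3 a b c $ 1 $ 3 = 0"
  "diag3 a b c $ 2 $ 1 = 0" "diag3 a b c $ 2 $ 2 = b" "diag3 a b c $ 2 $ 3 = 0"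
  "diag3 a b c $ 3 $ 1 = 0" "diag3 a b c $ 3 $ 2 = 0" "diag3 a b c $ 3 $ 3 = c"
  by (simp_all add: diag3_def)

lemma lax_z_pot: "lax_z u \<psi> l z = pot (d_z (\<lambda>w. of_real (u w)) z / 2) (\<i> * of_real (exp (u z / 2)))
    (- \<i> * \<psi> z * of_real (exp (- u z))) 0 0 l"
  by (simp add: mat_eq3_iff forall_3 pot_nth lax_z_def Let_def cscale_nth diag3_nth)

lemma lax_zbar_pot: "lax_zbar u \<psi> l z = pot (- d_zbar (\<lambda>w. of_real (u w)) z / 2) 0 0
    (\<i> * of_real (exp (u z / 2))) (- \<i> * cnj (\<psi> z) * of_real (exp (- u z))) l"
  by (simp add: mat_eq3_iff forall_3 pot_nth lax_zbar_def Let_def cscale_nth diag3_nth)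

lemma pot_add: "pot s a b p q l + pot s' a' b' p' q' l = pot (s + s') (a + a') (b + b') (p + p') (q + q') l"
  by (simp add: mat_eq3_iff forall_3 pot_nth algebra_simps)

lemma cscale_pot: "cscale c (pot s a b p q l) = pot (c * s) (c * a) (c * b) (c * p) (c * q) l"
  by (simp add: mat_eq3_iff forall_3 pot_nth cscale_nth algebra_simps)

lemma trace_pot: "trace (pot s a b p q l) = 0"
  by (simp add: trace3 pot_nth)

lemma sigma_algebra_pot:
  assumes "l \<noteq> 0"
  shows "sigma_algebra (pot s a b p q l) = pot s a b p q (eps * l)"
proof -
  have e: "eps * eps = eps\<^sup>2" "eps * eps\<^sup>2 = -1" "eps\<^sup>2 * eps = -1" "eps\<^sup>2 * eps\<^sup>2 = - eps"
    using eps_facts(1) eps4 by (simp_all add: power2_eq_square power3_eq_cube power4_eq_xxxx mult.assoc)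
  have inv: "inverse (eps * l) = - eps\<^sup>2 * inverse l" by (simp add: eps_facts)
  have e': "eps * (x * eps\<^sup>2) = - x" "eps\<^sup>2 * (x * eps) = - x" "eps\<^sup>2 * (x * eps\<^sup>2) = - eps * x"
     "eps * (x * eps) = eps\<^sup>2 * x" for x
    using e by (metis mult.assoc mult.commute mult_minus1)+
  show ?thesis
    by (simp add: mat_eq3_iff forall_3 sigma_algebra_eq mult_nth3 P_sigma_nth P_inv_nth transpose_nth
        pot_nth inv e e' mult_ac) (simp add: eps4 eps_facts(5) power2_eq_square mult_ac)
qed

lemma pot_holomorphic: "(\<lambda>l. pot s a b p q l $ i $ j) holomorphic_on - {0}"
  using exhaust_3[of i] exhaust_3[of j]
  by (elim disjE; simp add: pot_nth; intro holomorphic_intros; simp)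

lemma U1_conj_pot:
  assumes "c \<noteq> 0"
  shows "diag3 (inverse c) c 1 ** pot s a b p q l ** diag3 c (inverse c) 1
    = pot s (inverse c * a) (c\<^sup>2 * b) (c * p) ((inverse c)\<^sup>2 * q) l"
  using assms by (simp add: mat_eq3_iff forall_3 mult_nth3 pot_nth diag3_nth power2_eq_square field_simps)

section \<open>Potentials from equivariant frames\<close>

lemma U1_entries:
  assumes "k \<in> U1"
  shows "k = diag3 (k $ 1 $ 1) (inverse (k $ 1 $ 1)) 1" "k $ 1 $ 1 \<noteq> 0" "cmod (k $ 1 $ 1) = 1"
    "adjoint_mat k = diag3 (inverse (k $ 1 $ 1)) (k $ 1 $ 1) 1"
proof -
  obtain c where c: "k = diag3 c (inverse c) 1" "cmod c = 1" using assms unfolding U1_def by blast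
  then show "k = diag3 (k $ 1 $ 1) (inverse (k $ 1 $ 1)) 1" "cmod (k $ 1 $ 1) = 1" by (simp_all add: diag3_nth)
  show nz: "k $ 1 $ 1 \<noteq> 0" using c by (auto simp: diag3_nth)
  have "diag3 (inverse c) c 1 ** k = mat 1"
    using nz c by (simp add: mat_eq3_iff forall_3 mult_nth3 diag3_nth mat1_nth)
  then have "matrix_inv k = diag3 (inverse c) c 1" by (rule matrix_inv_unique')
  then show "adjoint_mat k = diag3 (inverse (k $ 1 $ 1)) (k $ 1 $ 1) 1"
    using SU3_inv[OF U1_SU3[OF assms]] c by (simp add: diag3_nth)
qed

text \<open>
  The logarithmic derivative of a diagonal gauge is diagonal and traceless, and does not contain the
  spectral parameter.
\<close>

lemma U1_gauge_derivative:
  assumes S: "open S" and k: "smooth_on S k" "k ` S \<subseteq> U1" and z: "z \<in> S"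
  shows "dx k z = k z ** diag3 (inverse (k z $ 1 $ 1) * dx k z $ 1 $ 1) (- (inverse (k z $ 1 $ 1) * dx k z $ 1 $ 1)) 0"
    and "dy k z = k z ** diag3 (inverse (k z $ 1 $ 1) * dy k z $ 1 $ 1) (- (inverse (k z $ 1 $ 1) * dy k z $ 1 $ 1)) 0"
proof -
  define c where "c w = k w $ 1 $ 1" for w
  have kc: "k w = diag3 (c w) (inverse (c w)) 1" and c0: "c w \<noteq> 0" if "w \<in> S" for w
    using U1_entries[of "k w"] k(2) that by (auto simp: c_def)
  have dk: "(k has_derivative (\<lambda>h. Re h *\<^sub>R dx k z + Im h *\<^sub>R dy k z)) (at z)"
    by (rule has_derivative_dx_dy[OF smooth_on_differentiable[OF k(1) z]])
  define c' where "c' h = Re h *\<^sub>R dx k z $ 1 $ 1 + Im h *\<^sub>R dy k z $ 1 $ 1" for h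
  have dc: "(c has_derivative c') (at z)"
    using bounded_linear.has_derivative[OF bounded_linear_nth2[of 1 1] dk] by (simp add: c_def[abs_def] c'_def[abs_def])
  have di: "((\<lambda>w. inverse (c w)) has_derivative (\<lambda>h. - (inverse (c z) * c' h * inverse (c z)))) (at z)"
    by (rule Deriv.has_derivative_inverse[OF c0[OF z] dc])
  have "((\<lambda>w. diag3 (c w) (inverse (c w)) 1) has_derivative
      (\<lambda>h. diag3 (c' h) (- (inverse (c z) * c' h * inverse (c z))) 0)) (at z)"
  proof (rule has_derivative_entries)
    fix i j :: 3
    show "((\<lambda>w. diag3 (c w) (inverse (c w)) 1 $ i $ j) has_derivative
      (\<lambda>h. diag3 (c' h) (- (inverse (c z) * c' h * inverse (c z))) 0 $ i $ j)) (at z)"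
      using exhaust_3[of i] exhaust_3[of j] dc di by (elim disjE) (auto simp: diag3_nth)
  qed
  then have "(k has_derivative (\<lambda>h. diag3 (c' h) (- (inverse (c z) * c' h * inverse (c z))) 0)) (at z)"
    by (rule has_derivative_transform_within_open[OF _ S z]) (simp add: kc)
  then have "(\<lambda>h. Re h *\<^sub>R dx k z + Im h *\<^sub>R dy k z) = (\<lambda>h. diag3 (c' h) (- (inverse (c z) * c' h * inverse (c z))) 0)"
    using dk has_derivative_unique by blast
  then have e: "Re h *\<^sub>R dx k z + Im h *\<^sub>R dy k z = diag3 (c' h) (- (inverse (c z) * c' h * inverse (c z))) 0" for h
    by metis
  have "dx k z = diag3 (c' 1) (- (inverse (c z) * c' 1 * inverse (c z))) 0"
    and "dy k z = diag3 (c' \<i>) (- (inverse (c z) * c' \<i> * inverse (c z))) 0"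
    using e[of 1] e[of \<i>] by simp_all
  moreover have "c' 1 = dx k z $ 1 $ 1" "c' \<i> = dy k z $ 1 $ 1" by (simp_all add: c'_def)
  ultimately have dxk: "dx k z = diag3 (dx k z $ 1 $ 1) (- (inverse (c z) * dx k z $ 1 $ 1 * inverse (c z))) 0"
    and dyk: "dy k z = diag3 (dy k z $ 1 $ 1) (- (inverse (c z) * dy k z $ 1 $ 1 * inverse (c z))) 0"
    by metis+
  have m: "diag3 (c z) (inverse (c z)) 1 ** diag3 (inverse (c z) * x) (- (inverse (c z) * x)) 0
      = diag3 x (- (inverse (c z) * x * inverse (c z))) 0" for x
    using c0[OF z] by (simp add: mat_eq3_iff forall_3 mult_nth3 diag3_nth)
  show "dx k z = k z ** diag3 (inverse (k z $ 1 $ 1) * dx k z $ 1 $ 1) (- (inverse (k z $ 1 $ 1) * dx k z $ 1 $ 1)) 0"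
    and "dy k z = k z ** diag3 (inverse (k z $ 1 $ 1) * dy k z $ 1 $ 1) (- (inverse (k z $ 1 $ 1) * dy k z $ 1 $ 1)) 0"
    unfolding c_def[symmetric] using m dxk dyk kc[OF z] by metis+
qed

lemma diag3_pot: "diag3 s (- s) 0 = pot s 0 0 0 0 l"
  by (simp add: mat_eq3_iff forall_3 pot_nth diag3_nth)

lemma smooth_on_entry: "open S \<Longrightarrow> smooth_on S k \<Longrightarrow> continuous_on S (\<lambda>z. k z $ i $ (j::3) :: complex)"
  for k :: "complex \<Rightarrow> complex^3^3"
  using bounded_linear.continuous_on[OF bounded_linear_nth2 smooth_on_continuous] by blast

text \<open>
  Gauging the Lax pair conjugates its coefficients and adds a diagonal term. So the Maurer-Cartan form
  of every extended frame keeps degree one in the spectral parameter, and its \<open>zbar\<close> part stays free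
  of poles.
\<close>

lemma extended_frame_structure:
  assumes S: "open S" and u: "smooth_on S u" and ef: "extended_frame S u f F"
  obtains s1 a1 b1 p1 q1 s2 p2 q2 where
    "\<And>z l. z \<in> S \<Longrightarrow> l \<in> sphere 0 1 \<Longrightarrow> F z l \<in> SU3"
    "\<And>l. l \<in> sphere 0 1 \<Longrightarrow> smooth_on S (\<lambda>z. F z l)"
    "\<And>z l. z \<in> S \<Longrightarrow> l \<in> sphere 0 1 \<Longrightarrow> dx (\<lambda>z. F z l) z = F z l ** pot (s1 z) (a1 z) (b1 z) (p1 z) (q1 z) l"
    "\<And>z l. z \<in> S \<Longrightarrow> l \<in> sphere 0 1 \<Longrightarrow> mat_d_zbar (\<lambda>z. F z l) z = F z l ** pot (s2 z) 0 0 (p2 z) (q2 z) l"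
    "continuous_on S s2" "continuous_on S p2" "continuous_on S q2"
proof -
  obtain \<psi> G k where \<psi>: "\<psi> holomorphic_on S"
    and G: "\<forall>l\<in>sphere 0 1. smooth_on S (\<lambda>z. G z l) \<and> (\<forall>z\<in>S. G z l \<in> SU3 \<and>
        matrix_inv (G z l) ** mat_d_z (\<lambda>w. G w l) z = lax_z u \<psi> l z \<and>
        matrix_inv (G z l) ** mat_d_zbar (\<lambda>w. G w l) z = lax_zbar u \<psi> l z)"
    and ks: "smooth_on S k" and kU: "k ` S \<subseteq> U1"
    and FG0: "\<forall>z\<in>S. \<forall>l\<in>sphere 0 1. F z l = G z l ** k z"
    using ef unfolding extended_frame_def by (elim exE conjE)
  have Gs: "smooth_on S (\<lambda>z. G z l)" if "l \<in> sphere 0 1" for l using G that by blast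
  have GU: "G z l \<in> SU3"
    and Gz: "matrix_inv (G z l) ** mat_d_z (\<lambda>w. G w l) z = lax_z u \<psi> l z"
    and Gzb: "matrix_inv (G z l) ** mat_d_zbar (\<lambda>w. G w l) z = lax_zbar u \<psi> l z"
    if "z \<in> S" "l \<in> sphere 0 1" for z l using G that by blast+
  have FG: "F z l = G z l ** k z" if "z \<in> S" "l \<in> sphere 0 1" for z l using FG0 that by blast
  define c where "c z = k z $ 1 $ 1" for z
  define cx where "cx z = inverse (c z) * dx k z $ 1 $ 1" for z
  define cy where "cy z = inverse (c z) * dy k z $ 1 $ 1" for z
  define r where "r z = \<i> * complex_of_real (exp (u z / 2))" for z
  define uz where "uz z = d_z (\<lambda>w. of_real (u w)) z / 2" for z
  define ub where "ub z = - d_zbar (\<lambda>w. of_real (u w)) z / 2" for z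
  define m where "m z = - \<i> * \<psi> z * of_real (exp (- u z))" for z
  define n where "n z = - \<i> * cnj (\<psi> z) * of_real (exp (- u z))" for z
  have c0: "c z \<noteq> 0" if "z \<in> S" for z using U1_entries(2) kU that by (auto simp: c_def)
  have Gd: "(\<lambda>z. G z l) differentiable (at z)" if "z \<in> S" "l \<in> sphere 0 1" for z l
    by (rule smooth_on_differentiable[OF Gs[OF that(2)] that(1)])
  have kd: "k differentiable (at z)" if "z \<in> S" for z by (rule smooth_on_differentiable[OF ks that])
  have Gz': "mat_d_z (\<lambda>w. G w l) z = G z l ** lax_z u \<psi> l z"
    and Gzb': "mat_d_zbar (\<lambda>w. G w l) z = G z l ** lax_zbar u \<psi> l z" if "z \<in> S" "l \<in> sphere 0 1" for z l
    using Gz[OF that] Gzb[OF that] SL3_inv(1)[OF SU3_SL3[OF GU[OF that]]]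
    by (metis matrix_mul_assoc matrix_mul_lid)+
  have Fs: "smooth_on S (\<lambda>z. F z l)" if "l \<in> sphere 0 1" for l
    using smooth_on_mult3[OF S Gs[OF that] ks] smooth_on_cong[OF S, of "\<lambda>z. F z l" "\<lambda>z. G z l ** k z"] FG that by blast
  have kk: "k z ** (adjoint_mat (k z) ** M ** k z) = M ** k z" if "z \<in> S" for z M
    using SU3_adj(2)[OF U1_SU3] kU that by (metis image_subset_iff matrix_mul_assoc matrix_mul_lid)
  have conj: "adjoint_mat (k z) ** pot s a b p q l ** k z
      = pot s (inverse (c z) * a) ((c z)\<^sup>2 * b) (c z * p) ((inverse (c z))\<^sup>2 * q) l" if "z \<in> S" for z s a b p q l
    using U1_entries[of "k z"] kU that U1_conj_pot[OF c0[OF that], of s a b p q l] unfolding c_def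
    by (metis image_subset_iff)
  \<comment> \<open>the gauge factor is moved to the left of a coefficient matrix\<close>
  have move: "G z l ** pot s a b p q l ** k z
      = F z l ** pot s (inverse (c z) * a) ((c z)\<^sup>2 * b) (c z * p) ((inverse (c z))\<^sup>2 * q) l"
    if "z \<in> S" "l \<in> sphere 0 1" for z l s a b p q
  proof -
    have "F z l ** pot s (inverse (c z) * a) ((c z)\<^sup>2 * b) (c z * p) ((inverse (c z))\<^sup>2 * q) l
        = (G z l ** k z) ** (adjoint_mat (k z) ** pot s a b p q l ** k z)"
      by (simp only: FG[OF that] conj[OF that(1)])
    also have "\<dots> = G z l ** (k z ** (adjoint_mat (k z) ** pot s a b p q l ** k z))" by (rule mult_assoc3)
    also have "\<dots> = G z l ** (pot s a b p q l ** k z)" by (simp only: kk[OF that(1)])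
    also have "\<dots> = G z l ** pot s a b p q l ** k z" by (rule matrix_mul_assoc)
    finally show ?thesis by (rule sym)
  qed
  have Fd: "dx (\<lambda>z. F z l) z = dx (\<lambda>z. G z l ** k z) z" "mat_d_zbar (\<lambda>z. F z l) z = mat_d_zbar (\<lambda>z. G z l ** k z) z"
    if "z \<in> S" "l \<in> sphere 0 1" for z l
  proof -
    have dF: "(\<lambda>z. F z l) differentiable (at z)" by (rule smooth_on_differentiable[OF Fs[OF that(2)] that(1)])
    have fr: "frechet_derivative (\<lambda>z. F z l) (at z) = frechet_derivative (\<lambda>z. G z l ** k z) (at z)"
      by (rule frechet_derivative_transform_within_open[OF dF S that(1)]) (rule FG[OF _ that(2)])
    then show "dx (\<lambda>z. F z l) z = dx (\<lambda>z. G z l ** k z) z" by (simp add: dx_def)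
    then show "mat_d_zbar (\<lambda>z. F z l) z = mat_d_zbar (\<lambda>z. G z l ** k z) z"
      using fr by (simp add: mat_d_z_eq[OF dF] mat_d_z_eq[OF mat_d_z_mult(5)[OF Gd[OF that] kd[OF that(1)]]] dy_def)
  qed
  have dxk: "dx k z = k z ** diag3 (cx z) (- cx z) 0" and dyk: "dy k z = k z ** diag3 (cy z) (- cy z) 0" if "z \<in> S" for z
    using U1_gauge_derivative[OF S ks kU that] by (simp_all add: cx_def cy_def c_def)
  show thesis
  proof
    show "F z l \<in> SU3" if "z \<in> S" "l \<in> sphere 0 1" for z l
      using FG[OF that] SU3_mult[OF GU[OF that] U1_SU3] kU that by auto
    show "dx (\<lambda>z. F z l) z = F z l ** pot (uz z + ub z + cx z) (inverse (c z) * r z) ((c z)\<^sup>2 * m z)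
        (c z * r z) ((inverse (c z))\<^sup>2 * n z) l" if z: "z \<in> S" "l \<in> sphere 0 1" for z l
    proof -
      have "dx (\<lambda>z. F z l) z = G z l ** (lax_z u \<psi> l z + lax_zbar u \<psi> l z) ** k z + F z l ** diag3 (cx z) (- cx z) 0"
        unfolding Fd[OF z] mat_d_z_mult(3)[OF Gd[OF z] kd[OF z(1)]] dx_dy_from_wirtinger(1)[OF Gd[OF z]] Gz'[OF z] Gzb'[OF z]
          dxk[OF z(1)] FG[OF z] by (simp add: mat_distrib)
      also have "lax_z u \<psi> l z + lax_zbar u \<psi> l z = pot (uz z + ub z) (r z) (m z) (r z) (n z) l"
        by (simp add: lax_z_pot lax_zbar_pot pot_add uz_def ub_def r_def m_def n_def)
      finally show ?thesis
        unfolding move[OF z] diag3_pot[of "cx z" l] mult_add_right[symmetric] pot_add by simp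
    qed
    show "mat_d_zbar (\<lambda>z. F z l) z = F z l ** pot (ub z + (cx z + \<i> * cy z) / 2) 0 0
        (c z * r z) ((inverse (c z))\<^sup>2 * n z) l" if z: "z \<in> S" "l \<in> sphere 0 1" for z l
    proof -
      have kb: "mat_d_zbar k z = k z ** diag3 ((cx z + \<i> * cy z) / 2) (- ((cx z + \<i> * cy z) / 2)) 0"
        unfolding mat_d_z_eq[OF kd[OF z(1)]] dxk[OF z(1)] dyk[OF z(1)]
        by (simp add: mat_eq3_iff forall_3 mult_nth3 cscale_nth diag3_nth field_simps)
      have "mat_d_zbar (\<lambda>z. F z l) z = G z l ** lax_zbar u \<psi> l z ** k z
          + F z l ** diag3 ((cx z + \<i> * cy z) / 2) (- ((cx z + \<i> * cy z) / 2)) 0"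
        unfolding Fd[OF z] mat_d_z_mult(2)[OF Gd[OF z] kd[OF z(1)]] Gzb'[OF z] kb FG[OF z] by (simp add: mat_distrib)
      also have "lax_zbar u \<psi> l z = pot (ub z) 0 0 (r z) (n z) l"
        by (simp add: lax_zbar_pot ub_def r_def n_def)
      finally show ?thesis
        unfolding move[OF z] diag3_pot[of "(cx z + \<i> * cy z) / 2" l] mult_add_right[symmetric] pot_add by simp
    qed
    have cc: "continuous_on S c" unfolding c_def using smooth_on_entry[OF S ks] .
    have cu: "continuous_on S u" by (rule smooth_on_continuous[OF u])
    have c\<psi>: "continuous_on S \<psi>" by (rule holomorphic_on_imp_continuous_on[OF \<psi>])
    have us: "smooth_on S (\<lambda>w. complex_of_real (u w))"
      by (rule smooth_on_bounded_linear[OF S bounded_linear_of_real u])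
    have "continuous_on S (dx (\<lambda>w. complex_of_real (u w)))" "continuous_on S (dy (\<lambda>w. complex_of_real (u w)))"
      using smooth_on_continuous[OF smooth_on_dx[OF us]] smooth_on_continuous[OF smooth_on_dy[OF us]] by auto
    then have cub: "continuous_on S ub" unfolding ub_def d_zbar_def by (intro continuous_intros) auto
    have ccx: "continuous_on S cx" "continuous_on S cy" unfolding cx_def cy_def
      using c0 by (auto intro!: continuous_intros cc smooth_on_entry[OF S] smooth_on_dx[OF ks] smooth_on_dy[OF ks])
    show "continuous_on S (\<lambda>z. ub z + (cx z + \<i> * cy z) / 2)"
      by (intro continuous_intros cub ccx) auto
    show "continuous_on S (\<lambda>z. c z * r z)" unfolding r_def by (intro continuous_intros cc cu) auto
    show "continuous_on S (\<lambda>z. (inverse (c z))\<^sup>2 * n z)" unfolding n_def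
      using c0 by (auto intro!: continuous_intros cc cu c\<psi>)
  qed (rule Fs)
qed

lemma strip_open_convex:
  assumes "strip S"
  shows "open S" "convex S" "0 \<in> S"
proof -
  obtain a b :: ereal where ab: "a < 0" "0 < b" "S = {z. a < ereal (Im z) \<and> ereal (Im z) < b}"
    using assms by (auto simp: strip_def)
  have e: "S = Im -` {y. a < ereal y \<and> ereal y < b}" using ab by auto
  have oc: "open {y::real. a < ereal y \<and> ereal y < b}" "convex {y::real. a < ereal y \<and> ereal y < b}"
  proof -
    have "{y::real. a < ereal y \<and> ereal y < b} = ereal -` {a<..<b}" by auto
    then show "open {y::real. a < ereal y \<and> ereal y < b}" by (simp add: open_ereal_vimage)
    have "is_interval {y::real. a < ereal y \<and> ereal y < b}"
      unfolding is_interval_1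
    proof (intro ballI allI impI)
      fix x y t assume "x \<in> {y. a < ereal y \<and> ereal y < b}" "y \<in> {y. a < ereal y \<and> ereal y < b}" "x \<le> t \<and> t \<le> y"
      then have "a < ereal x" "ereal x \<le> ereal t" "ereal t \<le> ereal y" "ereal y < b" by auto
      then show "t \<in> {y. a < ereal y \<and> ereal y < b}" using less_le_trans le_less_trans by blast
    qed
    then show "convex {y::real. a < ereal y \<and> ereal y < b}" by (rule is_interval_convex)
  qed
  show "open S" unfolding e by (rule open_vimage[OF oc(1)]) (intro continuous_intros)
  show "convex S" unfolding e
    by (rule convex_linear_vimage[OF bounded_linear.linear[OF bounded_linear_Im] oc(2)])
  show "0 \<in> S" using ab by (simp add: zero_ereal_def)
qed

lemma strip_vertical: "strip S \<Longrightarrow> z \<in> S \<Longrightarrow> s \<in> {0..1} \<Longrightarrow> of_real s * (\<i> * of_real (Im z)) \<in> S"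
proof -
  assume S: "strip S" and z: "z \<in> S" and s: "s \<in> {0..1}"
  have "\<i> * of_real (Im z) = of_real (- Re z) + z" by (simp add: complex_eq_iff)
  then have "\<i> * of_real (Im z) \<in> S" using strip_translate[OF S z, of "- Re z"] by simp
  then have "(1 - s) *\<^sub>R 0 + s *\<^sub>R (\<i> * of_real (Im z)) \<in> S"
    using strip_open_convex[OF S] s by (intro convexD) auto
  then show ?thesis by (simp add: scaleR_conv_of_real)
qed

lemma matrix_cancel_right:
  assumes "(A::complex^3^3) ** V = B ** V" "V \<in> SL3"
  shows "A = B"
proof -
  have "A ** (V ** matrix_inv V) = B ** (V ** matrix_inv V)" by (simp only: matrix_mul_assoc assms(1))
  then show ?thesis by (simp add: SL3_inv[OF assms(2)])
qed

text \<open>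
  A linear system whose coefficients are twisted and affine in the spectral parameter, without
  pole, has solutions that are twisted and entire in the parameter. This produces the factor of the
  splitting that extends to the disc.
\<close>

lemma holomorphic_factor:
  fixes s2 p2 q2 :: "real \<Rightarrow> complex"
  assumes c: "continuous_on {0..1} s2" "continuous_on {0..1} p2" "continuous_on {0..1} q2"
  obtains V where "V \<in> loop_plus_SL3" "\<And>l. V l \<in> SL3" "\<And>i j. (\<lambda>l. V l $ i $ j) holomorphic_on UNIV"
    "\<And>l. \<exists>U. U 0 = mat 1 \<and> U 1 = V l \<and> (\<forall>s\<in>{0..1}.
       (U has_vector_derivative pot (s2 s) 0 0 (p2 s) (q2 s) l ** U s) (at s within {0..1}))"
proof -
  define X where "X l s = pot (s2 s) 0 0 (p2 s) (q2 s) l" for l s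
  define C0 where "C0 s = pot (s2 s) 0 0 0 0 1" for s
  define C1 where "C1 s = pot 0 0 0 (p2 s) (q2 s) 1" for s
  have C: "continuous_on {0..1} C0" "continuous_on {0..1} C1"
  proof -
    have "continuous_on {0..1} (\<lambda>s. C0 s $ i $ j)" "continuous_on {0..1} (\<lambda>s. C1 s $ i $ j)" for i j
      unfolding C0_def C1_def using exhaust_3[of i] exhaust_3[of j]
      by (elim disjE; simp add: pot_nth; intro continuous_intros c)+
    then show "continuous_on {0..1} C0" "continuous_on {0..1} C1" by (intro continuous_on_entries; blast)+
  qed
  have X_eq: "X l s = C0 s + cscale l (C1 s) + cscale 0 0" for l s
    by (simp add: X_def C0_def C1_def mat_eq3_iff forall_3 pot_nth cscale_nth)
  have Xc: "continuous_on {0..1} (X l)" for l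
    unfolding X_eq by (intro continuous_intros C)
  have "\<forall>l. \<exists>U. U 0 = mat 1 \<and> (\<forall>s\<in>{0..1}. (U has_vector_derivative X l s ** U s + 0) (at s within {0..1}))"
    using linear_ode_01[OF Xc continuous_on_const[of _ 0]] by blast
  then obtain U where U0: "\<And>l. U l 0 = mat 1"
    and U: "\<And>l s. s \<in> {0..1} \<Longrightarrow> (U l has_vector_derivative X l s ** U l s) (at s within {0..1})"
    unfolding add_0_right by metis
  define V where "V l = U l 1" for l
  have hol: "(\<lambda>l. V l $ i $ j) holomorphic_on UNIV" for i j
    unfolding V_def
  proof (rule linear_ode_holomorphic[where V = "\<lambda>s l. U l s" and \<phi> = "\<lambda>l. l" and \<kappa> = "\<lambda>_. 0"
        and ?C0.0 = C0 and ?C1.0 = C1 and ?C2.0 = "\<lambda>_. 0"])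
    show "((\<lambda>s. U l s) has_vector_derivative (C0 s + cscale l (C1 s) + cscale 0 0) ** U l s) (at s within {0..1})"
      if "s \<in> {0..1}" for l s using U[OF that] by (simp only: X_eq)
  qed (use C U0 in \<open>auto intro: holomorphic_intros\<close>)
  have det: "V l \<in> SL3" for l
  proof -
    have "det (U l 1) = det (U l 0)" by (rule det_ode[OF U]) (auto simp: X_def trace_pot)
    then show ?thesis by (simp add: SL3_def V_def U0)
  qed
  have twist: "V (eps * l) = sigma_group (V l)" if "l \<noteq> 0" for l
    unfolding V_def
  proof (rule sigma_group_ode[OF U])
    show "(U (eps * l) has_vector_derivative sigma_algebra (X l s) ** U (eps * l) s) (at s within {0..1})"
      if "s \<in> {0..1}" for s
      using U[OF that, of "eps * l"] by (simp add: X_def sigma_algebra_pot[OF \<open>l \<noteq> 0\<close>])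
  qed (simp_all add: U0)
  have smooth: "smooth_loop V" by (rule smooth_loop_holomorphic[OF open_UNIV _ hol]) simp
  have contV: "continuous_on (cball 0 1) V"
    by (rule continuous_on_entries) (use holomorphic_on_imp_continuous_on[OF hol] continuous_on_subset in blast)
  have "V \<in> loop_SL3"
    unfolding loop_SL3_def using smooth det by (auto intro!: twist)
  then have plus: "V \<in> loop_plus_SL3"
    unfolding loop_plus_SL3_def using contV holomorphic_on_subset[OF hol] by blast
  show thesis
  proof (rule that[OF plus det hol])
    fix l
    show "\<exists>U. U 0 = mat 1 \<and> U 1 = V l \<and> (\<forall>s\<in>{0..1}.
       (U has_vector_derivative pot (s2 s) 0 0 (p2 s) (q2 s) l ** U s) (at s within {0..1}))"
      by (rule exI[of _ "U l"]) (use U U0 in \<open>auto simp: V_def X_def\<close>)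
  qed
qed

text \<open>
  The exponential is the value at time 1 of a linear system with constant coefficients, so that its
  dependence on the spectral parameter and its twisting follow from the results on linear systems.
\<close>

lemma mat_exp_pot_loop:
  "(\<lambda>l. mat_exp (cscale z (pot s a b p q l)) $ i $ j) holomorphic_on - {0}"
proof -
  have eq: "cscale z (pot s a b p q l) = cscale z (pot s 0 0 0 0 1) + cscale l (cscale z (pot 0 0 0 p q 1))
      + cscale (inverse l) (cscale z (pot 0 a b 0 0 1))" for l
    by (simp add: mat_eq3_iff forall_3 pot_nth cscale_nth)
  have "(\<lambda>l. mat_exp (cscale (of_real 1 * z) (pot s a b p q l)) $ i $ j) holomorphic_on - {0}"
  proof (rule linear_ode_holomorphic[where V = "\<lambda>t l. mat_exp (cscale (of_real t * z) (pot s a b p q l))"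
        and \<phi> = "\<lambda>l. l" and \<kappa> = "\<lambda>l. inverse l" and ?C0.0 = "\<lambda>_. cscale z (pot s 0 0 0 0 1)"
        and ?C1.0 = "\<lambda>_. cscale z (pot 0 0 0 p q 1)" and ?C2.0 = "\<lambda>_. cscale z (pot 0 a b 0 0 1)"])
    fix l :: complex and t :: real
    show "((\<lambda>t. mat_exp (cscale (of_real t * z) (pot s a b p q l))) has_vector_derivative
       (cscale z (pot s 0 0 0 0 1) + cscale l (cscale z (pot 0 0 0 p q 1))
      + cscale (inverse l) (cscale z (pot 0 a b 0 0 1))) ** mat_exp (cscale (of_real t * z) (pot s a b p q l)))
       (at t within {0..1})"
      using mat_exp_derivative[of z "pot s a b p q l" t "{0..1}"] unfolding eq .
  qed (auto intro!: holomorphic_intros)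
  then show ?thesis by simp
qed

lemma mat_exp_pot_twist:
  assumes "l \<noteq> 0"
  shows "mat_exp (cscale z (pot s a b p q (eps * l))) = sigma_group (mat_exp (cscale z (pot s a b p q l)))"
proof -
  have "mat_exp (cscale (of_real 1 * z) (pot s a b p q (eps * l)))
      = sigma_group (mat_exp (cscale (of_real 1 * z) (pot s a b p q l)))"
  proof (rule sigma_group_ode[where Z = "\<lambda>t. mat_exp (cscale (of_real t * z) (pot s a b p q l))"
        and Y = "\<lambda>t. mat_exp (cscale (of_real t * z) (pot s a b p q (eps * l)))" and X = "\<lambda>_. cscale z (pot s a b p q l)"])
    show "((\<lambda>t. mat_exp (cscale (of_real t * z) (pot s a b p q (eps * l)))) has_vector_derivative
        sigma_algebra (cscale z (pot s a b p q l)) ** mat_exp (cscale (of_real t * z) (pot s a b p q (eps * l))))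
        (at t within {0..1})" for t
      unfolding sigma_algebra_cscale sigma_algebra_pot[OF assms] by (rule mat_exp_derivative)
  qed (auto intro: mat_exp_derivative)
  then show ?thesis by simp
qed

lemma sphere_nonzero: "l \<in> sphere (0::complex) 1 \<Longrightarrow> l \<noteq> 0"
  by auto

text \<open>
  The group law integrates to \<open>\<rho>(t) = exp (t D)\<close>, which settles the splitting on the real axis with
  trivial second factor. Along the imaginary axis the second factor solves the pole-free system given
  by \<open>F\<^bsup>-1\<^esup> F\<^bsub>zbar\<^esub>\<close>, and translation carries the splitting to every point.
\<close>

theorem equivariant_frame_potential:
  assumes S: "strip S" and u: "smooth_on S u" and eq: "equivariant_frame S u f F \<rho>"
  defines "D \<equiv> (\<lambda>l. matrix_inv (F 0 l) ** dx (\<lambda>z. F z l) 0)"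
  shows "degree_one_constant_potential D \<and> generated_by S u f D"
proof -
  note oc = strip_open_convex[OF S]
  have ef: "extended_frame S u f F" using eq by (simp add: equivariant_frame_def)
  obtain s1 a1 b1 p1 q1 s2 p2 q2 where
    FU: "\<And>z l. z \<in> S \<Longrightarrow> l \<in> sphere 0 1 \<Longrightarrow> F z l \<in> SU3"
    and Fs: "\<And>l. l \<in> sphere 0 1 \<Longrightarrow> smooth_on S (\<lambda>z. F z l)"
    and Fx: "\<And>z l. z \<in> S \<Longrightarrow> l \<in> sphere 0 1 \<Longrightarrow> dx (\<lambda>z. F z l) z = F z l ** pot (s1 z) (a1 z) (b1 z) (p1 z) (q1 z) l"
    and Fzb: "\<And>z l. z \<in> S \<Longrightarrow> l \<in> sphere 0 1 \<Longrightarrow> mat_d_zbar (\<lambda>z. F z l) z = F z l ** pot (s2 z) 0 0 (p2 z) (q2 z) l"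
    and c2: "continuous_on S s2" "continuous_on S p2" "continuous_on S q2"
    using extended_frame_structure[OF oc(1) u ef] by blast
  have F0: "F 0 l = mat 1" and \<rho>1: "one_param_subgroup (\<lambda>t. \<rho> t l)" if "l \<in> sphere 0 1" for l
    using eq that by (simp_all add: equivariant_frame_def)
  have F\<rho>: "F (of_real t + z) l = \<rho> t l ** F z l" if "z \<in> S" "l \<in> sphere 0 1" for t z l
    using eq that by (simp add: equivariant_frame_def)
  have Fd: "(\<lambda>z. F z l) differentiable (at z)" if "z \<in> S" "l \<in> sphere 0 1" for z l
    by (rule smooth_on_differentiable[OF Fs[OF that(2)] that(1)])
  define P where "P l = pot (s1 0) (a1 0) (b1 0) (p1 0) (q1 0) l" for l
  have DP: "D l = P l" if "l \<in> sphere 0 1" for l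
    unfolding D_def P_def using F0[OF that] Fx[OF oc(3) that] matrix_inv_unique[of "mat 1" "mat 1"] by simp
  have \<rho>F: "\<rho> t l = F (of_real t) l" if "l \<in> sphere 0 1" for t l
    using F\<rho>[OF oc(3) that, of t] F0[OF that] by simp
  have hline: "((\<lambda>t. F (of_real t + z) l) has_vector_derivative dx (\<lambda>z. F z l) z) (at 0)"
    if "z \<in> S" "l \<in> sphere 0 1" for z l
    using line_derivative[of "\<lambda>z. F z l" z 0 1 UNIV] Fd[OF that] by (simp add: add.commute)
  have \<rho>': "((\<lambda>t. \<rho> t l) has_vector_derivative P l) (at 0)" if "l \<in> sphere 0 1" for l
    using hline[OF oc(3) that] Fx[OF oc(3) that] F0[OF that] by (simp add: \<rho>F[OF that] P_def)
  have \<rho>exp: "\<rho> t l = mat_exp (cscale (of_real t) (P l))" if "l \<in> sphere 0 1" for t l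
    using \<rho>1[OF that] by (intro one_param_subgroup_generator[OF _ _ \<rho>'[OF that]]) (auto simp: one_param_subgroup_def)
  have FxP: "dx (\<lambda>z. F z l) z = P l ** F z l" if "z \<in> S" "l \<in> sphere 0 1" for z l
  proof -
    have "((\<lambda>t. \<rho> t l ** F z l) has_vector_derivative P l ** F z l) (at 0)"
      using mult3_has_vector_derivative[OF \<rho>'[OF that(2)] has_vector_derivative_const[of "F z l"]] by simp
    then show ?thesis using hline[OF that] vector_derivative_unique_at by (simp add: F\<rho>[OF that]) blast
  qed
  have Psu: "P l \<in> su3" if l: "l \<in> sphere 0 1" for l
  proof -
    have "((\<lambda>t. adjoint_mat (\<rho> t l) ** \<rho> t l) has_vector_derivative adjoint_mat (\<rho> 0 l) ** P l + adjoint_mat (P l) ** \<rho> 0 l) (at 0)"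
      by (intro mult3_has_vector_derivative adjoint_has_vector_derivative \<rho>' l)
    moreover have "adjoint_mat (\<rho> t l) ** \<rho> t l = mat 1" for t
      using \<rho>1[OF l] SU3_adj(1) by (auto simp: one_param_subgroup_def)
    moreover have "\<rho> 0 l = mat 1" using \<rho>1[OF l] by (simp add: one_param_subgroup_def)
    ultimately have "((\<lambda>t::real. mat 1 :: complex^3^3) has_vector_derivative P l + adjoint_mat (P l)) (at 0)" by simp
    then have "P l + adjoint_mat (P l) = 0"
      using has_vector_derivative_const vector_derivative_unique_at by blast
    then have "adjoint_mat (P l) = - P l" by (simp add: eq_neg_iff_add_eq_0 add.commute)
    then show ?thesis by (simp add: su3_def P_def trace_pot)
  qed
  have cis: "cis \<theta> \<in> sphere 0 1" for \<theta> by simp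
  have deg: "degree_one_constant_potential D"
  proof -
    have "smooth_loop P"
      by (rule smooth_loop_holomorphic[where \<Omega> = "- {0}"]) (auto simp: P_def intro!: pot_holomorphic)
    then have "smooth_loop D" unfolding smooth_loop_def using DP[OF cis] by simp
    moreover have "D (eps * l) = sigma_algebra (D l)" if "l \<in> sphere 0 1" for l
      using that by (simp add: DP[OF that] DP[OF eps_sphere[OF that]] P_def sigma_algebra_pot[OF sphere_nonzero[OF that]])
    ultimately have "D \<in> loop_su3" using Psu DP by (auto simp: loop_su3_def)
    moreover have "\<forall>l\<in>sphere 0 1. D l = cscale (inverse l) (pot_minus (a1 0) (b1 0)) + diag3 (s1 0) (- s1 0) 0
        + cscale l (pot_plus (p1 0) (q1 0))"
      using DP by (simp add: P_def pot_def)
    ultimately show ?thesis unfolding degree_one_constant_potential_def by blast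
  qed
  have split: "\<exists>V. V \<in> loop_plus_SL3 \<and> F z \<in> loop_SU3 \<and> (\<forall>l\<in>sphere 0 1. mat_exp (cscale z (D l)) = F z l ** V l)"
    if z: "z \<in> S" for z
  proof -
    define y where "y = Im z"
    define \<gamma> where "\<gamma> s = of_real s * (\<i> * of_real y)" for s :: real
    have \<gamma>S: "\<gamma> s \<in> S" if "s \<in> {0..1}" for s using strip_vertical[OF S z that] by (simp add: \<gamma>_def y_def)
    have \<gamma>c: "continuous_on {0..1} \<gamma>" unfolding \<gamma>_def by (intro continuous_intros)
    \<comment> \<open>F(\<gamma> s)^(-1) exp(i y s P) has logarithmic derivative
      i y F^(-1) F_x - y F^(-1) F_y = 2 i y F^(-1) F_zbar\<close>
    define m where "m = 2 * \<i> * of_real y"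
    have cs: "continuous_on {0..1} (\<lambda>s. m * s2 (\<gamma> s))" "continuous_on {0..1} (\<lambda>s. m * p2 (\<gamma> s))"
        "continuous_on {0..1} (\<lambda>s. m * q2 (\<gamma> s))"
      using \<gamma>S by (auto intro!: continuous_intros continuous_on_compose2[OF c2(1) \<gamma>c]
          continuous_on_compose2[OF c2(2) \<gamma>c] continuous_on_compose2[OF c2(3) \<gamma>c])
    obtain V where V: "V \<in> loop_plus_SL3" "\<And>l. V l \<in> SL3" "\<And>i j. (\<lambda>l. V l $ i $ j) holomorphic_on UNIV"
      and VU: "\<And>l. \<exists>U. U 0 = mat 1 \<and> U 1 = V l \<and> (\<forall>s\<in>{0..1}. (U has_vector_derivative
         pot (m * s2 (\<gamma> s)) 0 0 (m * p2 (\<gamma> s)) (m * q2 (\<gamma> s)) l ** U s) (at s within {0..1}))"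
      using holomorphic_factor[OF cs] by blast
    have vert: "mat_exp (cscale (\<i> * of_real y) (P l)) = F (\<i> * of_real y) l ** V l" if l: "l \<in> sphere 0 1" for l
    proof -
      obtain U where U: "U 0 = mat 1" "U 1 = V l" and U': "\<And>s. s \<in> {0..1} \<Longrightarrow> (U has_vector_derivative
         pot (m * s2 (\<gamma> s)) 0 0 (m * p2 (\<gamma> s)) (m * q2 (\<gamma> s)) l ** U s) (at s within {0..1})"
        using VU[of l] by blast
      have "mat_exp (cscale (of_real 1 * (\<i> * of_real y)) (P l)) = F (\<gamma> 1) l ** U 1"
      proof (rule linear_ode_unique[where X = "\<lambda>_. cscale (\<i> * of_real y) (P l)"
            and Z = "\<lambda>s. mat_exp (cscale (of_real s * (\<i> * of_real y)) (P l))" and W = "\<lambda>s. F (\<gamma> s) l ** U s"])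
        fix s :: real assume s: "s \<in> {0..1}"
        note \<gamma>s = \<gamma>S[OF s]
        have dF: "((\<lambda>s. F (\<gamma> s) l) has_vector_derivative y *\<^sub>R dy (\<lambda>z. F z l) (\<gamma> s)) (at s within {0..1})"
          using line_derivative[of "\<lambda>z. F z l" 0 s "\<i> * of_real y" "{0..1}"] Fd[OF \<gamma>s l] by (simp add: \<gamma>_def)
        have zb: "F (\<gamma> s) l ** pot (m * s2 (\<gamma> s)) 0 0 (m * p2 (\<gamma> s)) (m * q2 (\<gamma> s)) l
            = cscale (\<i> * of_real y) (P l ** F (\<gamma> s) l) - y *\<^sub>R dy (\<lambda>z. F z l) (\<gamma> s)"
        proof -
          have "pot (m * s2 (\<gamma> s)) 0 0 (m * p2 (\<gamma> s)) (m * q2 (\<gamma> s)) l = cscale m (pot (s2 (\<gamma> s)) 0 0 (p2 (\<gamma> s)) (q2 (\<gamma> s)) l)"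
            by (simp add: cscale_pot)
          then have "F (\<gamma> s) l ** pot (m * s2 (\<gamma> s)) 0 0 (m * p2 (\<gamma> s)) (m * q2 (\<gamma> s)) l
              = cscale m (mat_d_zbar (\<lambda>z. F z l) (\<gamma> s))"
            by (simp add: mult_cscale_right Fzb[OF \<gamma>s l])
          also have "\<dots> = cscale (\<i> * of_real y) (dx (\<lambda>z. F z l) (\<gamma> s)) - y *\<^sub>R dy (\<lambda>z. F z l) (\<gamma> s)"
            unfolding mat_d_z_eq[OF Fd[OF \<gamma>s l]]
            by (simp add: m_def mat_eq3_iff cscale_nth scaleR_conv_of_real[where 'a=complex] algebra_simps)
          finally show ?thesis by (simp add: FxP[OF \<gamma>s l])
        qed
        have "F (\<gamma> s) l ** (pot (m * s2 (\<gamma> s)) 0 0 (m * p2 (\<gamma> s)) (m * q2 (\<gamma> s)) l ** U s)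
              + (y *\<^sub>R dy (\<lambda>z. F z l) (\<gamma> s)) ** U s
            = (F (\<gamma> s) l ** pot (m * s2 (\<gamma> s)) 0 0 (m * p2 (\<gamma> s)) (m * q2 (\<gamma> s)) l + y *\<^sub>R dy (\<lambda>z. F z l) (\<gamma> s)) ** U s"
          by (simp only: mult_add_left mult_assoc3)
        also have "\<dots> = cscale (\<i> * of_real y) (P l) ** (F (\<gamma> s) l ** U s)"
          unfolding zb by (simp add: mult_cscale_left mult_assoc3)
        finally show "((\<lambda>s. F (\<gamma> s) l ** U s) has_vector_derivative
            cscale (\<i> * of_real y) (P l) ** (F (\<gamma> s) l ** U s)) (at s within {0..1})"
          using mult3_has_vector_derivative[OF dF U'[OF s]] by simp
      qed (auto intro: mat_exp_derivative simp: \<gamma>_def F0[OF l] U(1))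
      then show ?thesis by (simp add: \<gamma>_def U(2))
    qed
    have zxy: "z = of_real (Re z) + \<i> * of_real y" by (simp add: complex_eq_iff y_def)
    have iy: "\<i> * of_real y \<in> S" using \<gamma>S[of 1] by (simp add: \<gamma>_def)
    have FV: "mat_exp (cscale z (P l)) = F z l ** V l" if l: "l \<in> sphere 0 1" for l
    proof -
      have "mat_exp (cscale z (P l)) = mat_exp (cscale (of_real (Re z)) (P l)) ** mat_exp (cscale (\<i> * of_real y) (P l))"
        unfolding mat_exp_add[symmetric] using zxy by simp
      also have "\<dots> = \<rho> (Re z) l ** F (\<i> * of_real y) l ** V l"
        by (simp add: vert[OF l] \<rho>exp[OF l] matrix_mul_assoc)
      also have "\<dots> = F z l ** V l" using F\<rho>[OF iy l, of "Re z"] zxy by simp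
      finally show ?thesis .
    qed
    \<comment> \<open>smoothness and twisting of F in the spectral parameter are inherited from the other two factors\<close>
    have FVadj: "F z l = mat_exp (cscale z (P l)) ** adj3 (V l)" if l: "l \<in> sphere 0 1" for l
      unfolding FV[OF l] using SL3_inv(1)[OF V(2)] by (simp add: matrix_inv_SL3[OF V(2)] mult_assoc3)
    have "smooth_loop (\<lambda>l. mat_exp (cscale z (P l)) ** adj3 (V l))"
      by (rule smooth_loop_holomorphic[where \<Omega> = "- {0}"])
         (auto simp: P_def mult_nth3 adj3_nth intro!: holomorphic_intros mat_exp_pot_loop holomorphic_on_subset[OF V(3)])
    then have smooth: "smooth_loop (F z)" unfolding smooth_loop_def using FVadj[OF cis] by simp
    have "F z (eps * l) = sigma_group (F z l)" if l: "l \<in> sphere 0 1" for l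
    proof (rule matrix_cancel_right[OF _ V(2)[of "eps * l"]])
      have "F z (eps * l) ** V (eps * l) = mat_exp (cscale z (P (eps * l)))" by (simp add: FV[OF eps_sphere[OF l]])
      also have "\<dots> = sigma_group (F z l ** V l)"
        unfolding FV[OF l, symmetric] P_def by (rule mat_exp_pot_twist[OF sphere_nonzero[OF l]])
      also have "\<dots> = sigma_group (F z l) ** V (eps * l)"
        using V(1) l by (simp add: sigma_group_mult[OF SU3_SL3[OF FU[OF z l]] V(2)] loop_plus_SL3_def loop_SL3_def)
      finally show "F z (eps * l) ** V (eps * l) = sigma_group (F z l) ** V (eps * l)" .
    qed
    then have "F z \<in> loop_SU3"
      using smooth FU[OF z] SU3_SL3 by (auto simp: loop_SU3_def loop_SL3_def)
    then show ?thesis using V(1) FV DP by auto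
  qed
  have "generated_by S u f D"
  proof -
    obtain V where "\<And>z. z \<in> S \<Longrightarrow> V z \<in> loop_plus_SL3 \<and> F z \<in> loop_SU3 \<and>
        (\<forall>l\<in>sphere 0 1. mat_exp (cscale z (D l)) = F z l ** V z l)"
      using split by metis
    then show ?thesis unfolding generated_by_def using ef by (intro exI[of _ F] exI[of _ V]) simp
  qed
  then show ?thesis using deg by simp
qed

section \<open>Structure equations of minimal Lagrangian surfaces\<close>

lemma trace_zero3 [simp]: "trace (0 :: complex^3^3) = 0"
  by (simp add: trace3)

text \<open>
  \<open>P\<close> is the projection onto a line, \<open>A\<close> and \<open>B\<close> stand for the two Wirtinger derivatives of the surface
  and \<open>E\<close> for \<open>exp u\<close>. The tangent matrices \<open>A\<close>, \<open>B\<close> exchange the line and its orthogonal complement.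
  The traces encode the metric, conformality and the Lagrangian condition; they say that \<open>A\<close> and \<open>B\<close>
  map the line to two orthogonal directions, which span the complement and so yield the resolution of
  the identity \<open>complete\<close>. Stated without adjoints, the assumptions are symmetric in \<open>A\<close> and \<open>B\<close>.
\<close>

locale lagrangian_point =
  fixes P A B :: "complex^3^3" and E :: complex
  assumes E: "E \<noteq> 0"
    and PP: "P ** P = P"
    and rank_one: "\<And>X. P ** (X ** P) = cscale (trace (P ** X)) P"
    and A: "A = A ** P + P ** A"
    and B: "B = B ** P + P ** B"
    and trAB: "trace (P ** (A ** B)) = E" and trBA: "trace (P ** (B ** A)) = E"
    and trAA: "trace (P ** (A ** A)) = 0" and trBB: "trace (P ** (B ** B)) = 0"
    and complete: "A ** (P ** B) + B ** (P ** A) = cscale E (mat 1 - P)"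
begin

lemma PP': "P ** (P ** X) = P ** X"
  using PP by (metis matrix_mul_assoc)

lemma off_diagonal: "X = X ** P + P ** X \<Longrightarrow> P ** (X ** P) = 0"
proof -
  assume X: "X = X ** P + P ** X"
  have "P ** (X ** P) = P ** ((X ** P + P ** X) ** P)" using X by simp
  also have "\<dots> = P ** (X ** P) + P ** (X ** P)" by (simp add: mat_distrib PP PP')
  finally show ?thesis by simp
qed

lemma PAP: "P ** (A ** P) = 0" and PBP: "P ** (B ** P) = 0"
  using off_diagonal A B by blast+

lemma PAP': "P ** (A ** (P ** X)) = 0" and PBP': "P ** (B ** (P ** X)) = 0"
  using PAP PBP by (metis matrix_mul_assoc times0_left)+

lemma PXYP:
  fixes X Y :: "complex^3^3"
  shows "P ** (X ** (Y ** P)) = cscale (trace (P ** (X ** Y))) P"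
  using rank_one[of "X ** Y"] by (simp only: mult_assoc3)

lemmas trs = trAB trBA trAA trBB

lemma AA: "A ** A = A ** (P ** A)"
proof -
  have "A ** A = (A ** P + P ** A) ** (A ** P + P ** A)" using A by simp
  also have "\<dots> = A ** (P ** A)" by (simp add: mat_distrib PP PP' PAP PAP' PXYP trs)
  finally show ?thesis .
qed

lemma BB: "B ** B = B ** (P ** B)"
proof -
  have "B ** B = (B ** P + P ** B) ** (B ** P + P ** B)" using B by simp
  also have "\<dots> = B ** (P ** B)" by (simp add: mat_distrib PP PP' PBP PBP' PXYP trs)
  finally show ?thesis .
qed

lemma AB: "A ** B = A ** (P ** B) + cscale E P"
proof -
  have "A ** B = (A ** P + P ** A) ** (B ** P + P ** B)" using A B by simp
  also have "\<dots> = A ** (P ** B) + cscale E P" by (simp add: mat_distrib PP PP' PAP PBP PAP' PBP' PXYP trs)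
  finally show ?thesis .
qed

lemma BA: "B ** A = B ** (P ** A) + cscale E P"
proof -
  have "B ** A = (B ** P + P ** B) ** (A ** P + P ** A)" using A B by simp
  also have "\<dots> = B ** (P ** A) + cscale E P" by (simp add: mat_distrib PP PP' PAP PBP PAP' PBP' PXYP trs)
  finally show ?thesis .
qed

lemma ABBA: "A ** B + B ** A = cscale E (mat 1 + P)"
proof -
  have "A ** B + B ** A = (A ** (P ** B) + B ** (P ** A)) + cscale (2 * E) P"
    by (simp add: AB BA mat_eq3_iff cscale_nth algebra_simps)
  then show ?thesis unfolding complete by (simp add: mat_eq3_iff cscale_nth algebra_simps)
qed

lemma trace_PA: "trace (P ** A) = 0"
proof -
  have "trace (P ** X) = 0" if "X = X ** P + P ** X" for X :: "complex^3^3"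
  proof -
    have "trace (P ** X) = trace ((P ** X) ** P)"
      using trace_mul_sym[of "P ** X" P] by (simp add: PP' mult_assoc3)
    then show ?thesis using off_diagonal[OF that] trace_zero3 by (simp add: mult_assoc3)
  qed
  then show ?thesis using A by blast
qed

lemma trace_AAA: "trace (A ** (A ** A)) = 0"
proof -
  have "A ** (A ** A) = (A ** A) ** A" by (simp only: mult_assoc3)
  also have "\<dots> = A ** (P ** (A ** A))" by (subst AA) (simp only: mult_assoc3)
  also have "\<dots> = 0" by (subst AA) (simp add: PAP')
  finally show ?thesis using trace_zero3 by simp
qed

lemma trace_AAB: "trace (A ** (A ** B)) = 0"
proof -
  have "A ** (A ** B) = (A ** A) ** B" by (simp only: mult_assoc3)
  also have "\<dots> = A ** (P ** (A ** B))" unfolding AA by (simp only: mult_assoc3)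
  also have "\<dots> = cscale E (A ** P)" unfolding AB by (simp add: mat_distrib PAP' PP)
  finally show ?thesis using trace_PA trace_mul_sym[of A P] by (simp add: trace_cscale)
qed

lemma trace_ABA: "trace (A ** (B ** A)) = 0"
  using trace_AAB trace_mul_sym[of A "A ** B"] by (simp add: mult_assoc3)

text \<open>
  The assumption on \<open>Q\<close> is the derivative of \<open>A = A P + P A\<close>. It fixes the two blocks of \<open>Q\<close> on the line
  and on its complement; the off-diagonal blocks are the tangential part, which vanishes by minimality.
\<close>

lemma mixed_second_derivative:
  assumes Q: "Q = Q ** P + A ** B + B ** A + P ** Q"
    and tangential: "P ** Q ** (mat 1 - P) + (mat 1 - P) ** Q ** P = 0"
  shows "Q = cscale E (mat 1 - cscale 3 P)"
proof -
  have Q': "Q = Q ** P + cscale E (mat 1 + P) + P ** Q" using Q ABBA by (simp add: add.assoc)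
  have "P ** (Q ** P) = P ** ((Q ** P + cscale E (mat 1 + P) + P ** Q) ** P)" using Q' by simp
  also have "\<dots> = P ** (Q ** P) + cscale (2 * E) P + P ** (Q ** P)"
  proof -
    have "P ** (cscale E (mat 1 + P) ** P) = cscale (2 * E) P"
      by (simp only: mat_distrib PP matrix_mul_lid) (simp add: mat_eq3_iff cscale_nth)
    then show ?thesis by (simp only: mult_add_left mult_add_right mult_assoc3 PP PP')
  qed
  finally have "cscale (2 * E) P + P ** (Q ** P) = 0" by (simp add: add.commute)
  then have PQP: "P ** (Q ** P) = - cscale (2 * E) P" by (simp add: eq_neg_iff_add_eq_0 add.commute)
  have "P ** Q + Q ** P = P ** (Q ** P) + P ** (Q ** P)"
    using tangential by (simp add: mat_distrib algebra_simps)
  then have s: "P ** Q + Q ** P = cscale (- 4 * E) P"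
    unfolding PQP by (simp add: mat_eq3_iff cscale_nth algebra_simps)
  have "Q = (P ** Q + Q ** P) + cscale E (mat 1 + P)"
    using Q' by (simp add: algebra_simps)
  then show ?thesis unfolding s by (simp add: mat_eq3_iff cscale_nth algebra_simps)
qed

lemma complement_resolution: "cscale E (X - P ** X) = A ** (P ** (B ** X)) + B ** (P ** (A ** X))"
  "cscale E (X - X ** P) = X ** (A ** (P ** B)) + X ** (B ** (P ** A))"
proof -
  have "(A ** (P ** B) + B ** (P ** A)) ** X = cscale E (X - P ** X)"
    unfolding complete by (simp add: mat_distrib)
  then show "cscale E (X - P ** X) = A ** (P ** (B ** X)) + B ** (P ** (A ** X))" by (simp add: mat_distrib)
  have "X ** (A ** (P ** B) + B ** (P ** A)) = cscale E (X - X ** P)"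
    unfolding complete by (simp add: mat_distrib)
  then show "cscale E (X - X ** P) = X ** (A ** (P ** B)) + X ** (B ** (P ** A))" by (simp add: mat_distrib)
qed

text \<open>
  The derivative of \<open>A = A P + P A\<close> fixes the diagonal blocks of \<open>W\<close>. The resolution of the identity
  expands the off-diagonal blocks in the directions of \<open>A\<close> and \<open>B\<close>, with the given traces as
  coefficients.
\<close>

lemma pure_second_derivative:
  assumes W: "W = W ** P + A ** A + A ** A + P ** W"
    and t: "trace (P ** (B ** W)) = c * E" "trace (P ** (W ** B)) = c * E"
      "trace (P ** (W ** A)) = - q" "trace (P ** (A ** W)) = q"
  shows "W = cscale 2 (A ** A) + cscale c A + cscale (q / E) (B ** P - P ** B)"
proof -
  have "P ** (W ** P) = P ** ((W ** P + A ** A + A ** A + P ** W) ** P)" using W by simp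
  also have "\<dots> = P ** (W ** P) + P ** (W ** P)"
    by (simp only: mat_distrib PP PP', simp only: PXYP trAA cscale_zero add_0_right)
  finally have PWP: "P ** (W ** P) = 0" by simp
  have "cscale E (W ** P) = A ** (P ** (B ** (W ** P))) + B ** (P ** (A ** (W ** P)))"
    using complement_resolution(1)[of "W ** P"] PWP by simp
  also have "\<dots> = cscale (c * E) (A ** P) + cscale q (B ** P)"
    by (simp add: PXYP t mat_distrib)
  finally have "cscale (inverse E) (cscale E (W ** P)) = cscale (inverse E) (cscale (c * E) (A ** P) + cscale q (B ** P))"
    by simp
  then have WP: "W ** P = cscale c (A ** P) + cscale (q / E) (B ** P)"
    using E by (simp add: cscale_add field_simps)
  have PWAP: "P ** (W ** (A ** (P ** X))) = cscale (- q) (P ** X)"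
    and PWBP: "P ** (W ** (B ** (P ** X))) = cscale (c * E) (P ** X)" for X
    using PXYP[of W A] PXYP[of W B] t by (metis matrix_mul_assoc mult_cscale_left)+
  have "cscale E (P ** W) = P ** (W ** (A ** (P ** B))) + P ** (W ** (B ** (P ** A)))"
    using complement_resolution(2)[of "P ** W"] PWP by (simp add: mult_assoc3)
  also have "\<dots> = cscale (- q) (P ** B) + cscale (c * E) (P ** A)" by (simp only: PWAP PWBP)
  finally have "cscale (inverse E) (cscale E (P ** W)) = cscale (inverse E) (cscale (- q) (P ** B) + cscale (c * E) (P ** A))"
    by simp
  then have PW: "P ** W = cscale (- (q / E)) (P ** B) + cscale c (P ** A)"
    using E by (simp add: cscale_add field_simps)
  have "W = cscale 2 (A ** A) + (W ** P + P ** W)"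
    by (subst W) (simp add: mat_eq3_iff cscale_nth algebra_simps)
  also have "\<dots> = cscale 2 (A ** A) + cscale c (A ** P + P ** A) + cscale (q / E) (B ** P - P ** B)"
    unfolding WP PW by (simp add: mat_eq3_iff cscale_nth algebra_simps)
  finally show ?thesis using A by simp
qed

text \<open>
  The matrix \<open>B P - P B\<close> is normal to the surface in the projective plane, up to a factor it is the
  complex structure applied to \<open>B\<close>. Traces against \<open>P B\<close> and \<open>P A\<close> read off the two coefficients.
\<close>

lemma tangent_normal_independent:
  assumes "cscale g A + cscale h (B ** P - P ** B) = 0"
  shows "g = 0" "h = 0"
proof -
  have "trace (P ** (B ** (cscale g A + cscale h (B ** P - P ** B)))) = g * E"
    by (simp add: mat_distrib cscale_add cscale_diff trace_add trace_sub trace_cscale trBA PXYP trBB PBP')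
  then show "g = 0" using assms E trace_zero3 by simp
  have "trace (P ** (A ** (cscale g A + cscale h (B ** P - P ** B)))) = h * trace (cscale E P)"
    by (simp add: mat_distrib cscale_add cscale_diff trace_add trace_sub trace_cscale trAA PXYP trAB PAP')
  moreover have "trace P \<noteq> 0"
  proof
    assume "trace P = 0"
    have "trace (P ** (A ** (B ** P))) = E * trace P" by (simp add: PXYP trAB trace_cscale)
    moreover have "trace (P ** (A ** (B ** P))) = trace (P ** (A ** B))"
      using trace_mul_sym[of "P ** (A ** B)" P] by (simp add: mult_assoc3 PP')
    ultimately show False using \<open>trace P = 0\<close> trAB E by simp
  qed
  ultimately show "h = 0" using assms E trace_zero3 by (simp add: trace_cscale)
qed

end

subsection \<open>Calculus of matrix-valued maps\<close>

lemma mat_d_cong: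
  assumes "open S" "z \<in> S" "\<And>w. w \<in> S \<Longrightarrow> F w = G w" "F differentiable (at z)"
  shows "mat_d_z F z = mat_d_z G z" "mat_d_zbar F z = mat_d_zbar G z" "dx F z = dx G z" "dy F z = dy G z"
proof -
  have fr: "frechet_derivative F (at z) = frechet_derivative G (at z)"
    by (rule frechet_derivative_transform_within_open[OF assms(4,1,2)]) (rule assms(3))
  then show "dx F z = dx G z" "dy F z = dy G z" by (simp_all add: dx_def dy_def)
  have "G differentiable (at z)"
    using assms by (metis (no_types, lifting) differentiable_def has_derivative_transform_within_open)
  then show "mat_d_z F z = mat_d_z G z" "mat_d_zbar F z = mat_d_zbar G z"
    using fr by (simp_all add: mat_d_z_eq assms(4) dx_def dy_def)
qed

lemma smooth_on_add: "open S \<Longrightarrow> smooth_on S f \<Longrightarrow> smooth_on S g \<Longrightarrow> smooth_on S (\<lambda>x. f x + g x)"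
  unfolding smooth_on_def using Ck_on_add by blast

lemma smooth_on_diff:
  assumes "open S" "smooth_on S f" "smooth_on S g"
  shows "smooth_on S (\<lambda>x. f x - g x)"
  using smooth_on_add[OF assms(1,2) smooth_on_bounded_linear[OF assms(1) bounded_linear_minus[OF bounded_linear_ident] assms(3)]]
  by simp

lemma smooth_on_mat_d:
  assumes S: "open S" and F: "smooth_on S F"
  shows "smooth_on S (mat_d_z F)" "smooth_on S (mat_d_zbar F)"
proof -
  have "smooth_on S (\<lambda>z. cscale (1/2) (dx F z - cscale \<i> (dy F z)))" "smooth_on S (\<lambda>z. cscale (1/2) (dx F z + cscale \<i> (dy F z)))"
    by (intro smooth_on_bounded_linear[OF S bounded_linear_cscale] smooth_on_diff[OF S] smooth_on_add[OF S]
        smooth_on_dx smooth_on_dy F)+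
  then show "smooth_on S (mat_d_z F)" "smooth_on S (mat_d_zbar F)"
    using smooth_on_cong[OF S, of "mat_d_z F" "\<lambda>z. cscale (1/2) (dx F z - cscale \<i> (dy F z))"]
      smooth_on_cong[OF S, of "mat_d_zbar F" "\<lambda>z. cscale (1/2) (dx F z + cscale \<i> (dy F z))"]
      mat_d_z_eq[OF smooth_on_differentiable[OF F]] by blast+
qed

lemma dx_dy_bounded_linear:
  assumes "bounded_linear L" "f differentiable (at z)"
  shows "dx (\<lambda>w. L (f w)) z = L (dx f z)" "dy (\<lambda>w. L (f w)) z = L (dy f z)"
    "(\<lambda>w. L (f w)) differentiable (at z)"
proof -
  interpret L: bounded_linear L by fact
  have "((\<lambda>w. L (f w)) has_derivative (\<lambda>h. Re h *\<^sub>R L (dx f z) + Im h *\<^sub>R L (dy f z))) (at z)"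
    using L.has_derivative[OF has_derivative_dx_dy[OF assms(2)]] by (simp add: L.add L.scaleR)
  then show "dx (\<lambda>w. L (f w)) z = L (dx f z)" "dy (\<lambda>w. L (f w)) z = L (dy f z)"
    "(\<lambda>w. L (f w)) differentiable (at z)"
    by (auto intro: dx_dy_eqI simp: differentiable_def)
qed

lemma dx_dy_add:
  assumes "f differentiable (at z)" "g differentiable (at z)"
  shows "dx (\<lambda>w. f w + g w) z = dx f z + dx g z" "dy (\<lambda>w. f w + g w) z = dy f z + dy g z"
    "(\<lambda>w. f w + g w) differentiable (at z)"
proof -
  have "((\<lambda>w. f w + g w) has_derivative (\<lambda>h. Re h *\<^sub>R (dx f z + dx g z) + Im h *\<^sub>R (dy f z + dy g z))) (at z)"
    using has_derivative_add[OF has_derivative_dx_dy[OF assms(1)] has_derivative_dx_dy[OF assms(2)]]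
    by (simp add: algebra_simps)
  then show "dx (\<lambda>w. f w + g w) z = dx f z + dx g z" "dy (\<lambda>w. f w + g w) z = dy f z + dy g z"
    "(\<lambda>w. f w + g w) differentiable (at z)"
    by (auto intro: dx_dy_eqI simp: differentiable_def)
qed

lemma mat_d_add:
  assumes "F differentiable (at z)" "G differentiable (at z)"
  shows "mat_d_z (\<lambda>w. F w + G w) z = mat_d_z F z + mat_d_z G z"
    "mat_d_zbar (\<lambda>w. F w + G w) z = mat_d_zbar F z + mat_d_zbar G z"
  by (simp_all add: mat_d_z_eq assms dx_dy_add[OF assms] mat_eq3_iff cscale_nth algebra_simps)

lemma mat_d_cscale:
  assumes "F differentiable (at z)"
  shows "mat_d_z (\<lambda>w. cscale c (F w)) z = cscale c (mat_d_z F z)"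
    "mat_d_zbar (\<lambda>w. cscale c (F w)) z = cscale c (mat_d_zbar F z)"
  by (simp_all add: mat_d_z_eq assms dx_dy_bounded_linear[OF bounded_linear_cscale assms] mat_eq3_iff cscale_nth algebra_simps)

lemma mat_d_adjoint:
  assumes "F differentiable (at z)"
  shows "mat_d_z (\<lambda>w. adjoint_mat (F w)) z = adjoint_mat (mat_d_zbar F z)"
    "mat_d_zbar (\<lambda>w. adjoint_mat (F w)) z = adjoint_mat (mat_d_z F z)"
  by (simp_all add: mat_d_z_eq assms dx_dy_bounded_linear[OF bounded_linear_adjoint assms] mat_eq3_iff cscale_nth adjoint_nth)

lemma d_z_trace:
  assumes "F differentiable (at z)"
  shows "d_z (\<lambda>w. trace (F w)) z = trace (mat_d_z F z)" "d_zbar (\<lambda>w. trace (F w)) z = trace (mat_d_zbar F z)"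
  by (simp_all add: d_z_def d_zbar_def mat_d_z_eq assms dx_dy_bounded_linear[OF bounded_linear_trace assms]
      trace_cscale trace_add trace_sub)

lemma bounded_linear_scalar_mat: "bounded_linear (\<lambda>c. cscale c (mat 1))"
  by (rule bounded_bilinear.bounded_linear_left[OF bounded_bilinear_cscale])

text \<open>
  Multiplication by a scalar function is matrix multiplication by a scalar matrix, which reduces this
  to the product rule for matrices.
\<close>

lemma mat_d_scalar_mult:
  assumes "c differentiable (at z)" "F differentiable (at z)"
  shows "mat_d_z (\<lambda>w. cscale (c w) (F w)) z = cscale (d_z c z) (F z) + cscale (c z) (mat_d_z F z)"
    "mat_d_zbar (\<lambda>w. cscale (c w) (F w)) z = cscale (d_zbar c z) (F z) + cscale (c z) (mat_d_zbar F z)"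
    "(\<lambda>w. cscale (c w) (F w)) differentiable (at z)"
proof -
  define C where "C w = cscale (c w) (mat 1)" for w
  have C: "(\<lambda>w. cscale (c w) (F w)) = (\<lambda>w. C w ** F w)" by (simp add: C_def mult_cscale_left)
  note L = dx_dy_bounded_linear[OF bounded_linear_scalar_mat assms(1), folded C_def]
  have Cz: "mat_d_z C z = cscale (d_z c z) (mat 1)" "mat_d_zbar C z = cscale (d_zbar c z) (mat 1)"
    using L by (simp_all add: mat_d_z_eq d_z_def d_zbar_def mat_eq3_iff cscale_nth algebra_simps)
  have Cd: "C differentiable (at z)" using L(3) .
  show "mat_d_z (\<lambda>w. cscale (c w) (F w)) z = cscale (d_z c z) (F z) + cscale (c z) (mat_d_z F z)"
    "mat_d_zbar (\<lambda>w. cscale (c w) (F w)) z = cscale (d_zbar c z) (F z) + cscale (c z) (mat_d_zbar F z)"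
    "(\<lambda>w. cscale (c w) (F w)) differentiable (at z)"
    unfolding C mat_d_z_mult(1,2)[OF Cd assms(2)] Cz using mat_d_z_mult(5)[OF Cd assms(2)]
    by (simp_all add: C_def mult_cscale_left)
qed

lemma mat_d_mixed:
  assumes S: "open S" and F: "smooth_on S F" and z: "z \<in> S"
  shows "mat_d_zbar (mat_d_z F) z = mat_d_z (mat_d_zbar F) z"
    "cscale 4 (mat_d_zbar (mat_d_z F) z) = dx (dx F) z + dy (dy F) z"
proof -
  have Fz: "mat_d_z F w = cscale (1/2) (dx F w - cscale \<i> (dy F w))"
    "mat_d_zbar F w = cscale (1/2) (dx F w + cscale \<i> (dy F w))" if "w \<in> S" for w
    using mat_d_z_eq[OF smooth_on_differentiable[OF F that]] by blast+
  note D = smooth_on_differentiable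
  have dd: "(\<lambda>w. cscale (- \<i>) (dy F w)) differentiable (at z)" "(\<lambda>w. cscale \<i> (dy F w)) differentiable (at z)"
    using dx_dy_bounded_linear(3)[OF bounded_linear_cscale D[OF smooth_on_dy[OF F] z]] by blast+
  have dA: "dx F differentiable (at z)" "dy F differentiable (at z)"
    using D[OF smooth_on_dx[OF F] z] D[OF smooth_on_dy[OF F] z] by auto
  note sum1 = dx_dy_add[OF dA(1) dd(1)] and sum2 = dx_dy_add[OF dA(1) dd(2)]
  have e1: "mat_d_zbar (mat_d_z F) z = mat_d_zbar (\<lambda>w. cscale (1/2) (dx F w + cscale (- \<i>) (dy F w))) z"
    by (rule mat_d_cong(2)[OF S z _ D[OF smooth_on_mat_d(1)[OF S F] z]])
       (simp add: Fz mat_eq3_iff cscale_nth)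
  have e2: "mat_d_z (mat_d_zbar F) z = mat_d_z (\<lambda>w. cscale (1/2) (dx F w + cscale \<i> (dy F w))) z"
    by (rule mat_d_cong(1)[OF S z _ D[OF smooth_on_mat_d(2)[OF S F] z]]) (simp add: Fz)
  have mp: "dx (dy F) z = dy (dx F) z" by (rule mixed_partials_commute[OF S F z])
  have E1: "mat_d_zbar (mat_d_z F) z = cscale (1/4) (dx (dx F) z + dy (dy F) z)"
    unfolding e1 mat_d_cscale(2)[OF sum1(3)] mat_d_z_eq(2)[OF sum1(3)] sum1(1,2)
      dx_dy_bounded_linear(1,2)[OF bounded_linear_cscale dA(2)] mp
    by (simp add: mat_eq3_iff cscale_nth field_simps)
  have E2: "mat_d_z (mat_d_zbar F) z = cscale (1/4) (dx (dx F) z + dy (dy F) z)"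
    unfolding e2 mat_d_cscale(1)[OF sum2(3)] mat_d_z_eq(1)[OF sum2(3)] sum2(1,2)
      dx_dy_bounded_linear(1,2)[OF bounded_linear_cscale dA(2)] mp
    by (simp add: mat_eq3_iff cscale_nth field_simps)
  show "mat_d_zbar (mat_d_z F) z = mat_d_z (mat_d_zbar F) z" by (simp add: E1 E2)
  show "cscale 4 (mat_d_zbar (mat_d_z F) z) = dx (dx F) z + dy (dy F) z" by (simp add: E1)
qed

lemma d_z_cong:
  assumes "open S" "z \<in> S" "\<And>w. w \<in> S \<Longrightarrow> h w = g w" "h differentiable (at z)"
  shows "d_z h z = d_z g z" "d_zbar h z = d_zbar g z"
proof -
  have "frechet_derivative h (at z) = frechet_derivative g (at z)"
    by (rule frechet_derivative_transform_within_open[OF assms(4,1,2)]) (rule assms(3))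
  then show "d_z h z = d_z g z" "d_zbar h z = d_zbar g z" by (simp_all add: d_z_def d_zbar_def dx_def dy_def)
qed

lemma d_z_exp:
  assumes "u differentiable (at z)"
  shows "d_z (\<lambda>w. complex_of_real (exp (u w))) z = of_real (exp (u z)) * d_z (\<lambda>w. of_real (u w)) z"
    "d_zbar (\<lambda>w. complex_of_real (exp (u w))) z = of_real (exp (u z)) * d_zbar (\<lambda>w. of_real (u w)) z"
    "(\<lambda>w. complex_of_real (exp (u w))) differentiable (at z)"
proof -
  note L = dx_dy_bounded_linear[OF bounded_linear_of_real[where 'a = complex] assms]
  have "((\<lambda>w. exp (u w)) has_derivative (\<lambda>h. (Re h *\<^sub>R dx u z + Im h *\<^sub>R dy u z) * exp (u z))) (at z)"
    by (rule derivative_eq_intros has_derivative_dx_dy[OF assms] refl)+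
  then have d: "((\<lambda>w. exp (u w)) has_derivative (\<lambda>h. Re h *\<^sub>R (exp (u z) * dx u z) + Im h *\<^sub>R (exp (u z) * dy u z))) (at z)"
    by (simp add: algebra_simps)
  have ed: "(\<lambda>w. exp (u w)) differentiable (at z)" using d by (auto simp: differentiable_def)
  note M = dx_dy_bounded_linear[OF bounded_linear_of_real[where 'a = complex] ed]
  show "d_z (\<lambda>w. complex_of_real (exp (u w))) z = of_real (exp (u z)) * d_z (\<lambda>w. of_real (u w)) z"
    "d_zbar (\<lambda>w. complex_of_real (exp (u w))) z = of_real (exp (u z)) * d_zbar (\<lambda>w. of_real (u w)) z"
    "(\<lambda>w. complex_of_real (exp (u w))) differentiable (at z)"
    using M(3) by (simp_all add: d_z_def d_zbar_def L(1,2) M(1,2) dx_dy_eqI[OF d] algebra_simps)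
qed

subsection \<open>Pointwise geometry\<close>

lemma CP2_unit:
  assumes "P \<in> CP2"
  obtains v where "norm v = 1" "P = outer v v"
proof -
  obtain v where v: "v \<noteq> 0" "P = cp_point v" using assms by (auto simp: CP2_def)
  define c where "c = complex_of_real (inverse (norm v))"
  have c0: "c \<noteq> 0" using v by (simp add: c_def)
  have "c *s v = inverse (norm v) *\<^sub>R v" by (simp add: vec_eq_iff c_def scaleR_conv_of_real[where 'a=complex])
  then have "norm (c *s v) = 1" using v by simp
  then show thesis using that[of "c *s v"] cp_point_unit cp_point_scale[OF c0] v(2) by metis
qed

lemma outer_rank_one: "outer v v ** (X ** outer v v) = cscale (trace (outer v v ** X)) (outer v v)"
  by (simp add: mat_eq3_iff forall_3 mult_nth3 trace3 cscale_nth outer_nth algebra_simps)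

lemma outer_adjoint: "adjoint_mat (outer v w) = outer w v"
  by (simp add: mat_eq3_iff adjoint_nth outer_nth mult.commute)

lemma trace_outer_cnj: "trace (outer v w) = cnj (trace (outer w v))"
  using trace_adjoint[of "outer w v"] by (simp add: outer_adjoint)

text \<open>
  A square matrix with orthonormal columns is unitary, so its rows are orthonormal too.
\<close>

lemma orthonormal_resolution:
  assumes "trace (outer x x) = 1" "trace (outer y y) = 1" "trace (outer z z) = 1"
    and "trace (outer x y) = 0" "trace (outer x z) = 0" "trace (outer y z) = 0"
  shows "outer x x + outer y y + outer z z = mat 1"
proof -
  have o: "trace (outer y x) = 0" "trace (outer z x) = 0" "trace (outer z y) = 0"
    using assms(4-6) trace_outer_cnj by (metis complex_cnj_zero)+
  define M :: "complex^3^3" where "M = (\<chi> i j. if j = 1 then x $ i else if j = 2 then y $ i else z $ i)"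
  have M: "M $ i $ 1 = x $ i" "M $ i $ 2 = y $ i" "M $ i $ 3 = z $ i" for i by (simp_all add: M_def)
  have "adjoint_mat M ** M = mat 1"
    using assms o by (simp add: mat_eq3_iff forall_3 mult_nth3 adjoint_nth M mat1_nth trace3 outer_nth mult.commute)
  then have "M ** adjoint_mat M = mat 1" by (rule matrix_left_right_inverse[THEN iffD1])
  moreover have "M ** adjoint_mat M = outer x x + outer y y + outer z z"
    by (simp add: mat_eq3_iff mult_nth3 adjoint_nth M outer_nth)
  ultimately show ?thesis by simp
qed

lemma outer_scale: "outer (c *s v) (d *s w) = cscale (c * cnj d) (outer v w)"
  by (simp add: mat_eq3_iff outer_nth cscale_nth)

text \<open>
  The horizontal lifts of the two Wirtinger derivatives and the lift itself form an orthogonal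
  basis of the ambient space precisely for conformal Lagrangian tangent planes.
\<close>

lemma lagrangian_pointI:
  assumes P: "P \<in> CP2" and A: "A = A ** P + P ** A" and e: "e > 0"
    and XX: "fs_metric (A + adjoint_mat A) (A + adjoint_mat A) = 2 * e"
    and YY: "fs_metric (cscale \<i> (A - adjoint_mat A)) (cscale \<i> (A - adjoint_mat A)) = 2 * e"
    and XY: "fs_metric (A + adjoint_mat A) (cscale \<i> (A - adjoint_mat A)) = 0"
    and kaehler: "kaehler_form P (A + adjoint_mat A) (cscale \<i> (A - adjoint_mat A)) = 0"
  shows "lagrangian_point P A (adjoint_mat A) (of_real e)"
    and "trace (A ** A) = 0" "trace (adjoint_mat A ** adjoint_mat A) = 0"
proof -
  obtain v where v: "norm v = 1" "P = outer v v" using CP2_unit[OF P] .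
  define B where "B = adjoint_mat A"
  define \<alpha> where "\<alpha> = trace (A ** A)"
  have tv: "trace P = 1" using trace_outer_self[of v] v by simp
  have rank: "P ** (X ** P) = cscale (trace (P ** X)) P" for X using outer_rank_one v(2) by blast
  have PP: "P ** P = P" using rank[of "mat 1"] tv by simp
  have adjP: "adjoint_mat P = P" using v(2) outer_adjoint by simp
  have B: "B = B ** P + P ** B"
    using arg_cong[OF A, of adjoint_mat] by (simp add: adjoint_simps adjP B_def add.commute)
  have sym: "trace (X ** Y) = trace (Y ** X)" for X Y :: "complex^3^3" by (rule trace_mul_sym)
  have gamma: "trace (B ** B) = cnj \<alpha>"
    using trace_adjoint[of "A ** A"] by (simp add: \<alpha>_def B_def adjoint_mult)
  define \<beta> where "\<beta> = trace (A ** B)"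
  have \<beta>': "trace (B ** A) = \<beta>" using sym by (simp add: \<beta>_def)
  have \<beta>_real: "cnj \<beta> = \<beta>"
    using trace_adjoint[of "A ** B"] by (simp add: \<beta>_def B_def adjoint_mult)
  have 1: "trace ((A + B) ** (A + B)) = \<alpha> + 2 * \<beta> + cnj \<alpha>"
    by (simp add: mat_distrib trace_add gamma \<beta>' \<alpha>_def[symmetric] \<beta>_def[symmetric])
  have 2: "trace (cscale \<i> (A - B) ** cscale \<i> (A - B)) = - (\<alpha> - 2 * \<beta> + cnj \<alpha>)"
    by (simp add: mat_distrib trace_sub trace_cscale cscale_diff gamma \<beta>' \<alpha>_def[symmetric] \<beta>_def[symmetric])
  have 3: "trace ((A + B) ** cscale \<i> (A - B)) = \<i> * (\<alpha> - cnj \<alpha>)"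
    by (simp add: mat_distrib trace_add trace_sub trace_cscale cscale_diff gamma \<beta>' \<alpha>_def[symmetric] \<beta>_def[symmetric] algebra_simps)
  have "Re \<alpha> = 0" "Re \<beta> = 2 * e" "Im \<alpha> = 0"
    using XX YY XY unfolding fs_metric_def B_def[symmetric] 1 2 3 by (simp_all add: complex_eq_iff)
  then have \<alpha>0: "\<alpha> = 0" and \<beta>e: "\<beta> = 2 * of_real e"
    using \<beta>_real by (simp_all add: complex_eq_iff)
  show "trace (A ** A) = 0" using \<alpha>0 by (simp add: \<alpha>_def)
  show "trace (adjoint_mat A ** adjoint_mat A) = 0" using gamma \<alpha>0 by (simp add: B_def)
  have cyc: "trace (X ** (Y ** Z)) = trace (Y ** (Z ** X))" for X Y Z :: "complex^3^3"
    using sym[of X "Y ** Z"] by (simp add: mult_assoc3)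
  define a where "a = trace (P ** (A ** B))"
  define b where "b = trace (P ** (B ** A))"
  have a_real: "cnj a = a"
    using trace_adjoint[of "P ** (A ** B)"] cyc[of P A B] sym[of "A ** B" P]
    by (simp add: a_def B_def adjoint_mult adjP mult_assoc3)
  have b_real: "cnj b = b"
    using trace_adjoint[of "P ** (B ** A)"] cyc[of P B A] sym[of "B ** A" P]
    by (simp add: b_def B_def adjoint_mult adjP mult_assoc3)
  have split: "trace (X ** Y) = trace (P ** (Y ** X)) + trace (P ** (X ** Y))" if "X = X ** P + P ** X" for X Y :: "complex^3^3"
  proof -
    have "trace (X ** Y) = trace ((X ** P + P ** X) ** Y)" using that by simp
    also have "\<dots> = trace (X ** (P ** Y)) + trace (P ** (X ** Y))" by (simp add: mat_distrib trace_add)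
    finally show ?thesis using cyc[of X P Y] by simp
  qed
  have ab: "a + b = 2 * of_real e" using split[OF A, of B] \<beta>e by (simp add: a_def b_def \<beta>_def add.commute)
  have PAA: "trace (P ** (A ** A)) = 0" using split[OF A, of A] \<alpha>0 by (simp add: \<alpha>_def)
  have PBB: "trace (P ** (B ** B)) = 0" using split[OF B, of B] gamma \<alpha>0 by simp
  \<comment> \<open>the Kaehler form measures the difference of a and b, and the metric their sum\<close>
  have "trace (fs_J P (A + B) ** cscale \<i> (A - B)) = - 2 * (a - b)"
  proof -
    have "fs_J P (A + B) ** cscale \<i> (A - B) = - ((A + B) ** (P ** (A - B)) - P ** ((A + B) ** (A - B)))"
      by (simp add: fs_J_def mat_distrib cscale_diff cscale_add) (simp add: mat_eq3_iff cscale_nth)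
    also have "trace \<dots> = - (trace (P ** ((A - B) ** (A + B))) - trace (P ** ((A + B) ** (A - B))))"
      using cyc[of "A + B" P "A - B"] by (simp add: trace_minus3 trace_sub)
    also have "\<dots> = - 2 * (a - b)"
      by (simp add: mat_distrib trace_add trace_sub PAA PBB a_def[symmetric] b_def[symmetric])
    finally show ?thesis .
  qed
  then have "Re (a - b) = 0"
    using kaehler unfolding kaehler_form_def fs_metric_def B_def[symmetric] by simp
  then have "a = b" using a_real b_real by (simp add: complex_eq_iff)
  then have ae: "a = of_real e" "b = of_real e" using ab by simp_all
  have PXP0: "P ** (X ** P) = 0" if "X = X ** P + P ** X" for X :: "complex^3^3"
  proof -
    have "P ** (X ** P) = P ** ((X ** P + P ** X) ** P)" using that by simp
    also have "\<dots> = P ** (X ** P) + P ** (X ** P)"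
      using PP by (simp add: mat_distrib) (simp add: matrix_mul_assoc PP)
    finally show ?thesis by simp
  qed
  have trX0: "trace (P ** X) = 0" if "X = X ** P + P ** X" for X :: "complex^3^3"
  proof -
    have "cscale (trace (P ** X)) P = 0" using PXP0[OF that] rank[of X] by simp
    then have "trace (P ** X) * trace P = 0" using trace_cscale[of "trace (P ** X)" P] by simp
    then show ?thesis using tv by simp
  qed
  \<comment> \<open>normalises the directions A v and B v, of length sqrt e, to unit length\<close>
  define r where "r = complex_of_real (inverse (sqrt e))"
  have rr: "r * cnj r * of_real e = 1"
  proof -
    have "r * cnj r * of_real e = of_real (inverse (sqrt e) * inverse (sqrt e) * e)" by (simp add: r_def)
    also have "inverse (sqrt e) * inverse (sqrt e) * e = 1" using e by (simp add: field_simps)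
    finally show ?thesis by simp
  qed
  have r0: "r \<noteq> 0" using e by (simp add: r_def)
  have oaa: "outer (A *v v) (A *v v) = A ** (P ** B)" and obb: "outer (B *v v) (B *v v) = B ** (P ** A)"
    and oab: "outer (A *v v) (B *v v) = A ** (P ** A)" 
    by (simp_all add: outer_matrix v(2) B_def mult_assoc3)
  have ov: "outer v (X *v v) = P ** adjoint_mat X" for X
    using outer_matrix[of "mat 1" v X v] by (simp add: v(2))
  have "outer v v + outer (r *s (A *v v)) (r *s (A *v v)) + outer (r *s (B *v v)) (r *s (B *v v)) = mat 1"
  proof (rule orthonormal_resolution)
    show "trace (outer v v) = 1" using tv v(2) by simp
    show "trace (outer (r *s (A *v v)) (r *s (A *v v))) = 1"
      using cyc[of A P B] rr ae by (simp add: outer_scale trace_cscale oaa b_def)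
    show "trace (outer (r *s (B *v v)) (r *s (B *v v))) = 1"
      using cyc[of B P A] rr ae by (simp add: outer_scale trace_cscale obb a_def)
    have o1: "outer v (r *s w) = cscale (cnj r) (outer v w)" for w using outer_scale[of 1 v r w] by simp
    show "trace (outer v (r *s (A *v v))) = 0" using trX0[OF B] by (simp add: o1 ov trace_cscale B_def)
    show "trace (outer v (r *s (B *v v))) = 0" using trX0[OF A] by (simp add: o1 ov trace_cscale B_def)
    show "trace (outer (r *s (A *v v)) (r *s (B *v v))) = 0"
      using cyc[of A P A] PAA by (simp add: outer_scale trace_cscale oab)
  qed
  then have "P + cscale (r * cnj r) (A ** (P ** B) + B ** (P ** A)) = mat 1"
    by (simp add: outer_scale oaa obb v(2)[symmetric] cscale_add add.assoc)
  then have "cscale (r * cnj r) (A ** (P ** B) + B ** (P ** A)) = mat 1 - P" by (simp add: algebra_simps)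
  then have "cscale (of_real e) (cscale (r * cnj r) (A ** (P ** B) + B ** (P ** A))) = cscale (of_real e) (mat 1 - P)"
    by simp
  then have "A ** (P ** B) + B ** (P ** A) = cscale (of_real e) (mat 1 - P)"
    using rr by (simp add: mult.commute)
  then have "lagrangian_point P A B (of_real e)"
    using e PP rank A B ae PAA PBB unfolding a_def b_def by unfold_locales simp_all
  then show "lagrangian_point P A (adjoint_mat A) (of_real e)" by (simp add: B_def)
qed

section \<open>Gauss and Codazzi equations\<close>

text \<open>
  For a horizontal lift \<open>L\<close> of unit length one has \<open>P P\<^sub>z = L L\<^bsub>zbar\<^esub>\<^sup>*\<close>, and the trace is the Hermitian product
  of \<open>L\<^bsub>zz\<^esub>\<close> with \<open>L\<^bsub>zbar\<^esub>\<close>: the coefficient of the Hopf differential, expressed without a lift.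
\<close>

definition hopf :: "(complex \<Rightarrow> complex^3^3) \<Rightarrow> complex \<Rightarrow> complex" where
  "hopf f z = trace (f z ** (mat_d_z f z ** mat_d_z (mat_d_z f) z))"

text \<open>
  Differentiating \<open>P P = P\<close> twice yields the shape of the second derivatives, and differentiating the
  first-order trace identities yields their coefficients. The Laplacian of \<open>f\<close> has no component
  tangent to the projective plane: the part normal to the surface is the mean curvature, and the part
  tangent to the surface vanishes because the parametrisation is conformal.
\<close>

theorem minimal_lagrangian_structure:
  assumes S: "open S" and cml: "conformal_minimal_lagrangian S u f" and z: "z \<in> S"
  shows "lagrangian_point (f z) (mat_d_z f z) (mat_d_zbar f z) (of_real (exp (u z)))"
    and "mat_d_zbar f z = adjoint_mat (mat_d_z f z)"
    and "mat_d_zbar (mat_d_z f) z = cscale (of_real (exp (u z))) (mat 1 - cscale 3 (f z))"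
    and "mat_d_z (mat_d_z f) z = cscale 2 (mat_d_z f z ** mat_d_z f z)
          + cscale (d_z (\<lambda>w. of_real (u w)) z) (mat_d_z f z)
          + cscale (hopf f z / of_real (exp (u z))) (mat_d_zbar f z ** f z - f z ** mat_d_zbar f z)"
proof -
  have us: "smooth_on S u" and fs: "smooth_on S f"
    using cml by (auto simp: conformal_minimal_lagrangian_def)
  define A where "A = mat_d_z f"
  define B where "B = mat_d_zbar f"
  have As: "smooth_on S A" and Bs: "smooth_on S B"
    unfolding A_def B_def by (intro smooth_on_mat_d[OF S fs])+
  have fd: "f differentiable (at w)" and Ad: "A differentiable (at w)" and Bd: "B differentiable (at w)" if "w \<in> S" for w
    using smooth_on_differentiable that fs As Bs by blast+
  have cp: "f w \<in> CP2" if "w \<in> S" for w using cml that by (simp add: conformal_minimal_lagrangian_def)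
  have fadj: "adjoint_mat (f w) = f w" and ff: "f w ** f w = f w" if w: "w \<in> S" for w
  proof -
    obtain v where v: "norm v = 1" "f w = outer v v" using CP2_unit[OF cp[OF w]] .
    show "adjoint_mat (f w) = f w" using v outer_adjoint by simp
    show "f w ** f w = f w" using outer_rank_one[of v "mat 1"] trace_outer_self[of v] v by simp
  qed
  have Badj: "B w = adjoint_mat (A w)" if w: "w \<in> S" for w
    using mat_d_cong(2)[OF S w fadj[symmetric] fd[OF w]] mat_d_adjoint(2)[OF fd[OF w]] by (simp add: A_def B_def)
  have Aeq: "A w = A w ** f w + f w ** A w" if w: "w \<in> S" for w
    using mat_d_cong(1)[OF S w ff[symmetric] fd[OF w]] mat_d_z_mult(1)[OF fd[OF w] fd[OF w]] by (simp add: A_def)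
  have X: "dx f w = A w + adjoint_mat (A w)" and Y: "dy f w = cscale \<i> (A w - adjoint_mat (A w))" if w: "w \<in> S" for w
    using dx_dy_from_wirtinger[OF fd[OF w]] Badj[OF w] by (simp_all add: A_def B_def)
  have lp: "lagrangian_point (f w) (A w) (B w) (of_real (exp (u w)))"
    and trAA0: "trace (A w ** A w) = 0" and trBB0: "trace (B w ** B w) = 0" if w: "w \<in> S" for w
    using lagrangian_pointI[OF cp[OF w] Aeq[OF w], of "exp (u w)"] cml w
    by (auto simp: conformal_minimal_lagrangian_def X[OF w, symmetric] Y[OF w, symmetric] Badj[OF w])
  show "lagrangian_point (f z) (mat_d_z f z) (mat_d_zbar f z) (of_real (exp (u z)))" using lp[OF z] by (simp add: A_def B_def)
  show "mat_d_zbar f z = adjoint_mat (mat_d_z f z)" using Badj[OF z] by (simp add: A_def B_def)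
  interpret lagrangian_point "f z" "A z" "B z" "of_real (exp (u z))" by (rule lp[OF z])
  define Q where "Q = mat_d_zbar A z"
  define W where "W = mat_d_z A z"
  have Q': "mat_d_z B z = Q" unfolding Q_def A_def B_def using mat_d_mixed(1)[OF S fs z] by simp
  have fz: "mat_d_z f z = A z" "mat_d_zbar f z = B z" by (simp_all add: A_def B_def)
  have Qeq: "Q = Q ** f z + A z ** B z + B z ** A z + f z ** Q"
  proof -
    have "Q = mat_d_zbar (\<lambda>w. A w ** f w + f w ** A w) z"
      unfolding Q_def by (rule mat_d_cong(2)[OF S z Aeq Ad[OF z]])
    then show ?thesis
      using mat_d_add(2)[OF mat_d_z_mult(5)[OF Ad[OF z] fd[OF z]] mat_d_z_mult(5)[OF fd[OF z] Ad[OF z]]]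
        mat_d_z_mult(2)[OF Ad[OF z] fd[OF z]] mat_d_z_mult(2)[OF fd[OF z] Ad[OF z]]
      by (simp add: fz Q_def add.assoc)
  qed
  have Weq: "W = W ** f z + A z ** A z + A z ** A z + f z ** W"
  proof -
    have "W = mat_d_z (\<lambda>w. A w ** f w + f w ** A w) z"
      unfolding W_def by (rule mat_d_cong(1)[OF S z Aeq Ad[OF z]])
    then show ?thesis
      using mat_d_add(1)[OF mat_d_z_mult(5)[OF Ad[OF z] fd[OF z]] mat_d_z_mult(5)[OF fd[OF z] Ad[OF z]]]
        mat_d_z_mult(1)[OF Ad[OF z] fd[OF z]] mat_d_z_mult(1)[OF fd[OF z] Ad[OF z]]
      by (simp add: fz W_def add.assoc)
  qed
  have zero: "d_z (\<lambda>w. 0) z = 0" "d_zbar (\<lambda>w. 0) z = 0" by (simp_all add: d_z_def d_zbar_def dx_def dy_def)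
  \<comment> \<open>derivatives of the conformality relations trace (A A) = 0 and trace (B B) = 0\<close>
  have trQA: "trace (Q ** A z) = 0"
  proof -
    have "d_zbar (\<lambda>w. trace (A w ** A w)) z = d_zbar (\<lambda>w. 0) z"
      by (rule d_z_cong(2)[OF S z trAA0 dx_dy_bounded_linear(3)[OF bounded_linear_trace mat_d_z_mult(5)[OF Ad[OF z] Ad[OF z]]]])
    then have "trace (Q ** A z) + trace (A z ** Q) = 0"
      by (simp add: d_z_trace[OF mat_d_z_mult(5)[OF Ad[OF z] Ad[OF z]]] mat_d_z_mult(2)[OF Ad[OF z] Ad[OF z]] zero Q_def trace_add)
    then show ?thesis using trace_mul_sym[of Q "A z"] by simp
  qed
  have trQB: "trace (Q ** B z) = 0"
  proof -
    have "d_z (\<lambda>w. trace (B w ** B w)) z = d_z (\<lambda>w. 0) z"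
      by (rule d_z_cong(1)[OF S z trBB0 dx_dy_bounded_linear(3)[OF bounded_linear_trace mat_d_z_mult(5)[OF Bd[OF z] Bd[OF z]]]])
    then have "trace (Q ** B z) + trace (B z ** Q) = 0"
      by (simp add: d_z_trace[OF mat_d_z_mult(5)[OF Bd[OF z] Bd[OF z]]] mat_d_z_mult(1)[OF Bd[OF z] Bd[OF z]] zero Q' trace_add)
    then show ?thesis using trace_mul_sym[of Q "B z"] by simp
  qed
  define T where "T = cp_tangential (f z) Q"
  have T4: "cp_tangential (f z) (dx (dx f) z + dy (dy f) z) = cscale 4 T"
    unfolding mat_d_mixed(2)[OF S fs z, symmetric] T_def Q_def A_def
    by (simp only: cp_tangential_def mult_cscale_left mult_cscale_right cscale_add)
  have tr0: "trace (T ** V) = 0" if V: "f z ** (V ** f z) = 0" "trace (Q ** V) = 0" "V = V ** f z + f z ** V" for V :: "complex^3^3"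
  proof -
    have c: "trace (X ** (Y ** Z)) = trace (Y ** (Z ** X))" for X Y Z :: "complex^3^3"
      using trace_mul_sym[of X "Y ** Z"] by (simp add: mult_assoc3)
    have z0: "trace (f z ** (Q ** (f z ** V))) = 0"
      using c[of "f z" Q "f z ** V"] by (simp add: mult_assoc3 V(1))
    have "T ** V = f z ** (Q ** V) - f z ** (Q ** (f z ** V)) + (Q ** (f z ** V) - f z ** (Q ** (f z ** V)))"
      by (simp only: T_def cp_tangential_def mat_distrib matrix_mul_lid matrix_mul_rid)
    then have "trace (T ** V) = trace (f z ** (Q ** V)) + trace (Q ** (f z ** V))"
      by (simp only: trace_add trace_sub z0 diff_zero)
    also have "\<dots> = trace (Q ** (V ** f z + f z ** V))"
      using c[of "f z" Q V] by (simp add: mat_distrib trace_add)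
    also have "\<dots> = 0" using V by simp
    finally show ?thesis .
  qed
  have TA: "trace (T ** A z) = 0" and TB: "trace (T ** B z) = 0"
    using tr0[OF PAP trQA A] tr0[OF PBP trQB B] by auto
  have "T = 0"
  proof -
    have "fs_metric (cscale 4 T) (dx f z) = 0" "fs_metric (cscale 4 T) (dy f z) = 0"
      using TA TB by (simp_all add: fs_metric_def X[OF z] Y[OF z] Badj[OF z, symmetric] mat_distrib cscale_diff
          trace_add trace_sub trace_cscale)
    moreover have "mean_curvature f z = 0" "fs_metric (dx f z) (dx f z) = 2 * exp (u z)"
      using cml z by (auto simp: conformal_minimal_lagrangian_def)
    ultimately have "cscale 4 T = 0" unfolding mean_curvature_def Let_def T4 by simp
    then have "cscale (1/4) (cscale 4 T) = 0" by simp
    then show ?thesis by simp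
  qed
  then have tang: "f z ** Q ** (mat 1 - f z) + (mat 1 - f z) ** Q ** f z = 0"
    by (simp add: T_def cp_tangential_def)
  have Qval: "Q = cscale (of_real (exp (u z))) (mat 1 - cscale 3 (f z))"
    by (rule mixed_second_derivative[OF Qeq tang])
  then show "mat_d_zbar (mat_d_z f) z = cscale (of_real (exp (u z))) (mat 1 - cscale 3 (f z))"
    by (simp add: Q_def A_def)
  define c where "c = d_z (\<lambda>w. complex_of_real (u w)) z"
  have ud: "u differentiable (at z)" using smooth_on_differentiable[OF us z] .
  have PQX: "trace (f z ** (Q ** V)) = 0" if "trace (f z ** V) = 0" for V
    using that by (simp add: Qval mat_distrib PP' trace_sub trace_cscale cscale_diff)
  have trXQ: "trace (f z ** (V ** Q)) = 0" if "trace (f z ** V) = 0" "f z ** (V ** f z) = 0" for V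
    using that by (simp add: Qval mat_distrib trace_sub trace_cscale cscale_diff)
  note triple = mat_d_z_mult(1)[OF fd[OF z] mat_d_z_mult(5)] mat_d_z_mult(5)[OF fd[OF z] mat_d_z_mult(5)]
  \<comment> \<open>derivatives of the relations trace (P B A) = trace (P A B) = exp u and trace (P A A) = 0\<close>
  have t1: "trace (f z ** (B z ** W)) = c * of_real (exp (u z))"
  proof -
    have d: "(\<lambda>w. f w ** (B w ** A w)) differentiable (at z)" by (intro triple Bd Ad z)
    have "d_z (\<lambda>w. trace (f w ** (B w ** A w))) z = d_z (\<lambda>w. of_real (exp (u w))) z"
      by (rule d_z_cong(1)[OF S z _ dx_dy_bounded_linear(3)[OF bounded_linear_trace d]])
         (use lp lagrangian_point.trBA in blast)
    also have "\<dots> = c * of_real (exp (u z))" by (simp add: d_z_exp[OF ud] c_def)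
    finally have "trace (A z ** (B z ** A z)) + (trace (f z ** (Q ** A z)) + trace (f z ** (B z ** W))) = c * of_real (exp (u z))"
      unfolding d_z_trace(1)[OF d]
      by (simp add: triple(1)[OF Bd[OF z] Ad[OF z]] mat_d_z_mult(1)[OF Bd[OF z] Ad[OF z]] fz Q' W_def[symmetric] mult_add_right trace_add)
    then show ?thesis using trace_ABA PQX[OF trace_PA] by simp
  qed
  have t2: "trace (f z ** (W ** B z)) = c * of_real (exp (u z))"
  proof -
    have d: "(\<lambda>w. f w ** (A w ** B w)) differentiable (at z)" by (intro triple Bd Ad z)
    have "d_z (\<lambda>w. trace (f w ** (A w ** B w))) z = d_z (\<lambda>w. of_real (exp (u w))) z"
      by (rule d_z_cong(1)[OF S z _ dx_dy_bounded_linear(3)[OF bounded_linear_trace d]])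
         (use lp lagrangian_point.trAB in blast)
    also have "\<dots> = c * of_real (exp (u z))" by (simp add: d_z_exp[OF ud] c_def)
    finally have "trace (A z ** (A z ** B z)) + (trace (f z ** (W ** B z)) + trace (f z ** (A z ** Q))) = c * of_real (exp (u z))"
      unfolding d_z_trace(1)[OF d]
      by (simp add: triple(1)[OF Ad[OF z] Bd[OF z]] mat_d_z_mult(1)[OF Ad[OF z] Bd[OF z]] fz Q' W_def[symmetric] mult_add_right trace_add)
    then show ?thesis using trace_AAB trXQ[OF trace_PA PAP] by simp
  qed
  have q: "hopf f z = trace (f z ** (A z ** W))" by (simp add: hopf_def A_def W_def)
  have t3: "trace (f z ** (W ** A z)) = - hopf f z"
  proof -
    have d: "(\<lambda>w. f w ** (A w ** A w)) differentiable (at z)" by (intro triple Ad z)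
    have "d_z (\<lambda>w. trace (f w ** (A w ** A w))) z = d_z (\<lambda>w. 0) z"
      by (rule d_z_cong(1)[OF S z _ dx_dy_bounded_linear(3)[OF bounded_linear_trace d]])
         (use lp lagrangian_point.trAA in blast)
    then have "trace (A z ** (A z ** A z)) + (trace (f z ** (W ** A z)) + trace (f z ** (A z ** W))) = 0"
      unfolding d_z_trace(1)[OF d] zero
      by (simp add: triple(1)[OF Ad[OF z] Ad[OF z]] mat_d_z_mult(1)[OF Ad[OF z] Ad[OF z]] fz W_def[symmetric] mult_add_right trace_add)
    then show ?thesis using trace_AAA q by (simp add: eq_neg_iff_add_eq_0)
  qed
  have "W = cscale 2 (A z ** A z) + cscale c (A z) + cscale (hopf f z / of_real (exp (u z))) (B z ** f z - f z ** B z)"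
    by (rule pure_second_derivative[OF Weq t1 t2 t3 q[symmetric]])
  then show "mat_d_z (mat_d_z f) z = cscale 2 (mat_d_z f z ** mat_d_z f z)
          + cscale (d_z (\<lambda>w. of_real (u w)) z) (mat_d_z f z)
          + cscale (hopf f z / of_real (exp (u z))) (mat_d_zbar f z ** f z - f z ** mat_d_zbar f z)"
    by (simp add: W_def A_def B_def c_def)
qed

lemma smooth_on_of_real: "open S \<Longrightarrow> smooth_on S u \<Longrightarrow> smooth_on S (\<lambda>w. complex_of_real (u w))"
  by (rule smooth_on_bounded_linear[OF _ bounded_linear_of_real])

lemma smooth_on_mult:
  fixes g h :: "complex \<Rightarrow> complex"
  shows "open S \<Longrightarrow> smooth_on S g \<Longrightarrow> smooth_on S h \<Longrightarrow> smooth_on S (\<lambda>z. g z * h z)"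
  unfolding smooth_on_def using Ck_on_bounded_bilinear[OF _ bounded_bilinear_mult] by blast

lemma smooth_on_exp:
  fixes u :: "complex \<Rightarrow> real"
  shows "open S \<Longrightarrow> smooth_on S u \<Longrightarrow> smooth_on S (\<lambda>z. exp (c * u z))"
  unfolding smooth_on_def using Ck_on_exp by blast

lemma smooth_on_d_z:
  assumes "open S" "smooth_on S h"
  shows "smooth_on S (d_z h)" "smooth_on S (d_zbar h)"
proof -
  have "smooth_on S (\<lambda>z. (1/2) * (dx h z - \<i> * dy h z))" "smooth_on S (\<lambda>z. (1/2) * (dx h z + \<i> * dy h z))"
    by (intro smooth_on_bounded_linear[OF assms(1) bounded_linear_mult_right] smooth_on_diff smooth_on_add
        smooth_on_dx smooth_on_dy assms)+
  then show "smooth_on S (d_z h)" "smooth_on S (d_zbar h)"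
    by (simp_all add: d_z_def[abs_def] d_zbar_def[abs_def])
qed

lemma smooth_on_hopf:
  assumes "open S" "smooth_on S f"
  shows "smooth_on S (hopf f)"
  unfolding hopf_def[abs_def]
  by (intro smooth_on_bounded_linear[OF assms(1) bounded_linear_trace] smooth_on_mult3 smooth_on_mat_d assms)

text \<open>
  Inserting the structure equations into \<open>(A\<^sub>z)\<^bsub>zbar\<^esub> = (A\<^bsub>zbar\<^esub>)\<^sub>z\<close> leaves a linear combination of a tangent
  and a normal matrix. By independence its two coefficients vanish; they are the Gauss equation and
  the holomorphy of the cubic coefficient.
\<close>

theorem gauss_codazzi:
  assumes S: "open S" and cml: "conformal_minimal_lagrangian S u f" and z: "z \<in> S"
  shows "d_zbar (d_z (\<lambda>w. of_real (u w))) z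
      = hopf f z * cnj (hopf f z) / (of_real (exp (u z)))\<^sup>2 - of_real (exp (u z))"
    and "d_zbar (hopf f) z = 0"
proof -
  have us: "smooth_on S u" and fs: "smooth_on S f"
    using cml by (auto simp: conformal_minimal_lagrangian_def)
  define A where "A = mat_d_z f"
  define B where "B = mat_d_zbar f"
  define g where "g = d_z (\<lambda>w. complex_of_real (u w))"
  define E where "E w = complex_of_real (exp (u w))" for w
  define c where "c w = hopf f w * of_real (exp (- 1 * u w))" for w
  have As: "smooth_on S A" and Bs: "smooth_on S B"
    unfolding A_def B_def by (intro smooth_on_mat_d[OF S fs])+
  have gs: "smooth_on S g" unfolding g_def by (intro smooth_on_d_z smooth_on_of_real S us)
  have cs: "smooth_on S c" unfolding c_def
    by (intro smooth_on_mult smooth_on_hopf smooth_on_of_real smooth_on_exp S us fs)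
  have Es: "smooth_on S E" unfolding E_def using smooth_on_of_real[OF S smooth_on_exp[OF S us, of 1]] by simp
  note D = smooth_on_differentiable[OF _ z]
  note fd = D[OF fs] and Ad = D[OF As] and Bd = D[OF Bs] and gd = D[OF gs] and cd = D[OF cs] and Ed = D[OF Es]
  have ud: "u differentiable (at z)" by (rule D[OF us])
  have c_eq: "c w = hopf f w / E w" for w by (simp add: c_def E_def exp_minus divide_inverse)
  have E0: "E w \<noteq> 0" for w by (simp add: E_def)
  note st = minimal_lagrangian_structure[OF S cml, folded A_def B_def E_def, folded g_def]
  have Badj: "B w = adjoint_mat (A w)" if "w \<in> S" for w by (rule st(2)[OF that])
  have Q: "mat_d_zbar A w = cscale (E w) (mat 1 - cscale 3 (f w))" if "w \<in> S" for w by (rule st(3)[OF that])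
  define N where "N w = B w ** f w - f w ** B w" for w
  have W: "mat_d_z A w = cscale 2 (A w ** A w) + (cscale (g w) (A w) + cscale (c w) (N w))" if "w \<in> S" for w
    using st(4)[OF that] by (simp add: c_eq N_def A_def add.assoc)
  interpret lagrangian_point "f z" "A z" "B z" "E z" by (rule st(1)[OF z])
  have fz: "mat_d_z f z = A z" "mat_d_zbar f z = B z" by (simp_all add: A_def B_def)
  have Neq: "N = (\<lambda>w. B w ** f w + cscale (-1) (f w ** B w))"
    by (simp add: fun_eq_iff N_def mat_eq3_iff cscale_nth)
  have d2: "(\<lambda>w. cscale (-1) (f w ** B w)) differentiable (at z)"
    by (rule dx_dy_bounded_linear(3)[OF bounded_linear_cscale mat_d_z_mult(5)[OF fd Bd]])
  have Nd: "N differentiable (at z)" unfolding Neq by (rule dx_dy_add(3)[OF mat_d_z_mult(5)[OF Bd fd] d2])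
  have Wb: "mat_d_zbar B z = adjoint_mat (mat_d_z A z)"
    using mat_d_cong(2)[OF S z Badj Bd] mat_d_adjoint(2)[OF Ad] by simp
  have fadj: "adjoint_mat (f z) = f z"
  proof -
    have "f z \<in> CP2" using cml z by (simp add: conformal_minimal_lagrangian_def)
    then obtain v where "f z = outer v v" using CP2_unit by metis
    then show ?thesis by (simp add: outer_adjoint)
  qed
  have adjN: "adjoint_mat (N z) = f z ** A z - A z ** f z"
    by (simp add: N_def adjoint_diff adjoint_mult fadj Badj[OF z])
  have gbar: "cnj (g z) = d_zbar (\<lambda>w. of_real (u w)) z"
    using dx_dy_bounded_linear(1,2)[OF bounded_linear_of_real[where 'a = complex] ud]
    by (simp add: g_def d_z_def d_zbar_def)
  define gb where "gb = cnj (g z)"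
  have Wbz: "mat_d_zbar B z = cscale 2 (B z ** B z) + (cscale gb (B z) + cscale (cnj (c z)) (f z ** A z - A z ** f z))"
    unfolding Wb W[OF z] by (simp add: adjoint_simps adjN Badj[OF z, symmetric] gb_def)
  have Nzb: "mat_d_zbar N z = cscale gb (N z) - cscale (cnj (c z)) (A z)"
  proof -
    have "mat_d_zbar N z = (mat_d_zbar B z ** f z + B z ** B z) + cscale (-1) (B z ** B z + f z ** mat_d_zbar B z)"
      unfolding Neq mat_d_add(2)[OF mat_d_z_mult(5)[OF Bd fd] d2] mat_d_cscale(2)[OF mat_d_z_mult(5)[OF fd Bd]]
        mat_d_z_mult(2)[OF Bd fd] mat_d_z_mult(2)[OF fd Bd] fz ..
    also have "\<dots> = mat_d_zbar B z ** f z - f z ** mat_d_zbar B z"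
      by (simp add: mat_eq3_iff cscale_nth)
    also have "\<dots> = cscale gb (B z ** f z - f z ** B z) - cscale (cnj (c z)) (A z ** f z + f z ** A z)"
    proof -
      have "B z ** B z ** f z = 0" "f z ** (B z ** B z) = 0"
        unfolding BB by (simp_all add: mult_assoc3 PBP PBP')
      then have z2: "B z ** (B z ** f z) = 0" "f z ** (B z ** B z) = 0" by (simp_all add: mult_assoc3)
      show ?thesis unfolding Wbz
        by (simp only: mat_distrib z2 PP PP' PAP PAP') (simp add: mat_eq3_iff cscale_nth algebra_simps)
    qed
    finally show ?thesis using A by (simp add: N_def)
  qed
  have mixed: "mat_d_zbar (mat_d_z A) z = mat_d_z (mat_d_zbar A) z" by (rule mat_d_mixed(1)[OF S As z])
  have gAd: "(\<lambda>w. cscale (g w) (A w)) differentiable (at z)" by (rule mat_d_scalar_mult(3)[OF gd Ad])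
  have cNd: "(\<lambda>w. cscale (c w) (N w)) differentiable (at z)" by (rule mat_d_scalar_mult(3)[OF cd Nd])
  have AAd: "(\<lambda>w. cscale 2 (A w ** A w)) differentiable (at z)"
    by (rule dx_dy_bounded_linear(3)[OF bounded_linear_cscale mat_d_z_mult(5)[OF Ad Ad]])
  have Qz: "mat_d_zbar A z = cscale (E z) (mat 1 - cscale 3 (f z))" by (rule Q[OF z])
  have lhs: "mat_d_zbar (mat_d_z A) z = cscale 2 (mat_d_zbar A z ** A z + A z ** mat_d_zbar A z)
      + ((cscale (d_zbar g z) (A z) + cscale (g z) (mat_d_zbar A z)) + (cscale (d_zbar c z) (N z) + cscale (c z) (mat_d_zbar N z)))"
  proof -
    have "mat_d_zbar (mat_d_z A) z
        = mat_d_zbar (\<lambda>w. cscale 2 (A w ** A w) + (cscale (g w) (A w) + cscale (c w) (N w))) z"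
      by (rule mat_d_cong(2)[OF S z W D[OF smooth_on_mat_d(1)[OF S As]]])
    then show ?thesis
      unfolding mat_d_add(2)[OF AAd dx_dy_add(3)[OF gAd cNd]] mat_d_add(2)[OF gAd cNd]
        mat_d_cscale(2)[OF mat_d_z_mult(5)[OF Ad Ad]] mat_d_z_mult(2)[OF Ad Ad]
        mat_d_scalar_mult(2)[OF gd Ad] mat_d_scalar_mult(2)[OF cd Nd] .
  qed
  have Id: "(\<lambda>w. mat 1 + cscale (- 3) (f w)) differentiable (at z)"
    by (rule dx_dy_add(3)[OF differentiable_const dx_dy_bounded_linear(3)[OF bounded_linear_cscale fd]])
  have dc0: "mat_d_z (\<lambda>w. mat 1 :: complex^3^3) z = 0"
    by (simp add: mat_d_z_eq dx_def dy_def mat_eq3_iff cscale_nth)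
  have rhs: "mat_d_z (mat_d_zbar A) z = cscale (E z * g z) (mat 1 - cscale 3 (f z)) - cscale (3 * E z) (A z)"
  proof -
    have "mat_d_z (mat_d_zbar A) z = mat_d_z (\<lambda>w. cscale (E w) (mat 1 + cscale (- 3) (f w))) z"
      by (rule mat_d_cong(1)[OF S z _ D[OF smooth_on_mat_d(2)[OF S As]]]) (simp add: Q mat_eq3_iff cscale_nth)
    also have "\<dots> = cscale (E z * g z) (mat 1 + cscale (- 3) (f z)) + cscale (E z) (cscale (- 3) (A z))"
      unfolding mat_d_scalar_mult(1)[OF Ed Id]
        mat_d_add(1)[OF differentiable_const dx_dy_bounded_linear(3)[OF bounded_linear_cscale fd]]
        mat_d_cscale(1)[OF fd] dc0 fz using d_z_exp(1)[OF ud] by (simp add: E_def[abs_def] g_def)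
    finally show ?thesis by (simp add: mat_eq3_iff cscale_nth algebra_simps)
  qed
  have QA: "mat_d_zbar A z ** A z + A z ** mat_d_zbar A z = - cscale (E z) (A z)"
  proof -
    have "mat_d_zbar A z ** A z + A z ** mat_d_zbar A z = cscale (2 * E z) (A z) - cscale (3 * E z) (A z ** f z + f z ** A z)"
      unfolding Qz by (simp only: mat_distrib matrix_mul_lid matrix_mul_rid) (simp add: mat_eq3_iff cscale_nth algebra_simps)
    also have "\<dots> = - cscale (E z) (A z)" using A by (simp add: mat_eq3_iff cscale_nth algebra_simps)
    finally show ?thesis .
  qed
  have "cscale (d_zbar g z + E z - c z * cnj (c z)) (A z) + cscale (d_zbar c z + c z * gb) (N z) = 0"
    using lhs[unfolded mixed rhs QA Nzb, unfolded Qz]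
    by (simp add: mat_eq3_iff cscale_nth algebra_simps)
  from tangent_normal_independent[OF this[unfolded N_def]]
  have 1: "d_zbar g z + E z - c z * cnj (c z) = 0" and 2: "d_zbar c z + c z * gb = 0" by auto
  have "c z * cnj (c z) = hopf f z * cnj (hopf f z) / (E z)\<^sup>2"
    by (simp add: c_eq power2_eq_square) (simp add: E_def)
  then show "d_zbar (d_z (\<lambda>w. of_real (u w))) z
      = hopf f z * cnj (hopf f z) / (of_real (exp (u z)))\<^sup>2 - of_real (exp (u z))"
    using 1 by (simp add: g_def E_def algebra_simps)
  show "d_zbar (hopf f) z = 0"
  proof -
    \<comment> \<open>scalar functions as scalar matrices, to reuse the product rule\<close>
    have cI: "(\<lambda>w. cscale (c w) (mat 1)) differentiable (at z)"
      by (rule mat_d_scalar_mult(3)[OF cd differentiable_const])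
    have hd: "hopf f differentiable (at z)" by (rule D[OF smooth_on_hopf[OF S fs]])
    have db0: "mat_d_zbar (\<lambda>w. mat 1 :: complex^3^3) z = 0"
      by (simp add: mat_d_z_eq dx_def dy_def mat_eq3_iff cscale_nth)
    have "(\<lambda>w. cscale (hopf f w) (mat 1)) = (\<lambda>w. cscale (E w) (cscale (c w) (mat 1)))"
      using E0 by (simp add: fun_eq_iff c_eq)
    then have "mat_d_zbar (\<lambda>w. cscale (hopf f w) (mat 1)) z = mat_d_zbar (\<lambda>w. cscale (E w) (cscale (c w) (mat 1))) z"
      by simp
    then have "cscale (d_zbar (hopf f) z) (mat 1)
        = cscale (d_zbar E z) (cscale (c z) (mat 1)) + cscale (E z) (cscale (d_zbar c z) (mat 1))"
      by (simp only: mat_d_scalar_mult(2)[OF hd differentiable_const] mat_d_scalar_mult(2)[OF Ed cI]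
          mat_d_scalar_mult(2)[OF cd differentiable_const] db0 cscale_zero add_0_right)
    then have "d_zbar (hopf f) z = d_zbar E z * c z + E z * d_zbar c z"
      by (simp add: mat_eq3_iff cscale_nth mat1_nth split: if_splits)
    also have "d_zbar E z = E z * gb" using d_z_exp(2)[OF ud] gbar by (simp add: E_def[abs_def] gb_def)
    also have "E z * gb * c z + E z * d_zbar c z = E z * (d_zbar c z + c z * gb)" by (simp add: algebra_simps)
    finally show ?thesis using 2 by simp
  qed
qed

section \<open>Translation invariance\<close>

lemma dx_dy_translate:
  assumes "F differentiable (at (w + z))"
  shows "dx (\<lambda>z. F (w + z)) z = dx F (w + z)" "dy (\<lambda>z. F (w + z)) z = dy F (w + z)"
    "(\<lambda>z. F (w + z)) differentiable (at z)"
proof -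
  have t: "((\<lambda>z. w + z) has_derivative (\<lambda>h. h)) (at z)" by (auto intro!: derivative_eq_intros)
  have "((\<lambda>z. F (w + z)) has_derivative (\<lambda>h. Re h *\<^sub>R dx F (w + z) + Im h *\<^sub>R dy F (w + z))) (at z)"
    using has_derivative_compose[OF t has_derivative_dx_dy[OF assms]] by simp
  then show "dx (\<lambda>z. F (w + z)) z = dx F (w + z)" "dy (\<lambda>z. F (w + z)) z = dy F (w + z)"
    "(\<lambda>z. F (w + z)) differentiable (at z)"
    by (auto intro: dx_dy_eqI simp: differentiable_def)
qed

lemma mat_d_z_translate:
  assumes "F differentiable (at (w + z))"
  shows "mat_d_z F (w + z) = mat_d_z (\<lambda>z. F (w + z)) z"
  using dx_dy_translate[OF assms] by (simp add: mat_d_z_eq assms)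

lemma mat_d_z_conj:
  assumes "F differentiable (at z)"
  shows "mat_d_z (\<lambda>w. R ** F w ** R') z = R ** mat_d_z F z ** R'"
proof -
  have L: "bounded_linear (\<lambda>X. R ** X ** R')"
    using bounded_linear_compose[OF bounded_bilinear.bounded_linear_left[OF bounded_bilinear_mult3]
        bounded_bilinear.bounded_linear_right[OF bounded_bilinear_mult3]] by blast
  show ?thesis
    using dx_dy_bounded_linear[OF L assms] by (simp add: mat_d_z_eq assms mat_distrib)
qed

lemma trace_conj:
  assumes "R \<in> SU3"
  shows "trace (R ** X ** adjoint_mat R) = trace X"
  using trace_mul_sym[of "R ** X" "adjoint_mat R"] by (simp add: matrix_mul_assoc SU3_adj[OF assms])

lemma conj_mult:
  assumes "R \<in> SU3"
  shows "(R ** X ** adjoint_mat R) ** (R ** Y ** adjoint_mat R) = R ** (X ** Y) ** adjoint_mat R"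
proof -
  have "(R ** X ** adjoint_mat R) ** (R ** Y ** adjoint_mat R) = R ** X ** (adjoint_mat R ** R) ** Y ** adjoint_mat R"
    by (simp only: mult_assoc3)
  then show ?thesis by (simp add: SU3_adj[OF assms] mult_assoc3)
qed

text \<open>
  Wirtinger derivatives commute with conjugation by a fixed matrix, and both quantities are traces of
  products of derivatives of \<open>f\<close>.
\<close>

theorem equivariant_invariants:
  assumes S: "strip S" and cml: "conformal_minimal_lagrangian S u f" and te: "translationally_equivariant S f"
    and z: "z \<in> S"
  shows "u (of_real t + z) = u z" "hopf f (of_real t + z) = hopf f z"
proof -
  note oS = strip_open_convex(1)[OF S]
  have fs: "smooth_on S f" using cml by (simp add: conformal_minimal_lagrangian_def)
  obtain R where R: "one_param_subgroup R" and Rf: "\<And>t z. z \<in> S \<Longrightarrow> f (of_real t + z) = cp_act (R t) (f z)"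
    using te unfolding translationally_equivariant_def by blast
  have U: "R t \<in> SU3" using R by (auto simp: one_param_subgroup_def)
  let ?w = "of_real t :: complex"
  have tS: "?w + z \<in> S" if "z \<in> S" for z using strip_translate[OF S that] .
  note D = smooth_on_differentiable
  have step: "mat_d_z F (?w + z) = R t ** mat_d_z F z ** adjoint_mat (R t)"
    if F: "smooth_on S F" and FR: "\<And>z. z \<in> S \<Longrightarrow> F (?w + z) = R t ** F z ** adjoint_mat (R t)" and z: "z \<in> S" for F z
  proof -
    have d: "F differentiable (at (?w + z))" by (rule D[OF F tS[OF z]])
    have "mat_d_z F (?w + z) = mat_d_z (\<lambda>z. F (?w + z)) z" by (rule mat_d_z_translate[OF d])
    also have "\<dots> = mat_d_z (\<lambda>z. R t ** F z ** adjoint_mat (R t)) z"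
      by (rule mat_d_cong(1)[OF oS z FR dx_dy_translate(3)[OF d]])
    also have "\<dots> = R t ** mat_d_z F z ** adjoint_mat (R t)" by (rule mat_d_z_conj[OF D[OF F z]])
    finally show ?thesis .
  qed
  have f: "f (?w + z) = R t ** f z ** adjoint_mat (R t)" if "z \<in> S" for z
    using Rf[OF that] by (simp add: cp_act_def)
  have A: "mat_d_z f (?w + z) = R t ** mat_d_z f z ** adjoint_mat (R t)" if "z \<in> S" for z
    by (rule step[OF fs f that])
  have W: "mat_d_z (mat_d_z f) (?w + z) = R t ** mat_d_z (mat_d_z f) z ** adjoint_mat (R t)"
    by (rule step[OF smooth_on_mat_d(1)[OF oS fs] A z])
  show "hopf f (?w + z) = hopf f z"
    unfolding hopf_def f[OF z] A[OF z] W by (simp only: conj_mult[OF U] trace_conj[OF U])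
  have B: "mat_d_zbar f (?w + z) = R t ** mat_d_zbar f z ** adjoint_mat (R t)"
    using minimal_lagrangian_structure(2)[OF oS cml] tS z A[OF z] by (simp add: adjoint_mult mult_assoc3)
  have "complex_of_real (exp (u (?w + z))) = of_real (exp (u z))"
    using lagrangian_point.trAB[OF minimal_lagrangian_structure(1)[OF oS cml tS[OF z]]]
      lagrangian_point.trAB[OF minimal_lagrangian_structure(1)[OF oS cml z]]
    unfolding f[OF z] A[OF z] B conj_mult[OF U] trace_conj[OF U] by simp
  then show "u (?w + z) = u z" by (simp only: of_real_eq_iff exp_inj_iff)
qed

section \<open>The Gauss equation as an ordinary differential equation\<close>

text \<open>
  The coordinates \<open>gauss_state\<close> turn the equation \<open>u'' = 4 (m exp (-2u) - exp u)\<close> into the quadratic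
  system given by \<open>gauss_bilinear\<close>, and its conserved energy \<open>v\<^sup>2 + 4 m exp (-2u) + 8 exp u\<close>, where
  \<open>v = u'\<close>, into the squared Euclidean norm.
\<close>

definition gauss_bilinear :: "real \<times> real \<times> real \<Rightarrow> real \<times> real \<times> real \<Rightarrow> real \<times> real \<times> real" where
  "gauss_bilinear x y = (fst (snd x) * fst (snd y) - snd (snd x) * snd (snd y) / 2,
     - (fst x * fst (snd y)), fst x * snd (snd y) / 2)"

definition gauss_state :: "real \<Rightarrow> real \<Rightarrow> real \<Rightarrow> real \<times> real \<times> real" where
  "gauss_state m u v = (v, 2 * sqrt m * exp (- u), 2 * sqrt 2 * exp (u / 2))"

lemma bounded_bilinear_gauss: "bounded_bilinear gauss_bilinear"
  by (rule bilinear_conv_bounded_bilinear[THEN iffD1])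
     (auto simp: bilinear_def gauss_bilinear_def algebra_simps add_divide_distrib intro!: linearI)

lemma gauss_tangential: "x \<bullet> gauss_bilinear x x = 0"
  by (simp add: gauss_bilinear_def inner_prod_def algebra_simps)

lemma gauss_state_derivative:
  assumes "m \<ge> 0" "(u has_real_derivative v t) (at t within T)"
    and "(v has_real_derivative 4 * (m * exp (- 2 * u t) - exp (u t))) (at t within T)"
  shows "((\<lambda>t. gauss_state m (u t) (v t)) has_vector_derivative
      gauss_bilinear (gauss_state m (u t) (v t)) (gauss_state m (u t) (v t))) (at t within T)"
proof -
  have 1: "((\<lambda>t. 2 * sqrt m * exp (- u t)) has_real_derivative 2 * sqrt m * (exp (- u t) * - v t)) (at t within T)"
    by (rule derivative_eq_intros assms(2) refl | simp)+
  have 2: "((\<lambda>t. 2 * sqrt 2 * exp (u t / 2)) has_real_derivative 2 * sqrt 2 * (exp (u t / 2) * (v t / 2))) (at t within T)"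
    by (rule derivative_eq_intros assms(2) refl | simp)+
  have e: "exp (- u t) * exp (- u t) = exp (- 2 * u t)" "exp (u t / 2) * exp (u t / 2) = exp (u t)"
    by (simp_all add: exp_add[symmetric])
  have "2 * sqrt m * exp (- u t) * (2 * sqrt m * exp (- u t)) = 4 * ((sqrt m * sqrt m) * (exp (- u t) * exp (- u t)))"
    by (simp only: mult_ac; simp)
  then have f1: "2 * sqrt m * exp (- u t) * (2 * sqrt m * exp (- u t)) = 4 * (m * exp (- 2 * u t))"
    using e assms(1) by simp
  have "2 * sqrt 2 * exp (u t / 2) * (2 * sqrt 2 * exp (u t / 2)) = 4 * ((sqrt 2 * sqrt 2) * (exp (u t / 2) * exp (u t / 2)))"
    by (simp only: mult_ac; simp)
  then have f2: "2 * sqrt 2 * exp (u t / 2) * (2 * sqrt 2 * exp (u t / 2)) = 8 * exp (u t)"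
    using e by simp
  have "((\<lambda>t. gauss_state m (u t) (v t)) has_vector_derivative
      (4 * (m * exp (- 2 * u t) - exp (u t)), 2 * sqrt m * (exp (- u t) * - v t), 2 * sqrt 2 * (exp (u t / 2) * (v t / 2))))
      (at t within T)"
    unfolding gauss_state_def
    by (intro has_vector_derivative_Pair assms(3)[unfolded has_real_derivative_iff_has_vector_derivative]
        1[unfolded has_real_derivative_iff_has_vector_derivative] 2[unfolded has_real_derivative_iff_has_vector_derivative])
  moreover have "gauss_bilinear (gauss_state m (u t) (v t)) (gauss_state m (u t) (v t)) =
      (4 * (m * exp (- 2 * u t) - exp (u t)), 2 * sqrt m * (exp (- u t) * - v t), 2 * sqrt 2 * (exp (u t / 2) * (v t / 2)))"
    by (simp only: gauss_bilinear_def gauss_state_def fst_conv snd_conv f1 f2) (simp add: algebra_simps)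
  ultimately show ?thesis by simp
qed

lemma gauss_state_inj: "gauss_state m u v = gauss_state m u' v' \<Longrightarrow> u = u' \<and> v = v'"
  by (auto simp: gauss_state_def)

text \<open>
  The quadratic system has a global solution on the sphere through the initial state. Its last two
  components satisfy linear equations with coefficient \<open>v\<close>, so they are the required exponentials of an
  antiderivative \<open>u\<close> of \<open>v\<close>.
\<close>

theorem gauss_ode_global:
  fixes m u0 v0 :: real
  assumes m: "m \<ge> 0"
  obtains u v r where "u 0 = u0" "v 0 = v0"
    "\<And>t. (u has_real_derivative v t) (at t)"
    "\<And>t. (v has_real_derivative 4 * (m * exp (- 2 * u t) - exp (u t))) (at t)"
    "\<And>t. norm (gauss_state m (u t) (v t)) \<le> r"
proof -
  define x0 where "x0 = gauss_state m u0 v0"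
  define r where "r = norm x0"
  have "snd (snd x0) \<noteq> 0" by (simp add: x0_def gauss_state_def)
  then have r: "r > 0" by (auto simp: r_def)
  obtain K where K: "\<And>x y. norm (gauss_bilinear x y) \<le> norm x * norm y * K" "K \<ge> 0"
    using bounded_bilinear.nonneg_bounded[OF bounded_bilinear_gauss] by blast
  interpret b: bounded_bilinear gauss_bilinear by (rule bounded_bilinear_gauss)
  have "\<exists>x. x 0 = x0 \<and> (\<forall>t. (x has_vector_derivative gauss_bilinear (x t) (x t)) (at t) \<and> norm (x t) = r)"
  proof (rule tangential_ode_global[where \<Phi> = "\<lambda>x. gauss_bilinear x x" and r = r and L = "2 * r * K"])
    fix x y :: "real \<times> real \<times> real" assume xy: "x \<in> cball 0 r" "y \<in> cball 0 r"
    have "gauss_bilinear x x - gauss_bilinear y y = gauss_bilinear x (x - y) + gauss_bilinear (x - y) y"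
      by (simp add: b.diff_left b.diff_right)
    then have "norm (gauss_bilinear x x - gauss_bilinear y y) \<le> norm x * norm (x - y) * K + norm (x - y) * norm y * K"
      using norm_triangle_le[OF add_mono[OF K(1) K(1)]] by metis
    also have "\<dots> \<le> r * norm (x - y) * K + norm (x - y) * r * K"
      using xy K(2) by (intro add_mono mult_right_mono mult_left_mono) auto
    finally show "norm (gauss_bilinear x x - gauss_bilinear y y) \<le> 2 * r * K * norm (x - y)"
      by (simp add: algebra_simps)
  qed (use r K(2) gauss_tangential in \<open>auto simp: r_def\<close>)
  then obtain x where x0: "x 0 = x0" and x: "\<And>t. (x has_vector_derivative gauss_bilinear (x t) (x t)) (at t)"
    and xr: "\<And>t. norm (x t) = r" by blast
  define v where "v t = fst (x t)" for t
  define s where "s t = fst (snd (x t))" for t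
  define p where "p t = snd (snd (x t))" for t
  have comp: "(v has_vector_derivative fst (gauss_bilinear (x t) (x t))) (at t)"
    "(s has_vector_derivative fst (snd (gauss_bilinear (x t) (x t)))) (at t)"
    "(p has_vector_derivative snd (snd (gauss_bilinear (x t) (x t)))) (at t)" for t
    unfolding v_def s_def p_def
    by (rule bounded_linear.has_vector_derivative[OF bounded_linear_fst x]
        bounded_linear.has_vector_derivative[OF bounded_linear_fst bounded_linear.has_vector_derivative[OF bounded_linear_snd x]]
        bounded_linear.has_vector_derivative[OF bounded_linear_snd bounded_linear.has_vector_derivative[OF bounded_linear_snd x]])+
  have dv: "(v has_real_derivative s t * s t - p t * p t / 2) (at t)"
    and ds: "(s has_real_derivative - (v t * s t)) (at t)" and dp: "(p has_real_derivative v t * p t / 2) (at t)" for t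
    using comp[of t] by (simp_all add: has_real_derivative_iff_has_vector_derivative gauss_bilinear_def v_def s_def p_def)
  have cv: "continuous_on UNIV v"
    using dv by (meson DERIV_isCont continuous_at_imp_continuous_on)
  define u where "u t = u0 + antider v t" for t
  have du: "(u has_real_derivative v t) (at t)" for t
  proof -
    have "(u has_vector_derivative 0 + v t) (at t)" unfolding u_def
      by (intro has_vector_derivative_add has_vector_derivative_const antider_has_vector_derivative cv)
    then show ?thesis by (simp add: has_real_derivative_iff_has_vector_derivative)
  qed
  have u0: "u 0 = u0" by (simp add: u_def)
  have i: "v 0 = v0" "s 0 = 2 * sqrt m * exp (- u0)" "p 0 = 2 * sqrt 2 * exp (u0 / 2)"
    using x0 by (simp_all add: v_def s_def p_def x0_def gauss_state_def)
  have "s t * exp (u t) = s 0 * exp (u 0)" for t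
  proof (rule DERIV_isconst_all[where f = "\<lambda>t. s t * exp (u t)"], rule allI)
    fix t show "((\<lambda>t. s t * exp (u t)) has_real_derivative 0) (at t)"
      by (rule derivative_eq_intros ds du refl | simp)+
  qed
  then have "s t * exp (u t) = 2 * sqrt m" for t by (simp add: i u0 exp_minus)
  then have st: "s t = 2 * sqrt m * exp (- u t)" for t
    by (metis exp_minus exp_not_eq_zero mult.assoc mult.right_neutral right_inverse)
  have "p t * exp (- u t / 2) = p 0 * exp (- u 0 / 2)" for t
  proof (rule DERIV_isconst_all[where f = "\<lambda>t. p t * exp (- u t / 2)"], rule allI)
    fix t show "((\<lambda>t. p t * exp (- u t / 2)) has_real_derivative 0) (at t)"
      by (rule derivative_eq_intros dp du refl | simp)+
  qed
  moreover have "exp (u0 / 2) * exp (- u0 / 2) = 1" by (simp add: exp_add[symmetric])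
  ultimately have "p t * exp (- u t / 2) = 2 * sqrt 2" for t by (simp add: i u0 mult.assoc)
  then have pt: "p t = 2 * sqrt 2 * exp (u t / 2)" for t
  proof -
    have one: "exp (- u t / 2) * exp (u t / 2) = 1" by (simp add: exp_add[symmetric])
    have "2 * sqrt 2 * exp (u t / 2) = p t * exp (- u t / 2) * exp (u t / 2)"
      by (simp only: \<open>p t * exp (- u t / 2) = 2 * sqrt 2\<close>)
    also have "\<dots> = p t * (exp (- u t / 2) * exp (u t / 2))" by (rule mult.assoc)
    also have "\<dots> = p t" by (simp only: one mult_1_right)
    finally show ?thesis by (rule sym)
  qed
  have xt: "x t = gauss_state m (u t) (v t)" for t
    using st[of t] pt[of t] by (simp add: gauss_state_def v_def s_def p_def prod_eq_iff)
  have e: "exp (- u t) * exp (- u t) = exp (- 2 * u t)" "exp (u t / 2) * exp (u t / 2) = exp (u t)" for t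
    by (simp_all add: exp_add[symmetric])
  have "s t * s t = 4 * ((sqrt m * sqrt m) * (exp (- u t) * exp (- u t)))"
    "p t * p t = 4 * ((sqrt 2 * sqrt 2) * (exp (u t / 2) * exp (u t / 2)))" for t
    unfolding st pt by algebra+
  then have "s t * s t - p t * p t / 2 = 4 * (m * exp (- 2 * u t) - exp (u t))" for t
    using e[of t] m by simp
  then show thesis
    using that[of u v r] u0 i(1) du dv xr xt by simp
qed

text \<open>
  A quadratic map is Lipschitz on bounded sets, and both states are bounded on the segment. The
  equations are assumed on the segment from 0 to \<open>t\<close> only, for surfaces over strips.
\<close>

theorem gauss_ode_unique:
  assumes m: "m \<ge> 0"
    and 1: "\<And>s. s \<in> {0..1} \<Longrightarrow> (u has_real_derivative v (s * t)) (at (s * t))"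
      "\<And>s. s \<in> {0..1} \<Longrightarrow> (v has_real_derivative 4 * (m * exp (- 2 * u (s * t)) - exp (u (s * t)))) (at (s * t))"
    and 2: "\<And>s. s \<in> {0..1} \<Longrightarrow> (u' has_real_derivative v' (s * t)) (at (s * t))"
      "\<And>s. s \<in> {0..1} \<Longrightarrow> (v' has_real_derivative 4 * (m * exp (- 2 * u' (s * t)) - exp (u' (s * t)))) (at (s * t))"
    and eq: "u 0 = u' 0" "v 0 = v' 0"
  shows "u t = u' t" "v t = v' t"
proof -
  define x where "x s = gauss_state m (u (s * t)) (v (s * t))" for s
  define y where "y s = gauss_state m (u' (s * t)) (v' (s * t))" for s
  interpret b: bounded_bilinear gauss_bilinear by (rule bounded_bilinear_gauss)
  have line: "((\<lambda>s. s * t) has_vector_derivative t) (at s within {0..1})" for s :: real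
    by (auto intro!: derivative_eq_intros)
  have path: "((\<lambda>s. gauss_state m (u (s * t)) (v (s * t))) has_vector_derivative
      t *\<^sub>R gauss_bilinear (gauss_state m (u (s * t)) (v (s * t))) (gauss_state m (u (s * t)) (v (s * t)))) (at s within {0..1})"
    if "(u has_real_derivative v (s * t)) (at (s * t))"
      "(v has_real_derivative 4 * (m * exp (- 2 * u (s * t)) - exp (u (s * t)))) (at (s * t))" for u v s
    using vector_diff_chain_within[OF line has_vector_derivative_at_within[OF gauss_state_derivative[OF m that]]]
    by (simp add: o_def)
  have dx: "(x has_vector_derivative t *\<^sub>R gauss_bilinear (x s) (x s)) (at s within {0..1})" if "s \<in> {0..1}" for s
    using path[OF 1[OF that]] by (simp add: x_def[abs_def])
  have dy: "(y has_vector_derivative t *\<^sub>R gauss_bilinear (y s) (y s)) (at s within {0..1})" if "s \<in> {0..1}" for s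
    using path[OF 2[OF that]] by (simp add: y_def[abs_def])
  have "continuous_on {0..1} x" "continuous_on {0..1} y"
    using dx dy by (meson continuous_on_eq_continuous_within has_vector_derivative_continuous)+
  then obtain X Y where X: "\<And>s. s \<in> {0..1} \<Longrightarrow> norm (x s) \<le> X" and Y: "\<And>s. s \<in> {0..1} \<Longrightarrow> norm (y s) \<le> Y"
    using bounded_on_01 by metis
  obtain K where K: "\<And>x y. norm (gauss_bilinear x y) \<le> norm x * norm y * K" "K \<ge> 0"
    using bounded_bilinear.nonneg_bounded[OF bounded_bilinear_gauss] by blast
  have "x 1 - y 1 = 0"
  proof (rule gronwall_zero[where w = "\<lambda>s. x s - y s" and C = "\<bar>t\<bar> * (X * K + Y * K)"])
    fix s :: real assume s: "s \<in> {0..1}"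
    show "((\<lambda>s. x s - y s) has_vector_derivative t *\<^sub>R gauss_bilinear (x s) (x s) - t *\<^sub>R gauss_bilinear (y s) (y s)) (at s within {0..1})"
      by (rule has_vector_derivative_diff[OF dx[OF s] dy[OF s]])
    have e: "gauss_bilinear (x s) (x s) - gauss_bilinear (y s) (y s) = gauss_bilinear (x s) (x s - y s) + gauss_bilinear (x s - y s) (y s)"
      by (simp add: b.diff_left b.diff_right)
    have "norm (gauss_bilinear (x s) (x s) - gauss_bilinear (y s) (y s))
        \<le> norm (x s) * norm (x s - y s) * K + norm (x s - y s) * norm (y s) * K"
      unfolding e by (rule norm_triangle_le[OF add_mono[OF K(1) K(1)]])
    also have "\<dots> \<le> X * norm (x s - y s) * K + norm (x s - y s) * Y * K"
      using X[OF s] Y[OF s] K(2) by (intro add_mono mult_right_mono mult_left_mono) auto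
    finally have "\<bar>t\<bar> * norm (gauss_bilinear (x s) (x s) - gauss_bilinear (y s) (y s)) \<le> \<bar>t\<bar> * (X * norm (x s - y s) * K + norm (x s - y s) * Y * K)"
      by (rule mult_left_mono) simp
    moreover have "norm (t *\<^sub>R gauss_bilinear (x s) (x s) - t *\<^sub>R gauss_bilinear (y s) (y s))
        = \<bar>t\<bar> * norm (gauss_bilinear (x s) (x s) - gauss_bilinear (y s) (y s))"
      by (simp only: scaleR_diff_right[symmetric] norm_scaleR)
    moreover have "\<bar>t\<bar> * (X * norm (x s - y s) * K + norm (x s - y s) * Y * K) = \<bar>t\<bar> * (X * K + Y * K) * norm (x s - y s)"
      by (simp add: algebra_simps)
    ultimately show "norm (t *\<^sub>R gauss_bilinear (x s) (x s) - t *\<^sub>R gauss_bilinear (y s) (y s)) \<le> \<bar>t\<bar> * (X * K + Y * K) * norm (x s - y s)"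
      by simp
  qed (use eq in \<open>auto simp: x_def y_def\<close>)
  then show "u t = u' t" "v t = v' t" using gauss_state_inj by (auto simp: x_def y_def)
qed

section \<open>Frames over solutions of the Gauss equation\<close>

lemma norm_le_entries: "norm (M :: complex^3^3) \<le> (\<Sum>i\<in>UNIV. \<Sum>j\<in>UNIV. norm (M $ i $ j))"
proof -
  have v: "norm (w :: 'a::real_normed_vector ^ 3) \<le> (\<Sum>i\<in>UNIV. norm (w $ i))" for w
    unfolding norm_vec_def by (rule L2_set_le_sum) simp
  have "norm M \<le> (\<Sum>i\<in>UNIV. norm (M $ i))" by (rule v)
  also have "\<dots> \<le> (\<Sum>i\<in>UNIV. \<Sum>j\<in>UNIV. norm (M $ i $ j))" by (intro sum_mono v)
  finally show ?thesis .
qed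

text \<open>
  The solution \<open>U\<close> of the Gauss equation, with derivative \<open>V\<close>, and a constant cubic coefficient \<open>\<psi>\<close>
  determine all coefficients of the Lax pair. The bound is the conservation of energy.
\<close>

locale gauss_solution =
  fixes U V :: "real \<Rightarrow> real" and \<psi> :: complex and r :: real
  assumes dU: "\<And>t. (U has_real_derivative V t) (at t)"
    and dV: "\<And>t. (V has_real_derivative 4 * ((cmod \<psi>)\<^sup>2 * exp (- 2 * U t) - exp (U t))) (at t)"
    and bound: "\<And>t. norm (gauss_state ((cmod \<psi>)\<^sup>2) (U t) (V t)) \<le> r"
begin

definition a :: "real \<Rightarrow> complex" where "a y = \<i> * of_real (exp (U y / 2))"
definition b :: "real \<Rightarrow> complex" where "b y = - \<i> * \<psi> * of_real (exp (- U y))"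
definition q :: "real \<Rightarrow> complex" where "q y = - \<i> * cnj \<psi> * of_real (exp (- U y))"

text \<open>
  The \<open>dx\<close> and \<open>dy\<close> parts of the Maurer-Cartan form: the sum of the two Lax matrices and \<open>\<i>\<close> times
  their difference.
\<close>

definition al :: "real \<Rightarrow> complex \<Rightarrow> complex^3^3" where
  "al y l = pot (- \<i> * of_real (V y) / 2) (a y) (b y) (a y) (q y) l"
definition be :: "real \<Rightarrow> complex \<Rightarrow> complex^3^3" where
  "be y l = pot 0 (\<i> * a y) (\<i> * b y) (- \<i> * a y) (- \<i> * q y) l"

definition conf :: "complex \<Rightarrow> real" where "conf z = U (Im z)"

lemma aa: "a y * a y = - of_real (exp (U y))"
  by (simp add: a_def mult_ac of_real_mult[symmetric] exp_add[symmetric] del: of_real_mult)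

lemma qb: "q y * b y = - of_real ((cmod \<psi>)\<^sup>2 * exp (- 2 * U y))"
proof -
  have "q y * b y = - ((\<psi> * cnj \<psi>) * (of_real (exp (- U y)) * of_real (exp (- U y))))"
    by (simp add: q_def b_def mult_ac)
  also have "of_real (exp (- U y)) * of_real (exp (- U y)) = complex_of_real (exp (- 2 * U y))"
    by (simp only: of_real_mult[symmetric] exp_add[symmetric]) simp
  finally show ?thesis by (simp only: of_real_mult complex_norm_square)
qed

lemma of_real_deriv:
  assumes "(g has_real_derivative d) (at t)"
  shows "((\<lambda>t. complex_of_real (g t)) has_vector_derivative of_real d) (at t)"
  using bounded_linear.has_vector_derivative[OF bounded_linear_of_real
      assms[unfolded has_real_derivative_iff_has_vector_derivative]] .

lemma da: "(a has_vector_derivative a y * of_real (V y) / 2) (at y)"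
proof -
  have "((\<lambda>y. exp (U y / 2)) has_real_derivative exp (U y / 2) * (V y / 2)) (at y)"
    by (rule derivative_eq_intros dU refl | simp)+
  from has_vector_derivative_mult_right[OF of_real_deriv[OF this], of \<i>]
  show ?thesis by (simp add: a_def[abs_def] mult_ac)
qed

lemma db: "(b has_vector_derivative - (b y * of_real (V y))) (at y)"
  and dq: "(q has_vector_derivative - (q y * of_real (V y))) (at y)"
proof -
  have d: "((\<lambda>y. exp (- U y)) has_real_derivative exp (- U y) * - V y) (at y)"
    by (rule derivative_eq_intros dU refl | simp)+
  from has_vector_derivative_mult_right[OF of_real_deriv[OF this], of "- \<i> * \<psi>"]
  show "(b has_vector_derivative - (b y * of_real (V y))) (at y)" by (simp add: b_def[abs_def] mult_ac)
  from has_vector_derivative_mult_right[OF of_real_deriv[OF d], of "- \<i> * cnj \<psi>"]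
  show "(q has_vector_derivative - (q y * of_real (V y))) (at y)" by (simp add: q_def[abs_def] mult_ac)
qed

lemma pot_has_vector_derivative:
  assumes "(s has_vector_derivative s') F" "(f has_vector_derivative f') F" "(g has_vector_derivative g') F"
    "(h has_vector_derivative h') F" "(k has_vector_derivative k') F"
  shows "((\<lambda>y. pot (s y) (f y) (g y) (h y) (k y) l) has_vector_derivative pot s' f' g' h' k' l) F"
  unfolding has_vector_derivative_entries
proof (intro allI)
  fix i j :: 3
  show "((\<lambda>y. pot (s y) (f y) (g y) (h y) (k y) l $ i $ j) has_vector_derivative pot s' f' g' h' k' l $ i $ j) F"
    using exhaust_3[of i] exhaust_3[of j] assms
    by (elim disjE) (auto simp: pot_nth intro!: has_vector_derivative_mult_right has_vector_derivative_minus)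
qed

text \<open>
  Flatness of the Maurer-Cartan form: nothing depends on \<open>x\<close>, so it reduces to a Lax equation. The
  Gauss equation is its diagonal entry, the derivative of \<open>V\<close>.
\<close>

lemma al_lax:
  assumes "l \<noteq> 0"
  shows "((\<lambda>y. al y l) has_vector_derivative al y l ** be y l - be y l ** al y l) (at y)"
proof -
  define v where "v = complex_of_real (V y)"
  define w where "w = complex_of_real (4 * ((cmod \<psi>)\<^sup>2 * exp (- 2 * U y) - exp (U y)))"
  have w: "w = 4 * (a y * a y - q y * b y)" unfolding aa qb w_def by simp
  have dv: "((\<lambda>y. - \<i> * of_real (V y) / 2) has_vector_derivative - \<i> * w / 2) (at y)"
    using has_vector_derivative_mult_right[OF of_real_deriv[OF dV], of "- \<i> / 2"] by (simp add: w_def)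
  have "((\<lambda>y. al y l) has_vector_derivative
      pot (- \<i> * w / 2) (a y * v / 2) (- (b y * v)) (a y * v / 2) (- (q y * v)) l) (at y)"
    unfolding al_def v_def by (rule pot_has_vector_derivative[OF dv da db da dq])
  moreover have "pot (- \<i> * w / 2) (a y * v / 2) (- (b y * v)) (a y * v / 2) (- (q y * v)) l
      = al y l ** be y l - be y l ** al y l"
  proof -
    have l: "l * inverse l = 1" "inverse l * l = 1" "\<And>x. l * (inverse l * x) = x" "\<And>x. inverse l * (l * x) = x"
      using assms by auto
    show ?thesis
      unfolding w
      by (simp add: mat_eq3_iff forall_3 mult_nth3 al_def be_def pot_nth v_def[symmetric] algebra_simps l)
        (simp add: field_simps assms)?
  qed
  ultimately show ?thesis by simp
qed

lemma cnj_a: "cnj (a y) = - a y" and cnj_b: "cnj (b y) = - q y" and cnj_q: "cnj (q y) = - b y"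
  by (simp_all add: a_def b_def q_def)

lemma sphere_inverse: "l \<in> sphere 0 1 \<Longrightarrow> inverse l = cnj l" for l :: complex
proof -
  assume "l \<in> sphere 0 1"
  then have "l * cnj l = 1" by (simp add: complex_norm_square[symmetric])
  then show "inverse l = cnj l" by (rule inverse_unique)
qed

lemma al_su3: "l \<in> sphere 0 1 \<Longrightarrow> al y l \<in> su3" and be_su3: "l \<in> sphere 0 1 \<Longrightarrow> be y l \<in> su3"
  by (simp_all add: su3_def al_def be_def trace_pot, simp_all add: mat_eq3_iff forall_3 adjoint_nth pot_nth
      sphere_inverse cnj_a cnj_b cnj_q)

lemma be_continuous: "continuous_on UNIV (\<lambda>y. be y l)"
proof -
  have "continuous_on UNIV a" "continuous_on UNIV b" "continuous_on UNIV q"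
    using da db dq by (meson continuous_at_imp_continuous_on has_vector_derivative_continuous)+
  then have "continuous_on UNIV (\<lambda>y. be y l $ i $ j)" for i j
    using exhaust_3[of i] exhaust_3[of j]
    by (elim disjE) (auto simp: be_def pot_nth intro!: continuous_intros)
  then show ?thesis by (rule continuous_on_entries)
qed

text \<open>
  Conservation of energy bounds \<open>exp (U/2)\<close> and \<open>|\<psi>| exp (-U)\<close>, hence each of the nine entries, by \<open>r\<close>. This
  is what makes the vertical frame exist for all \<open>y\<close>.
\<close>

lemma be_bounded:
  assumes l: "l \<in> sphere 0 1"
  shows "norm (be y l) \<le> 9 * r"
proof -
  let ?x = "gauss_state ((cmod \<psi>)\<^sup>2) (U y) (V y)"
  have "norm (fst (snd ?x)) \<le> r" "norm (snd (snd ?x)) \<le> r"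
    using bound[of y] norm_snd_le[of ?x] norm_fst_le[of "snd ?x"] norm_snd_le[of "snd ?x"]
    by (metis order_trans norm_snd_le norm_fst_le prod.collapse)+
  then have 1: "2 * cmod \<psi> * exp (- U y) \<le> r" and 2: "2 * sqrt 2 * exp (U y / 2) \<le> r"
    by (simp_all add: gauss_state_def)
  have r0: "0 \<le> r" using order_trans[OF norm_ge_zero bound] .
  have "1 \<le> sqrt (2::real)" by simp
  then have "1 \<le> 2 * sqrt (2::real)" by linarith
  from mult_right_mono[OF this, of "exp (U y / 2)"] have "exp (U y / 2) \<le> r"
    using 2 exp_ge_zero[of "U y / 2"] by linarith
  then have na: "cmod (a y) \<le> r" by (simp add: a_def norm_mult)
  have "0 \<le> cmod \<psi> * exp (- U y)" by simp
  then have "cmod \<psi> * exp (- U y) \<le> r" using 1 by linarith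
  then have nb: "cmod (b y) \<le> r" "cmod (q y) \<le> r" by (simp_all add: b_def q_def norm_mult)
  have nl: "cmod l = 1" using l by simp
  have "norm (be y l $ i $ j) \<le> r" for i j
    using exhaust_3[of i] exhaust_3[of j] na nb r0 nl
    by (elim disjE) (simp_all add: be_def pot_nth norm_mult norm_inverse)
  then have "(\<Sum>i\<in>UNIV. \<Sum>j\<in>UNIV. norm (be y l $ i $ j)) \<le> (\<Sum>i\<in>(UNIV::3 set). \<Sum>j\<in>(UNIV::3 set). r)"
    by (intro sum_mono)
  then show ?thesis using norm_le_entries[of "be y l"] by (simp add: sum_3)
qed

text \<open>
  By the Lax equation \<open>H al H\<^sup>*\<close> is constant along the solution of \<open>H' = H be\<close>.
\<close>

lemma vertical_frame:
  assumes l: "l \<in> sphere 0 1"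
  shows "\<exists>H. H 0 = mat 1 \<and> (\<forall>y. (H has_vector_derivative H y ** be y l) (at y)) \<and> (\<forall>y. H y \<in> SU3)
     \<and> (\<forall>y. al 0 l ** H y = H y ** al y l)"
proof -
  have "continuous_on UNIV (\<lambda>y. adjoint_mat (be y l))" by (intro continuous_intros be_continuous)
  moreover have "adjoint_mat (be y l) = - be y l" for y using be_su3[OF l] by (simp add: su3_def)
  then have "norm (adjoint_mat (be y l)) \<le> 9 * r" for y using be_bounded[OF l] by simp
  \<comment> \<open>the adjoint of H, which solves a system with coefficients on the left\<close>
  ultimately obtain K where K0: "K 0 = mat 1"
    and K: "\<And>y. (K has_vector_derivative adjoint_mat (be y l) ** K y + 0) (at y)"
    using linear_ode_global[of "\<lambda>y. adjoint_mat (be y l)" "9 * r" "\<lambda>_. 0" 0 "mat 1"] by auto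
  define H where "H y = adjoint_mat (K y)" for y
  have H0: "H 0 = mat 1" by (simp add: H_def K0)
  have H: "(H has_vector_derivative H y ** be y l) (at y)" for y
    using adjoint_has_vector_derivative[OF K] by (simp add: H_def[abs_def] adjoint_mult)
  have HU: "H y \<in> SU3" for y
  proof -
    have "H (1 * y) \<in> SU3"
    proof (rule SU3_ode[where Z = "\<lambda>s. H (s * y)" and X = "\<lambda>s. y *\<^sub>R be (s * y) l"])
      fix s :: real
      have "((\<lambda>s. s * y) has_vector_derivative y) (at s)" by (auto intro!: derivative_eq_intros)
      from vector_diff_chain_at[OF this H]
      show "((\<lambda>s. H (s * y)) has_vector_derivative H (s * y) ** y *\<^sub>R be (s * y) l) (at s within {0..1})"
        by (simp add: o_def mult_scaleR_right3 has_vector_derivative_at_within)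
      show "y *\<^sub>R be (s * y) l \<in> su3"
        using be_su3[OF l, of "s * y"] by (simp add: su3_def adjoint_scaleR trace_scaleR3)
    qed (auto simp: H0 SU3_mat1)
    then show ?thesis by simp
  qed
  have "H y ** al y l ** adjoint_mat (H y) = H 0 ** al 0 l ** adjoint_mat (H 0)" for y
  proof -
    have d: "((\<lambda>y. H y ** al y l ** adjoint_mat (H y)) has_vector_derivative 0) (at y)" for y
    proof -
      have lz: "l \<noteq> 0" using l by auto
      have "((\<lambda>y. H y ** al y l ** adjoint_mat (H y)) has_vector_derivative
        H y ** al y l ** adjoint_mat (H y ** be y l)
        + (H y ** (al y l ** be y l - be y l ** al y l) + H y ** be y l ** al y l) ** adjoint_mat (H y)) (at y)"
        by (intro mult3_has_vector_derivative adjoint_has_vector_derivative H al_lax[OF lz])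
      moreover have "adjoint_mat (be y l) = - be y l" using be_su3[OF l] by (simp add: su3_def)
      ultimately show ?thesis by (simp add: adjoint_mult mat_distrib)
    qed
    obtain c where "\<And>y. H y ** al y l ** adjoint_mat (H y) = c"
      using has_vector_derivative_zero_constant[of UNIV "\<lambda>y. H y ** al y l ** adjoint_mat (H y)"] d by auto
    then show ?thesis by simp
  qed
  then have c: "H y ** al y l ** adjoint_mat (H y) = al 0 l" for y by (simp add: H0)
  have "al 0 l ** H y = H y ** al y l" for y
    unfolding c[of y, symmetric] using SU3_adj(1)[OF HU[of y]] by (simp add: mult_assoc3)
  then show ?thesis using H0 H HU by blast
qed

lemma conf_derivative: "(conf has_derivative (\<lambda>h. Re h *\<^sub>R 0 + Im h *\<^sub>R V (Im z))) (at z)"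
proof -
  have "(U has_derivative (\<lambda>h. V (Im z) * h)) (at (Im z))"
    using dU[of "Im z"] by (simp add: has_field_derivative_def)
  from has_derivative_compose[OF has_derivative_Im[OF has_derivative_ident] this]
  show ?thesis by (simp add: conf_def[abs_def] mult.commute)
qed

lemma V_derivative: "((\<lambda>z. V (Im z)) has_derivative (\<lambda>h. Re h *\<^sub>R 0 + Im h *\<^sub>R
    (4 *\<^sub>R ((cmod \<psi>)\<^sup>2 *\<^sub>R exp (- 2 * conf z) + - exp (1 * conf z))))) (at z)"
proof -
  have "(V has_derivative (\<lambda>h. 4 * ((cmod \<psi>)\<^sup>2 * exp (- 2 * U (Im z)) - exp (U (Im z))) * h)) (at (Im z))"
    using dV[of "Im z"] by (simp add: has_field_derivative_def)
  from has_derivative_compose[OF has_derivative_Im[OF has_derivative_ident] this]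
  show ?thesis by (simp add: conf_def mult_ac)
qed

lemma smooth_conf: "smooth_on T conf" and smooth_V: "smooth_on T (\<lambda>z. V (Im z))"
proof -
  have "Ck_on k UNIV conf \<and> Ck_on k UNIV (\<lambda>z. V (Im z))" for k
  proof (induction k)
    case 0
    then show ?case using conf_derivative V_derivative
      by (auto intro!: continuous_at_imp_continuous_on has_derivative_continuous)
  next
    case (Suc k)
    have "Ck_on k UNIV (\<lambda>z. 4 *\<^sub>R ((cmod \<psi>)\<^sup>2 *\<^sub>R exp (- 2 * conf z) + - exp (1 * conf z)))"
      using Suc
      by (intro Ck_on_bounded_linear[OF open_UNIV bounded_linear_scaleR_right] Ck_on_add[OF open_UNIV] Ck_on_exp[OF open_UNIV]
          Ck_on_bounded_linear[OF open_UNIV bounded_linear_minus[OF bounded_linear_ident]]) auto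
    then show ?case
      using Ck_on_dxdyI[OF open_UNIV conf_derivative Ck_on_const conjunct2[OF Suc]]
        Ck_on_dxdyI[OF open_UNIV V_derivative Ck_on_const] by blast
  qed
  then show "smooth_on T conf" "smooth_on T (\<lambda>z. V (Im z))"
    using smooth_on_subset[of UNIV _ T] by (auto simp: smooth_on_def)
qed

lemma smooth_pot:
  assumes "smooth_on UNIV s" "smooth_on UNIV f" "smooth_on UNIV g" "smooth_on UNIV h" "smooth_on UNIV k"
  shows "smooth_on (UNIV :: complex set) (\<lambda>z. pot (s z) (f z) (g z) (h z) (k z) l)"
proof -
  have mc: "Ck_on n UNIV (\<lambda>z. c * w z)" if "Ck_on n UNIV w" for n c and w :: "complex \<Rightarrow> complex"
    by (rule Ck_on_bounded_linear[OF open_UNIV bounded_linear_mult_right that])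
  have mm: "Ck_on n UNIV (\<lambda>z. - w z)" if "Ck_on n UNIV w" for n and w :: "complex \<Rightarrow> complex"
    using mc[OF that, of "-1"] by simp
  have "Ck_on n UNIV (\<lambda>z. pot (s z) (f z) (g z) (h z) (k z) l)" for n
  proof (rule Ck_on_entries[OF open_UNIV])
    fix i j :: 3
    show "Ck_on n UNIV (\<lambda>z. pot (s z) (f z) (g z) (h z) (k z) l $ i $ j)"
      using exhaust_3[of i] exhaust_3[of j] assms unfolding smooth_on_def
      by (elim disjE) (auto simp: pot_nth intro: mc mm Ck_on_const)
  qed
  then show ?thesis by (simp add: smooth_on_def)
qed

lemma smooth_coeffs:
  "smooth_on UNIV (\<lambda>z. c * a (Im z))" "smooth_on UNIV (\<lambda>z. c * b (Im z))" "smooth_on UNIV (\<lambda>z. c * q (Im z))"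
  "smooth_on UNIV (\<lambda>z. c * of_real (V (Im z)))"
proof -
  have e: "smooth_on UNIV (\<lambda>z. d * complex_of_real (exp (x * conf z)))" for x d
    by (intro smooth_on_bounded_linear[OF open_UNIV bounded_linear_mult_right] smooth_on_of_real smooth_on_exp smooth_conf open_UNIV)
  show "smooth_on UNIV (\<lambda>z. c * a (Im z))"
    using e[of "c * \<i>" "1/2"] by (simp add: a_def conf_def mult.assoc)
  show "smooth_on UNIV (\<lambda>z. c * b (Im z))"
    using e[of "c * (- \<i> * \<psi>)" "- 1"] by (simp add: b_def conf_def mult.assoc)
  show "smooth_on UNIV (\<lambda>z. c * q (Im z))"
    using e[of "c * (- \<i> * cnj \<psi>)" "- 1"] by (simp add: q_def conf_def mult.assoc)
  show "smooth_on UNIV (\<lambda>z. c * of_real (V (Im z)))"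
    by (intro smooth_on_bounded_linear[OF open_UNIV bounded_linear_mult_right] smooth_on_of_real smooth_V open_UNIV)
qed

lemma smooth_al: "smooth_on UNIV (\<lambda>z. al (Im z) l)" and smooth_be: "smooth_on UNIV (\<lambda>z. be (Im z) l)"
proof -
  show "smooth_on UNIV (\<lambda>z. al (Im z) l)" unfolding al_def
    using smooth_coeffs[of 1] smooth_coeffs(4)[of "- \<i> / 2"] by (intro smooth_pot) simp_all
  show "smooth_on UNIV (\<lambda>z. be (Im z) l)" unfolding be_def
    using smooth_coeffs[of \<i>] smooth_coeffs[of "- \<i>"] by (intro smooth_pot smooth_on_const) simp_all
qed

text \<open>
  The frame is \<open>exp (x al\<^sub>0) H(y)\<close>. Its \<open>y\<close> derivative is prescribed by \<open>H\<close>, and its \<open>x\<close> derivative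
  \<open>exp (x al\<^sub>0) al\<^sub>0 H(y)\<close> has the right form because \<open>H\<close> intertwines \<open>al\<^sub>0\<close> and \<open>al\<close>.
\<close>

theorem frame_exists:
  obtains G where
    "\<And>l. l \<in> sphere 0 1 \<Longrightarrow> G 0 l = mat 1"
    "\<And>l z. l \<in> sphere 0 1 \<Longrightarrow> G z l \<in> SU3"
    "\<And>l t z. l \<in> sphere 0 1 \<Longrightarrow> G (of_real t + z) l = mat_exp (cscale (of_real t) (al 0 l)) ** G z l"
    "\<And>l z. l \<in> sphere 0 1 \<Longrightarrow> ((\<lambda>z. G z l) has_derivative
       (\<lambda>h. Re h *\<^sub>R (G z l ** al (Im z) l) + Im h *\<^sub>R (G z l ** be (Im z) l))) (at z)"
    "\<And>l. l \<in> sphere 0 1 \<Longrightarrow> smooth_on UNIV (\<lambda>z. G z l)"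
proof -
  obtain H where H: "\<forall>l\<in>sphere 0 1. H l 0 = mat 1 \<and> (\<forall>y. (H l has_vector_derivative H l y ** be y l) (at y))
      \<and> (\<forall>y. H l y \<in> SU3) \<and> (\<forall>y. al 0 l ** H l y = H l y ** al y l)"
    using vertical_frame by metis
  define X where "X l t = mat_exp (cscale (of_real t) (al 0 l))" for l and t :: real
  define G where "G z l = X l (Re z) ** H l (Im z)" for z l
  have dG: "((\<lambda>z. G z l) has_derivative
       (\<lambda>h. Re h *\<^sub>R (G z l ** al (Im z) l) + Im h *\<^sub>R (G z l ** be (Im z) l))) (at z)" if l: "l \<in> sphere 0 1" for l z
  proof -
    have "(X l has_vector_derivative al 0 l ** X l (Re z)) (at (Re z))"
      using mat_exp_derivative[of 1 "al 0 l" "Re z" UNIV] by (simp add: X_def[abs_def])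
    then have dX: "(X l has_derivative (\<lambda>h. h *\<^sub>R (al 0 l ** X l (Re z)))) (at (Re z))"
      by (simp add: has_vector_derivative_def)
    have dH: "(H l has_derivative (\<lambda>h. h *\<^sub>R (H l (Im z) ** be (Im z) l))) (at (Im z))"
      using H l by (simp add: has_vector_derivative_def)
    have "((\<lambda>z. X l (Re z) ** H l (Im z)) has_derivative
        (\<lambda>h. X l (Re z) ** (Im h *\<^sub>R (H l (Im z) ** be (Im z) l)) + (Re h *\<^sub>R (al 0 l ** X l (Re z))) ** H l (Im z))) (at z)"
      by (rule mult3_has_derivative[OF has_derivative_compose[OF has_derivative_Re[OF has_derivative_ident] dX]
            has_derivative_compose[OF has_derivative_Im[OF has_derivative_ident] dH]])
    moreover have "al 0 l ** X l (Re z) = X l (Re z) ** al 0 l"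
      unfolding X_def by (rule mat_exp_commute_cscale[symmetric])
    then have "al 0 l ** X l (Re z) ** H l (Im z) = G z l ** al (Im z) l"
      using H l by (simp add: G_def mult_assoc3)
    ultimately show ?thesis by (simp add: G_def[abs_def] mat_distrib add.commute)
  qed
  show thesis
  proof (rule that[of G])
    fix l :: complex assume l: "l \<in> sphere 0 1"
    show "G 0 l = mat 1" using H l by (simp add: G_def X_def)
    show "G z l \<in> SU3" for z unfolding G_def X_def using H l by (intro SU3_mult mat_exp_SU3 al_su3) auto
    show "G (of_real t + z) l = mat_exp (cscale (of_real t) (al 0 l)) ** G z l" for t z
      by (simp add: G_def X_def mat_exp_add mult_assoc3)
    show "((\<lambda>z. G z l) has_derivative
       (\<lambda>h. Re h *\<^sub>R (G z l ** al (Im z) l) + Im h *\<^sub>R (G z l ** be (Im z) l))) (at z)" for z by (rule dG[OF l])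
    show "smooth_on UNIV (\<lambda>z. G z l)"
      by (rule smooth_on_linear_system[OF open_UNIV dG[OF l] smooth_al smooth_be])
  qed
qed

lemma lax_conf:
  "lax_z conf (\<lambda>_. \<psi>) l z = cscale (1/2) (al (Im z) l - cscale \<i> (be (Im z) l))"
  "lax_zbar conf (\<lambda>_. \<psi>) l z = cscale (1/2) (al (Im z) l + cscale \<i> (be (Im z) l))"
proof -
  have d: "conf differentiable (at z)" using conf_derivative by (auto simp: differentiable_def)
  note L = dx_dy_bounded_linear[OF bounded_linear_of_real[where 'a = complex] d]
  have "d_z (\<lambda>w. complex_of_real (conf w)) z = - \<i> * of_real (V (Im z)) / 2"
    "d_zbar (\<lambda>w. complex_of_real (conf w)) z = \<i> * of_real (V (Im z)) / 2"
    using dx_dy_eqI[OF conf_derivative] by (simp_all add: d_z_def d_zbar_def L)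
  then show "lax_z conf (\<lambda>_. \<psi>) l z = cscale (1/2) (al (Im z) l - cscale \<i> (be (Im z) l))"
    "lax_zbar conf (\<lambda>_. \<psi>) l z = cscale (1/2) (al (Im z) l + cscale \<i> (be (Im z) l))"
    unfolding lax_z_pot lax_zbar_pot al_def be_def
    by (simp_all add: mat_eq3_iff forall_3 pot_nth cscale_nth)
      (simp_all add: a_def b_def q_def conf_def algebra_simps)
qed

end

section \<open>The surface of a frame\<close>

definition E3 :: "complex^3^3" where
  "E3 = outer (axis 3 1) (axis 3 1)"

lemma E3_nth:
  "E3 $ 1 $ 1 = 0" "E3 $ 1 $ 2 = 0" "E3 $ 1 $ 3 = 0" "E3 $ 2 $ 1 = 0" "E3 $ 2 $ 2 = 0" "E3 $ 2 $ 3 = 0"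
  "E3 $ 3 $ 1 = 0" "E3 $ 3 $ 2 = 0" "E3 $ 3 $ 3 = 1"
  by (simp_all add: E3_def outer_nth axis_def)

text \<open>
  In the moving frame \<open>G\<close>, differentiation becomes a commutator with the Maurer-Cartan form plus the
  derivative of the representing matrix. This reduces the geometry of the surface to matrices at the
  base point.
\<close>

lemma conj_frame_derivative:
  fixes G N :: "complex \<Rightarrow> complex^3^3"
  assumes G: "(G has_derivative (\<lambda>h. Re h *\<^sub>R (G z ** \<alpha>) + Im h *\<^sub>R (G z ** \<beta>))) (at z)"
    and su: "adjoint_mat \<alpha> = - \<alpha>" "adjoint_mat \<beta> = - \<beta>" and N: "N differentiable (at z)"
  shows "dx (\<lambda>w. G w ** N w ** adjoint_mat (G w)) z = G z ** (\<alpha> ** N z - N z ** \<alpha> + dx N z) ** adjoint_mat (G z)"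
    and "dy (\<lambda>w. G w ** N w ** adjoint_mat (G w)) z = G z ** (\<beta> ** N z - N z ** \<beta> + dy N z) ** adjoint_mat (G z)"
    and "(\<lambda>w. G w ** N w ** adjoint_mat (G w)) differentiable (at z)"
proof -
  have d: "((\<lambda>w. G w ** N w ** adjoint_mat (G w)) has_derivative
    (\<lambda>h. G z ** N z ** adjoint_mat (Re h *\<^sub>R (G z ** \<alpha>) + Im h *\<^sub>R (G z ** \<beta>))
      + (G z ** (Re h *\<^sub>R dx N z + Im h *\<^sub>R dy N z) + (Re h *\<^sub>R (G z ** \<alpha>) + Im h *\<^sub>R (G z ** \<beta>)) ** N z) ** adjoint_mat (G z))) (at z)"
    by (intro mult3_has_derivative bounded_linear.has_derivative[OF bounded_linear_adjoint] G has_derivative_dx_dy N)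
  have "((\<lambda>w. G w ** N w ** adjoint_mat (G w)) has_derivative
    (\<lambda>h. Re h *\<^sub>R (G z ** (\<alpha> ** N z - N z ** \<alpha> + dx N z) ** adjoint_mat (G z))
       + Im h *\<^sub>R (G z ** (\<beta> ** N z - N z ** \<beta> + dy N z) ** adjoint_mat (G z)))) (at z)"
    by (rule has_derivative_eq_rhs[OF d])
       (simp add: fun_eq_iff adjoint_simps su mat_distrib, simp add: algebra_simps)
  then show "dx (\<lambda>w. G w ** N w ** adjoint_mat (G w)) z = G z ** (\<alpha> ** N z - N z ** \<alpha> + dx N z) ** adjoint_mat (G z)"
    and "dy (\<lambda>w. G w ** N w ** adjoint_mat (G w)) z = G z ** (\<beta> ** N z - N z ** \<beta> + dy N z) ** adjoint_mat (G z)"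
    and "(\<lambda>w. G w ** N w ** adjoint_mat (G w)) differentiable (at z)"
    by (auto intro: dx_dy_eqI simp: differentiable_def)
qed

context gauss_solution
begin

text \<open>
  The Wirtinger derivatives of the surface, moved to the base point by the frame.
\<close>

definition NA :: "real \<Rightarrow> complex^3^3" where
  "NA y = vector [vector [0, 0, a y], vector [0, 0, 0], vector [0, - a y, 0]]"

definition NB :: "real \<Rightarrow> complex^3^3" where
  "NB y = vector [vector [0, 0, 0], vector [0, 0, a y], vector [- a y, 0, 0]]"

lemma NA_nth: "NA y $ 1 $ 1 = 0" "NA y $ 1 $ 2 = 0" "NA y $ 1 $ 3 = a y"
  "NA y $ 2 $ 1 = 0" "NA y $ 2 $ 2 = 0" "NA y $ 2 $ 3 = 0"
  "NA y $ 3 $ 1 = 0" "NA y $ 3 $ 2 = - a y" "NA y $ 3 $ 3 = 0"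
  by (simp_all add: NA_def)

lemma NB_nth: "NB y $ 1 $ 1 = 0" "NB y $ 1 $ 2 = 0" "NB y $ 1 $ 3 = 0"
  "NB y $ 2 $ 1 = 0" "NB y $ 2 $ 2 = 0" "NB y $ 2 $ 3 = a y"
  "NB y $ 3 $ 1 = - a y" "NB y $ 3 $ 2 = 0" "NB y $ 3 $ 3 = 0"
  by (simp_all add: NB_def)

lemma tangent_matrices:
  "al y 1 ** E3 - E3 ** al y 1 = NA y + NB y"
  "be y 1 ** E3 - E3 ** be y 1 = cscale \<i> (NA y - NB y)"
  by (simp_all add: mat_eq3_iff forall_3 mult_nth3 E3_nth al_def be_def pot_nth NA_nth NB_nth cscale_nth)

lemma NA_derivative: "((\<lambda>z. NA (Im z)) has_derivative (\<lambda>h. Re h *\<^sub>R 0 + Im h *\<^sub>R cscale (of_real (V (Im z)) / 2) (NA (Im z)))) (at z)"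
proof (rule has_derivative_entries)
  fix i j :: 3
  have "(a has_derivative (\<lambda>h. h *\<^sub>R (a (Im z) * of_real (V (Im z)) / 2))) (at (Im z))"
    using da by (simp add: has_vector_derivative_def)
  from has_derivative_compose[OF has_derivative_Im[OF has_derivative_ident] this]
  have 1: "((\<lambda>z. a (Im z)) has_derivative (\<lambda>h. Im h *\<^sub>R (a (Im z) * of_real (V (Im z)) / 2))) (at z)" .
  have 2: "((\<lambda>z. - a (Im z)) has_derivative (\<lambda>h. - (Im h *\<^sub>R (a (Im z) * of_real (V (Im z)) / 2)))) (at z)"
    by (rule has_derivative_minus[OF 1])
  show "((\<lambda>z. NA (Im z) $ i $ j) has_derivative
      (\<lambda>h. (Re h *\<^sub>R 0 + Im h *\<^sub>R cscale (of_real (V (Im z)) / 2) (NA (Im z))) $ i $ j)) (at z)"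
    using exhaust_3[of i] exhaust_3[of j] 1 2 by (elim disjE) (simp_all add: NA_nth cscale_nth mult_ac)
qed

text \<open>
  The moved second derivatives of the surface. The mixed one is block diagonal with respect to \<open>E3\<close>,
  hence normal to the projective plane, which is minimality; the pure one contains the cubic
  coefficient.
\<close>

lemma second_derivative_matrices:
  "cscale (1/2) ((al y 1 ** NA y - NA y ** al y 1)
      + cscale \<i> (be y 1 ** NA y - NA y ** be y 1 + cscale (of_real (V y) / 2) (NA y)))
    = cscale (of_real (exp (U y))) (mat 1 - cscale 3 E3)"
  "trace (E3 ** (NA y ** cscale (1/2) ((al y 1 ** NA y - NA y ** al y 1)
      - cscale \<i> (be y 1 ** NA y - NA y ** be y 1 + cscale (of_real (V y) / 2) (NA y))))) = - \<i> * \<psi>"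
proof -
  have e: "of_real (exp (U y)) = - (a y * a y)" by (simp add: aa)
  have ab: "a y * (a y * b y) = \<i> * \<psi>"
  proof -
    have "a y * (a y * b y) = (a y * a y) * b y" by (simp only: mult.assoc)
    also have "\<dots> = \<i> * \<psi> * (of_real (exp (U y)) * of_real (exp (- U y)))" by (simp add: aa b_def)
    also have "of_real (exp (U y)) * of_real (exp (- U y)) = (1 :: complex)"
      by (simp only: of_real_mult[symmetric] exp_add[symmetric]) simp
    finally show ?thesis by simp
  qed
  show "cscale (1/2) ((al y 1 ** NA y - NA y ** al y 1)
      + cscale \<i> (be y 1 ** NA y - NA y ** be y 1 + cscale (of_real (V y) / 2) (NA y)))
    = cscale (of_real (exp (U y))) (mat 1 - cscale 3 E3)"
    unfolding e by (simp add: mat_eq3_iff forall_3 mult_nth3 E3_nth al_def be_def pot_nth NA_nth cscale_nth mat1_nth)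
      (simp add: algebra_simps)?
  show "trace (E3 ** (NA y ** cscale (1/2) ((al y 1 ** NA y - NA y ** al y 1)
      - cscale \<i> (be y 1 ** NA y - NA y ** be y 1 + cscale (of_real (V y) / 2) (NA y))))) = - \<i> * \<psi>"
    using ab by (simp add: trace3 mult_nth3 E3_nth al_def be_def pot_nth NA_nth cscale_nth algebra_simps)
qed

lemma U1_axis: "k \<in> U1 \<Longrightarrow> k *v axis 3 1 = axis 3 1"
  using U1_entries(1)[of k] by (auto simp: vec_eq_iff forall_3 matrix_vector_nth3 axis_def) (metis diag3_nth)+

text \<open>
  After moving to the base point, all conditions on the surface are identities between the matrices
  computed before. Multiplying the frame by \<open>k\<^sup>*\<close> from the left and gauging it by \<open>k\<close> from the right keeps
  it the identity at 0 and realises all initial data which the normalisation allows.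
\<close>

theorem surface_exists:
  assumes k: "k \<in> U1"
  obtains F f' \<rho> where
    "conformal_minimal_lagrangian UNIV conf f'" "translationally_equivariant UNIV f'"
    "equivariant_frame UNIV conf f' F \<rho>"
    "f' 0 = adjoint_mat k ** E3 ** k" "mat_d_z f' 0 = adjoint_mat k ** NA 0 ** k"
    "\<And>z. hopf f' z = - \<i> * \<psi>"
proof -
  obtain G0 where G00: "\<And>l. l \<in> sphere 0 1 \<Longrightarrow> G0 0 l = mat 1"
    and G0U: "\<And>l z. l \<in> sphere 0 1 \<Longrightarrow> G0 z l \<in> SU3"
    and G0t: "\<And>l t z. l \<in> sphere 0 1 \<Longrightarrow> G0 (of_real t + z) l = mat_exp (cscale (of_real t) (al 0 l)) ** G0 z l"
    and G0d: "\<And>l z. l \<in> sphere 0 1 \<Longrightarrow> ((\<lambda>z. G0 z l) has_derivative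
       (\<lambda>h. Re h *\<^sub>R (G0 z l ** al (Im z) l) + Im h *\<^sub>R (G0 z l ** be (Im z) l))) (at z)"
    and G0s: "\<And>l. l \<in> sphere 0 1 \<Longrightarrow> smooth_on UNIV (\<lambda>z. G0 z l)"
    using frame_exists by blast
  have kU: "k \<in> SU3" "adjoint_mat k \<in> SU3" using U1_SU3[OF k] SU3_adjoint by auto
  have k1: "k ** adjoint_mat k = mat 1" "adjoint_mat k ** k = mat 1" using SU3_adj[OF kU(1)] by auto
  define G where "G z l = adjoint_mat k ** G0 z l" for z l
  define F where "F z l = G z l ** k" for z l
  define \<rho> where "\<rho> t l = mat_exp (cscale (of_real t) (adjoint_mat k ** al 0 l ** k))" for t :: real and l
  define f' where "f' z = cp_point (F z 1 *v axis 3 1)" for z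
  have one: "1 \<in> sphere (0::complex) 1" by simp
  have GU: "G z l \<in> SU3" if "l \<in> sphere 0 1" for z l unfolding G_def using kU(2) G0U[OF that] by (rule SU3_mult)
  have Gd: "((\<lambda>z. G z l) has_derivative (\<lambda>h. Re h *\<^sub>R (G z l ** al (Im z) l) + Im h *\<^sub>R (G z l ** be (Im z) l))) (at z)"
    if "l \<in> sphere 0 1" for z l
    using bounded_linear.has_derivative[OF bounded_bilinear.bounded_linear_right[OF bounded_bilinear_mult3] G0d[OF that], of "adjoint_mat k"]
    by (simp add: G_def mat_distrib)
  have Gs: "smooth_on UNIV (\<lambda>z. G z l)" if "l \<in> sphere 0 1" for l
    unfolding G_def by (intro smooth_on_mult3 smooth_on_const G0s that open_UNIV)
  have F0: "F 0 l = mat 1" if "l \<in> sphere 0 1" for l by (simp add: F_def G_def G00[OF that] k1)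
  have \<rho>1: "one_param_subgroup (\<lambda>t. \<rho> t l)" if "l \<in> sphere 0 1" for l
    unfolding \<rho>_def
  proof (rule one_param_subgroup_exp)
    show "adjoint_mat k ** al 0 l ** k \<in> su3"
      using al_su3[OF that, of 0] trace_conj[OF kU(2), of "al 0 l"]
      by (simp add: su3_def adjoint_mult mat_distrib)
  qed
  have F\<rho>: "F (of_real t + z) l = \<rho> t l ** F z l" if "l \<in> sphere 0 1" for t z l
  proof -
    have "\<rho> t l ** F z l = adjoint_mat k ** mat_exp (cscale (of_real t) (al 0 l)) ** (k ** adjoint_mat k) ** G0 z l ** k"
      unfolding \<rho>_def mat_exp_conj[OF k1(2)] F_def G_def by (simp only: mult_assoc3)
    then show ?thesis by (simp add: k1 F_def G_def G0t[OF that] mult_assoc3)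
  qed
  define G1 where "G1 z = G z 1" for z
  have G1U: "G1 z \<in> SU3" for z unfolding G1_def by (rule GU[OF one])
  have G1d: "(G1 has_derivative (\<lambda>h. Re h *\<^sub>R (G1 z ** al (Im z) 1) + Im h *\<^sub>R (G1 z ** be (Im z) 1))) (at z)" for z
    using Gd[OF one] by (simp add: G1_def[abs_def])
  have G1s: "smooth_on UNIV G1" using Gs[OF one] by (simp add: G1_def[abs_def])
  have nax: "norm (axis 3 1 :: complex^3) = 1" by (simp add: norm_axis_1)
  have F1: "F z 1 *v axis 3 1 = G1 z *v axis 3 1" for z
    unfolding F_def matrix_vector_mul_assoc[symmetric] U1_axis[OF k] G1_def ..
  have f'_eq: "f' z = G1 z ** E3 ** adjoint_mat (G1 z)" for z
    unfolding f'_def F1 using SU3_norm[OF G1U, of z "axis 3 1"] nax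
    by (simp add: cp_point_unit outer_matrix E3_def)
  have su: "adjoint_mat (al y 1) = - al y 1" "adjoint_mat (be y 1) = - be y 1" for y
    using al_su3[OF one] be_su3[OF one] by (simp_all add: su3_def)
  have f'_fun: "f' = (\<lambda>z. G1 z ** E3 ** adjoint_mat (G1 z))" using f'_eq by blast
  have dc0: "dx (\<lambda>w. E3) z = 0" "dy (\<lambda>w. E3) z = 0" for z by (simp_all add: dx_def dy_def)
  have fd: "f' differentiable (at z)" for z
    unfolding f'_fun by (rule conj_frame_derivative(3)[OF G1d su differentiable_const])
  have fx: "dx f' z = G1 z ** (NA (Im z) + NB (Im z)) ** adjoint_mat (G1 z)"
    and fy: "dy f' z = G1 z ** cscale \<i> (NA (Im z) - NB (Im z)) ** adjoint_mat (G1 z)" for z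
    unfolding f'_fun using conj_frame_derivative(1,2)[OF G1d su differentiable_const[of E3]]
    by (simp_all add: dc0 tangent_matrices)
  have fA: "mat_d_z f' z = G1 z ** NA (Im z) ** adjoint_mat (G1 z)" for z
    unfolding mat_d_z_eq[OF fd] fx fy by (simp add: mat_distrib cscale_diff cscale_add) (simp add: mat_eq3_iff cscale_nth)
  have NAd: "(\<lambda>z. NA (Im z)) differentiable (at z)" for z using NA_derivative by (auto simp: differentiable_def)
  note NAxy = dx_dy_eqI[OF NA_derivative]
  have A_fun: "mat_d_z f' = (\<lambda>z. G1 z ** NA (Im z) ** adjoint_mat (G1 z))" using fA by blast
  have Ad: "(\<lambda>z. G1 z ** NA (Im z) ** adjoint_mat (G1 z)) differentiable (at z)" for z
    by (rule conj_frame_derivative(3)[OF G1d su NAd])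
  have Axy: "dx (\<lambda>z. G1 z ** NA (Im z) ** adjoint_mat (G1 z)) z
      = G1 z ** (al (Im z) 1 ** NA (Im z) - NA (Im z) ** al (Im z) 1) ** adjoint_mat (G1 z)"
    "dy (\<lambda>z. G1 z ** NA (Im z) ** adjoint_mat (G1 z)) z
      = G1 z ** (be (Im z) 1 ** NA (Im z) - NA (Im z) ** be (Im z) 1 + cscale (of_real (V (Im z)) / 2) (NA (Im z))) ** adjoint_mat (G1 z)" for z
    using conj_frame_derivative(1,2)[OF G1d su NAd, of z] by (simp_all add: NAxy)
  have conj_lin: "cscale (1/2) (G1 z ** X ** adjoint_mat (G1 z) + cscale \<i> (G1 z ** Y ** adjoint_mat (G1 z)))
      = G1 z ** cscale (1/2) (X + cscale \<i> Y) ** adjoint_mat (G1 z)"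
    "cscale (1/2) (G1 z ** X ** adjoint_mat (G1 z) - cscale \<i> (G1 z ** Y ** adjoint_mat (G1 z)))
      = G1 z ** cscale (1/2) (X - cscale \<i> Y) ** adjoint_mat (G1 z)" for X Y z
    by (simp_all only: mat_distrib cscale_add cscale_diff)
  have Qz: "mat_d_zbar (mat_d_z f') z = G1 z ** cscale (of_real (exp (U (Im z)))) (mat 1 - cscale 3 E3) ** adjoint_mat (G1 z)" for z
    unfolding A_fun mat_d_z_eq(2)[OF Ad] Axy conj_lin second_derivative_matrices(1) ..
  have hopf: "hopf f' z = - \<i> * \<psi>" for z
  proof -
    have "hopf f' z = trace (E3 ** (NA (Im z) ** cscale (1/2) ((al (Im z) 1 ** NA (Im z) - NA (Im z) ** al (Im z) 1)
      - cscale \<i> (be (Im z) 1 ** NA (Im z) - NA (Im z) ** be (Im z) 1 + cscale (of_real (V (Im z)) / 2) (NA (Im z))))))"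
      unfolding hopf_def A_fun mat_d_z_eq(1)[OF Ad] Axy conj_lin f'_eq by (simp only: conj_mult[OF G1U] trace_conj[OF G1U])
    then show ?thesis by (simp only: second_derivative_matrices(2))
  qed
  have f's: "smooth_on UNIV f'" unfolding f'_fun
    by (intro smooth_on_mult3 smooth_on_const G1s open_UNIV smooth_on_bounded_linear[OF open_UNIV bounded_linear_adjoint])
  have metric: "fs_metric (G1 z ** X ** adjoint_mat (G1 z)) (G1 z ** Y ** adjoint_mat (G1 z)) = fs_metric X Y" for X Y z
    unfolding fs_metric_def by (simp only: conj_mult[OF G1U] trace_conj[OF G1U])
  have J: "fs_J (f' z) (G1 z ** X ** adjoint_mat (G1 z)) = G1 z ** fs_J E3 X ** adjoint_mat (G1 z)" for X z
    unfolding fs_J_def f'_eq conj_mult[OF G1U] by (simp only: mat_distrib cscale_diff)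
  have Re_aa: "Re (a y * a y) = - exp (U y)" "Im (a y * a y) = 0" for y unfolding aa by simp_all
  have cml: "conformal_minimal_lagrangian UNIV conf f'"
    unfolding conformal_minimal_lagrangian_def
  proof (intro conjI ballI smooth_conf f's)
    fix z
    show "f' z \<in> CP2"
    proof -
      have "norm (F z 1 *v axis 3 1) = 1" unfolding F1 SU3_norm[OF G1U] by (rule nax)
      then have "F z 1 *v axis 3 1 \<noteq> 0" by auto
      then show ?thesis unfolding f'_def CP2_def by blast
    qed
    show "fs_metric (dx f' z) (dx f' z) = 2 * exp (conf z)"
      unfolding fx metric using Re_aa[of "Im z"]
      by (simp add: fs_metric_def trace3 mult_nth3 NA_nth NB_nth conf_def)
    show "fs_metric (dy f' z) (dy f' z) = 2 * exp (conf z)"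
      unfolding fy metric using Re_aa[of "Im z"]
      by (simp add: fs_metric_def trace3 mult_nth3 NA_nth NB_nth conf_def cscale_nth)
    show "fs_metric (dx f' z) (dy f' z) = 0"
      unfolding fx fy metric using Re_aa[of "Im z"]
      by (simp add: fs_metric_def trace3 mult_nth3 NA_nth NB_nth conf_def cscale_nth)
    show "kaehler_form (f' z) (dx f' z) (dy f' z) = 0"
      unfolding kaehler_form_def fx fy J metric using Re_aa[of "Im z"]
      by (simp add: fs_metric_def fs_J_def trace3 mult_nth3 NA_nth NB_nth conf_def cscale_nth E3_nth)
    have "cp_tangential (f' z) (dx (dx f') z + dy (dy f') z) = 0"
    proof -
      define c where "c = 4 * complex_of_real (exp (U (Im z)))"
      have m1: "mat 1 = G1 z ** mat 1 ** adjoint_mat (G1 z)" using SU3_adj(2)[OF G1U] by simp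
      have "dx (dx f') z + dy (dy f') z = G1 z ** cscale c (mat 1 - cscale 3 E3) ** adjoint_mat (G1 z)"
        unfolding mat_d_mixed(2)[OF open_UNIV f's UNIV_I, symmetric] Qz
        by (simp add: mult_cscale_left mult_cscale_right c_def)
      moreover have "mat 1 - f' z = G1 z ** (mat 1 - E3) ** adjoint_mat (G1 z)"
        unfolding f'_eq by (subst m1) (simp only: mat_distrib)
      ultimately have "cp_tangential (f' z) (dx (dx f') z + dy (dy f') z)
          = G1 z ** (E3 ** cscale c (mat 1 - cscale 3 E3) ** (mat 1 - E3)
             + (mat 1 - E3) ** cscale c (mat 1 - cscale 3 E3) ** E3) ** adjoint_mat (G1 z)"
        unfolding cp_tangential_def
        by (simp only: f'_eq conj_mult[OF G1U]) (simp only: mat_distrib)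
      moreover have "E3 ** cscale c (mat 1 - cscale 3 E3) ** (mat 1 - E3)
             + (mat 1 - E3) ** cscale c (mat 1 - cscale 3 E3) ** E3 = 0"
        by (simp add: mat_eq3_iff forall_3 mult_nth3 E3_nth cscale_nth mat1_nth)
      ultimately show ?thesis by simp
    qed
    then show "mean_curvature f' z = 0" by (simp add: mean_curvature_def Let_def fs_metric_def)
  qed
  have ef: "extended_frame UNIV conf f' F"
    unfolding extended_frame_def
  proof (rule exI[of _ "\<lambda>_. \<psi>"], rule exI[of _ G], rule exI[of _ "\<lambda>_. k"], intro conjI ballI)
    show "(\<lambda>_. \<psi>) holomorphic_on UNIV" by simp
    show "smooth_on UNIV (\<lambda>_. k)" by (rule smooth_on_const)
    show "(\<lambda>_. k) ` UNIV \<subseteq> U1" using k by auto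
    show "F z l = G z l ** k" for z l by (simp add: F_def)
    show "f' z = cp_point (F z 1 *v axis 3 1)" for z by (simp add: f'_def)
    fix l :: complex assume l: "l \<in> sphere 0 1"
    show "smooth_on UNIV (\<lambda>z. G z l)" by (rule Gs[OF l])
    fix z
    show "G z l \<in> SU3" by (rule GU[OF l])
    have d: "(\<lambda>w. G w l) differentiable (at z)" by (rule smooth_on_differentiable[OF Gs[OF l] UNIV_I])
    note xy = dx_dy_eqI[OF Gd[OF l]]
    have inv: "matrix_inv (G z l) ** (G z l ** X) = X" for X
      using SL3_inv(2)[OF SU3_SL3[OF GU[OF l]]] by (metis matrix_mul_assoc matrix_mul_lid)
    have "mat_d_z (\<lambda>w. G w l) z = G z l ** lax_z conf (\<lambda>_. \<psi>) l z"
      "mat_d_zbar (\<lambda>w. G w l) z = G z l ** lax_zbar conf (\<lambda>_. \<psi>) l z"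
      unfolding mat_d_z_eq[OF d] xy lax_conf by (simp_all only: mat_distrib)
    then show "matrix_inv (G z l) ** mat_d_z (\<lambda>w. G w l) z = lax_z conf (\<lambda>_. \<psi>) l z"
      "matrix_inv (G z l) ** mat_d_zbar (\<lambda>w. G w l) z = lax_zbar conf (\<lambda>_. \<psi>) l z"
      by (simp_all only: inv)
  qed
  have eqf: "equivariant_frame UNIV conf f' F \<rho>"
    unfolding equivariant_frame_def using ef F0 \<rho>1 F\<rho> by blast
  have te: "translationally_equivariant UNIV f'"
    unfolding translationally_equivariant_def
  proof (intro exI conjI allI ballI)
    show "one_param_subgroup (\<lambda>t. \<rho> t 1)" by (rule \<rho>1[OF one])
    fix t z
    have "\<rho> t 1 \<in> SU3" using \<rho>1[OF one] by (auto simp: one_param_subgroup_def)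
    then show "f' (of_real t + z) = cp_act (\<rho> t 1) (f' z)"
      unfolding f'_def F\<rho>[OF one] matrix_vector_mul_assoc[symmetric] by (rule cp_point_SU3)
  qed
  have G10: "G1 0 = adjoint_mat k" by (simp add: G1_def G_def G00[OF one])
  show thesis
    by (rule that[OF cml te eqf _ _ hopf]) (simp_all add: f'_eq fA G10)
qed

end

section \<open>Congruence of surfaces with the same invariants\<close>

text \<open>
  The norm is bounded on the compact set of pairs of a time and a unit vector.
\<close>

lemma linear_family_bound:
  fixes T :: "real \<Rightarrow> 'a::euclidean_space \<Rightarrow> 'b::real_normed_vector"
  assumes cont: "continuous_on ({0..1} \<times> UNIV) (\<lambda>(s, x). T s x)"
    and lin: "\<And>s. linear (T s)"
  obtains C where "\<And>s x. s \<in> {0..1} \<Longrightarrow> norm (T s x) \<le> C * norm x"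
proof -
  have "compact ((\<lambda>(s, x). T s x) ` ({0..1} \<times> sphere 0 1))"
    by (intro compact_continuous_image continuous_on_subset[OF cont] compact_Times) auto
  then obtain C where C: "\<And>y. y \<in> (\<lambda>(s, x). T s x) ` ({0..1} \<times> sphere 0 1) \<Longrightarrow> norm y \<le> C"
    using compact_imp_bounded bounded_iff by metis
  have "norm (T s x) \<le> C * norm x" if s: "s \<in> {0..1}" for s x
  proof (cases "x = 0")
    case True then show ?thesis using linear_0[OF lin] by simp
  next
    case False
    define y where "y = inverse (norm x) *\<^sub>R x"
    have "norm y = 1" using False by (simp add: y_def)
    then have "norm (T s y) \<le> C" using C[of "T s y"] s by force
    moreover have "T s x = norm x *\<^sub>R T s y"
      using False linear_scale[OF lin, of s "inverse (norm x)" x] by (simp add: y_def)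
    ultimately show ?thesis using False by (simp add: mult.commute mult_left_mono)
  qed
  then show thesis using that by blast
qed

lemma radial_derivative:
  assumes "F differentiable (at (of_real s * z))"
  shows "((\<lambda>s. F (of_real s * z)) has_vector_derivative
     cscale z (mat_d_z F (of_real s * z)) + cscale (cnj z) (mat_d_zbar F (of_real s * z))) (at s within T)"
proof -
  have "Re z *\<^sub>R X + Im z *\<^sub>R Y = cscale z (cscale (1/2) (X - cscale \<i> Y)) + cscale (cnj z) (cscale (1/2) (X + cscale \<i> Y))" for X Y
  proof -
    have r: "(z + cnj z) / 2 = of_real (Re z)" "- \<i> * (z - cnj z) / 2 = of_real (Im z)"
      by (simp_all add: complex_eq_iff)
    have "cscale z (cscale (1/2) (X - cscale \<i> Y)) + cscale (cnj z) (cscale (1/2) (X + cscale \<i> Y))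
        = cscale ((z + cnj z) / 2) X + cscale (- \<i> * (z - cnj z) / 2) Y"
      by (simp add: mat_eq3_iff cscale_nth field_simps)
    then show ?thesis by (simp only: r cscale_of_real)
  qed
  then show ?thesis using line_derivative[of F 0 s z T] assms by (simp add: mat_d_z_eq)
qed

text \<open>
  By the structure equations, all derivatives of \<open>P\<close> and \<open>A\<close> are polynomials in \<open>P\<close>, \<open>A\<close> and \<open>B = A\<^sup>*\<close> with
  coefficients that the two surfaces share. So along a segment from 0 the differences solve a homogeneous linear
  system, and Gronwall's inequality forces them to vanish.
\<close>

theorem minimal_lagrangian_congruence:
  assumes S: "open S" "convex S" "0 \<in> S"
    and cml: "conformal_minimal_lagrangian S u f" "conformal_minimal_lagrangian S u f'"
    and hopf: "\<And>z. z \<in> S \<Longrightarrow> hopf f z = hopf f' z"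
    and init: "f 0 = f' 0" "mat_d_z f 0 = mat_d_z f' 0" and z: "z \<in> S"
  shows "f z = f' z"
proof -
  have us: "smooth_on S u" and fs: "smooth_on S f" and fs': "smooth_on S f'"
    using cml by (auto simp: conformal_minimal_lagrangian_def)
  define \<gamma> where "\<gamma> s = complex_of_real s * z" for s
  have \<gamma>S: "\<gamma> s \<in> S" if "s \<in> {0..1}" for s
  proof -
    have "(1 - s) *\<^sub>R 0 + s *\<^sub>R z \<in> S" using S z that by (intro convexD) auto
    then show ?thesis by (simp add: \<gamma>_def scaleR_conv_of_real)
  qed
  have \<gamma>c: "continuous_on {0..1} \<gamma>" unfolding \<gamma>_def by (intro continuous_intros)
  have path: "continuous_on {0..1} (\<lambda>s. h (\<gamma> s))" if "smooth_on S h" for h :: "complex \<Rightarrow> 'x::real_normed_vector"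
    by (rule continuous_on_compose2[OF smooth_on_continuous[OF that] \<gamma>c]) (use \<gamma>S in auto)
  define A where "A = mat_d_z f"
  define B where "B = mat_d_zbar f"
  define A' where "A' = mat_d_z f'"
  define B' where "B' = mat_d_zbar f'"
  define g where "g = d_z (\<lambda>w. complex_of_real (u w))"
  define E where "E w = complex_of_real (exp (1 * u w))" for w
  define c where "c w = hopf f w / E w" for w
  note sm = smooth_on_mat_d[OF S(1) fs, folded A_def B_def] smooth_on_mat_d[OF S(1) fs', folded A'_def B'_def]
  have gs: "smooth_on S g" unfolding g_def by (intro smooth_on_d_z smooth_on_of_real S us)
  have Es: "smooth_on S E" unfolding E_def by (intro smooth_on_of_real smooth_on_exp S us)
  have Ec: "continuous_on {0..1} (\<lambda>s. E (\<gamma> s))" and gc: "continuous_on {0..1} (\<lambda>s. g (\<gamma> s))"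
    by (rule path[OF Es], rule path[OF gs])
  have cc: "continuous_on {0..1} (\<lambda>s. c (\<gamma> s))"
    unfolding c_def by (intro continuous_intros path[OF smooth_on_hopf[OF S(1) fs]] Ec) (simp add: E_def)
  note st = minimal_lagrangian_structure[OF S(1) cml(1), folded A_def B_def, folded g_def]
  note st' = minimal_lagrangian_structure[OF S(1) cml(2), folded A'_def B'_def, folded g_def]
  have Eexp: "of_real (exp (u w)) = E w" for w by (simp add: E_def)
  define p where "p s = f (\<gamma> s) - f' (\<gamma> s)" for s
  define d where "d s = A (\<gamma> s) - A' (\<gamma> s)" for s
  \<comment> \<open>products are split as A A - A' A' = A (A - A') + (A - A') A',
    so that T is real linear in the differences p of f and a of A; b is the difference of B\<close>
  define T where "T s x = (let p = fst x; a = snd x; w = \<gamma> s; b = adjoint_mat a in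
      (cscale z a + cscale (cnj z) b,
       cscale z (cscale 2 (A w ** a + a ** A' w) + cscale (g w) a
          + cscale (c w) (b ** f w + B' w ** p - (p ** B w + f' w ** b)))
       + cscale (cnj z) (cscale (- 3 * E w) p)))" for s and x :: "(complex^3^3) \<times> (complex^3^3)"
  have lin: "linear (T s)" for s
  proof (rule linearI)
    show "T s (x + y) = T s x + T s y" for x y
      by (simp add: T_def Let_def adjoint_add mat_distrib cscale_add) (simp add: mat_eq3_iff cscale_nth algebra_simps)
    show "T s (r *\<^sub>R x) = r *\<^sub>R T s x" for r x
      by (simp add: T_def Let_def adjoint_scaleR mat_distrib) (simp add: mat_eq3_iff cscale_nth algebra_simps)
  qed
  have cont: "continuous_on ({0..1} \<times> UNIV) (\<lambda>(s, x). T s x)"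
  proof -
    have fst_c: "continuous_on ({0..1} \<times> UNIV) (\<lambda>x :: real \<times> (complex^3^3) \<times> (complex^3^3). h (\<gamma> (fst x)))"
      if "continuous_on {0..1} (\<lambda>s. h (\<gamma> s))" for h :: "complex \<Rightarrow> 'x::real_normed_vector"
      by (rule continuous_on_compose2[OF that]) (auto intro: continuous_intros)
    note k = fst_c[OF path[OF sm(1)]] fst_c[OF path[OF sm(2)]] fst_c[OF path[OF sm(3)]] fst_c[OF path[OF sm(4)]]
      fst_c[OF path[OF fs]] fst_c[OF path[OF fs']] fst_c[OF Ec] fst_c[OF gc] fst_c[OF cc]
    show ?thesis unfolding T_def Let_def case_prod_beta'
      by (intro continuous_intros k)
  qed
  obtain C where C: "\<And>s x. s \<in> {0..1} \<Longrightarrow> norm (T s x) \<le> C * norm x"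
    using linear_family_bound[OF cont lin] by blast
  have deriv: "((\<lambda>s. (p s, d s)) has_vector_derivative T s (p s, d s)) (at s within {0..1})" if s: "s \<in> {0..1}" for s
  proof -
    define w where "w = \<gamma> s"
    have w: "w \<in> S" using \<gamma>S[OF s] by (simp add: w_def)
    have rad: "((\<lambda>s. F (\<gamma> s)) has_vector_derivative cscale z (mat_d_z F w) + cscale (cnj z) (mat_d_zbar F w)) (at s within {0..1})"
      if "smooth_on S F" for F
      using radial_derivative[of F s z "{0..1}"] smooth_on_differentiable[OF that w] by (simp add: \<gamma>_def w_def)
    have db: "B w - B' w = adjoint_mat (A w - A' w)" using st(2)[OF w] st'(2)[OF w] by (simp add: adjoint_diff)
    have dp: "(p has_vector_derivative cscale z (A w - A' w) + cscale (cnj z) (adjoint_mat (A w - A' w))) (at s within {0..1})"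
      using has_vector_derivative_diff[OF rad[OF fs] rad[OF fs']]
      unfolding A_def[symmetric] B_def[symmetric] A'_def[symmetric] B'_def[symmetric] db[symmetric] p_def
      by (simp add: cscale_diff algebra_simps)
    define Wd where "Wd = cscale 2 (A w ** (A w - A' w) + (A w - A' w) ** A' w) + cscale (g w) (A w - A' w)
        + cscale (c w) (adjoint_mat (A w - A' w) ** f w + B' w ** (f w - f' w)
            - ((f w - f' w) ** B w + f' w ** adjoint_mat (A w - A' w)))"
    have W: "mat_d_z A w - mat_d_z A' w = Wd"
      unfolding st(4)[OF w] st'(4)[OF w] hopf[OF w, symmetric] Eexp c_def[symmetric] Wd_def db[symmetric]
      by (simp add: mat_distrib) (simp add: mat_eq3_iff cscale_nth algebra_simps)
    have Q: "mat_d_zbar A w - mat_d_zbar A' w = cscale (- 3 * E w) (f w - f' w)"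
      unfolding st(3)[OF w] st'(3)[OF w] Eexp by (simp add: mat_eq3_iff cscale_nth algebra_simps)
    have "(d has_vector_derivative cscale z (mat_d_z A w - mat_d_z A' w) + cscale (cnj z) (mat_d_zbar A w - mat_d_zbar A' w)) (at s within {0..1})"
      using has_vector_derivative_diff[OF rad[OF sm(1)] rad[OF sm(3)]]
      unfolding d_def by (simp add: cscale_diff algebra_simps)
    then have dd: "(d has_vector_derivative cscale z Wd + cscale (cnj z) (cscale (- 3 * E w) (f w - f' w))) (at s within {0..1})"
      by (simp only: W Q)
    have "T s (p s, d s) = (cscale z (A w - A' w) + cscale (cnj z) (adjoint_mat (A w - A' w)),
        cscale z Wd + cscale (cnj z) (cscale (- 3 * E w) (f w - f' w)))"
      by (simp add: T_def Let_def p_def d_def w_def Wd_def)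
    then show ?thesis using has_vector_derivative_Pair[OF dp dd] by simp
  qed
  have "(p 1, d 1) = 0"
  proof (rule gronwall_zero[OF deriv C])
    show "(p 0, d 0) = 0" using init by (simp add: p_def d_def \<gamma>_def A_def A'_def zero_prod_def)
  qed auto
  then show ?thesis by (simp add: p_def \<gamma>_def zero_prod_def)
qed

section \<open>The normalisation\<close>

lemma bounded_bilinear_outer: "bounded_bilinear outer"
  by (rule bilinear_conv_bounded_bilinear[THEN iffD1])
     (auto simp: bilinear_def mat_eq3_iff outer_nth algebra_simps intro!: linearI)

text \<open>
  The matrix \<open>P\<^sub>z\<close> at a point where the frame is the identity; \<open>a\<close> is \<open>\<i> exp (u/2)\<close>.
\<close>

definition normal_tangent :: "complex \<Rightarrow> complex^3^3" where
  "normal_tangent a = vector [vector [0, 0, a], vector [0, 0, 0], vector [0, - a, 0]]"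

text \<open>
  The lift frame at 0 is \<open>k\<^sup>*\<close>, so that its columns give \<open>L\<close>, \<open>L\<^sub>z\<close> and \<open>L\<^bsub>zbar\<^esub>\<close> at 0; now use \<open>f = L L\<^sup>*\<close> and
  \<open>f\<^sub>z = L\<^sub>z L\<^sup>* + L L\<^bsub>zbar\<^esub>\<^sup>*\<close>.
\<close>

lemma normalized_initial_data:
  assumes "normalized_at_0 S u f"
  shows "\<exists>k. k \<in> U1 \<and> f 0 = adjoint_mat k ** E3 ** k \<and>
    mat_d_z f 0 = adjoint_mat k ** normal_tangent (\<i> * of_real (exp (u 0 / 2))) ** k"
proof -
  obtain W L k where W: "open W" "0 \<in> W" and hl: "horizontal_lift W f L" and k: "k \<in> U1"
    and fr: "lift_frame u L 0 ** k = mat 1"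
    using assms unfolding normalized_at_0_def by blast
  have Ls: "smooth_on W L" and fL: "\<And>w. w \<in> W \<Longrightarrow> f w = outer (L w) (L w)"
    using hl by (auto simp: horizontal_lift_def cp_point_unit)
  have Ld: "L differentiable (at 0)" by (rule smooth_on_differentiable[OF Ls W(2)])
  define M where "M = adjoint_mat k"
  have kU: "k \<in> SU3" by (rule U1_SU3[OF k])
  have "lift_frame u L 0 = (lift_frame u L 0 ** k) ** adjoint_mat k"
    using SU3_adj(2)[OF kU] by (simp add: mult_assoc3)
  then have Mfr: "lift_frame u L 0 = M" using fr by (simp add: M_def)
  define e where "e = complex_of_real (exp (- u 0 / 2))"
  define e' where "e' = complex_of_real (exp (u 0 / 2))"
  have ee: "e' * e = 1" unfolding e_def e'_def of_real_mult[symmetric] exp_add[symmetric] by simp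
  have M: "M $ i $ 1 = - \<i> * e * vec_d_z L 0 $ i" "M $ i $ 2 = - \<i> * e * vec_d_zbar L 0 $ i" "M $ i $ 3 = L 0 $ i" for i
    unfolding Mfr[symmetric] by (simp_all add: lift_frame_def transpose_nth e_def)
  have Lx: "dx (\<lambda>w. L w $ i) 0 = dx L 0 $ i" "dy (\<lambda>w. L w $ i) 0 = dy L 0 $ i" for i
    by (rule dx_dy_bounded_linear[OF bounded_linear_vec_nth Ld])+
  have Lz: "vec_d_z L 0 $ i = (dx L 0 $ i - \<i> * dy L 0 $ i) / 2" "vec_d_zbar L 0 $ i = (dx L 0 $ i + \<i> * dy L 0 $ i) / 2" for i
    by (simp_all add: vec_d_z_def vec_d_zbar_def d_z_def d_zbar_def Lx)
  have "((\<lambda>w. outer (L w) (L w)) has_derivative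
      (\<lambda>h. outer (L 0) (Re h *\<^sub>R dx L 0 + Im h *\<^sub>R dy L 0) + outer (Re h *\<^sub>R dx L 0 + Im h *\<^sub>R dy L 0) (L 0))) (at 0)"
    by (rule bounded_bilinear.FDERIV[OF bounded_bilinear_outer has_derivative_dx_dy[OF Ld] has_derivative_dx_dy[OF Ld]])
  moreover have "outer (L 0) (Re h *\<^sub>R dx L 0 + Im h *\<^sub>R dy L 0) + outer (Re h *\<^sub>R dx L 0 + Im h *\<^sub>R dy L 0) (L 0)
      = Re h *\<^sub>R (outer (L 0) (dx L 0) + outer (dx L 0) (L 0)) + Im h *\<^sub>R (outer (L 0) (dy L 0) + outer (dy L 0) (L 0))" for h
    by (simp add: mat_eq3_iff outer_nth algebra_simps)
  ultimately have "((\<lambda>w. outer (L w) (L w)) has_derivative (\<lambda>h.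
      Re h *\<^sub>R (outer (L 0) (dx L 0) + outer (dx L 0) (L 0)) + Im h *\<^sub>R (outer (L 0) (dy L 0) + outer (dy L 0) (L 0)))) (at 0)"
    by simp
  then have fd: "(f has_derivative (\<lambda>h.
      Re h *\<^sub>R (outer (L 0) (dx L 0) + outer (dx L 0) (L 0)) + Im h *\<^sub>R (outer (L 0) (dy L 0) + outer (dy L 0) (L 0)))) (at 0)"
    by (rule has_derivative_transform_within_open[OF _ W]) (simp add: fL)
  have fd': "f differentiable (at 0)" using fd by (auto simp: differentiable_def)
  have fz: "mat_d_z f 0 $ i $ j = vec_d_z L 0 $ i * cnj (L 0 $ j) + L 0 $ i * cnj (vec_d_zbar L 0 $ j)" for i j
    unfolding mat_d_z_eq(1)[OF fd'] dx_dy_eqI[OF fd] by (simp add: cscale_nth outer_nth Lz field_simps)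
  have kM: "k $ i $ j = cnj (M $ j $ i)" for i j
    using adjoint_nth[of M i j] by (simp add: M_def)
  have f0: "f 0 = adjoint_mat k ** E3 ** k"
    unfolding M_def[symmetric] fL[OF W(2)]
    by (simp add: mat_eq3_iff outer_nth mult_nth3 E3_nth kM M)
  have A0: "mat_d_z f 0 = adjoint_mat k ** normal_tangent (\<i> * of_real (exp (u 0 / 2))) ** k"
  proof -
    define N where "N = normal_tangent (\<i> * e')"
    have N: "N $ 1 $ 1 = 0" "N $ 1 $ 2 = 0" "N $ 1 $ 3 = \<i> * e'" "N $ 2 $ 1 = 0" "N $ 2 $ 2 = 0" "N $ 2 $ 3 = 0"
      "N $ 3 $ 1 = 0" "N $ 3 $ 2 = - (\<i> * e')" "N $ 3 $ 3 = 0"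
      by (simp_all add: N_def normal_tangent_def)
    have "(adjoint_mat k ** N ** k) $ i $ j = M $ i $ 1 * (\<i> * e') * cnj (M $ j $ 3) - M $ i $ 3 * (\<i> * e') * cnj (M $ j $ 2)" for i j
      unfolding M_def[symmetric] by (simp add: mult_nth3 N kM)
    also have "M $ i $ 1 * (\<i> * e') * cnj (M $ j $ 3) - M $ i $ 3 * (\<i> * e') * cnj (M $ j $ 2)
        = (e' * e) * (vec_d_z L 0 $ i * cnj (L 0 $ j)) + (e' * e) * (L 0 $ i * cnj (vec_d_zbar L 0 $ j))" for i j
      by (simp add: M e_def) (simp add: algebra_simps)?
    finally have "mat_d_z f 0 = adjoint_mat k ** N ** k" by (simp add: mat_eq3_iff fz ee)
    then show ?thesis by (simp add: N_def e'_def)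
  qed
  show ?thesis using k f0 A0 by blast
qed

section \<open>Translationally equivariant surfaces\<close>

lemma translation_invariant_dx:
  fixes h :: "complex \<Rightarrow> 'a::real_normed_vector"
  assumes "h differentiable (at z)" "\<And>t. h (of_real t + z) = h z"
  shows "dx h z = 0"
proof -
  have "((\<lambda>t. h (z + of_real t * 1)) has_vector_derivative dx h z) (at 0)"
    using line_derivative[of h z 0 1 UNIV] assms(1) by simp
  moreover have "h (z + of_real t * 1) = h z" for t using assms(2)[of t] by (simp add: add.commute)
  ultimately have "((\<lambda>t::real. h z) has_vector_derivative dx h z) (at 0)" by simp
  then show ?thesis using vector_derivative_unique_at[OF has_vector_derivative_const] by metis
qed

lemma extended_frame_restrict:
  assumes S: "open S" and ef: "extended_frame UNIV u' f' F"
    and u: "\<And>z. z \<in> S \<Longrightarrow> u z = u' z" "smooth_on S u" and f: "\<And>z. z \<in> S \<Longrightarrow> f z = f' z"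
  shows "extended_frame S u f F"
proof -
  obtain \<psi> G k where \<psi>: "\<psi> holomorphic_on UNIV"
    and G: "\<forall>l\<in>sphere 0 1. smooth_on UNIV (\<lambda>z. G z l) \<and> (\<forall>z\<in>UNIV. G z l \<in> SU3 \<and>
        matrix_inv (G z l) ** mat_d_z (\<lambda>w. G w l) z = lax_z u' \<psi> l z \<and>
        matrix_inv (G z l) ** mat_d_zbar (\<lambda>w. G w l) z = lax_zbar u' \<psi> l z)"
    and k: "smooth_on UNIV k" "k ` UNIV \<subseteq> U1"
    and FG: "\<forall>z\<in>UNIV. \<forall>l\<in>sphere 0 1. F z l = G z l ** k z"
    and fF: "\<forall>z\<in>UNIV. f' z = cp_point (F z 1 *v axis 3 1)"
    using ef unfolding extended_frame_def by (elim exE conjE)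
  have lax: "lax_z u \<psi> l z = lax_z u' \<psi> l z" "lax_zbar u \<psi> l z = lax_zbar u' \<psi> l z" if z: "z \<in> S" for l z
  proof -
    have d: "(\<lambda>w. complex_of_real (u w)) differentiable (at z)"
      by (rule smooth_on_differentiable[OF smooth_on_of_real[OF S u(2)] z])
    have "d_z (\<lambda>w. complex_of_real (u w)) z = d_z (\<lambda>w. of_real (u' w)) z"
      "d_zbar (\<lambda>w. complex_of_real (u w)) z = d_zbar (\<lambda>w. of_real (u' w)) z"
      by (rule d_z_cong[OF S z _ d]; simp add: u)+
    then show "lax_z u \<psi> l z = lax_z u' \<psi> l z" "lax_zbar u \<psi> l z = lax_zbar u' \<psi> l z"
      using u(1)[OF z] by (simp_all add: lax_z_def lax_zbar_def)
  qed
  show ?thesis unfolding extended_frame_def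
  proof (rule exI[of _ \<psi>], rule exI[of _ G], rule exI[of _ k], intro conjI ballI)
    show "\<psi> holomorphic_on S" using \<psi> holomorphic_on_subset by blast
    show "smooth_on S k" using k(1) smooth_on_subset by blast
    show "k ` S \<subseteq> U1" using k(2) by blast
    show "smooth_on S (\<lambda>z. G z l)" if "l \<in> sphere 0 1" for l using G that smooth_on_subset by blast
    fix l z assume "l \<in> sphere (0::complex) 1" and z: "z \<in> S"
    then have g: "G z l \<in> SU3" "matrix_inv (G z l) ** mat_d_z (\<lambda>w. G w l) z = lax_z u' \<psi> l z"
      "matrix_inv (G z l) ** mat_d_zbar (\<lambda>w. G w l) z = lax_zbar u' \<psi> l z" using G by blast+
    show "G z l \<in> SU3" by (rule g(1))
    show "matrix_inv (G z l) ** mat_d_z (\<lambda>w. G w l) z = lax_z u \<psi> l z"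
      "matrix_inv (G z l) ** mat_d_zbar (\<lambda>w. G w l) z = lax_zbar u \<psi> l z"
      using g(2,3) by (simp_all add: lax[OF z])
  next
    show "F z l = G z l ** k z" if "l \<in> sphere 0 1" for z l using FG that by blast
    show "f z = cp_point (F z 1 *v axis 3 1)" if "z \<in> S" for z using fF f[OF that] by simp
  qed
qed

text \<open>
  A holomorphic function whose \<open>x\<close> derivative vanishes is constant; for a function of \<open>y\<close> alone the
  operator \<open>\<partial>\<^bsub>zbar\<^esub> \<partial>\<^sub>z\<close> is a quarter of the second derivative.
\<close>

lemma equivariant_gauss:
  assumes S: "strip S" and cml: "conformal_minimal_lagrangian S u f" and te: "translationally_equivariant S f"
    and z: "z \<in> S"
  shows "hopf f z = hopf f 0" "dx u z = 0" "dx (dy u) z = 0"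
    "dy (dy u) z = 4 * ((cmod (hopf f 0))\<^sup>2 * exp (- 2 * u z) - exp (u z))"
proof -
  note oc = strip_open_convex[OF S]
  have us: "smooth_on S u" and fs: "smooth_on S f" using cml by (auto simp: conformal_minimal_lagrangian_def)
  note inv = equivariant_invariants[OF S cml te]
  have ud: "u differentiable (at z)" if "z \<in> S" for z by (rule smooth_on_differentiable[OF us that])
  have hs: "smooth_on S (hopf f)" by (rule smooth_on_hopf[OF oc(1) fs])
  have hd: "hopf f differentiable (at z)" if "z \<in> S" for z by (rule smooth_on_differentiable[OF hs that])
  have hx: "dx (hopf f) z = 0" if "z \<in> S" for z
    by (rule translation_invariant_dx[OF hd[OF that]]) (rule inv(2)[OF that])
  have hy: "dy (hopf f) z = 0" if "z \<in> S" for z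
    using gauss_codazzi(2)[OF oc(1) cml that] hx[OF that] by (simp add: d_zbar_def)
  have "(hopf f has_derivative (\<lambda>h. 0)) (at z within S)" if "z \<in> S" for z
    using has_derivative_at_withinI[OF has_derivative_dx_dy[OF hd[OF that]]] hx[OF that] hy[OF that] by simp
  then show const: "hopf f z = hopf f 0"
    using has_derivative_zero_unique[OF oc(2), of "hopf f"] z oc(3) by blast
  have ux: "dx u z = 0" if "z \<in> S" for z
    by (rule translation_invariant_dx[OF ud[OF that]]) (rule inv(1)[OF that])
  then show "dx u z = 0" using z by blast
  have uys: "smooth_on S (dy u)" by (rule smooth_on_dy[OF us])
  have uyd: "dy u differentiable (at z)" by (rule smooth_on_differentiable[OF uys z])
  have "dy u (of_real t + z) = dy u z" for t
  proof -
    have d: "u differentiable (at (of_real t + z))" by (rule ud[OF strip_translate[OF S z]])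
    have "dy u (of_real t + z) = dy (\<lambda>z. u (of_real t + z)) z" by (rule dx_dy_translate(2)[OF d, symmetric])
    also have "frechet_derivative (\<lambda>z. u (of_real t + z)) (at z) = frechet_derivative u (at z)"
      by (rule frechet_derivative_transform_within_open[OF dx_dy_translate(3)[OF d] oc(1) z]) (rule inv(1))
    then have "dy (\<lambda>z. u (of_real t + z)) z = dy u z" by (simp add: dy_def)
    finally show ?thesis .
  qed
  then show uxy: "dx (dy u) z = 0" by (rule translation_invariant_dx[OF uyd])
  have g: "d_z (\<lambda>w. complex_of_real (u w)) w = (- \<i> / 2) * of_real (dy u w)" if "w \<in> S" for w
    using dx_dy_bounded_linear[OF bounded_linear_of_real[where 'a = complex] ud[OF that]] ux[OF that]
    by (simp add: d_z_def)
  define m where "m x = (- \<i> / 2) * complex_of_real x" for x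
  have ml: "bounded_linear m" unfolding m_def
    by (rule bounded_linear_compose[OF bounded_linear_mult_right bounded_linear_of_real])
  have "d_zbar (d_z (\<lambda>w. complex_of_real (u w))) z = d_zbar (\<lambda>w. m (dy u w)) z"
    by (rule d_z_cong(2)[OF oc(1) z _ smooth_on_differentiable[OF smooth_on_d_z(1)[OF oc(1) smooth_on_of_real[OF oc(1) us]] z]])
       (simp add: g m_def)
  also have "\<dots> = of_real (dy (dy u) z) / 4"
    using dx_dy_bounded_linear(1,2)[OF ml uyd] uxy by (simp add: d_zbar_def m_def)
  finally have "of_real (dy (dy u) z) / 4
      = hopf f z * cnj (hopf f z) / (of_real (exp (u z)))\<^sup>2 - complex_of_real (exp (u z))"
    using gauss_codazzi(1)[OF oc(1) cml z] by simp
  also have "\<dots> = of_real ((cmod (hopf f 0))\<^sup>2 / (exp (u z))\<^sup>2 - exp (u z))"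
    by (simp add: const complex_norm_square[symmetric])
  finally have "complex_of_real (dy (dy u) z) = of_real (4 * ((cmod (hopf f 0))\<^sup>2 / (exp (u z))\<^sup>2 - exp (u z)))"
    by (simp add: field_simps)
  then have "dy (dy u) z = 4 * ((cmod (hopf f 0))\<^sup>2 / (exp (u z))\<^sup>2 - exp (u z))" by (simp only: of_real_eq_iff)
  moreover have "exp (- 2 * u z) = 1 / (exp (u z))\<^sup>2"
    using exp_double[of "u z"] by (simp add: exp_minus inverse_eq_divide)
  ultimately show "dy (dy u) z = 4 * ((cmod (hopf f 0))\<^sup>2 * exp (- 2 * u z) - exp (u z))" by simp
qed

text \<open>
  The given surface is congruent to a model built from a global solution of the Gauss equation with
  the same initial values. The conformal factors agree by uniqueness for that equation, and the
  surfaces by uniqueness for the structure equations.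
\<close>

theorem equivariant_extension:
  assumes S: "strip S" and cml: "conformal_minimal_lagrangian S u f" and norm0: "normalized_at_0 S u f"
    and te: "translationally_equivariant S f"
  obtains u' f' F \<rho> where "conformal_minimal_lagrangian UNIV u' f'" "translationally_equivariant UNIV f'"
    "\<And>z. z \<in> S \<Longrightarrow> f' z = f z" "equivariant_frame S u f F \<rho>"
proof -
  note oc = strip_open_convex[OF S]
  have us: "smooth_on S u" and fs: "smooth_on S f" using cml by (auto simp: conformal_minimal_lagrangian_def)
  note eg = equivariant_gauss[OF S cml te]
  \<comment> \<open>the frame with coefficient \<psi> belongs to the cubic coefficient - i \<psi>\<close>
  define \<psi> where "\<psi> = \<i> * hopf f 0"
  have m\<psi>: "cmod \<psi> = cmod (hopf f 0)" by (simp add: \<psi>_def norm_mult)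
  obtain U V r where UV: "U 0 = u 0" "V 0 = dy u 0"
    and dU: "\<And>t. (U has_real_derivative V t) (at t)"
    and dV: "\<And>t. (V has_real_derivative 4 * ((cmod \<psi>)\<^sup>2 * exp (- 2 * U t) - exp (U t))) (at t)"
    and bd: "\<And>t. norm (gauss_state ((cmod \<psi>)\<^sup>2) (U t) (V t)) \<le> r"
    using gauss_ode_global[of "(cmod \<psi>)\<^sup>2" "u 0" "dy u 0"] zero_le_power2 by blast
  interpret gauss_solution U V \<psi> r by unfold_locales (rule dU dV bd)+
  have u_conf: "u z = conf z" if z: "z \<in> S" for z
  proof -
    define y where "y = Im z"
    have vS: "\<i> * of_real (s * y) \<in> S" if "s \<in> {0..1}" for s
      using strip_vertical[OF S z that] by (simp add: y_def mult_ac)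
    have line: "((\<lambda>t. h (\<i> * of_real t)) has_real_derivative dy h (\<i> * of_real x)) (at x)"
      if "h differentiable (at (\<i> * of_real x))" for h :: "complex \<Rightarrow> real" and x
      using line_derivative[of h 0 x \<i> UNIV] that
      by (simp add: has_real_derivative_iff_has_vector_derivative mult.commute)
    have "u (\<i> * of_real y) = U y"
    proof (rule gauss_ode_unique(1)[where m = "(cmod \<psi>)\<^sup>2" and u = "\<lambda>t. u (\<i> * of_real t)"
          and v = "\<lambda>t. dy u (\<i> * of_real t)" and u' = U and v' = V and t = y])
      fix s :: real assume s: "s \<in> {0..1}"
      note w = vS[OF s]
      show "((\<lambda>t. u (\<i> * of_real t)) has_real_derivative dy u (\<i> * of_real (s * y))) (at (s * y))"
        by (rule line[OF smooth_on_differentiable[OF us w]])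
      show "((\<lambda>t. dy u (\<i> * of_real t)) has_real_derivative
          4 * ((cmod \<psi>)\<^sup>2 * exp (- 2 * u (\<i> * of_real (s * y))) - exp (u (\<i> * of_real (s * y))))) (at (s * y))"
        using line[OF smooth_on_differentiable[OF smooth_on_dy[OF us] w]] unfolding eg(4)[OF w] m\<psi> .
    qed (use UV dU dV in simp_all)
    moreover have "u z = u (\<i> * of_real y)"
    proof -
      have iy: "\<i> * of_real y \<in> S" using vS[of 1] by simp
      have "z = of_real (Re z) + \<i> * of_real y" by (simp add: complex_eq_iff y_def)
      then show ?thesis using equivariant_invariants(1)[OF S cml te iy, of "Re z"] by simp
    qed
    ultimately show ?thesis by (simp add: conf_def y_def)
  qed
  obtain k where k: "k \<in> U1" and f0: "f 0 = adjoint_mat k ** E3 ** k"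
    and A0: "mat_d_z f 0 = adjoint_mat k ** normal_tangent (\<i> * of_real (exp (u 0 / 2))) ** k"
    using normalized_initial_data[OF norm0] by blast
  obtain F f' \<rho> where cml': "conformal_minimal_lagrangian UNIV conf f'"
    and te': "translationally_equivariant UNIV f'" and ef': "equivariant_frame UNIV conf f' F \<rho>"
    and f'0: "f' 0 = adjoint_mat k ** E3 ** k" and A'0: "mat_d_z f' 0 = adjoint_mat k ** NA 0 ** k"
    and hopf': "\<forall>z. hopf f' z = - \<i> * \<psi>"
  proof (rule surface_exists[OF k])
    fix F f' \<rho>
    assume a: "conformal_minimal_lagrangian UNIV conf f'" "translationally_equivariant UNIV f'"
      "equivariant_frame UNIV conf f' F \<rho>" "f' 0 = adjoint_mat k ** E3 ** k"
      "mat_d_z f' 0 = adjoint_mat k ** NA 0 ** k" "\<And>z. hopf f' z = - \<i> * \<psi>"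
    then have "\<forall>z. hopf f' z = - \<i> * \<psi>" by blast
    from that[OF a(1-5) this] show thesis .
  qed
  have "NA 0 = normal_tangent (\<i> * of_real (exp (u 0 / 2)))"
    by (simp add: NA_def a_def UV normal_tangent_def)
  then have Aeq: "mat_d_z f 0 = mat_d_z f' 0" using A0 A'0 by simp
  have cmlS: "conformal_minimal_lagrangian S u f'"
    using cml' us u_conf smooth_on_subset[of UNIV f' S] by (auto simp: conformal_minimal_lagrangian_def)
  have hopf: "hopf f z = hopf f' z" if "z \<in> S" for z
    unfolding eg(1)[OF that] hopf'[rule_format] by (simp add: \<psi>_def)
  have ff: "f z = f' z" if "z \<in> S" for z
    by (rule minimal_lagrangian_congruence[OF oc cml cmlS hopf _ Aeq that]) (simp_all add: f0 f'0)
  have "extended_frame UNIV conf f' F" using ef' by (simp add: equivariant_frame_def)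
  from extended_frame_restrict[OF oc(1) this _ us] have "extended_frame S u f F" using u_conf ff by blast
  then have ef: "equivariant_frame S u f F \<rho>" using ef' by (simp add: equivariant_frame_def)
  show thesis by (rule that[OF cml' te' ff[symmetric] ef])
qed

theorem proposition4p4:
  fixes S :: "complex set" and u :: "complex \<Rightarrow> real" and f :: "complex \<Rightarrow> complex^3^3"
  assumes "strip S"
    and "conformal_minimal_lagrangian S u f"
    and "normalized_at_0 S u f"
  shows "(translationally_equivariant S f \<longleftrightarrow>
            (\<exists>D. degree_one_constant_potential D \<and> generated_by S u f D)) \<and>
         (translationally_equivariant S f \<longrightarrow>
            (\<exists>u' f'. conformal_minimal_lagrangian UNIV u' f' \<and>
               translationally_equivariant UNIV f' \<and> (\<forall>z\<in>S. f' z = f z)) \<and>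
            (\<exists>F \<rho>. equivariant_frame S u f F \<rho>) \<and>
            (\<forall>F \<rho>. equivariant_frame S u f F \<rho> \<longrightarrow>
               (let D = (\<lambda>l. matrix_inv (F 0 l) ** dx (\<lambda>z. F z l) 0) in
                degree_one_constant_potential D \<and> generated_by S u f D)))"
proof -
  have us: "smooth_on S u" using assms(2) by (simp add: conformal_minimal_lagrangian_def)
  have ext: "(\<exists>u' f'. conformal_minimal_lagrangian UNIV u' f' \<and>
         translationally_equivariant UNIV f' \<and> (\<forall>z\<in>S. f' z = f z)) \<and> (\<exists>F \<rho>. equivariant_frame S u f F \<rho>)"
    if te: "translationally_equivariant S f"
  proof -
    obtain u' f' F \<rho> where "conformal_minimal_lagrangian UNIV u' f'" "translationally_equivariant UNIV f'"
      "\<And>z. z \<in> S \<Longrightarrow> f' z = f z" "equivariant_frame S u f F \<rho>"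
      using equivariant_extension[OF assms te] by blast
    then show ?thesis by blast
  qed
  have pot: "let D = (\<lambda>l. matrix_inv (F 0 l) ** dx (\<lambda>z. F z l) 0) in
      degree_one_constant_potential D \<and> generated_by S u f D" if "equivariant_frame S u f F \<rho>" for F \<rho>
    using equivariant_frame_potential[OF assms(1) us that] by (simp add: Let_def)
  have fwd: "\<exists>D. degree_one_constant_potential D \<and> generated_by S u f D" if te: "translationally_equivariant S f"
  proof -
    obtain F \<rho> where "equivariant_frame S u f F \<rho>" using ext[OF te] by blast
    from pot[OF this] show ?thesis unfolding Let_def
      by (rule exI[of _ "\<lambda>l. matrix_inv (F 0 l) ** dx (\<lambda>z. F z l) 0"])
  qed
  have bwd: "translationally_equivariant S f"
    if "\<exists>D. degree_one_constant_potential D \<and> generated_by S u f D"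
    using that generated_imp_equivariant[OF assms(1)] by (elim exE conjE)
  show ?thesis
  proof (intro conjI iffI impI allI)
    assume te: "translationally_equivariant S f"
    show "\<exists>D. degree_one_constant_potential D \<and> generated_by S u f D" by (rule fwd[OF te])
    show "\<exists>u' f'. conformal_minimal_lagrangian UNIV u' f' \<and>
         translationally_equivariant UNIV f' \<and> (\<forall>z\<in>S. f' z = f z)" by (rule conjunct1[OF ext[OF te]])
    show "\<exists>F \<rho>. equivariant_frame S u f F \<rho>" by (rule conjunct2[OF ext[OF te]])
  qed (rule bwd, assumption, rule pot, assumption)
qed

end
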